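(* Let $K$ be a field with $\mathrm{char}\,K=0$ and let $X$ be an algebraic supergroup over $K$. Then the canonical morphism $g_X:U(Lie(X))\to Dist(X)$, induced by the inclusion $Lie(X)\subseteq Dist(X)$, is an isomorphism of Hopf superalgebras.
   Context: An algebraic supergroup $X$ is a functor from commutative ($ab=(-1)^{|a||b|}ba$) $K$-superalgebras to groups represented by a finitely generated commutative Hopf superalgebra $K[X]$, with comultiplication $\delta_X$, counit $\epsilon_X$, antipode $s_X$. Put $\mathcal{M}=\ker\epsilon_X$, $Dist_n(X)=(K[X]/\mathcal{M}^{n+1})^*\subseteq K[X]^*$ and $Dist(X)=\bigcup_{n\geq0}Dist_n(X)$. $Dist(X)$ is a Hopf superalgebra with multiplication $\phi\psi(f)=\sum(-1)^{|\psi||f_1|}\phi(f_1)\psi(f_2)$, where $\delta_X(f)=\sum f_1\otimes f_2$, unit $\epsilon_X$, counit $\phi\mapsto\phi(1)$, comultiplication dual to the multiplication of $K[X]$, i.e. $\delta(\phi)=\sum\phi_1\otimes\phi_2$ with $\phi(fh)=\sum(-1)^{|\phi_2||f|}\phi_1(f)\phi_2(h)$, and antipode $s(\phi)(f)=\phi(s_X(f))$. $Lie(X)=\{\phi\in Dist_1(X)\mid\phi(1)=0\}$ is a Lie superalgebra with $[\phi,\psi]=\phi\psi-(-1)^{|\phi||\psi|}\psi\phi$. For a Lie superalgebra $L$, $U(L)$ is its universal enveloping superalgebra, a Hopf superalgebra with $\delta(x)=x\otimes1+1\otimes x$, $\epsilon(x)=0$, $s(x)=-x$ for $x\in L$. 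*)

theory Defs
  imports
    "HOL-Algebra.Module"
    "HOL-Algebra.QuotRing"
    "HOL-Algebra.Ideal_Product"
    "HOL-Library.Z2"
    "HOL-Library.Poly_Mapping"
begin

section \<open>Superspaces and superalgebras\<close>

text \<open>The base field is the type \<open>'k\<close>. A superspace is a vector space in the sense of
  \<^theory>\<open>HOL-Algebra.Module\<close> (so the fields \<open>mult\<close> and \<open>one\<close> carry no meaning unless the
  superspace is an algebra), together with its even part \<open>homog A 0\<close> and its odd part
  \<open>homog A 1\<close>.\<close>

record ('k, 'a) superspace = "('k, 'a) module" +
  homog :: "bit \<Rightarrow> 'a set"

definition ground :: "('k::field, 'k) superspace" where
  "ground = \<lparr>carrier = UNIV, mult = (*), one = 1, zero = 0, add = (+), smult = (*),
     homog = (\<lambda>i. if i = 0 then UNIV else {0})\<rparr>"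

locale superspace = Module.module ground A
  for A :: "('k::field, 'a, 'm) superspace_scheme" (structure) +
  assumes homog_submodule: "submodule (homog A i) ground A"
    and homog_decomp: "a \<in> carrier A \<Longrightarrow> \<exists>x\<in>homog A 0. \<exists>y\<in>homog A 1. a = x \<oplus> y"
    and homog_disjoint: "homog A 0 \<inter> homog A 1 = {\<zero>}"

locale superalgebra = superspace A + ring A
  for A :: "('k::field, 'a, 'm) superspace_scheme" (structure) +
  assumes smult_mult_left: "\<lbrakk>x \<in> carrier A; y \<in> carrier A\<rbrakk> \<Longrightarrow> (c \<odot> x) \<otimes> y = c \<odot> (x \<otimes> y)"
    and smult_mult_right: "\<lbrakk>x \<in> carrier A; y \<in> carrier A\<rbrakk> \<Longrightarrow> x \<otimes> (c \<odot> y) = c \<odot> (x \<otimes> y)"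
    and one_even: "\<one> \<in> homog A 0"
    and homog_mult: "\<lbrakk>x \<in> homog A i; y \<in> homog A j\<rbrakk> \<Longrightarrow> x \<otimes> y \<in> homog A (i + j)"

definition linear_maps ::
  "('k, 'a, 'm) superspace_scheme \<Rightarrow> ('k, 'b, 'n) superspace_scheme \<Rightarrow> ('a \<Rightarrow> 'b) set" where
  "linear_maps A B = {f \<in> carrier A \<rightarrow> carrier B.
     (\<forall>x\<in>carrier A. \<forall>y\<in>carrier A. f (x \<oplus>\<^bsub>A\<^esub> y) = f x \<oplus>\<^bsub>B\<^esub> f y) \<and>
     (\<forall>c. \<forall>x\<in>carrier A. f (c \<odot>\<^bsub>A\<^esub> x) = c \<odot>\<^bsub>B\<^esub> f x)}"

definition even_linear_maps ::
  "('k, 'a, 'm) superspace_scheme \<Rightarrow> ('k, 'b, 'n) superspace_scheme \<Rightarrow> ('a \<Rightarrow> 'b) set" where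
  "even_linear_maps A B = {f \<in> linear_maps A B. \<forall>i. f ` homog A i \<subseteq> homog B i}"

definition superalgebra_hom ::
  "('k, 'a, 'm) superspace_scheme \<Rightarrow> ('k, 'b, 'n) superspace_scheme \<Rightarrow> ('a \<Rightarrow> 'b) set" where
  "superalgebra_hom A B = ring_hom A B \<inter> even_linear_maps A B"

definition koszul :: "bit \<Rightarrow> bit \<Rightarrow> 'k::field" where
  "koszul i j = (if i = 1 \<and> j = 1 then - 1 else 1)"

text \<open>The component of parity \<open>i\<close>. Formulas with signs, which are stated for homogeneous
  elements, are extended to all elements by summing over the components.\<close>

definition component :: "('k, 'a, 'm) superspace_scheme \<Rightarrow> bit \<Rightarrow> 'a \<Rightarrow> 'a" where
  "component A i a = (THE x. x \<in> homog A i \<and> (\<exists>y\<in>homog A (i + 1). a = x \<oplus>\<^bsub>A\<^esub> y))"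

definition super_opposite ::
  "('k::field, 'a, 'm) superspace_scheme \<Rightarrow> ('k, 'a, 'm) superspace_scheme" where
  "super_opposite A = A\<lparr>mult := (\<lambda>a b. finsum A
     (\<lambda>(i, j). koszul i j \<odot>\<^bsub>A\<^esub> (component A j b \<otimes>\<^bsub>A\<^esub> component A i a)) UNIV)\<rparr>"

text \<open>The quotient by a subspace \<open>N\<close>; if \<open>A\<close> is an algebra and \<open>N\<close> an ideal, this is the
  quotient algebra, whose ring part is \<open>A Quot N\<close>.\<close>

definition quotient_superspace ::
  "('k, 'a) superspace \<Rightarrow> 'a set \<Rightarrow> ('k, 'a set) superspace" where
  "quotient_superspace A N =
    \<lparr>carrier = a_rcosets\<^bsub>A\<^esub> N, mult = rcoset_mult A N, one = N +>\<^bsub>A\<^esub> \<one>\<^bsub>A\<^esub>, zero = N,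
     add = set_add A, smult = (\<lambda>c C. \<Union>x\<in>C. N +>\<^bsub>A\<^esub> (c \<odot>\<^bsub>A\<^esub> x)),
     homog = (\<lambda>i. (\<lambda>x. N +>\<^bsub>A\<^esub> x) ` homog A i)\<rparr>"

definition pm_scale :: "'k::field \<Rightarrow> ('a \<Rightarrow>\<^sub>0 'k) \<Rightarrow> ('a \<Rightarrow>\<^sub>0 'k)" where
  "pm_scale c p = Poly_Mapping.map ((*) c) p"


section \<open>Tensor products\<close>

text \<open>The free vector space on \<open>A \<times> B\<close>. Its product is the bilinear extension of
  \<open>(a, b)(a', b') = (-1)\<^bsup>|b||a'|\<^esup> (aa', bb')\<close>, which induces the usual product on
  \<open>A \<otimes> B\<close> if \<open>A\<close> and \<open>B\<close> are superalgebras.\<close>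

definition tensor_free :: "('k::field, 'a, 'm) superspace_scheme \<Rightarrow>
    ('k, 'b, 'n) superspace_scheme \<Rightarrow> ('k, 'a \<times> 'b \<Rightarrow>\<^sub>0 'k) superspace" where
  "tensor_free A B =
    \<lparr>carrier = {p. Poly_Mapping.keys p \<subseteq> carrier A \<times> carrier B},
     mult = (\<lambda>p q. \<Sum>(a, b)\<in>Poly_Mapping.keys p. \<Sum>(a', b')\<in>Poly_Mapping.keys q. \<Sum>(i, j)\<in>UNIV.
        Poly_Mapping.single (a \<otimes>\<^bsub>A\<^esub> component A j a', component B i b \<otimes>\<^bsub>B\<^esub> b')
          (Poly_Mapping.lookup p (a, b) * Poly_Mapping.lookup q (a', b') * koszul i j)),
     one = Poly_Mapping.single (\<one>\<^bsub>A\<^esub>, \<one>\<^bsub>B\<^esub>) 1, zero = 0, add = (+), smult = pm_scale,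
     homog = (\<lambda>i. {p. Poly_Mapping.keys p \<subseteq> (\<Union>j. homog A j \<times> homog B (i + j))})\<rparr>"

definition tensor_relators :: "('k::field, 'a, 'm) superspace_scheme \<Rightarrow>
    ('k, 'b, 'n) superspace_scheme \<Rightarrow> ('a \<times> 'b \<Rightarrow>\<^sub>0 'k) set" where
  "tensor_relators A B = (let pure = (\<lambda>a b. Poly_Mapping.single (a, b) 1) in
     {pure (a \<oplus>\<^bsub>A\<^esub> a') b - pure a b - pure a' b | a a' b.
        a \<in> carrier A \<and> a' \<in> carrier A \<and> b \<in> carrier B} \<union>
     {pure a (b \<oplus>\<^bsub>B\<^esub> b') - pure a b - pure a b' | a b b'.
        a \<in> carrier A \<and> b \<in> carrier B \<and> b' \<in> carrier B} \<union>
     {pure (c \<odot>\<^bsub>A\<^esub> a) b - pm_scale c (pure a b) | c a b. a \<in> carrier A \<and> b \<in> carrier B} \<union>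
     {pure a (c \<odot>\<^bsub>B\<^esub> b) - pm_scale c (pure a b) | c a b. a \<in> carrier A \<and> b \<in> carrier B})"

definition tensor_null :: "('k::field, 'a, 'm) superspace_scheme \<Rightarrow>
    ('k, 'b, 'n) superspace_scheme \<Rightarrow> ('a \<times> 'b \<Rightarrow>\<^sub>0 'k) set" where
  "tensor_null A B = \<Inter>{H. submodule H (ground :: ('k, 'k) superspace) (tensor_free A B) \<and>
     tensor_relators A B \<subseteq> H}"

definition tensor :: "('k::field, 'a, 'm) superspace_scheme \<Rightarrow>
    ('k, 'b, 'n) superspace_scheme \<Rightarrow> ('k, ('a \<times> 'b \<Rightarrow>\<^sub>0 'k) set) superspace" where
  "tensor A B = quotient_superspace (tensor_free A B) (tensor_null A B)"

definition tens :: "('k::field, 'a, 'm) superspace_scheme \<Rightarrow>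
    ('k, 'b, 'n) superspace_scheme \<Rightarrow> 'a \<Rightarrow> 'b \<Rightarrow> ('a \<times> 'b \<Rightarrow>\<^sub>0 'k) set" where
  "tens A B a b = tensor_null A B +>\<^bsub>tensor_free A B\<^esub> Poly_Mapping.single (a, b) 1"

text \<open>The linear map \<open>A \<otimes> B \<rightarrow> C\<close> with \<open>a \<otimes> b \<mapsto> \<beta> a b\<close> for bilinear \<open>\<beta>\<close>: the linear
  extension of \<open>\<beta>\<close> to the free vector space is constant on each coset.\<close>

definition tensor_lift :: "('k::field, 'c, 'm) superspace_scheme \<Rightarrow>
    ('a \<Rightarrow> 'b \<Rightarrow> 'c) \<Rightarrow> ('a \<times> 'b \<Rightarrow>\<^sub>0 'k) set \<Rightarrow> 'c" where
  "tensor_lift C \<beta> t = the_elem ((\<lambda>p. finsum C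
     (\<lambda>(a, b). Poly_Mapping.lookup p (a, b) \<odot>\<^bsub>C\<^esub> \<beta> a b) (Poly_Mapping.keys p)) ` t)"


section \<open>Hopf superalgebras\<close>

record (overloaded) ('k::zero, 'a) hopf_superalg = "('k, 'a) superspace" +
  comult :: "'a \<Rightarrow> ('a \<times> 'a \<Rightarrow>\<^sub>0 'k) set"
  counit :: "'a \<Rightarrow> 'k"
  antipode :: "'a \<Rightarrow> 'a"

locale hopf_superalgebra = superalgebra A
  for A :: "('k::field, 'a, 'm) hopf_superalg_scheme" (structure) +
  assumes comult_hom: "comult A \<in> superalgebra_hom A (tensor A A)"
    and counit_hom: "counit A \<in> superalgebra_hom A ground"
    and antipode_even_linear: "antipode A \<in> even_linear_maps A A"
    and coassoc: "a \<in> carrier A \<Longrightarrow>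
      tensor_lift (tensor A (tensor A A))
        (\<lambda>x y. tensor_lift (tensor A (tensor A A))
          (\<lambda>u v. tens A (tensor A A) u (tens A A v y)) (comult A x)) (comult A a) =
      tensor_lift (tensor A (tensor A A))
        (\<lambda>x y. tens A (tensor A A) x (comult A y)) (comult A a)"
    and counit_left: "a \<in> carrier A \<Longrightarrow>
      tensor_lift A (\<lambda>x y. counit A x \<odot> y) (comult A a) = a"
    and counit_right: "a \<in> carrier A \<Longrightarrow>
      tensor_lift A (\<lambda>x y. counit A y \<odot> x) (comult A a) = a"
    and antipode_left: "a \<in> carrier A \<Longrightarrow>
      tensor_lift A (\<lambda>x y. antipode A x \<otimes> y) (comult A a) = counit A a \<odot> \<one>"
    and antipode_right: "a \<in> carrier A \<Longrightarrow>
      tensor_lift A (\<lambda>x y. x \<otimes> antipode A y) (comult A a) = counit A a \<odot> \<one>"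

definition hopf_superalgebra_hom :: "('k::field, 'a, 'm) hopf_superalg_scheme \<Rightarrow>
    ('k, 'b, 'n) hopf_superalg_scheme \<Rightarrow> ('a \<Rightarrow> 'b) \<Rightarrow> bool" where
  "hopf_superalgebra_hom A B g \<longleftrightarrow>
     hopf_superalgebra A \<and> hopf_superalgebra B \<and> g \<in> superalgebra_hom A B \<and>
     (\<forall>a\<in>carrier A. comult B (g a) =
        tensor_lift (tensor B B) (\<lambda>x y. tens B B (g x) (g y)) (comult A a)) \<and>
     (\<forall>a\<in>carrier A. counit B (g a) = counit A a) \<and>
     (\<forall>a\<in>carrier A. antipode B (g a) = g (antipode A a))"

definition hopf_superalgebra_iso :: "('k::field, 'a, 'm) hopf_superalg_scheme \<Rightarrow>
    ('k, 'b, 'n) hopf_superalg_scheme \<Rightarrow> ('a \<Rightarrow> 'b) \<Rightarrow> bool" where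
  "hopf_superalgebra_iso A B g \<longleftrightarrow>
     hopf_superalgebra_hom A B g \<and> bij_betw g (carrier A) (carrier B)"


section \<open>Algebraic supergroups\<close>

inductive_set generated_subalgebra ::
    "('k, 'a, 'm) superspace_scheme \<Rightarrow> 'a set \<Rightarrow> 'a set" for A and S where
  one: "\<one>\<^bsub>A\<^esub> \<in> generated_subalgebra A S"
| incl: "x \<in> S \<Longrightarrow> x \<in> generated_subalgebra A S"
| add: "\<lbrakk>x \<in> generated_subalgebra A S; y \<in> generated_subalgebra A S\<rbrakk> \<Longrightarrow>
    x \<oplus>\<^bsub>A\<^esub> y \<in> generated_subalgebra A S"
| mult: "\<lbrakk>x \<in> generated_subalgebra A S; y \<in> generated_subalgebra A S\<rbrakk> \<Longrightarrow>
    x \<otimes>\<^bsub>A\<^esub> y \<in> generated_subalgebra A S"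
| smult: "x \<in> generated_subalgebra A S \<Longrightarrow> c \<odot>\<^bsub>A\<^esub> x \<in> generated_subalgebra A S"

text \<open>An algebraic supergroup \<open>X\<close> is given by the Hopf superalgebra \<open>K[X]\<close> representing it;
  the record \<open>X\<close> is this Hopf superalgebra.\<close>

locale algebraic_supergroup = hopf_superalgebra X
  for X :: "('k::field, 'a, 'm) hopf_superalg_scheme" (structure) +
  assumes supercommutative: "\<lbrakk>x \<in> homog X i; y \<in> homog X j\<rbrakk> \<Longrightarrow> x \<otimes> y = koszul i j \<odot> (y \<otimes> x)"
    and finitely_generated:
      "\<exists>S. finite S \<and> S \<subseteq> carrier X \<and> carrier X = generated_subalgebra X S"


section \<open>The distribution superalgebra\<close>

text \<open>Linear functionals on \<open>A\<close>; a functional has parity \<open>i\<close> if it vanishes on the part of the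
  opposite parity. Functionals are \<^const>\<open>undefined\<close> outside the carrier, so that equality of
  functionals is equality of functions.\<close>

definition dual_superspace ::
  "('k::field, 'a, 'm) superspace_scheme \<Rightarrow> ('k, 'a \<Rightarrow> 'k) superspace" where
  "dual_superspace A =
    \<lparr>carrier = linear_maps A ground \<inter> extensional (carrier A),
     mult = undefined, one = undefined,
     zero = (\<lambda>f\<in>carrier A. 0),
     add = (\<lambda>\<phi> \<psi>. \<lambda>f\<in>carrier A. \<phi> f + \<psi> f),
     smult = (\<lambda>c \<phi>. \<lambda>f\<in>carrier A. c * \<phi> f),
     homog = (\<lambda>i. {\<phi> \<in> linear_maps A ground \<inter> extensional (carrier A).
        \<forall>f\<in>homog A (i + 1). \<phi> f = 0})\<rparr>"

primrec ideal_pow :: "('a, 'm) ring_scheme \<Rightarrow> 'a set \<Rightarrow> nat \<Rightarrow> 'a set" where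
  "ideal_pow R I 0 = carrier R"
| "ideal_pow R I (Suc n) = ideal_prod R I (ideal_pow R I n)"

definition augmentation_ideal :: "('k::field, 'a, 'm) hopf_superalg_scheme \<Rightarrow> 'a set" where
  "augmentation_ideal X = a_kernel X (ground :: ('k, 'k) superspace) (counit X)"

text \<open>\<open>(K[X] / M\<^bsup>n+1\<^esup>)\<^sup>*\<close> is identified with the functionals on \<open>K[X]\<close> that vanish on
  \<open>M\<^bsup>n+1\<^esup>\<close>.\<close>

definition dist_filt :: "('k::field, 'a, 'm) hopf_superalg_scheme \<Rightarrow> nat \<Rightarrow> ('a \<Rightarrow> 'k) set" where
  "dist_filt X n = {\<phi> \<in> carrier (dual_superspace X).
     \<forall>f\<in>ideal_pow X (augmentation_ideal X) (n + 1). \<phi> f = 0}"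

text \<open>\<open>(\<phi>\<psi>)(f) = \<Sum> (-1)\<^bsup>|\<psi>||f\<^sub>1|\<^esup> \<phi>(f\<^sub>1) \<psi>(f\<^sub>2)\<close>\<close>

definition dist_mult :: "('k::field, 'a, 'm) hopf_superalg_scheme \<Rightarrow>
    ('a \<Rightarrow> 'k) \<Rightarrow> ('a \<Rightarrow> 'k) \<Rightarrow> ('a \<Rightarrow> 'k)" where
  "dist_mult X \<phi> \<psi> = (\<lambda>f\<in>carrier X. tensor_lift ground
     (\<lambda>f1 f2. \<Sum>(i, j)\<in>UNIV. koszul j i * \<phi> (component X i f1) *
        component (dual_superspace X) j \<psi> f2) (comult X f))"

definition dist_alg ::
  "('k::field, 'a, 'm) hopf_superalg_scheme \<Rightarrow> ('k, 'a \<Rightarrow> 'k) superspace" where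
  "dist_alg X = (dual_superspace X)
    \<lparr>carrier := (\<Union>n. dist_filt X n),
     mult := dist_mult X,
     one := restrict (counit X) (carrier X),
     homog := (\<lambda>i. (\<Union>n. dist_filt X n) \<inter> homog (dual_superspace X) i)\<rparr>"

text \<open>\<open>\<Sum> (-1)\<^bsup>|\<phi>\<^sub>2||f|\<^esup> \<phi>\<^sub>1(f) \<phi>\<^sub>2(h)\<close> for \<open>t = \<Sum> \<phi>\<^sub>1 \<otimes> \<phi>\<^sub>2\<close>\<close>

definition dist_pairing :: "('k::field, 'a, 'm) hopf_superalg_scheme \<Rightarrow>
    (('a \<Rightarrow> 'k) \<times> ('a \<Rightarrow> 'k) \<Rightarrow>\<^sub>0 'k) set \<Rightarrow> 'a \<Rightarrow> 'a \<Rightarrow> 'k" where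
  "dist_pairing X t f h = tensor_lift ground
     (\<lambda>\<phi>1 \<phi>2. \<Sum>(i, j)\<in>UNIV. koszul j i * \<phi>1 (component X i f) *
        component (dual_superspace X) j \<phi>2 h) t"

definition dist_comult :: "('k::field, 'a, 'm) hopf_superalg_scheme \<Rightarrow>
    ('a \<Rightarrow> 'k) \<Rightarrow> (('a \<Rightarrow> 'k) \<times> ('a \<Rightarrow> 'k) \<Rightarrow>\<^sub>0 'k) set" where
  "dist_comult X \<phi> = (THE t. t \<in> carrier (tensor (dist_alg X) (dist_alg X)) \<and>
     (\<forall>f\<in>carrier X. \<forall>h\<in>carrier X. \<phi> (f \<otimes>\<^bsub>X\<^esub> h) = dist_pairing X t f h))"

definition Dist ::
  "('k::field, 'a, 'm) hopf_superalg_scheme \<Rightarrow> ('k, 'a \<Rightarrow> 'k) hopf_superalg" where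
  "Dist X = superspace.extend (dist_alg X) (hopf_superalg.fields
     (dist_comult X)
     (\<lambda>\<phi>. \<phi> \<one>\<^bsub>X\<^esub>)
     (\<lambda>\<phi>. \<lambda>f\<in>carrier X. \<phi> (antipode X f)))"


section \<open>The Lie superalgebra of a supergroup\<close>

record ('k, 'a) lie_superalg = "('k, 'a) superspace" +
  bracket :: "'a \<Rightarrow> 'a \<Rightarrow> 'a"

definition supercommutator :: "('k::field, 'a, 'm) superspace_scheme \<Rightarrow> 'a \<Rightarrow> 'a \<Rightarrow> 'a" where
  "supercommutator A x y = finsum A
     (\<lambda>(i, j). component A i x \<otimes>\<^bsub>A\<^esub> component A j y \<ominus>\<^bsub>A\<^esub>
        koszul i j \<odot>\<^bsub>A\<^esub> (component A j y \<otimes>\<^bsub>A\<^esub> component A i x)) UNIV"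

definition lie_space :: "('k::field, 'a, 'm) hopf_superalg_scheme \<Rightarrow> ('a \<Rightarrow> 'k) set" where
  "lie_space X = {\<phi> \<in> dist_filt X 1. \<phi> \<one>\<^bsub>X\<^esub> = 0}"

definition Lie ::
  "('k::field, 'a, 'm) hopf_superalg_scheme \<Rightarrow> ('k, 'a \<Rightarrow> 'k) lie_superalg" where
  "Lie X = superspace.extend
     ((dual_superspace X)
       \<lparr>carrier := lie_space X, homog := (\<lambda>i. lie_space X \<inter> homog (dual_superspace X) i)\<rparr>)
     (lie_superalg.fields (supercommutator (dist_alg X)))"


section \<open>Universal enveloping superalgebras\<close>

text \<open>Words over \<open>'a\<close> under concatenation, written additively: with this instance
  \<open>'a free_monoid \<Rightarrow>\<^sub>0 'k\<close> with its convolution product is the free associative \<open>'k\<close>-algebra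
  on \<open>'a\<close>.\<close>

datatype 'a free_monoid = Word (letters: "'a list")

instantiation free_monoid :: (type) monoid_add
begin

definition zero_free_monoid :: "'a free_monoid" where
  "zero_free_monoid = Word []"

definition plus_free_monoid :: "'a free_monoid \<Rightarrow> 'a free_monoid \<Rightarrow> 'a free_monoid" where
  "plus_free_monoid u v = Word (letters u @ letters v)"

instance
  by standard (simp_all add: zero_free_monoid_def plus_free_monoid_def)

end

text \<open>The free algebra on the elements of \<open>L\<close>. A word of homogeneous letters has as parity the
  sum of the parities of its letters.\<close>

definition ue_free ::
  "('k::field, 'a, 'm) superspace_scheme \<Rightarrow> ('k, 'a free_monoid \<Rightarrow>\<^sub>0 'k) superspace" where
  "ue_free L =
    \<lparr>carrier = {p. \<forall>w\<in>Poly_Mapping.keys p. set (letters w) \<subseteq> carrier L},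
     mult = (*), one = 1, zero = 0, add = (+), smult = pm_scale,
     homog = (\<lambda>i. {p. \<forall>w\<in>Poly_Mapping.keys p.
        \<exists>js. list_all2 (\<lambda>x j. x \<in> homog L j) (letters w) js \<and> sum_list js = i})\<rparr>"

definition letter :: "'a \<Rightarrow> ('a free_monoid \<Rightarrow>\<^sub>0 'k::field)" where
  "letter x = Poly_Mapping.single (Word [x]) 1"

text \<open>The first two families of relators cut the free algebra down to the tensor algebra
  of \<open>L\<close>.\<close>

definition ue_relators ::
  "('k::field, 'a, 'm) lie_superalg_scheme \<Rightarrow> ('a free_monoid \<Rightarrow>\<^sub>0 'k) set" where
  "ue_relators L =
     {letter (x \<oplus>\<^bsub>L\<^esub> y) - letter x - letter y | x y. x \<in> carrier L \<and> y \<in> carrier L} \<union>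
     {letter (c \<odot>\<^bsub>L\<^esub> x) - pm_scale c (letter x) | c x. x \<in> carrier L} \<union>
     {letter x * letter y - pm_scale (koszul i j) (letter y * letter x) - letter (bracket L x y)
        | i j x y. x \<in> homog L i \<and> y \<in> homog L j}"

definition ue_ideal ::
  "('k::field, 'a, 'm) lie_superalg_scheme \<Rightarrow> ('a free_monoid \<Rightarrow>\<^sub>0 'k) set" where
  "ue_ideal L = genideal (ue_free L) (ue_relators L)"

definition ue_alg ::
  "('k::field, 'a, 'm) lie_superalg_scheme \<Rightarrow> ('k, ('a free_monoid \<Rightarrow>\<^sub>0 'k) set) superspace" where
  "ue_alg L = quotient_superspace (ue_free L) (ue_ideal L)"

definition ue_incl ::
  "('k::field, 'a, 'm) lie_superalg_scheme \<Rightarrow> 'a \<Rightarrow> ('a free_monoid \<Rightarrow>\<^sub>0 'k) set" where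
  "ue_incl L x = ue_ideal L +>\<^bsub>ue_free L\<^esub> letter x"

text \<open>The algebra homomorphism \<open>U(L) \<rightarrow> B\<close> induced by a Lie superalgebra map \<open>f\<close> from \<open>L\<close>
  to \<open>B\<close>: the extension of \<open>f\<close> to the free algebra is constant on each coset of the ideal.\<close>

definition ue_lift :: "('k::field, 'b, 'n) superspace_scheme \<Rightarrow> ('a \<Rightarrow> 'b) \<Rightarrow>
    ('a free_monoid \<Rightarrow>\<^sub>0 'k) set \<Rightarrow> 'b" where
  "ue_lift B f C = the_elem ((\<lambda>p. finsum B
     (\<lambda>w. Poly_Mapping.lookup p w \<odot>\<^bsub>B\<^esub> foldr (\<lambda>x b. f x \<otimes>\<^bsub>B\<^esub> b) (letters w) \<one>\<^bsub>B\<^esub>)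
     (Poly_Mapping.keys p)) ` C)"

text \<open>Comultiplication and counit are the homomorphisms of superalgebras, and the antipode is the
  homomorphism to the super-opposite algebra (i.e. \<open>s(ab) = (-1)\<^bsup>|a||b|\<^esup> s(b) s(a)\<close>), with the
  prescribed values on \<open>L\<close>.\<close>

definition UE :: "('k::field, 'a, 'm) lie_superalg_scheme \<Rightarrow>
    ('k, ('a free_monoid \<Rightarrow>\<^sub>0 'k) set) hopf_superalg" where
  "UE L = (let U = ue_alg L in superspace.extend U (hopf_superalg.fields
     (ue_lift (tensor U U)
        (\<lambda>x. tens U U (ue_incl L x) \<one>\<^bsub>U\<^esub> \<oplus>\<^bsub>tensor U U\<^esub> tens U U \<one>\<^bsub>U\<^esub> (ue_incl L x)))
     (ue_lift ground (\<lambda>x. 0))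
     (ue_lift (super_opposite U) (\<lambda>x. \<ominus>\<^bsub>U\<^esub> ue_incl L x))))"

text \<open>Induced by the inclusion of \<open>Lie(X)\<close> into \<open>Dist(X)\<close>.\<close>

definition canonical_morphism :: "('k::field, 'a, 'm) hopf_superalg_scheme \<Rightarrow>
    (('a \<Rightarrow> 'k) free_monoid \<Rightarrow>\<^sub>0 'k) set \<Rightarrow> ('a \<Rightarrow> 'k)" where
  "canonical_morphism X = ue_lift (Dist X) (\<lambda>\<phi>. \<phi>)"

end

theory Submission
  imports Defs
begin

text \<open>

  Both sides of the morphism consist of linear functionals on the coordinate ring \<open>K[X]\<close>. Convolution makes
  the dual space of \<open>K[X]\<close> an associative superalgebra, and a word in elements of \<open>Lie(X)\<close> evaluates to the
  convolution product of its letters (\<open>eval_free\<close>). Let \<open>M\<close> be the augmentation ideal. The statement is that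
  evaluation maps the words modulo the relations of the enveloping superalgebra bijectively onto the functionals
  that vanish on some power of \<open>M\<close>, and that all structure maps agree.

  The elements of \<open>Lie(X)\<close> are the functionals that satisfy the Leibniz rule at the identity, and
  \<open>\<phi> \<mapsto> x \<phi>\<close> is dual to an invariant superderivation of \<open>K[X]\<close> (\<open>conv_derivation\<close>). Since \<open>K[X]\<close> is
  finitely generated, there are finite dual bases \<open>x\<^sub>j\<close> of \<open>Lie(X)\<close> and \<open>f\<^sub>j\<close> of \<open>M / M\<^sup>2\<close>, with homogeneous
  elements (\<open>dual_basis_exists\<close>). The operator \<open>E(\<phi>) = \<Sum> x\<^sub>j \<phi>(\<sqdot> f\<^sub>j)\<close> is then dual to an Euler
  vector field: if \<open>\<phi>\<close> vanishes on the power \<open>k + 1\<close> of \<open>M\<close>, then \<open>E(\<phi>) = k \<phi>\<close> on the power \<open>k\<close>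
  (\<open>euler\<close>). In characteristic zero one can divide by \<open>k\<close>, and this gives both halves of bijectivity.

  \<^item> Surjectivity (\<open>dist_filt_generated\<close>). If \<open>\<phi>\<close> vanishes on the power \<open>k + 1\<close>, then the functionals
    \<open>\<phi>(\<sqdot> f\<^sub>j)\<close> vanish on the power \<open>k\<close>. By induction they are combinations of words, hence so is
    \<open>E(\<phi>)\<close>, and \<open>\<phi> - E(\<phi>) / k\<close> vanishes on the power \<open>k\<close>.
  \<^item> Injectivity (\<open>eval_free_kernel\<close>). The operation \<open>\<phi> \<mapsto> \<phi>(\<sqdot> f)\<close> has a lift to words, which
    removes a letter \<open>x\<close> at the price of the factor \<open>x f\<close> (\<open>contract\<close>, \<open>eval_contract\<close>), and
    \<open>\<Sum> x\<^sub>j contract f\<^sub>j w\<close> is \<open>k w\<close> up to relations and shorter words if \<open>w\<close> has length \<open>k\<close>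
    (\<open>euler_word\<close>). If a combination of words of length at most \<open>k\<close> evaluates to a functional that is zero on the
    power \<open>k\<close>, its contractions are zero on the power \<open>k - 1\<close>; by induction these are shorter modulo
    the relations, and then so is \<open>k\<close> times the combination. Descending on the length, a combination that
    evaluates to zero lies in the ideal of relations.

  For the Hopf structure, the locale \<open>functional_model\<close> treats any superalgebra \<open>B\<close> of functionals on a
  Hopf superalgebra \<open>A\<close>. An element of \<open>B \<otimes> B\<close> is determined by its values on pairs of elements of \<open>A\<close>, so
  there is at most one comultiplication on \<open>B\<close> that is dual to the product of \<open>A\<close>; it is multiplicative, and with
  the transposed antipode each axiom for \<open>B\<close> becomes an axiom for \<open>A\<close> (\<open>B_hopf_superalgebra\<close>). Both
  superalgebras of the theorem are of this kind. The comultiplication of the enveloping superalgebra is dual to the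
  product because it is so on \<open>Lie(X)\<close> (\<open>dual_comult_generator\<close>), and its antipode is the transposed
  antipode because inversion turns left invariant vector fields into right invariant ones (\<open>conv_antipode\<close>).
  By uniqueness, the structure maps of the two sides correspond.
\<close>

section \<open>Linear algebra over the ground field\<close>

abbreviation single where "single \<equiv> Poly_Mapping.single"
abbreviation keys where "keys \<equiv> Poly_Mapping.keys"
abbreviation lookup where "lookup \<equiv> Poly_Mapping.lookup"

lemma ground_simps [simp]:
  "carrier ground = UNIV" "\<zero>\<^bsub>ground\<^esub> = 0" "\<one>\<^bsub>ground\<^esub> = 1"
  "x \<oplus>\<^bsub>ground\<^esub> y = x + y" "x \<otimes>\<^bsub>ground\<^esub> y = x * y" "x \<odot>\<^bsub>ground\<^esub> y = x * y"
  by (simp_all add: ground_def)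

lemma ground_homog: "homog ground i = (if i = 0 then UNIV else {0})"
  by (simp add: ground_def)

lemma ground_cring: "cring (ground :: ('k::field, 'k) superspace)"
proof (rule cringI)
  show "abelian_group (ground :: ('k, 'k) superspace)"
    by (rule abelian_groupI) (auto intro: exI[where x = "- _"] simp: algebra_simps add_eq_0_iff)
  show "Group.comm_monoid (ground :: ('k, 'k) superspace)"
    by (rule comm_monoidI) (auto simp: algebra_simps)
qed (auto simp: algebra_simps)

lemma ground_module: "Module.module ground (ground :: ('k::field, 'k) superspace)"
  by (rule moduleI)
    (use ground_cring in \<open>auto simp: algebra_simps cring_def ring_def\<close>)

text \<open>Additive inverses come for free: they are multiples by \<open>-1\<close>.\<close>

lemma moduleI_ground:
  fixes M (structure)
  assumes "\<And>x y. \<lbrakk>x \<in> carrier M; y \<in> carrier M\<rbrakk> \<Longrightarrow> x \<oplus> y \<in> carrier M"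
    and "\<zero> \<in> carrier M"
    and "\<And>x y z. \<lbrakk>x \<in> carrier M; y \<in> carrier M; z \<in> carrier M\<rbrakk> \<Longrightarrow> (x \<oplus> y) \<oplus> z = x \<oplus> (y \<oplus> z)"
    and "\<And>x y. \<lbrakk>x \<in> carrier M; y \<in> carrier M\<rbrakk> \<Longrightarrow> x \<oplus> y = y \<oplus> x"
    and "\<And>x. x \<in> carrier M \<Longrightarrow> \<zero> \<oplus> x = x"
    and smult: "\<And>c x. x \<in> carrier M \<Longrightarrow> c \<odot> x \<in> carrier M"
    and l: "\<And>a b x. x \<in> carrier M \<Longrightarrow> (a + b) \<odot> x = a \<odot> x \<oplus> b \<odot> x"
    and "\<And>a x y. \<lbrakk>x \<in> carrier M; y \<in> carrier M\<rbrakk> \<Longrightarrow> a \<odot> (x \<oplus> y) = a \<odot> x \<oplus> a \<odot> y"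
    and "\<And>a b x. x \<in> carrier M \<Longrightarrow> (a * b) \<odot> x = a \<odot> (b \<odot> x)"
    and one: "\<And>x. x \<in> carrier M \<Longrightarrow> 1 \<odot> x = x"
    and null: "\<And>x. x \<in> carrier M \<Longrightarrow> 0 \<odot> x = \<zero>"
  shows "Module.module ground (M :: ('k::field, 'b, 'm) module_scheme)"
proof (rule moduleI[OF ground_cring])
  show "abelian_group M"
  proof (rule abelian_groupI)
    fix x assume x: "x \<in> carrier M"
    show "\<exists>y\<in>carrier M. y \<oplus> x = \<zero>"
      by (rule bexI[where x = "(-1) \<odot> x"]) (use x l[of x "-1" 1] one null smult in auto)
  qed (use assms in auto)
qed (use assms in auto)

lemma finsum_ground [simp]: "finsum (ground :: ('k::field, 'k) superspace) f A = sum f A"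
proof -
  interpret cring "ground :: ('k, 'k) superspace" by (rule ground_cring)
  show ?thesis
    by (induction A rule: infinite_finite_induct) (auto simp: finsum_infinite)
qed

subsection \<open>Linear functionals and sums of lists\<close>

abbreviation functionals :: "('k::field, 'a, 'm) superspace_scheme \<Rightarrow> ('a \<Rightarrow> 'k) set" where
  "functionals A \<equiv> linear_maps A (ground :: ('k, 'k) superspace)"

lemma functionals_iff: "\<phi> \<in> functionals A \<longleftrightarrow>
   (\<forall>x\<in>carrier A. \<forall>y\<in>carrier A. \<phi> (x \<oplus>\<^bsub>A\<^esub> y) = \<phi> x + \<phi> y) \<and>
   (\<forall>c. \<forall>x\<in>carrier A. \<phi> (c \<odot>\<^bsub>A\<^esub> x) = c * \<phi> x)"
  by (auto simp: linear_maps_def)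

lemma functional_add: "\<phi> \<in> functionals A \<Longrightarrow> x \<in> carrier A \<Longrightarrow> y \<in> carrier A \<Longrightarrow>
    \<phi> (x \<oplus>\<^bsub>A\<^esub> y) = \<phi> x + \<phi> y"
  and functional_smult: "\<phi> \<in> functionals A \<Longrightarrow> x \<in> carrier A \<Longrightarrow> \<phi> (c \<odot>\<^bsub>A\<^esub> x) = c * \<phi> x"
  by (auto simp: linear_maps_def)

lemma linear_map_closed: "f \<in> linear_maps A B \<Longrightarrow> x \<in> carrier A \<Longrightarrow> f x \<in> carrier B"
  and linear_map_add: "f \<in> linear_maps A B \<Longrightarrow> x \<in> carrier A \<Longrightarrow> y \<in> carrier A \<Longrightarrow>
    f (x \<oplus>\<^bsub>A\<^esub> y) = f x \<oplus>\<^bsub>B\<^esub> f y"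
  and linear_map_smult: "f \<in> linear_maps A B \<Longrightarrow> x \<in> carrier A \<Longrightarrow> f (c \<odot>\<^bsub>A\<^esub> x) = c \<odot>\<^bsub>B\<^esub> f x"
  by (auto simp: linear_maps_def)

lemma functional_zero:
  assumes "Module.module ground A" "\<phi> \<in> functionals A" shows "\<phi> \<zero>\<^bsub>A\<^esub> = 0"
proof -
  interpret Module.module ground A by fact
  show ?thesis using functional_smult[OF assms(2), of "\<zero>\<^bsub>A\<^esub>" 0] by simp
qed

lemma module_null: "Module.module ground A \<Longrightarrow> x \<in> carrier A \<Longrightarrow> 0 \<odot>\<^bsub>A\<^esub> x = \<zero>\<^bsub>A\<^esub>"
  using Module.module.smult_l_null[of ground A x] by simp

definition lsum :: "('b, 'm) ring_scheme \<Rightarrow> 'b list \<Rightarrow> 'b" where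
  "lsum C ys = foldr (\<lambda>x y. x \<oplus>\<^bsub>C\<^esub> y) ys \<zero>\<^bsub>C\<^esub>"

lemma lsum_simps [simp]: "lsum C [] = \<zero>\<^bsub>C\<^esub>" "lsum C (y # ys) = y \<oplus>\<^bsub>C\<^esub> lsum C ys"
  by (simp_all add: lsum_def)

lemma lsum_closed:
  assumes "Module.module ground C" "set ys \<subseteq> carrier C" shows "lsum C ys \<in> carrier C"
proof -
  interpret Module.module ground C by fact
  show ?thesis using assms(2) by (induction ys) auto
qed

lemma functional_lsum:
  assumes "Module.module ground C" "\<phi> \<in> functionals C" "set ys \<subseteq> carrier C"
  shows "\<phi> (lsum C ys) = sum_list (map \<phi> ys)"
  using assms(3)
  by (induction ys)
    (auto simp: functional_zero[OF assms(1,2)] functional_add[OF assms(2)] lsum_closed[OF assms(1)])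

lemma functional_finsum:
  assumes "Module.module ground C" "\<phi> \<in> functionals C" "f \<in> S \<rightarrow> carrier C"
  shows "\<phi> (finsum C f S) = (\<Sum>s\<in>S. \<phi> (f s))"
proof -
  interpret Module.module ground C by fact
  show ?thesis using assms(3)
    by (induction S rule: infinite_finite_induct)
      (auto simp: finsum_infinite functional_zero[OF assms(1,2)] functional_add[OF assms(2)] Pi_def)
qed

lemma sum_list_cong: "(\<And>x. x \<in> set xs \<Longrightarrow> f x = g x) \<Longrightarrow> sum_list (map f xs) = sum_list (map g xs)"
  by (metis map_cong)

lemma sum_list_swap:
  "(\<Sum>x\<leftarrow>xs. \<Sum>y\<leftarrow>ys. f x y) = (\<Sum>y\<leftarrow>ys. \<Sum>x\<leftarrow>xs. (f x y :: 'k::comm_monoid_add))"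
  by (induction xs) (auto simp: sum_list_addf)

subsection \<open>Linear extension from a basis\<close>

text \<open>Values of \<^const>\<open>tensor_lift\<close> and \<^const>\<open>ue_lift\<close> are values of such extensions.\<close>

definition linear_extension ::
  "('k::field, 'c, 'm) superspace_scheme \<Rightarrow> ('i \<Rightarrow> 'c) \<Rightarrow> ('i \<Rightarrow>\<^sub>0 'k) \<Rightarrow> 'c" where
  "linear_extension C \<gamma> p =
    finsum C (\<lambda>k. lookup p k \<odot>\<^bsub>C\<^esub> \<gamma> k) (keys p)"

lemma lookup_pm_scale [simp]: "lookup (pm_scale c p) k = c * lookup p k"
  by (auto simp: pm_scale_def Poly_Mapping.map.rep_eq when_def)

lemma pm_scale_add: "pm_scale c (p + q) = pm_scale c p + pm_scale c q"
  and pm_scale_add_left: "pm_scale (a + b) p = pm_scale a p + pm_scale b p"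
  and pm_scale_scale: "pm_scale (a * b) p = pm_scale a (pm_scale b p)"
  and pm_scale_one [simp]: "pm_scale 1 p = p"
  and pm_scale_zero [simp]: "pm_scale 0 p = 0"
  and pm_scale_zero_right [simp]: "pm_scale a 0 = 0"
  and pm_scale_minus_one: "pm_scale (- 1) p = - p"
  and pm_scale_single: "pm_scale c (single k a) = single k (c * a)"
  and pm_scale_diff: "pm_scale c (p - q) = pm_scale c p - pm_scale c q"
  by (auto intro!: poly_mapping_eqI simp: lookup_add lookup_minus lookup_single when_def algebra_simps)

lemma keys_pm_scale: "keys (pm_scale c p) \<subseteq> keys p"
  by (auto simp: in_keys_iff)

context
  fixes C :: "('k::field, 'c, 'm) superspace_scheme" (structure)
  assumes C: "Module.module ground C"
begin

interpretation C: Module.module ground C by (rule C)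

lemma linear_extension_superset:
  assumes "\<And>k. k \<in> S \<Longrightarrow> \<gamma> k \<in> carrier C" "finite S" "keys p \<subseteq> S"
  shows "linear_extension C \<gamma> p = finsum C (\<lambda>k. lookup p k \<odot> \<gamma> k) S"
  unfolding linear_extension_def
  by (rule C.add.finprod_mono_neutral_cong_left) (use assms in \<open>auto simp: in_keys_iff module_null[OF C]\<close>)

lemma linear_extension_closed:
  assumes "\<And>k. k \<in> keys p \<Longrightarrow> \<gamma> k \<in> carrier C"
  shows "linear_extension C \<gamma> p \<in> carrier C"
  unfolding linear_extension_def by (rule C.finsum_closed) (use assms in auto)

lemma linear_extension_add:
  assumes "\<And>k. k \<in> keys p \<union> keys q \<Longrightarrow> \<gamma> k \<in> carrier C"
  shows "linear_extension C \<gamma> (p + q) = linear_extension C \<gamma> p \<oplus> linear_extension C \<gamma> q"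
proof -
  let ?S = "keys p \<union> keys q"
  have "linear_extension C \<gamma> (p + q) = finsum C (\<lambda>k. lookup (p + q) k \<odot> \<gamma> k) ?S"
    by (rule linear_extension_superset) (use assms keys_add[of p q] in auto)
  also have "\<dots> = finsum C (\<lambda>k. lookup p k \<odot> \<gamma> k \<oplus> lookup q k \<odot> \<gamma> k) ?S"
    by (rule C.finsum_cong')
      (use assms C.smult_l_distr in \<open>auto simp: lookup_add\<close>)
  also have "\<dots> = finsum C (\<lambda>k. lookup p k \<odot> \<gamma> k) ?S \<oplus>
      finsum C (\<lambda>k. lookup q k \<odot> \<gamma> k) ?S"
    by (rule C.finsum_addf) (use assms in auto)
  also have "\<dots> = linear_extension C \<gamma> p \<oplus> linear_extension C \<gamma> q"
    using linear_extension_superset[of ?S \<gamma> p] linear_extension_superset[of ?S \<gamma> q] assms by auto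
  finally show ?thesis .
qed

lemma linear_extension_scale:
  assumes "\<And>k. k \<in> keys p \<Longrightarrow> \<gamma> k \<in> carrier C"
  shows "linear_extension C \<gamma> (pm_scale c p) = c \<odot> linear_extension C \<gamma> p"
proof -
  have "linear_extension C \<gamma> (pm_scale c p) =
      finsum C (\<lambda>k. lookup (pm_scale c p) k \<odot> \<gamma> k) (keys p)"
    by (rule linear_extension_superset) (use assms keys_pm_scale[of c p] in auto)
  also have "\<dots> = finsum C (\<lambda>k. c \<odot> (lookup p k \<odot> \<gamma> k)) (keys p)"
    by (rule C.finsum_cong') (use assms C.smult_assoc1 in auto)
  also have "\<dots> = c \<odot> linear_extension C \<gamma> p"
    unfolding linear_extension_def by (rule C.finsum_smult_ldistr[symmetric]) (use assms in auto)
  finally show ?thesis .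
qed

lemma linear_extension_single:
  assumes "\<gamma> k \<in> carrier C"
  shows "linear_extension C \<gamma> (single k a) = a \<odot> \<gamma> k"
  using assms by (auto simp: linear_extension_def module_null[OF C])

lemma linear_extension_diff:
  assumes "\<And>k. k \<in> keys p \<union> keys q \<Longrightarrow> \<gamma> k \<in> carrier C"
  shows "linear_extension C \<gamma> (p - q) = linear_extension C \<gamma> p \<ominus> linear_extension C \<gamma> q"
proof -
  have "linear_extension C \<gamma> (p - q) = linear_extension C \<gamma> (p + pm_scale (- 1) q)"
    by (simp add: pm_scale_minus_one)
  also have "\<dots> = linear_extension C \<gamma> p \<oplus> linear_extension C \<gamma> (pm_scale (- 1) q)"
    by (rule linear_extension_add) (use assms keys_pm_scale[of "- 1" q] in auto)
  also have "linear_extension C \<gamma> (pm_scale (- 1) q) = (- 1) \<odot> linear_extension C \<gamma> q"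
    by (rule linear_extension_scale) (use assms in auto)
  also have "\<dots> = \<ominus> linear_extension C \<gamma> q"
  proof -
    have "\<ominus>\<^bsub>ground\<^esub> 1 = (- 1 :: 'k)"
      using C.R.minus_equality[of "- 1" 1] by simp
    then show ?thesis
      using C.smult_l_minus[of 1] linear_extension_closed[of q \<gamma>] assms C.smult_one by auto
  qed
  finally show ?thesis by (simp add: a_minus_def)
qed

end

lemma functional_linear_extension:
  assumes "Module.module ground C" "\<phi> \<in> functionals C"
    "\<And>k. k \<in> keys p \<Longrightarrow> \<gamma> k \<in> carrier C"
  shows "\<phi> (linear_extension C \<gamma> p) =
    (\<Sum>k\<in>keys p. lookup p k * \<phi> (\<gamma> k))"
proof -
  interpret Module.module ground C by fact
  show ?thesis unfolding linear_extension_def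
    by (subst functional_finsum[OF assms(1,2)]) (use assms in \<open>auto simp: functional_smult\<close>)
qed

lemma poly_mapping_sum_singles:
  fixes p :: "'i \<Rightarrow>\<^sub>0 'k::comm_monoid_add"
  shows "(\<Sum>k\<in>keys p. single k (lookup p k)) = p"
  by (rule poly_mapping_eqI) (auto simp: lookup_sum lookup_single when_def in_keys_iff sum.delta)

lemma pm_induct [consumes 1, case_names zero single add]:
  fixes p :: "'i \<Rightarrow>\<^sub>0 'k::comm_monoid_add"
  assumes "keys p \<subseteq> S" "P 0" "\<And>k c. k \<in> S \<Longrightarrow> P (single k c)"
    "\<And>p q. keys p \<subseteq> S \<Longrightarrow> keys q \<subseteq> S \<Longrightarrow> P p \<Longrightarrow> P q \<Longrightarrow> P (p + q)"
  shows "P p"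
proof -
  define f where "f = (\<lambda>k. single k (lookup p k))"
  have "keys (sum f T) \<subseteq> S \<and> P (sum f T)" if "finite T" "T \<subseteq> S" for T
    using that
  proof (induction T)
    case (insert k T)
    then show ?case using keys_add[of "f k" "sum f T"] assms(3,4) keys_single
      by (auto simp: f_def split: if_splits)
  qed (use assms in auto)
  from this[of "keys p"] assms(1) show ?thesis
    by (simp add: f_def poly_mapping_sum_singles)
qed

subsection \<open>Quotients of free vector spaces\<close>

text \<open>The tensor product and the enveloping superalgebra are both quotients of a space of finitely supported
  functions; this locale serves for both.\<close>

locale pm_quotient =
  fixes F :: "('k::field, 'i \<Rightarrow>\<^sub>0 'k) superspace" and N :: "('i \<Rightarrow>\<^sub>0 'k) set"
  assumes add_F: "add F = (+)" and zero_F: "zero F = 0" and smult_F: "smult F = pm_scale"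
    and F_add: "\<And>p q. p \<in> carrier F \<Longrightarrow> q \<in> carrier F \<Longrightarrow> p + q \<in> carrier F"
    and F_scale: "\<And>p c. p \<in> carrier F \<Longrightarrow> pm_scale c p \<in> carrier F"
    and N_sub: "N \<subseteq> carrier F" and N_zero: "0 \<in> N"
    and N_add: "\<And>p q. p \<in> N \<Longrightarrow> q \<in> N \<Longrightarrow> p + q \<in> N"
    and N_scale: "\<And>p c. p \<in> N \<Longrightarrow> pm_scale c p \<in> N"
begin

abbreviation Q where "Q \<equiv> quotient_superspace F N"

lemma coset_eq: "N +>\<^bsub>F\<^esub> p = {n + p | n. n \<in> N}"
  by (auto simp: a_r_coset_def r_coset_def add_F)

lemma N_minus: "p \<in> N \<Longrightarrow> q \<in> N \<Longrightarrow> p - q \<in> N"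
  using N_add[of p "pm_scale (- 1) q"] N_scale[of q "- 1"] by (simp add: pm_scale_minus_one)

lemma coset_eq_iff: "N +>\<^bsub>F\<^esub> p = N +>\<^bsub>F\<^esub> q \<longleftrightarrow> p - q \<in> N"
proof
  assume "N +>\<^bsub>F\<^esub> p = N +>\<^bsub>F\<^esub> q"
  then have "0 + p \<in> {n + q | n. n \<in> N}" using N_zero unfolding coset_eq by blast
  then show "p - q \<in> N" by auto
next
  assume pq: "p - q \<in> N"
  have "n + p = (n + (p - q)) + q \<and> n + q = (n - (p - q)) + p" for n by simp
  then show "N +>\<^bsub>F\<^esub> p = N +>\<^bsub>F\<^esub> q"
    unfolding coset_eq using N_add[OF _ pq] N_minus[OF _ pq] by blast
qed

lemma carrier_Q: "carrier Q = (\<lambda>p. N +>\<^bsub>F\<^esub> p) ` carrier F"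
  by (auto simp: quotient_superspace_def A_RCOSETS_def RCOSETS_def a_r_coset_def)

lemma coset_in_Q: "p \<in> carrier F \<Longrightarrow> N +>\<^bsub>F\<^esub> p \<in> carrier Q"
  by (simp add: carrier_Q)

lemma zero_Q: "\<zero>\<^bsub>Q\<^esub> = N +>\<^bsub>F\<^esub> 0"
  by (simp add: quotient_superspace_def coset_eq)

lemma add_Q: "(N +>\<^bsub>F\<^esub> p) \<oplus>\<^bsub>Q\<^esub> (N +>\<^bsub>F\<^esub> q) = N +>\<^bsub>F\<^esub> (p + q)"
proof -
  have "(N +>\<^bsub>F\<^esub> p) \<oplus>\<^bsub>Q\<^esub> (N +>\<^bsub>F\<^esub> q) = {x + y | x y. x \<in> N +>\<^bsub>F\<^esub> p \<and> y \<in> N +>\<^bsub>F\<^esub> q}"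
    by (auto simp: quotient_superspace_def set_add_def set_mult_def add_F)
  also have "\<dots> = N +>\<^bsub>F\<^esub> (p + q)"
  proof (rule Set.set_eqI, rule iffI)
    fix z assume "z \<in> {x + y | x y. x \<in> N +>\<^bsub>F\<^esub> p \<and> y \<in> N +>\<^bsub>F\<^esub> q}"
    then obtain m n where "m \<in> N" "n \<in> N" "z = (m + p) + (n + q)" by (auto simp: coset_eq)
    then show "z \<in> N +>\<^bsub>F\<^esub> (p + q)"
      using N_add by (auto simp: coset_eq algebra_simps intro!: exI[where x = "m + n"])
  next
    fix z assume "z \<in> N +>\<^bsub>F\<^esub> (p + q)"
    then obtain n where n: "n \<in> N" "z = (n + p) + (0 + q)" by (auto simp: coset_eq algebra_simps)
    then show "z \<in> {x + y | x y. x \<in> N +>\<^bsub>F\<^esub> p \<and> y \<in> N +>\<^bsub>F\<^esub> q}"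
      using N_zero unfolding coset_eq by blast
  qed
  finally show ?thesis .
qed

lemma smult_Q: "c \<odot>\<^bsub>Q\<^esub> (N +>\<^bsub>F\<^esub> p) = N +>\<^bsub>F\<^esub> pm_scale c p"
proof -
  have *: "N +>\<^bsub>F\<^esub> pm_scale c x = N +>\<^bsub>F\<^esub> pm_scale c p" if "x \<in> N +>\<^bsub>F\<^esub> p" for x
    using that N_scale by (auto simp: coset_eq[of p] coset_eq_iff pm_scale_add)
  have "p \<in> N +>\<^bsub>F\<^esub> p" using N_zero by (auto simp: coset_eq intro!: exI[where x = 0])
  then have "(\<Union>x\<in>N +>\<^bsub>F\<^esub> p. N +>\<^bsub>F\<^esub> pm_scale c x) = N +>\<^bsub>F\<^esub> pm_scale c p"
    by (intro SUP_eq_const) (blast, erule *)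
  then show ?thesis by (simp add: quotient_superspace_def smult_F)
qed

lemma Q_cases:
  assumes "x \<in> carrier Q" obtains p where "p \<in> carrier F" "x = N +>\<^bsub>F\<^esub> p"
  using assms unfolding carrier_Q by blast

lemma module_Q: "Module.module ground Q"
proof (rule moduleI_ground)
  have "0 \<in> carrier F" using N_sub N_zero by auto
  then show "\<zero>\<^bsub>Q\<^esub> \<in> carrier Q" by (simp add: zero_Q coset_in_Q)
next
  fix x y z a b assume x: "x \<in> carrier Q" and y: "y \<in> carrier Q" and z: "z \<in> carrier Q"
  obtain p where p: "p \<in> carrier F" "x = N +>\<^bsub>F\<^esub> p" using x by (rule Q_cases)
  obtain q where q: "q \<in> carrier F" "y = N +>\<^bsub>F\<^esub> q" using y by (rule Q_cases)
  obtain r where r: "r \<in> carrier F" "z = N +>\<^bsub>F\<^esub> r" using z by (rule Q_cases)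
  show "x \<oplus>\<^bsub>Q\<^esub> y \<oplus>\<^bsub>Q\<^esub> z = x \<oplus>\<^bsub>Q\<^esub> (y \<oplus>\<^bsub>Q\<^esub> z)" unfolding p q r by (simp only: add_Q add.assoc)
next
  fix x y a assume x: "x \<in> carrier Q" and y: "y \<in> carrier Q"
  obtain p where p: "p \<in> carrier F" "x = N +>\<^bsub>F\<^esub> p" using x by (rule Q_cases)
  obtain q where q: "q \<in> carrier F" "y = N +>\<^bsub>F\<^esub> q" using y by (rule Q_cases)
  show "x \<oplus>\<^bsub>Q\<^esub> y \<in> carrier Q" unfolding p q add_Q by (intro coset_in_Q F_add p q)
  show "x \<oplus>\<^bsub>Q\<^esub> y = y \<oplus>\<^bsub>Q\<^esub> x" unfolding p q add_Q by (simp only: add.commute)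
  show "a \<odot>\<^bsub>Q\<^esub> (x \<oplus>\<^bsub>Q\<^esub> y) = a \<odot>\<^bsub>Q\<^esub> x \<oplus>\<^bsub>Q\<^esub> a \<odot>\<^bsub>Q\<^esub> y"
    unfolding p q by (simp only: add_Q smult_Q pm_scale_add)
next
  fix x a b assume x: "x \<in> carrier Q"
  obtain p where p: "p \<in> carrier F" "x = N +>\<^bsub>F\<^esub> p" using x by (rule Q_cases)
  show "a \<odot>\<^bsub>Q\<^esub> x \<in> carrier Q" unfolding p smult_Q by (intro coset_in_Q F_scale p)
  show "\<zero>\<^bsub>Q\<^esub> \<oplus>\<^bsub>Q\<^esub> x = x" unfolding p zero_Q add_Q by simp
  show "(a + b) \<odot>\<^bsub>Q\<^esub> x = a \<odot>\<^bsub>Q\<^esub> x \<oplus>\<^bsub>Q\<^esub> b \<odot>\<^bsub>Q\<^esub> x"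
    unfolding p by (simp only: add_Q smult_Q pm_scale_add_left)
  show "(a * b) \<odot>\<^bsub>Q\<^esub> x = a \<odot>\<^bsub>Q\<^esub> (b \<odot>\<^bsub>Q\<^esub> x)"
    unfolding p by (simp only: smult_Q pm_scale_scale)
  show "1 \<odot>\<^bsub>Q\<^esub> x = x" unfolding p by (simp only: smult_Q pm_scale_one)
  show "0 \<odot>\<^bsub>Q\<^esub> x = \<zero>\<^bsub>Q\<^esub>" unfolding p by (simp only: smult_Q pm_scale_zero zero_Q)
qed

lemma homog_Q: "homog Q i = (\<lambda>p. N +>\<^bsub>F\<^esub> p) ` homog F i"
  and one_Q: "\<one>\<^bsub>Q\<^esub> = N +>\<^bsub>F\<^esub> \<one>\<^bsub>F\<^esub>"
  by (simp_all add: quotient_superspace_def)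

lemma mult_Q:
  assumes pq: "p \<in> carrier F" "q \<in> carrier F"
    and l: "\<And>n q. n \<in> N \<Longrightarrow> q \<in> carrier F \<Longrightarrow> n \<otimes>\<^bsub>F\<^esub> q \<in> N"
    and r: "\<And>n q. n \<in> N \<Longrightarrow> q \<in> carrier F \<Longrightarrow> q \<otimes>\<^bsub>F\<^esub> n \<in> N"
    and dl: "\<And>x y z. \<lbrakk>x \<in> carrier F; y \<in> carrier F; z \<in> carrier F\<rbrakk> \<Longrightarrow>
       (x + y) \<otimes>\<^bsub>F\<^esub> z = x \<otimes>\<^bsub>F\<^esub> z + y \<otimes>\<^bsub>F\<^esub> z"
    and dr: "\<And>x y z. \<lbrakk>x \<in> carrier F; y \<in> carrier F; z \<in> carrier F\<rbrakk> \<Longrightarrow>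
       z \<otimes>\<^bsub>F\<^esub> (x + y) = z \<otimes>\<^bsub>F\<^esub> x + z \<otimes>\<^bsub>F\<^esub> y"
  shows "(N +>\<^bsub>F\<^esub> p) \<otimes>\<^bsub>Q\<^esub> (N +>\<^bsub>F\<^esub> q) = N +>\<^bsub>F\<^esub> (p \<otimes>\<^bsub>F\<^esub> q)"
proof -
  have *: "N +>\<^bsub>F\<^esub> (x \<otimes>\<^bsub>F\<^esub> y) = N +>\<^bsub>F\<^esub> (p \<otimes>\<^bsub>F\<^esub> q)"
    if xy: "x \<in> N +>\<^bsub>F\<^esub> p" "y \<in> N +>\<^bsub>F\<^esub> q" for x y
  proof -
    obtain m n where mn: "m \<in> N" "n \<in> N" "x = m + p" "y = n + q" using xy unfolding coset_eq by blast
    then have c: "m \<in> carrier F" "n \<in> carrier F" using N_sub by auto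
    have "x \<otimes>\<^bsub>F\<^esub> y = (m \<otimes>\<^bsub>F\<^esub> (n + q) + p \<otimes>\<^bsub>F\<^esub> n) + p \<otimes>\<^bsub>F\<^esub> q"
      using c pq mn by (simp add: dl dr F_add add.assoc)
    moreover have "m \<otimes>\<^bsub>F\<^esub> (n + q) + p \<otimes>\<^bsub>F\<^esub> n \<in> N"
      using c pq mn by (intro N_add l r F_add)
    ultimately show ?thesis by (simp add: coset_eq_iff)
  qed
  have "p \<in> N +>\<^bsub>F\<^esub> p" "q \<in> N +>\<^bsub>F\<^esub> q"
    using N_zero by (auto simp: coset_eq intro!: exI[where x = 0])
  then have "(\<Union>x\<in>N +>\<^bsub>F\<^esub> p. \<Union>y\<in>N +>\<^bsub>F\<^esub> q. N +>\<^bsub>F\<^esub> (x \<otimes>\<^bsub>F\<^esub> y)) = N +>\<^bsub>F\<^esub> (p \<otimes>\<^bsub>F\<^esub> q)"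
    by (intro SUP_eq_const) (blast, blast, erule (1) *)
  then show ?thesis by (simp add: quotient_superspace_def rcoset_mult_def)
qed

text \<open>\<^const>\<open>tensor_lift\<close> and \<^const>\<open>ue_lift\<close> take the unique value of a function on a coset.\<close>

lemma the_elem_coset:
  assumes "p \<in> carrier F" "\<And>n. n \<in> N \<Longrightarrow> h (n + p) = h p"
  shows "the_elem (h ` (N +>\<^bsub>F\<^esub> p)) = h p"
proof -
  have "h ` (N +>\<^bsub>F\<^esub> p) = {h p}"
    using assms N_zero by (force simp: coset_eq)
  then show ?thesis by simp
qed

end

section \<open>Superspaces\<close>

text \<open>Parities are added, so sums of bits have to stay sums.\<close>

declare add_bit_eq_xor [simp del]

lemma bit_add_self [simp]: "(i::bit) + i = 0" "(i::bit) + (i + j) = j" "(i + j) + j = (i::bit)"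
  by (cases i; cases j; simp)+

lemma bit_plus_one_neq [simp]: "(i::bit) + 1 \<noteq> i" "i \<noteq> (i::bit) + 1"
  by (cases i; simp)+

lemma bit_UNIV: "(UNIV :: bit set) = {0, 1}"
  using bit.exhaust by auto

lemma sum_bit: "(\<Sum>i\<in>(UNIV::bit set). f i) = f 0 + f 1"
  by (simp add: bit_UNIV)

lemma sum_bit_pairs:
  "(\<Sum>(i, j)\<in>(UNIV :: (bit \<times> bit) set). f i j) = (\<Sum>i\<in>UNIV. \<Sum>j\<in>UNIV. f i j)"
  by (simp add: sum.cartesian_product flip: UNIV_Times_UNIV)

lemma sum_bit_delta [simp]:
  "(\<Sum>i\<in>(UNIV::bit set). if i = j then f i else 0) = f j"
  "(\<Sum>i\<in>(UNIV::bit set). if j = i then f i else 0) = f j"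
  by (cases j; simp add: bit_UNIV)+

lemma koszul_simps [simp]: "koszul 0 j = 1" "koszul i 0 = 1" "koszul 1 1 = - 1"
  by (auto simp: koszul_def)

lemma koszul_sq [simp]: "koszul i j * koszul i j = 1" "koszul i j * (koszul i j * x) = (x :: 'k::field)"
  by (auto simp: koszul_def)

lemma koszul_sym: "koszul i j = koszul j i"
  by (auto simp: koszul_def)

lemma koszul_add: "koszul i (j + k) = (koszul i j * koszul i k :: 'k::field)"
  "koszul (j + k) i = (koszul j i * koszul k i :: 'k::field)"
  by (cases i; cases j; cases k; simp)+

lemma submoduleI_ground:
  fixes A :: "('k::field, 'b, 'm) module_scheme" (structure)
  assumes A: "Module.module (ground :: ('k, 'k) superspace) A" and H: "H \<subseteq> carrier A" "\<zero> \<in> H"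
    "\<And>a b. \<lbrakk>a \<in> H; b \<in> H\<rbrakk> \<Longrightarrow> a \<oplus> b \<in> H" "\<And>a x. x \<in> H \<Longrightarrow> a \<odot> x \<in> H"
  shows "submodule H (ground :: ('k, 'k) superspace) A"
proof -
  interpret Module.module "ground :: ('k, 'k) superspace" A by (rule A)
  show ?thesis
  proof (rule submoduleI)
    fix a assume a: "a \<in> H"
    have "\<ominus> a = (\<ominus>\<^bsub>ground\<^esub> (1 :: 'k)) \<odot> a"
      using a H smult_l_minus[of 1 a] smult_one[of a] by auto
    then show "\<ominus> a \<in> H" using H(4)[OF a] by simp
  qed (use H in auto)
qed

lemma ground_minus [simp]: "\<ominus>\<^bsub>ground\<^esub> (x :: 'k::field) = - x"
proof -
  interpret cring "ground :: ('k, 'k) superspace" by (rule ground_cring)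
  show ?thesis using minus_equality[of "- x" x] by simp
qed

lemma module_minus: "Module.module ground A \<Longrightarrow> x \<in> carrier A \<Longrightarrow> (- 1) \<odot>\<^bsub>A\<^esub> x = \<ominus>\<^bsub>A\<^esub> x"
  using Module.module.smult_l_minus[of ground A 1 x] Module.module.smult_one[of ground A x] by simp

context superspace
begin

lemma module_A: "Module.module ground A" ..

lemma homog_closed: "x \<in> homog A i \<Longrightarrow> x \<in> carrier A"
  using submoduleE(1)[OF homog_submodule] by blast

lemma homog_add: "x \<in> homog A i \<Longrightarrow> y \<in> homog A i \<Longrightarrow> x \<oplus> y \<in> homog A i"
  and homog_smult: "x \<in> homog A i \<Longrightarrow> c \<odot> x \<in> homog A i"
  and homog_uminus: "x \<in> homog A i \<Longrightarrow> \<ominus> x \<in> homog A i"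
  using submoduleE[OF homog_submodule[of i]] by auto

lemma homog_zero: "\<zero> \<in> homog A i"
  using homog_disjoint by (cases i) auto

lemma homog_both: "x \<in> homog A i \<Longrightarrow> x \<in> homog A (i + 1) \<Longrightarrow> x = \<zero>"
  using homog_disjoint by (cases i) auto

lemma scale_simps [simp]: "x \<in> carrier A \<Longrightarrow> 1 \<odot> x = x" "x \<in> carrier A \<Longrightarrow> 0 \<odot> x = \<zero>"
  "c \<odot> \<zero> = \<zero>" "x \<in> carrier A \<Longrightarrow> c \<odot> x \<in> carrier A"
  using smult_one module_null[OF module_A] smult_r_null[of c] smult_closed by auto

lemma scale_add: "x \<in> carrier A \<Longrightarrow> y \<in> carrier A \<Longrightarrow> c \<odot> (x \<oplus> y) = c \<odot> x \<oplus> c \<odot> y"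
  and scale_add_left: "x \<in> carrier A \<Longrightarrow> (c + d) \<odot> x = c \<odot> x \<oplus> d \<odot> x"
  and scale_scale: "x \<in> carrier A \<Longrightarrow> c \<odot> (d \<odot> x) = (c * d) \<odot> x"
  using smult_r_distr smult_l_distr smult_assoc1 by auto

lemma homog_decomp_at: "a \<in> carrier A \<Longrightarrow> \<exists>x\<in>homog A i. \<exists>y\<in>homog A (i + 1). a = x \<oplus> y"
  using homog_decomp[of a] a_comm homog_closed by (cases i) (auto, metis)

lemma component_eqI:
  assumes "x \<in> homog A i" "y \<in> homog A (i + 1)"
  shows "component A i (x \<oplus> y) = x"
  unfolding component_def
proof (rule the_equality)
  fix x' assume "x' \<in> homog A i \<and> (\<exists>y'\<in>homog A (i + 1). x \<oplus> y = x' \<oplus> y')"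
  then obtain y' where x': "x' \<in> homog A i" and y': "y' \<in> homog A (i + 1)" "x \<oplus> y = x' \<oplus> y'" by auto
  have c: "x \<in> carrier A" "y \<in> carrier A" "x' \<in> carrier A" "y' \<in> carrier A"
    using assms x' y' homog_closed by auto
  have "x' \<ominus> x = y \<ominus> y'"
    using c y'(2) by (metis M.add.inv_solve_left M.add.inv_solve_right M.minus_eq a_assoc a_comm
        M.add.inv_closed M.add.m_closed)
  moreover have "x' \<ominus> x \<in> homog A i" "y \<ominus> y' \<in> homog A (i + 1)"
    using assms x' y' by (auto simp: M.minus_eq intro!: homog_add homog_uminus)
  ultimately have "x' \<ominus> x = \<zero>" using homog_both by auto
  then show "x' = x" using c
    by (metis M.minus_eq M.l_neg M.a_assoc M.r_zero M.l_zero M.a_inv_closed)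
qed (use assms in auto)

lemma component_in: "a \<in> carrier A \<Longrightarrow> component A i a \<in> homog A i"
  using homog_decomp_at[of a i] component_eqI by auto

lemma component_closed [simp]: "a \<in> carrier A \<Longrightarrow> component A i a \<in> carrier A"
  using component_in homog_closed by auto

lemma component_decomp: "a \<in> carrier A \<Longrightarrow> component A i a \<oplus> component A (i + 1) a = a"
proof -
  assume a: "a \<in> carrier A"
  then obtain x y where xy: "x \<in> homog A i" "y \<in> homog A (i + 1)" "a = x \<oplus> y"
    using homog_decomp_at by blast
  have "component A (i + 1) (y \<oplus> x) = y"
    by (rule component_eqI) (use xy in \<open>auto simp: add.assoc\<close>)
  then show ?thesis using xy component_eqI[of x i y] a_comm[of x y] homog_closed by auto
qed

lemma component_decomp_01: "a \<in> carrier A \<Longrightarrow> component A 0 a \<oplus> component A 1 a = a"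
  using component_decomp[of a 0] by simp

lemma component_homog: "a \<in> homog A j \<Longrightarrow> component A i a = (if i = j then a else \<zero>)"
proof -
  assume a: "a \<in> homog A j"
  then have c: "a \<in> carrier A" by (rule homog_closed)
  show ?thesis
  proof (cases "i = j")
    case True then show ?thesis using component_eqI[of a i \<zero>] a c homog_zero by auto
  next
    case False
    then have "j = i + 1" by (cases i; cases j) auto
    then show ?thesis using component_eqI[of \<zero> i a] a c homog_zero False by auto
  qed
qed

lemma component_add: "a \<in> carrier A \<Longrightarrow> b \<in> carrier A \<Longrightarrow>
    component A i (a \<oplus> b) = component A i a \<oplus> component A i b"
proof -
  assume ab: "a \<in> carrier A" "b \<in> carrier A"
  have "a \<oplus> b = (component A i a \<oplus> component A (i + 1) a) \<oplus> (component A i b \<oplus> component A (i + 1) b)"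
    using ab component_decomp by simp
  also have "\<dots> = (component A i a \<oplus> component A i b) \<oplus> (component A (i + 1) a \<oplus> component A (i + 1) b)"
    using ab by (simp add: M.add.m_ac)
  finally show ?thesis
    using component_eqI[of "component A i a \<oplus> component A i b" i
        "component A (i + 1) a \<oplus> component A (i + 1) b"] ab component_in homog_add by metis
qed

lemma component_smult: "a \<in> carrier A \<Longrightarrow> component A i (c \<odot> a) = c \<odot> component A i a"
proof -
  assume a: "a \<in> carrier A"
  have "c \<odot> a = c \<odot> component A i a \<oplus> c \<odot> component A (i + 1) a"
    using component_decomp[OF a, of i] scale_add[of "component A i a" "component A (i + 1) a" c] a by simp
  then show ?thesis
    using component_eqI[of "c \<odot> component A i a" i "c \<odot> component A (i + 1) a"]
      component_in[OF a] homog_smult by metis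
qed

lemma functional_components:
  assumes "\<phi> \<in> functionals A" "a \<in> carrier A"
  shows "\<phi> a = (\<Sum>i\<in>UNIV. \<phi> (component A i a))"
  using functional_add[OF assms(1), of "component A 0 a" "component A 1 a"] assms(2)
    component_decomp_01 by (simp add: sum_bit)

end

section \<open>Tensor products\<close>

definition bilinear :: "('k::field, 'a, 'm) superspace_scheme \<Rightarrow> ('k, 'b, 'n) superspace_scheme \<Rightarrow>
    ('k, 'c, 'l) superspace_scheme \<Rightarrow> ('a \<Rightarrow> 'b \<Rightarrow> 'c) \<Rightarrow> bool" where
  "bilinear A B C \<beta> \<longleftrightarrow>
     (\<forall>b\<in>carrier B. (\<lambda>a. \<beta> a b) \<in> linear_maps A C) \<and> (\<forall>a\<in>carrier A. \<beta> a \<in> linear_maps B C)"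

lemma bilinearD:
  assumes "bilinear A B C \<beta>" "b \<in> carrier B" "a \<in> carrier A"
  shows "(\<lambda>a. \<beta> a b) \<in> linear_maps A C" "\<beta> a \<in> linear_maps B C" "\<beta> a b \<in> carrier C"
    "a' \<in> carrier A \<Longrightarrow> \<beta> (a \<oplus>\<^bsub>A\<^esub> a') b = \<beta> a b \<oplus>\<^bsub>C\<^esub> \<beta> a' b"
    "b' \<in> carrier B \<Longrightarrow> \<beta> a (b \<oplus>\<^bsub>B\<^esub> b') = \<beta> a b \<oplus>\<^bsub>C\<^esub> \<beta> a b'"
    "\<beta> (c \<odot>\<^bsub>A\<^esub> a) b = c \<odot>\<^bsub>C\<^esub> \<beta> a b" "\<beta> a (c \<odot>\<^bsub>B\<^esub> b) = c \<odot>\<^bsub>C\<^esub> \<beta> a b"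
  using assms by (auto simp: bilinear_def linear_maps_def)

lemma bilinearI:
  assumes "\<And>a b. a \<in> carrier A \<Longrightarrow> b \<in> carrier B \<Longrightarrow> \<beta> a b \<in> carrier C"
    "\<And>a a' b. a \<in> carrier A \<Longrightarrow> a' \<in> carrier A \<Longrightarrow> b \<in> carrier B \<Longrightarrow>
       \<beta> (a \<oplus>\<^bsub>A\<^esub> a') b = \<beta> a b \<oplus>\<^bsub>C\<^esub> \<beta> a' b"
    "\<And>a b b'. a \<in> carrier A \<Longrightarrow> b \<in> carrier B \<Longrightarrow> b' \<in> carrier B \<Longrightarrow>
       \<beta> a (b \<oplus>\<^bsub>B\<^esub> b') = \<beta> a b \<oplus>\<^bsub>C\<^esub> \<beta> a b'"
    "\<And>c a b. a \<in> carrier A \<Longrightarrow> b \<in> carrier B \<Longrightarrow> \<beta> (c \<odot>\<^bsub>A\<^esub> a) b = c \<odot>\<^bsub>C\<^esub> \<beta> a b"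
    "\<And>c a b. a \<in> carrier A \<Longrightarrow> b \<in> carrier B \<Longrightarrow> \<beta> a (c \<odot>\<^bsub>B\<^esub> b) = c \<odot>\<^bsub>C\<^esub> \<beta> a b"
  shows "bilinear A B C \<beta>"
  using assms by (auto simp: bilinear_def linear_maps_def)

definition tsum :: "('k::field, 'a, 'm) superspace_scheme \<Rightarrow>
    ('k, 'b, 'n) superspace_scheme \<Rightarrow> ('a \<times> 'b) list \<Rightarrow> ('a \<times> 'b \<Rightarrow>\<^sub>0 'k) set" where
  "tsum A B xs = lsum (tensor A B) (map (\<lambda>(a, b). tens A B a b) xs)"

lemma tsum_Cons: "tsum A B (x # xs) = tens A B (fst x) (snd x) \<oplus>\<^bsub>tensor A B\<^esub> tsum A B xs"
  and tsum_Nil: "tsum A B [] = \<zero>\<^bsub>tensor A B\<^esub>"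
  by (auto simp: tsum_def split: prod.splits)

locale tensor_spaces =
  fixes A :: "('k::field, 'a, 'm) superspace_scheme" and B :: "('k, 'b, 'n) superspace_scheme"
  assumes A: "Module.module ground A" and B: "Module.module ground B"
begin

interpretation A: Module.module ground A by (rule A)
interpretation B: Module.module ground B by (rule B)

abbreviation F where "F \<equiv> tensor_free A B"
abbreviation N where "N \<equiv> tensor_null A B"
abbreviation T where "T \<equiv> tensor A B"

lemma F_simps: "carrier F = {p. keys p \<subseteq> carrier A \<times> carrier B}"
  "add F = (+)" "zero F = 0" "smult F = pm_scale"
  by (auto simp: tensor_free_def)

lemma single_in_F: "a \<in> carrier A \<Longrightarrow> b \<in> carrier B \<Longrightarrow> single (a, b) c \<in> carrier F"
  by (auto simp: F_simps)

lemma F_add: "p \<in> carrier F \<Longrightarrow> q \<in> carrier F \<Longrightarrow> p + q \<in> carrier F"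
  using keys_add[of p q] by (auto simp: F_simps)

lemma F_scale: "p \<in> carrier F \<Longrightarrow> pm_scale c p \<in> carrier F"
  using keys_pm_scale[of c p] by (auto simp: F_simps)

lemma F_diff: "p \<in> carrier F \<Longrightarrow> q \<in> carrier F \<Longrightarrow> p - q \<in> carrier F"
  using F_add[of p "pm_scale (- 1) q"] F_scale[of q "- 1"] by (simp add: pm_scale_minus_one)

lemma module_F: "Module.module ground F"
  by (rule moduleI_ground) (auto simp: F_add[unfolded F_simps, simplified] F_scale[unfolded F_simps, simplified] F_simps pm_scale_add
      pm_scale_add_left pm_scale_scale algebra_simps)

interpretation F: Module.module ground F by (rule module_F)

lemma relators_in_F: "tensor_relators A B \<subseteq> carrier F"
  unfolding tensor_relators_def Let_def
  by (safe; intro F_diff F_scale single_in_F) auto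

lemma N_submodule:
  "N \<subseteq> carrier F" "0 \<in> N" "p \<in> N \<Longrightarrow> q \<in> N \<Longrightarrow> p + q \<in> N" "p \<in> N \<Longrightarrow> pm_scale c p \<in> N"
proof -
  let ?S = "{H. submodule H (ground :: ('k, 'k) superspace) F \<and> tensor_relators A B \<subseteq> H}"
  have "carrier F \<in> ?S" using F.carrier_is_submodule relators_in_F by auto
  then show "N \<subseteq> carrier F" unfolding tensor_null_def by blast
  show "0 \<in> N" unfolding tensor_null_def
    using subgroup.one_closed[OF submodule.axioms(1)] F_simps(3) by fastforce
  show "p \<in> N \<Longrightarrow> q \<in> N \<Longrightarrow> p + q \<in> N" unfolding tensor_null_def
    using F.submoduleE(5) F_simps(2) by fastforce
  show "p \<in> N \<Longrightarrow> pm_scale c p \<in> N" unfolding tensor_null_def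
    using F.submoduleE(4) F_simps(4) by fastforce
qed

sublocale TQ: pm_quotient F N
  by unfold_locales (auto simp: F_simps(2-) F_add F_scale N_submodule(2-) intro: N_submodule(1)[THEN subsetD])

lemma N_induct [consumes 1, case_names zero relator add scale]:
  assumes "n \<in> N" "P 0" "\<And>r. r \<in> tensor_relators A B \<Longrightarrow> P r"
    "\<And>p q. p \<in> carrier F \<Longrightarrow> q \<in> carrier F \<Longrightarrow> P p \<Longrightarrow> P q \<Longrightarrow> P (p + q)"
    "\<And>c p. p \<in> carrier F \<Longrightarrow> P p \<Longrightarrow> P (pm_scale c p)"
  shows "P n"
proof -
  have "submodule {p \<in> carrier F. P p} ground F"
    by (rule submoduleI_ground[OF module_F]) (use assms F_add F_scale N_submodule(1,2) in \<open>auto simp: F_simps(2-)\<close>)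
  moreover have "tensor_relators A B \<subseteq> {p \<in> carrier F. P p}" using assms relators_in_F by auto
  ultimately have "N \<subseteq> {p \<in> carrier F. P p}" unfolding tensor_null_def by blast
  then show ?thesis using assms(1) by auto
qed

lemma T_eq: "T = TQ.Q" by (simp add: tensor_def)

lemma module_T: "Module.module ground T"
  unfolding T_eq by (rule TQ.module_Q)

lemma tens_eq: "tens A B a b = N +>\<^bsub>F\<^esub> single (a, b) 1"
  by (simp add: tens_def)

lemma coset_single: "N +>\<^bsub>F\<^esub> single (a, b) c = c \<odot>\<^bsub>T\<^esub> tens A B a b"
  unfolding tens_eq T_eq TQ.smult_Q by (simp add: pm_scale_single)

lemma tens_closed: "a \<in> carrier A \<Longrightarrow> b \<in> carrier B \<Longrightarrow> tens A B a b \<in> carrier T"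
  unfolding tens_eq T_eq by (intro TQ.coset_in_Q single_in_F)

lemma relator_in_N: "r \<in> tensor_relators A B \<Longrightarrow> r \<in> N"
  unfolding tensor_null_def by blast

lemma tens_bilinear: "bilinear A B T (tens A B)"
proof (rule bilinearI)
  fix a a' b assume *: "a \<in> carrier A" "a' \<in> carrier A" "b \<in> carrier B"
  have "single (a \<oplus>\<^bsub>A\<^esub> a', b) 1 - single (a, b) 1
      - single (a', b) 1 \<in> N"
    by (rule relator_in_N, unfold tensor_relators_def Let_def, rule UnI1, rule UnI1, rule UnI1, rule CollectI,
        intro exI conjI, rule refl) (use * in auto)
  then show "tens A B (a \<oplus>\<^bsub>A\<^esub> a') b = tens A B a b \<oplus>\<^bsub>T\<^esub> tens A B a' b"
    by (simp add: tens_eq T_eq TQ.add_Q TQ.coset_eq_iff algebra_simps)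
next
  fix a b b' assume *: "a \<in> carrier A" "b \<in> carrier B" "b' \<in> carrier B"
  have "single (a, b \<oplus>\<^bsub>B\<^esub> b') 1 - single (a, b) 1
      - single (a, b') 1 \<in> N"
    by (rule relator_in_N, unfold tensor_relators_def Let_def, rule UnI1, rule UnI1, rule UnI2, rule CollectI,
        intro exI conjI, rule refl) (use * in auto)
  then show "tens A B a (b \<oplus>\<^bsub>B\<^esub> b') = tens A B a b \<oplus>\<^bsub>T\<^esub> tens A B a b'"
    by (simp add: tens_eq T_eq TQ.add_Q TQ.coset_eq_iff algebra_simps)
next
  fix c a b assume *: "a \<in> carrier A" "b \<in> carrier B"
  have "single (c \<odot>\<^bsub>A\<^esub> a, b) 1 - pm_scale c (single (a, b) 1) \<in> N"
    by (rule relator_in_N, unfold tensor_relators_def Let_def, rule UnI1, rule UnI2, rule CollectI,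
        intro exI conjI, rule refl) (use * in auto)
  moreover have "single (a, c \<odot>\<^bsub>B\<^esub> b) 1 - pm_scale c (single (a, b) 1) \<in> N"
    by (rule relator_in_N, unfold tensor_relators_def Let_def, rule UnI2, rule CollectI,
        intro exI conjI, rule refl) (use * in auto)
  ultimately show "tens A B (c \<odot>\<^bsub>A\<^esub> a) b = c \<odot>\<^bsub>T\<^esub> tens A B a b" "tens A B a (c \<odot>\<^bsub>B\<^esub> b) = c \<odot>\<^bsub>T\<^esub> tens A B a b"
    by (simp_all add: tens_eq T_eq TQ.smult_Q TQ.coset_eq_iff)
qed (rule tens_closed)

lemma tsum_closed: "set xs \<subseteq> carrier A \<times> carrier B \<Longrightarrow> tsum A B xs \<in> carrier T"
  unfolding tsum_def by (rule lsum_closed[OF module_T]) (auto intro: tens_closed)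

text \<open>The coefficients are absorbed into the first factors, which keeps track of the supports; this is what preserves
  homogeneity in the representation of homogeneous tensors below.\<close>

lemma coset_rep:
  assumes "p \<in> carrier F"
  shows "\<exists>xs. set xs \<subseteq> (\<lambda>(a, b). (lookup p (a, b) \<odot>\<^bsub>A\<^esub> a, b)) ` keys p \<and>
    N +>\<^bsub>F\<^esub> p = tsum A B xs"
proof -
  have *: "\<exists>xs. set xs \<subseteq> (\<lambda>(a, b). (lookup p (a, b) \<odot>\<^bsub>A\<^esub> a, b)) ` S \<and>
    N +>\<^bsub>F\<^esub> (\<Sum>k\<in>S. single k (lookup p k)) = tsum A B xs"
    if "finite S" "S \<subseteq> carrier A \<times> carrier B" for S
    using that
  proof (induction S)
    case empty
    then show ?case by (auto simp: tsum_Nil T_eq TQ.zero_Q intro!: exI[where x = "[]"])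
  next
    case (insert k S)
    obtain a b where k: "k = (a, b)" "a \<in> carrier A" "b \<in> carrier B" using insert by (cases k) auto
    obtain xs where xs: "set xs \<subseteq> (\<lambda>(a, b). (lookup p (a, b) \<odot>\<^bsub>A\<^esub> a, b)) ` S"
      "N +>\<^bsub>F\<^esub> (\<Sum>k\<in>S. single k (lookup p k)) = tsum A B xs"
      using insert by auto
    have "N +>\<^bsub>F\<^esub> (\<Sum>k\<in>insert k S. single k (lookup p k)) =
        (N +>\<^bsub>F\<^esub> single k (lookup p k)) \<oplus>\<^bsub>T\<^esub> tsum A B xs"
      unfolding xs(2)[symmetric] T_eq TQ.add_Q using insert(1,2) by simp
    also have "\<dots> = tsum A B ((lookup p k \<odot>\<^bsub>A\<^esub> a, b) # xs)"
      by (simp add: tsum_Cons k coset_single bilinearD[OF tens_bilinear])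
    finally show ?case using xs(1) k by (intro exI[where x = "(lookup p k \<odot>\<^bsub>A\<^esub> a, b) # xs"]) auto
  qed
  from *[of "keys p"] assms show ?thesis by (auto simp: poly_mapping_sum_singles F_simps)
qed

lemma tensor_rep:
  assumes "t \<in> carrier T"
  shows "\<exists>xs. set xs \<subseteq> carrier A \<times> carrier B \<and> t = tsum A B xs"
proof -
  obtain p where p: "p \<in> carrier F" "t = N +>\<^bsub>F\<^esub> p" using assms unfolding T_eq by (rule TQ.Q_cases)
  obtain xs where xs: "set xs \<subseteq> (\<lambda>(a, b). (lookup p (a, b) \<odot>\<^bsub>A\<^esub> a, b)) ` keys p"
    "t = tsum A B xs" using coset_rep[OF p(1)] p(2) by blast
  moreover have "(\<lambda>(a, b). (lookup p (a, b) \<odot>\<^bsub>A\<^esub> a, b)) ` keys p \<subseteq> carrier A \<times> carrier B"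
    using p(1) by (auto simp: F_simps)
  ultimately show ?thesis by (intro exI[where x = xs]) blast
qed

text \<open>The universal property of the tensor product: the linear extension of a bilinear map kills the relators, so it
  descends to the cosets.\<close>

context
  fixes C :: "('k, 'c, 'l) superspace_scheme" and \<beta> :: "'a \<Rightarrow> 'b \<Rightarrow> 'c"
  assumes C: "Module.module ground C" and bil: "bilinear A B C \<beta>"
begin

interpretation C: Module.module ground C by (rule C)

lemma beta_closed: "p \<in> carrier F \<Longrightarrow> k \<in> keys p \<Longrightarrow> case_prod \<beta> k \<in> carrier C"
  using bilinearD(3)[OF bil] by (auto simp: F_simps)

lemma null_extension: "n \<in> N \<Longrightarrow> linear_extension C (case_prod \<beta>) n = \<zero>\<^bsub>C\<^esub>"
proof (induction n rule: N_induct)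
  case zero
  then show ?case by (simp add: linear_extension_def)
next
  case (add p q)
  then show ?case by (subst linear_extension_add[OF C]) (auto dest: beta_closed)
next
  case (scale c p)
  then show ?case
    using C.smult_r_null[of c] by (subst linear_extension_scale[OF C]) (auto dest: beta_closed)
next
  case (relator r)
  note E = linear_extension_diff[OF C] linear_extension_scale[OF C] linear_extension_single[OF C]
  have *: "case_prod \<beta> k \<in> carrier C" if "k \<in> carrier A \<times> carrier B" for k
    using that bilinearD(3)[OF bil] by auto
  have keys: "keys (x - y :: 'a \<times> 'b \<Rightarrow>\<^sub>0 'k) \<subseteq> keys x \<union> keys y" for x y
    by (auto simp: in_keys_iff lookup_minus)
  have z1: "x \<ominus>\<^bsub>C\<^esub> x = \<zero>\<^bsub>C\<^esub>" if "x \<in> carrier C" for x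
    using that by (simp add: C.minus_eq C.r_neg)
  have z2: "(x \<oplus>\<^bsub>C\<^esub> y) \<ominus>\<^bsub>C\<^esub> x \<ominus>\<^bsub>C\<^esub> y = \<zero>\<^bsub>C\<^esub>" if "x \<in> carrier C" "y \<in> carrier C" for x y
  proof -
    have "(x \<oplus>\<^bsub>C\<^esub> y) \<ominus>\<^bsub>C\<^esub> x \<ominus>\<^bsub>C\<^esub> y = (x \<oplus>\<^bsub>C\<^esub> \<ominus>\<^bsub>C\<^esub> x) \<oplus>\<^bsub>C\<^esub> (y \<oplus>\<^bsub>C\<^esub> \<ominus>\<^bsub>C\<^esub> y)"
      using that by (simp add: C.minus_eq C.M.add.m_ac)
    then show ?thesis using that by (simp add: C.r_neg)
  qed
  have ext_single: "linear_extension C (case_prod \<beta>) (single (a, b) 1) = \<beta> a b"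
    if "a \<in> carrier A" "b \<in> carrier B" for a b
    using E(3)[of "case_prod \<beta>" "(a, b)" 1] that bilinearD(3)[OF bil] C.smult_one by auto
  have three: "linear_extension C (case_prod \<beta>) (single k 1 - single l 1 - single m 1) =
     case_prod \<beta> k \<ominus>\<^bsub>C\<^esub> case_prod \<beta> l \<ominus>\<^bsub>C\<^esub> case_prod \<beta> m"
    if klm: "k \<in> carrier A \<times> carrier B" "l \<in> carrier A \<times> carrier B" "m \<in> carrier A \<times> carrier B" for k l m
  proof (subst E(1))
    show "case_prod \<beta> x \<in> carrier C" if "x \<in> keys (single k 1 - single l (1::'k)) \<union>
        keys (single m (1::'k))" for x
      using that keys[of "single k 1" "single l 1"] klm by (intro *) auto
    show "linear_extension C (case_prod \<beta>) (single k 1 - single l 1) \<ominus>\<^bsub>C\<^esub>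
      linear_extension C (case_prod \<beta>) (single m 1) = case_prod \<beta> k \<ominus>\<^bsub>C\<^esub> case_prod \<beta> l \<ominus>\<^bsub>C\<^esub> case_prod \<beta> m"
      using klm by (subst E(1)) (auto simp: ext_single intro: bilinearD(3)[OF bil])
  qed
  have two: "linear_extension C (case_prod \<beta>) (single k 1 - pm_scale c (single l 1)) =
     case_prod \<beta> k \<ominus>\<^bsub>C\<^esub> c \<odot>\<^bsub>C\<^esub> case_prod \<beta> l"
    if klm: "k \<in> carrier A \<times> carrier B" "l \<in> carrier A \<times> carrier B" for k l c
  proof (subst E(1))
    show "case_prod \<beta> x \<in> carrier C" if "x \<in> keys (single k (1::'k)) \<union>
        keys (pm_scale c (single l (1::'k)))" for x
      using that keys_pm_scale[of c "single l 1"] klm by (intro *) auto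
    show "linear_extension C (case_prod \<beta>) (single k 1) \<ominus>\<^bsub>C\<^esub>
      linear_extension C (case_prod \<beta>) (pm_scale c (single l 1)) = case_prod \<beta> k \<ominus>\<^bsub>C\<^esub> c \<odot>\<^bsub>C\<^esub> case_prod \<beta> l"
      using klm by (subst E(2)) (auto simp: ext_single intro: bilinearD(3)[OF bil])
  qed
  from relator show ?case
    unfolding tensor_relators_def Let_def
    by (elim UnE CollectE exE conjE; simp only:)
      (simp_all add: three two z1 z2 bilinearD[OF bil])
qed

lemma tensor_lift_coset:
  assumes "p \<in> carrier F"
  shows "tensor_lift C \<beta> (N +>\<^bsub>F\<^esub> p) = linear_extension C (case_prod \<beta>) p"
proof -
  have "tensor_lift C \<beta> (N +>\<^bsub>F\<^esub> p) = the_elem (linear_extension C (case_prod \<beta>) ` (N +>\<^bsub>F\<^esub> p))"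
    unfolding tensor_lift_def linear_extension_def by (simp add: case_prod_unfold)
  also have "\<dots> = linear_extension C (case_prod \<beta>) p"
  proof (rule TQ.the_elem_coset[OF assms])
    fix n assume n: "n \<in> N"
    then have "n \<in> carrier F" using N_submodule by auto
    then show "linear_extension C (case_prod \<beta>) (n + p) = linear_extension C (case_prod \<beta>) p"
      using linear_extension_add[OF C, of n p "case_prod \<beta>"] assms beta_closed null_extension[OF n]
        linear_extension_closed[OF C, of p "case_prod \<beta>"] by auto
  qed
  finally show ?thesis .
qed

lemma tensor_lift_linear: "tensor_lift C \<beta> \<in> linear_maps T C"
proof -
  have "tensor_lift C \<beta> t \<in> carrier C" if "t \<in> carrier T" for t
    using that unfolding T_eq
    by (elim TQ.Q_cases) (auto simp: tensor_lift_coset intro!: linear_extension_closed[OF C] dest: beta_closed)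
  moreover have "tensor_lift C \<beta> (t \<oplus>\<^bsub>T\<^esub> u) = tensor_lift C \<beta> t \<oplus>\<^bsub>C\<^esub> tensor_lift C \<beta> u"
    if tu: "t \<in> carrier T" "u \<in> carrier T" for t u
  proof -
    obtain p where p: "p \<in> carrier F" "t = N +>\<^bsub>F\<^esub> p" using tu(1) unfolding T_eq by (rule TQ.Q_cases)
    obtain q where q: "q \<in> carrier F" "u = N +>\<^bsub>F\<^esub> q" using tu(2) unfolding T_eq by (rule TQ.Q_cases)
    have "t \<oplus>\<^bsub>T\<^esub> u = N +>\<^bsub>F\<^esub> (p + q)" unfolding p q T_eq TQ.add_Q ..
    moreover have "linear_extension C (case_prod \<beta>) (p + q) =
        linear_extension C (case_prod \<beta>) p \<oplus>\<^bsub>C\<^esub> linear_extension C (case_prod \<beta>) q"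
      by (rule linear_extension_add[OF C]) (use p q beta_closed in blast)
    ultimately show ?thesis using p q by (simp add: tensor_lift_coset F_add)
  qed
  moreover have "tensor_lift C \<beta> (c \<odot>\<^bsub>T\<^esub> t) = c \<odot>\<^bsub>C\<^esub> tensor_lift C \<beta> t" if ct: "t \<in> carrier T" for c t
  proof -
    obtain p where p: "p \<in> carrier F" "t = N +>\<^bsub>F\<^esub> p" using ct unfolding T_eq by (rule TQ.Q_cases)
    have "c \<odot>\<^bsub>T\<^esub> t = N +>\<^bsub>F\<^esub> (pm_scale c p)" unfolding p T_eq TQ.smult_Q ..
    moreover have "linear_extension C (case_prod \<beta>) (pm_scale c p) = c \<odot>\<^bsub>C\<^esub> linear_extension C (case_prod \<beta>) p"
      by (rule linear_extension_scale[OF C]) (use p beta_closed in blast)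
    ultimately show ?thesis using p by (simp add: tensor_lift_coset F_scale)
  qed
  ultimately show ?thesis by (auto simp: linear_maps_def)
qed

lemma tensor_lift_tens:
  assumes "a \<in> carrier A" "b \<in> carrier B" shows "tensor_lift C \<beta> (tens A B a b) = \<beta> a b"
  using assms tensor_lift_coset[OF single_in_F[OF assms, of 1]]
    linear_extension_single[OF C, of "case_prod \<beta>" "(a, b)" 1] bilinearD(3)[OF bil, of b a] C.smult_one
  by (auto simp: tens_eq)

end

lemma functional_tsum:
  assumes "h \<in> functionals T" "set xs \<subseteq> carrier A \<times> carrier B"
  shows "h (tsum A B xs) = (\<Sum>(a, b)\<leftarrow>xs. h (tens A B a b))"
  unfolding tsum_def
  by (subst functional_lsum[OF module_T assms(1)])
    (use assms in \<open>auto simp: comp_def case_prod_unfold intro!: tens_closed\<close>)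

lemma functional_T_eqI:
  assumes "h \<in> functionals T" "h' \<in> functionals T" "t \<in> carrier T"
    "\<And>a b. a \<in> carrier A \<Longrightarrow> b \<in> carrier B \<Longrightarrow> h (tens A B a b) = h' (tens A B a b)"
  shows "h t = h' t"
proof -
  obtain xs where xs: "set xs \<subseteq> carrier A \<times> carrier B" "t = tsum A B xs" using tensor_rep[OF assms(3)] by blast
  then show ?thesis
    using assms(4) by (auto simp: functional_tsum[OF assms(1)] functional_tsum[OF assms(2)] intro!: sum_list_cong)
qed

lemma lift_tsum:
  assumes "bilinear A B (ground :: ('k, 'k) superspace) \<beta>" "set xs \<subseteq> carrier A \<times> carrier B"
  shows "tensor_lift ground \<beta> (tsum A B xs) = (\<Sum>(a, b)\<leftarrow>xs. \<beta> a b)"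
  by (subst functional_tsum[OF tensor_lift_linear[OF ground_module assms(1)] assms(2)])
    (use assms in \<open>auto simp: tensor_lift_tens[OF ground_module assms(1)] intro!: sum_list_cong\<close>)

text \<open>Together with the fact that functionals on \<open>A \<otimes> B\<close> are determined by pure tensors, this reduces
  identities between lifts to computations with scalars.\<close>

lemma functional_lift:
  assumes C: "Module.module ground C" and b: "bilinear A B C \<beta>" and h: "h \<in> functionals C"
    and t: "t \<in> carrier T"
  shows "h (tensor_lift C \<beta> t) = tensor_lift ground (\<lambda>a b. h (\<beta> a b)) t"
proof -
  have b': "bilinear A B ground (\<lambda>a b. h (\<beta> a b))"
    by (rule bilinearI) (use h in \<open>auto simp: bilinearD[OF b] functional_add functional_smult\<close>)
  note l = tensor_lift_linear[OF C b]
  have "(\<lambda>t. h (tensor_lift C \<beta> t)) \<in> functionals T"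
    using linear_map_add[OF l] linear_map_smult[OF l] linear_map_closed[OF l]
    by (auto simp: functionals_iff functional_add[OF h] functional_smult[OF h])
  from functional_T_eqI[OF this tensor_lift_linear[OF ground_module b'] t] show ?thesis
    by (simp add: tensor_lift_tens[OF C b] tensor_lift_tens[OF ground_module b'])
qed

text \<open>Values outside the carriers do not matter, since a coset of the null space contains only elements that are
  supported in the carriers.\<close>

lemma lift_cong:
  assumes C: "Module.module ground C" and b: "bilinear A B C \<beta>" and t: "t \<in> carrier T"
    and eq: "\<And>a b. a \<in> carrier A \<Longrightarrow> b \<in> carrier B \<Longrightarrow> \<beta> a b = \<beta>' a b"
  shows "tensor_lift C \<beta> t = tensor_lift C \<beta>' t"
proof -
  obtain p where p: "p \<in> carrier F" "t = N +>\<^bsub>F\<^esub> p" using t unfolding T_eq by (rule TQ.Q_cases)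
  have "finsum C (\<lambda>(a, b). lookup q (a, b) \<odot>\<^bsub>C\<^esub> \<beta> a b) (keys q) =
    finsum C (\<lambda>(a, b). lookup q (a, b) \<odot>\<^bsub>C\<^esub> \<beta>' a b) (keys q)"
    if "q \<in> t" for q
  proof -
    have "q \<in> carrier F" using that p N_submodule(1) F_add by (auto simp: TQ.coset_eq)
    then have *: "(a, b) \<in> keys q \<Longrightarrow> \<beta> a b = \<beta>' a b" for a b by (auto simp: F_simps eq)
    interpret C: Module.module ground C by (rule C)
    have "\<beta> a b \<in> carrier C" if "(a, b) \<in> keys q" for a b
      by (rule bilinearD(3)[OF b]) (use that \<open>q \<in> carrier F\<close> in \<open>auto simp: F_simps\<close>)
    then have "\<beta>' a b \<in> carrier C" if "(a, b) \<in> keys q" for a b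
      using *[OF that] that by metis
    then show ?thesis
      by (intro C.finsum_cong'[OF refl]) (auto simp: *)
  qed
  then show ?thesis unfolding tensor_lift_def by (metis (no_types, lifting) image_cong)
qed

text \<open>Induction on the number of summands: a functional that does not vanish on the first vector gives a relation
  between the second factors, which removes one summand.\<close>

lemma tsum_separation:
  assumes Phi: "\<Phi> \<subseteq> functionals A" "\<And>a. a \<in> carrier A \<Longrightarrow> (\<And>\<phi>. \<phi> \<in> \<Phi> \<Longrightarrow> \<phi> a = 0) \<Longrightarrow> a = \<zero>\<^bsub>A\<^esub>"
    and Psi: "\<Psi> \<subseteq> functionals B" "\<And>b. b \<in> carrier B \<Longrightarrow> (\<And>\<psi>. \<psi> \<in> \<Psi> \<Longrightarrow> \<psi> b = 0) \<Longrightarrow> b = \<zero>\<^bsub>B\<^esub>"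
    and xs: "set xs \<subseteq> carrier A \<times> carrier B"
    and zero: "\<And>\<phi> \<psi>. \<phi> \<in> \<Phi> \<Longrightarrow> \<psi> \<in> \<Psi> \<Longrightarrow> (\<Sum>(a, b)\<leftarrow>xs. \<phi> a * \<psi> b) = 0"
  shows "tsum A B xs = \<zero>\<^bsub>T\<^esub>"
  using xs zero
proof (induction "length xs" arbitrary: xs)
  case 0
  then show ?case by (simp add: tsum_Nil)
next
  case (Suc n)
  interpret T: Module.module ground T by (rule module_T)
  obtain v w ys where xs: "xs = (v, w) # ys" using Suc(2) by (cases xs) auto
  have c: "v \<in> carrier A" "w \<in> carrier B" "set ys \<subseteq> carrier A \<times> carrier B" using Suc xs by auto
  note bil = bilinearD[OF tens_bilinear]
  note Phi' = subsetD[OF Phi(1)] and Psi' = subsetD[OF Psi(1)]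
  show ?case
  proof (cases "v = \<zero>\<^bsub>A\<^esub>")
    case True
    have "tens A B v w = 0 \<odot>\<^bsub>T\<^esub> tens A B v w"
      using bil(6)[of w v 0] c True by (simp add: module_null[OF A])
    then have "tens A B v w = \<zero>\<^bsub>T\<^esub>" using c by (simp add: module_null[OF module_T] tens_closed)
    moreover have "tsum A B ys = \<zero>\<^bsub>T\<^esub>"
      using Suc(1)[of ys] Suc(2,4) c xs True by (auto simp: functional_zero[OF A Phi'])
    ultimately show ?thesis by (simp add: xs tsum_Cons)
  next
    case False
    then obtain \<phi> where phi: "\<phi> \<in> \<Phi>" "\<phi> v \<noteq> 0" using Phi(2)[OF c(1)] by auto
    define d where "d = (\<lambda>a. - (\<phi> a / \<phi> v))"
    define z where "z = lsum B (map (\<lambda>(a, b). d a \<odot>\<^bsub>B\<^esub> b) ys)"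
    define ys' where "ys' = map (\<lambda>(a, b). (a \<oplus>\<^bsub>A\<^esub> d a \<odot>\<^bsub>A\<^esub> v, b)) ys"
    have z: "z \<in> carrier B" unfolding z_def by (rule lsum_closed[OF B]) (use c in auto)
    have psi_z: "\<psi> z = (\<Sum>(a, b)\<leftarrow>ys. d a * \<psi> b)" if "\<psi> \<in> \<Psi>" for \<psi>
      unfolding z_def using c
      by (subst functional_lsum[OF B Psi'[OF that]])
        (auto simp: functional_smult[OF Psi'[OF that]] intro!: sum_list_cong)
    have psi_w: "\<psi> w = \<psi> z" if "\<psi> \<in> \<Psi>" for \<psi>
    proof -
      have "\<phi> v * \<psi> w + (\<Sum>(a, b)\<leftarrow>ys. \<phi> a * \<psi> b) = 0" using Suc(4)[OF phi(1) that] xs by simp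
      moreover have "\<phi> v * \<psi> z = - (\<Sum>(a, b)\<leftarrow>ys. \<phi> a * \<psi> b)"
        unfolding psi_z[OF that] using phi(2)
        by (induction ys) (auto simp: d_def field_simps)
      ultimately have "\<phi> v * (\<psi> w - \<psi> z) = 0" by (simp add: algebra_simps)
      then show ?thesis using phi(2) by simp
    qed
    have "w \<oplus>\<^bsub>B\<^esub> (- 1) \<odot>\<^bsub>B\<^esub> z = \<zero>\<^bsub>B\<^esub>"
      using Psi(2)[of "w \<oplus>\<^bsub>B\<^esub> (- 1) \<odot>\<^bsub>B\<^esub> z"] c z psi_w
      by (auto simp: functional_add[OF Psi'] functional_smult[OF Psi'])
    then have wz: "w = z" using c z
      by (metis B.l_neg B.minus_minus B.minus_equality B.a_inv_closed module_minus[OF B])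
    have ys': "tsum A B (map (\<lambda>(a, b). (a \<oplus>\<^bsub>A\<^esub> d a \<odot>\<^bsub>A\<^esub> v, b)) us) =
        tsum A B us \<oplus>\<^bsub>T\<^esub> tens A B v (lsum B (map (\<lambda>(a, b). d a \<odot>\<^bsub>B\<^esub> b) us))"
      if "set us \<subseteq> carrier A \<times> carrier B" for us
      using that
    proof (induction us)
      case Nil
      have "tens A B v \<zero>\<^bsub>B\<^esub> = 0 \<odot>\<^bsub>T\<^esub> tens A B v \<zero>\<^bsub>B\<^esub>"
        using bil(7)[of "\<zero>\<^bsub>B\<^esub>" v 0] c by (simp add: module_null[OF B])
      then show ?case using c by (simp add: module_null[OF module_T] tens_closed tsum_Nil)
    next
      case (Cons u us)
      obtain a b where u: "u = (a, b)" "a \<in> carrier A" "b \<in> carrier B" using Cons by auto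
      have l: "lsum B (map (\<lambda>(a, b). d a \<odot>\<^bsub>B\<^esub> b) us) \<in> carrier B"
        by (rule lsum_closed[OF B]) (use Cons in auto)
      have "tens A B (d a \<odot>\<^bsub>A\<^esub> v) b = tens A B v (d a \<odot>\<^bsub>B\<^esub> b)"
        using u c by (simp add: bil)
      then show ?case
        using Cons u c l
        by (simp add: tsum_Cons bil(4,5) tens_closed tsum_closed T.M.add.m_ac)
    qed
    have "tsum A B ys' = \<zero>\<^bsub>T\<^esub>"
    proof (rule Suc(1))
      show "n = length ys'" using Suc(2) xs by (simp add: ys'_def)
      show "set ys' \<subseteq> carrier A \<times> carrier B" using c by (auto simp: ys'_def)
      fix \<phi>' \<psi> assume *: "\<phi>' \<in> \<Phi>" "\<psi> \<in> \<Psi>"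
      have "(\<Sum>(a, b)\<leftarrow>ys'. \<phi>' a * \<psi> b) = (\<Sum>(a, b)\<leftarrow>ys. \<phi>' a * \<psi> b + \<phi>' v * (d a * \<psi> b))"
        unfolding ys'_def using c *
        by (auto simp: comp_def case_prod_unfold functional_add[OF Phi'] functional_smult[OF Phi'] algebra_simps
            intro!: sum_list_cong)
      also have "\<dots> = (\<Sum>(a, b)\<leftarrow>ys. \<phi>' a * \<psi> b) + \<phi>' v * \<psi> z"
        by (simp add: psi_z[OF *(2)] case_prod_unfold sum_list_addf sum_list_const_mult)
      also have "\<dots> = 0" using Suc(4)[OF *] xs psi_w[OF *(2)] by (simp add: add.commute)
      finally show "(\<Sum>(a, b)\<leftarrow>ys'. \<phi>' a * \<psi> b) = 0" .
    qed
    moreover have "tsum A B ys' = tsum A B xs"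
      using ys'[OF c(3)] c
      by (simp add: ys'_def xs tsum_Cons wz z_def[symmetric] T.a_comm tens_closed tsum_closed)
    ultimately show ?thesis by simp
  qed
qed

lemma tensor_eqI:
  assumes Phi: "\<Phi> \<subseteq> functionals A" "\<And>a. a \<in> carrier A \<Longrightarrow> (\<And>\<phi>. \<phi> \<in> \<Phi> \<Longrightarrow> \<phi> a = 0) \<Longrightarrow> a = \<zero>\<^bsub>A\<^esub>"
    and Psi: "\<Psi> \<subseteq> functionals B" "\<And>b. b \<in> carrier B \<Longrightarrow> (\<And>\<psi>. \<psi> \<in> \<Psi> \<Longrightarrow> \<psi> b = 0) \<Longrightarrow> b = \<zero>\<^bsub>B\<^esub>"
    and tu: "t \<in> carrier T" "u \<in> carrier T"
    and eq: "\<And>\<phi> \<psi>. \<phi> \<in> \<Phi> \<Longrightarrow> \<psi> \<in> \<Psi> \<Longrightarrow>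
      tensor_lift ground (\<lambda>a b. \<phi> a * \<psi> b) t = tensor_lift ground (\<lambda>a b. \<phi> a * \<psi> b) u"
  shows "t = u"
proof -
  interpret T: Module.module ground T by (rule module_T)
  have d: "t \<oplus>\<^bsub>T\<^esub> (- 1) \<odot>\<^bsub>T\<^esub> u \<in> carrier T" using tu by simp
  obtain xs where xs: "set xs \<subseteq> carrier A \<times> carrier B" "t \<oplus>\<^bsub>T\<^esub> (- 1) \<odot>\<^bsub>T\<^esub> u = tsum A B xs"
    using tensor_rep[OF d] by blast
  have "tsum A B xs = \<zero>\<^bsub>T\<^esub>"
  proof (rule tsum_separation[OF Phi Psi xs(1)])
    fix \<phi> \<psi> assume *: "\<phi> \<in> \<Phi>" "\<psi> \<in> \<Psi>"
    have **: "\<phi> \<in> functionals A" "\<psi> \<in> functionals B" using Phi(1) Psi(1) * by auto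
    have bil: "bilinear A B ground (\<lambda>a b. \<phi> a * \<psi> b)"
      by (rule bilinearI) (use ** in \<open>auto simp: functional_add functional_smult algebra_simps\<close>)
    note l = tensor_lift_linear[OF ground_module bil]
    show "(\<Sum>(a, b)\<leftarrow>xs. \<phi> a * \<psi> b) = 0"
      using functional_add[OF l tu(1), of "(- 1) \<odot>\<^bsub>T\<^esub> u"] functional_smult[OF l tu(2), of "- 1"] tu eq[OF *]
      by (simp add: xs(2) lift_tsum[OF bil xs(1)])
  qed
  then show ?thesis using xs(2) tu
    by (metis T.l_neg T.minus_minus T.minus_equality T.a_inv_closed module_minus[OF module_T])
qed

end

subsection \<open>Tensor products of superalgebras\<close>

lemma linear_map_bilinear:
  assumes "bilinear A B C \<beta>" "f \<in> linear_maps A' A" "g \<in> linear_maps B' B"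
  shows "bilinear A' B' C (\<lambda>a b. \<beta> (f a) (g b))"
  by (rule bilinearI)
    (use assms in \<open>auto simp: linear_map_closed linear_map_add linear_map_smult bilinearD[OF assms(1)]\<close>)

lemma bilinear_sum:
  assumes C: "Module.module ground C" and "bilinear A B C \<beta>" "bilinear A B C \<beta>'"
  shows "bilinear A B C (\<lambda>a b. \<beta> a b \<oplus>\<^bsub>C\<^esub> \<beta>' a b)"
proof -
  interpret C: Module.module ground C by (rule C)
  show ?thesis
    by (rule bilinearI)
      (auto simp: bilinearD[OF assms(2)] bilinearD[OF assms(3)] C.M.add.m_ac C.smult_r_distr)
qed

lemma bilinear_scale:
  assumes C: "Module.module ground C" and b: "bilinear A B C \<beta>"
  shows "bilinear A B C (\<lambda>a b. c \<odot>\<^bsub>C\<^esub> \<beta> a b)"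
proof -
  interpret C: Module.module ground C by (rule C)
  have "c \<odot>\<^bsub>C\<^esub> (d \<odot>\<^bsub>C\<^esub> x) = d \<odot>\<^bsub>C\<^esub> (c \<odot>\<^bsub>C\<^esub> x)" if "x \<in> carrier C" for d x
    using that C.smult_assoc1[of c d x] C.smult_assoc1[of d c x] by (simp add: mult.commute)
  then show ?thesis
    by (intro bilinearI) (auto simp: bilinearD[OF b] C.smult_r_distr)
qed

lemma bilinear_zero: "Module.module ground C \<Longrightarrow> bilinear A B C (\<lambda>a b. \<zero>\<^bsub>C\<^esub>)"
proof -
  assume C: "Module.module ground C"
  interpret C: Module.module ground C by (rule C)
  show ?thesis using C.smult_r_null by (intro bilinearI) auto
qed

context superspace
begin

lemma component_linear: "component A i \<in> linear_maps A A"
  by (auto simp: linear_maps_def component_add component_smult)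

end

context superalgebra
begin

lemma mult_linear_left: "b \<in> carrier A \<Longrightarrow> (\<lambda>a. a \<otimes> b) \<in> linear_maps A A"
  and mult_linear_right: "b \<in> carrier A \<Longrightarrow> (\<lambda>a. b \<otimes> a) \<in> linear_maps A A"
  by (auto simp: linear_maps_def l_distr r_distr smult_mult_left smult_mult_right)

end

locale tensor_algebras = A: superalgebra A + B: superalgebra B
  for A :: "('k::field, 'a, 'm) superspace_scheme" and B :: "('k, 'b, 'n) superspace_scheme"
begin

sublocale tensor_spaces A B
  by (rule tensor_spaces.intro[OF A.module_A B.module_A])

interpretation T: Module.module ground T by (rule module_T)

text \<open>The product of two pure tensors, with its four summands for the parities of the inner factors.\<close>

definition pure_mult :: "'a \<times> 'b \<Rightarrow> 'a \<times> 'b \<Rightarrow> ('a \<times> 'b \<Rightarrow>\<^sub>0 'k)" where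
  "pure_mult = (\<lambda>(a, b) (c, d). \<Sum>i\<in>UNIV. \<Sum>j\<in>UNIV.
     single (a \<otimes>\<^bsub>A\<^esub> component A j c, component B i b \<otimes>\<^bsub>B\<^esub> d) (koszul i j))"

lemma pm_scale_sum: "pm_scale c (sum f S) = (\<Sum>s\<in>S. pm_scale c (f s))"
  by (induction S rule: infinite_finite_induct) (auto simp: pm_scale_add)

lemma mult_F: "p \<otimes>\<^bsub>F\<^esub> q = (\<Sum>k\<in>keys p. \<Sum>l\<in>keys q.
    pm_scale (lookup p k * lookup q l) (pure_mult k l))"
  by (auto simp: tensor_free_def pure_mult_def pm_scale_sum pm_scale_single sum_bit_pairs
      intro!: sum.cong)

lemma mult_F_superset:
  assumes "finite S" "keys p \<subseteq> S" "finite S'" "keys q \<subseteq> S'"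
  shows "p \<otimes>\<^bsub>F\<^esub> q = (\<Sum>k\<in>S. \<Sum>l\<in>S'.
    pm_scale (lookup p k * lookup q l) (pure_mult k l))"
  unfolding mult_F
  by (rule sum.mono_neutral_cong_left; (rule sum.mono_neutral_cong_left)?)
    (use assms in \<open>auto simp: in_keys_iff\<close>)

lemma mult_F_add_left: "(p + q) \<otimes>\<^bsub>F\<^esub> r = p \<otimes>\<^bsub>F\<^esub> r + q \<otimes>\<^bsub>F\<^esub> r"
proof -
  let ?S = "keys p \<union> keys q"
  show ?thesis
    by (subst (1 2 3) mult_F_superset[where S = ?S and S' = "keys r"])
      (use keys_add[of p q] in \<open>auto simp: lookup_add algebra_simps pm_scale_add_left sum.distrib\<close>)
qed

lemma mult_F_add_right: "r \<otimes>\<^bsub>F\<^esub> (p + q) = r \<otimes>\<^bsub>F\<^esub> p + r \<otimes>\<^bsub>F\<^esub> q"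
proof -
  let ?S = "keys p \<union> keys q"
  show ?thesis
    by (subst (1 2 3) mult_F_superset[where S' = ?S and S = "keys r"])
      (use keys_add[of p q] in \<open>auto simp: lookup_add algebra_simps pm_scale_add_left sum.distrib\<close>)
qed

lemma mult_F_single: "single k c \<otimes>\<^bsub>F\<^esub> single l d = pm_scale (c * d) (pure_mult k l)"
  by (auto simp: mult_F)

lemma mult_F_single_scale:
  "single k c \<otimes>\<^bsub>F\<^esub> q = pm_scale c (single k 1 \<otimes>\<^bsub>F\<^esub> q)"
  "q \<otimes>\<^bsub>F\<^esub> single k c = pm_scale c (q \<otimes>\<^bsub>F\<^esub> single k 1)"
  by (auto simp: mult_F pm_scale_sum mult.commute simp flip: pm_scale_scale)

lemma pure_mult_closed:
  "k \<in> carrier A \<times> carrier B \<Longrightarrow> l \<in> carrier A \<times> carrier B \<Longrightarrow> pure_mult k l \<in> carrier F"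
  by (auto simp: pure_mult_def sum_bit intro!: F_add single_in_F)

lemma zero_in_F: "0 \<in> carrier F" by (simp add: F_simps)

lemma F_induct [consumes 1, case_names zero single add]:
  assumes "p \<in> carrier F" "P 0"
    "\<And>a b c. a \<in> carrier A \<Longrightarrow> b \<in> carrier B \<Longrightarrow> P (single (a, b) c)"
    "\<And>p q. p \<in> carrier F \<Longrightarrow> q \<in> carrier F \<Longrightarrow> P p \<Longrightarrow> P q \<Longrightarrow> P (p + q)"
  shows "P p"
  by (rule pm_induct[of p "carrier A \<times> carrier B"]) (use assms in \<open>auto simp: F_simps\<close>)

lemma mult_F_closed: "p \<in> carrier F \<Longrightarrow> q \<in> carrier F \<Longrightarrow> p \<otimes>\<^bsub>F\<^esub> q \<in> carrier F"
proof (induction p rule: F_induct)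
  case zero
  then show ?case by (simp add: mult_F zero_in_F)
next
  case (add p p')
  then show ?case by (simp add: mult_F_add_left F_add)
next
  case (single a b c)
  from single(3) show ?case
  proof (induction q rule: F_induct)
    case zero
    then show ?case by (simp add: mult_F zero_in_F)
  next
    case (add p p')
    then show ?case by (simp add: mult_F_add_right F_add)
  next
    case (single a' b' c')
    then show ?case using \<open>a \<in> carrier A\<close> \<open>b \<in> carrier B\<close>
      by (auto simp: mult_F_single intro!: F_scale pure_mult_closed)
  qed
qed

lemma coset_T_add: "N +>\<^bsub>F\<^esub> (p + q) = (N +>\<^bsub>F\<^esub> p) \<oplus>\<^bsub>T\<^esub> (N +>\<^bsub>F\<^esub> q)"
  unfolding T_eq TQ.add_Q ..

lemma coset_pure_mult:
  "N +>\<^bsub>F\<^esub> pure_mult (a, b) (c, d) =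
     (tens A B (a \<otimes>\<^bsub>A\<^esub> component A 0 c) (component B 0 b \<otimes>\<^bsub>B\<^esub> d) \<oplus>\<^bsub>T\<^esub>
      tens A B (a \<otimes>\<^bsub>A\<^esub> component A 1 c) (component B 0 b \<otimes>\<^bsub>B\<^esub> d)) \<oplus>\<^bsub>T\<^esub>
     (tens A B (a \<otimes>\<^bsub>A\<^esub> component A 0 c) (component B 1 b \<otimes>\<^bsub>B\<^esub> d) \<oplus>\<^bsub>T\<^esub>
      (- 1) \<odot>\<^bsub>T\<^esub> tens A B (a \<otimes>\<^bsub>A\<^esub> component A 1 c) (component B 1 b \<otimes>\<^bsub>B\<^esub> d))"
proof -
  have "N +>\<^bsub>F\<^esub> (p + q) = (N +>\<^bsub>F\<^esub> p) \<oplus>\<^bsub>T\<^esub> (N +>\<^bsub>F\<^esub> q)" for p q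
    unfolding T_eq TQ.add_Q ..
  then show ?thesis
    by (simp add: pure_mult_def sum_bit coset_single[of _ _ "- 1"] flip: tens_eq)
qed

text \<open>Multiplication by a fixed element is bilinear in the two factors of a pure tensor, so the universal property
  applies to it: this is why the null space is an ideal.\<close>

lemma bilinear_mult_single:
  assumes q: "q \<in> carrier F"
  shows "bilinear A B T (\<lambda>a b. N +>\<^bsub>F\<^esub> (single (a, b) 1 \<otimes>\<^bsub>F\<^esub> q))"
    "bilinear A B T (\<lambda>a b. N +>\<^bsub>F\<^esub> (q \<otimes>\<^bsub>F\<^esub> single (a, b) 1))"
  using q
proof (induction q rule: F_induct)
  case zero
  show "bilinear A B T (\<lambda>a b. N +>\<^bsub>F\<^esub> (single (a, b) 1 \<otimes>\<^bsub>F\<^esub> 0))"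
    "bilinear A B T (\<lambda>a b. N +>\<^bsub>F\<^esub> (0 \<otimes>\<^bsub>F\<^esub> single (a, b) 1))"
    using bilinear_zero[OF module_T, of A B] by (simp_all add: mult_F T_eq TQ.zero_Q)
next
  case (add p q)
  show "bilinear A B T (\<lambda>a b. N +>\<^bsub>F\<^esub> (single (a, b) 1 \<otimes>\<^bsub>F\<^esub> (p + q)))"
    "bilinear A B T (\<lambda>a b. N +>\<^bsub>F\<^esub> ((p + q) \<otimes>\<^bsub>F\<^esub> single (a, b) 1))"
    using bilinear_sum[OF module_T add(3,5)] bilinear_sum[OF module_T add(4,6)]
    by (simp_all add: mult_F_add_left mult_F_add_right T_eq TQ.add_Q)
next
  case (single c d r)
  note bl = bilinear_sum[OF module_T] bilinear_scale[OF module_T]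
    linear_map_bilinear[OF tens_bilinear]
  have lA: "(\<lambda>a. a \<otimes>\<^bsub>A\<^esub> component A j c) \<in> linear_maps A A" "(\<lambda>a. c \<otimes>\<^bsub>A\<^esub> component A j a) \<in> linear_maps A A" for j
    using single A.mult_linear_left[of "component A j c"] A.mult_linear_right[of c] A.component_linear[of j]
    by (auto simp: linear_maps_def Pi_def)
  have lB: "(\<lambda>b. b \<otimes>\<^bsub>B\<^esub> component B j d) \<in> linear_maps B B" "(\<lambda>b. component B j b \<otimes>\<^bsub>B\<^esub> d) \<in> linear_maps B B"
    "(\<lambda>b. component B j d \<otimes>\<^bsub>B\<^esub> b) \<in> linear_maps B B" for j
    using single B.mult_linear_left[of "component B j d"] B.mult_linear_left[of d] B.mult_linear_right[of "component B j d"]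
      B.component_linear[of j]
    by (auto simp: linear_maps_def Pi_def)
  have *: "N +>\<^bsub>F\<^esub> (single k 1 \<otimes>\<^bsub>F\<^esub> single (c, d) r) = r \<odot>\<^bsub>T\<^esub> (N +>\<^bsub>F\<^esub> pure_mult k (c, d))"
    "N +>\<^bsub>F\<^esub> (single (c, d) r \<otimes>\<^bsub>F\<^esub> single k 1) = r \<odot>\<^bsub>T\<^esub> (N +>\<^bsub>F\<^esub> pure_mult (c, d) k)" for k
    by (simp_all add: mult_F_single T_eq TQ.smult_Q)
  show "bilinear A B T (\<lambda>a b. N +>\<^bsub>F\<^esub> (single (a, b) 1 \<otimes>\<^bsub>F\<^esub> single (c, d) r))"
    unfolding * coset_pure_mult by (intro bl lA lB)
  show "bilinear A B T (\<lambda>a b. N +>\<^bsub>F\<^esub> (single (c, d) r \<otimes>\<^bsub>F\<^esub> single (a, b) 1))"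
    unfolding * coset_pure_mult by (intro bl lA lB)
qed

lemma coset_mult_extension:
  assumes "p \<in> carrier F" "q \<in> carrier F"
  shows "N +>\<^bsub>F\<^esub> (p \<otimes>\<^bsub>F\<^esub> q) = linear_extension T (\<lambda>(a, b). N +>\<^bsub>F\<^esub> (single (a, b) 1 \<otimes>\<^bsub>F\<^esub> q)) p"
    "N +>\<^bsub>F\<^esub> (q \<otimes>\<^bsub>F\<^esub> p) = linear_extension T (\<lambda>(a, b). N +>\<^bsub>F\<^esub> (q \<otimes>\<^bsub>F\<^esub> single (a, b) 1)) p"
  using assms(1)
proof (induction p rule: F_induct)
  case zero
  show "N +>\<^bsub>F\<^esub> (0 \<otimes>\<^bsub>F\<^esub> q) = linear_extension T (\<lambda>(a, b). N +>\<^bsub>F\<^esub> (single (a, b) 1 \<otimes>\<^bsub>F\<^esub> q)) 0"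
    "N +>\<^bsub>F\<^esub> (q \<otimes>\<^bsub>F\<^esub> 0) = linear_extension T (\<lambda>(a, b). N +>\<^bsub>F\<^esub> (q \<otimes>\<^bsub>F\<^esub> single (a, b) 1)) 0"
    by (simp_all add: mult_F linear_extension_def) (simp_all add: T_eq TQ.zero_Q)
next
  case (single a b c)
  show "N +>\<^bsub>F\<^esub> (single (a, b) c \<otimes>\<^bsub>F\<^esub> q) =
      linear_extension T (\<lambda>(a, b). N +>\<^bsub>F\<^esub> (single (a, b) 1 \<otimes>\<^bsub>F\<^esub> q)) (single (a, b) c)"
    "N +>\<^bsub>F\<^esub> (q \<otimes>\<^bsub>F\<^esub> single (a, b) c) =
      linear_extension T (\<lambda>(a, b). N +>\<^bsub>F\<^esub> (q \<otimes>\<^bsub>F\<^esub> single (a, b) 1)) (single (a, b) c)"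
    using single bilinearD(3)[OF bilinear_mult_single(1)[OF assms(2)]] bilinearD(3)[OF bilinear_mult_single(2)[OF assms(2)]]
    by (subst linear_extension_single[OF module_T], simp,
        subst mult_F_single_scale, simp add: T_eq TQ.smult_Q)+
next
  case (add p p')
  have "case_prod (\<lambda>a b. N +>\<^bsub>F\<^esub> (single (a, b) 1 \<otimes>\<^bsub>F\<^esub> q)) k \<in> carrier T"
    "case_prod (\<lambda>a b. N +>\<^bsub>F\<^esub> (q \<otimes>\<^bsub>F\<^esub> single (a, b) 1)) k \<in> carrier T"
    if "k \<in> keys p \<union> keys p'" for k
    using that add(1,2) bilinearD(3)[OF bilinear_mult_single(1)[OF assms(2)]] bilinearD(3)[OF bilinear_mult_single(2)[OF assms(2)]]
    by (auto simp: F_simps)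
  then have E: "linear_extension T (\<lambda>(a, b). N +>\<^bsub>F\<^esub> (single (a, b) 1 \<otimes>\<^bsub>F\<^esub> q)) (p + p') =
      linear_extension T (\<lambda>(a, b). N +>\<^bsub>F\<^esub> (single (a, b) 1 \<otimes>\<^bsub>F\<^esub> q)) p \<oplus>\<^bsub>T\<^esub>
      linear_extension T (\<lambda>(a, b). N +>\<^bsub>F\<^esub> (single (a, b) 1 \<otimes>\<^bsub>F\<^esub> q)) p'"
    "linear_extension T (\<lambda>(a, b). N +>\<^bsub>F\<^esub> (q \<otimes>\<^bsub>F\<^esub> single (a, b) 1)) (p + p') =
      linear_extension T (\<lambda>(a, b). N +>\<^bsub>F\<^esub> (q \<otimes>\<^bsub>F\<^esub> single (a, b) 1)) p \<oplus>\<^bsub>T\<^esub>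
      linear_extension T (\<lambda>(a, b). N +>\<^bsub>F\<^esub> (q \<otimes>\<^bsub>F\<^esub> single (a, b) 1)) p'"
    by (simp_all only: linear_extension_add[OF module_T])
  show "N +>\<^bsub>F\<^esub> ((p + p') \<otimes>\<^bsub>F\<^esub> q) = linear_extension T (\<lambda>(a, b). N +>\<^bsub>F\<^esub> (single (a, b) 1 \<otimes>\<^bsub>F\<^esub> q)) (p + p')"
    "N +>\<^bsub>F\<^esub> (q \<otimes>\<^bsub>F\<^esub> (p + p')) = linear_extension T (\<lambda>(a, b). N +>\<^bsub>F\<^esub> (q \<otimes>\<^bsub>F\<^esub> single (a, b) 1)) (p + p')"
    by (simp_all only: E mult_F_add_left mult_F_add_right coset_T_add add(3,4,5,6))
qed

lemma null_mult:
  assumes n: "n \<in> N" and q: "q \<in> carrier F" shows "n \<otimes>\<^bsub>F\<^esub> q \<in> N" "q \<otimes>\<^bsub>F\<^esub> n \<in> N"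
proof -
  have nF: "n \<in> carrier F" using n N_submodule by auto
  have "N +>\<^bsub>F\<^esub> (n \<otimes>\<^bsub>F\<^esub> q) = \<zero>\<^bsub>T\<^esub>" "N +>\<^bsub>F\<^esub> (q \<otimes>\<^bsub>F\<^esub> n) = \<zero>\<^bsub>T\<^esub>"
    using null_extension[OF module_T bilinear_mult_single(1)[OF q] n]
      null_extension[OF module_T bilinear_mult_single(2)[OF q] n] coset_mult_extension[OF nF q] by simp_all
  then show "n \<otimes>\<^bsub>F\<^esub> q \<in> N" "q \<otimes>\<^bsub>F\<^esub> n \<in> N"
    unfolding T_eq TQ.zero_Q TQ.coset_eq_iff by simp_all
qed

lemma mult_T:
  assumes "p \<in> carrier F" "q \<in> carrier F"
  shows "(N +>\<^bsub>F\<^esub> p) \<otimes>\<^bsub>T\<^esub> (N +>\<^bsub>F\<^esub> q) = N +>\<^bsub>F\<^esub> (p \<otimes>\<^bsub>F\<^esub> q)"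
  unfolding T_eq by (rule TQ.mult_Q) (use assms null_mult mult_F_add_left mult_F_add_right in auto)

lemma mult_T_closed: "t \<in> carrier T \<Longrightarrow> u \<in> carrier T \<Longrightarrow> t \<otimes>\<^bsub>T\<^esub> u \<in> carrier T"
  by (metis T_eq TQ.Q_cases TQ.coset_in_Q mult_F_closed mult_T)

lemma mult_T_add:
  assumes "t \<in> carrier T" "u \<in> carrier T" "v \<in> carrier T"
  shows "(t \<oplus>\<^bsub>T\<^esub> u) \<otimes>\<^bsub>T\<^esub> v = t \<otimes>\<^bsub>T\<^esub> v \<oplus>\<^bsub>T\<^esub> u \<otimes>\<^bsub>T\<^esub> v" "v \<otimes>\<^bsub>T\<^esub> (t \<oplus>\<^bsub>T\<^esub> u) = v \<otimes>\<^bsub>T\<^esub> t \<oplus>\<^bsub>T\<^esub> v \<otimes>\<^bsub>T\<^esub> u"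
proof -
  obtain p where p: "p \<in> carrier F" "t = N +>\<^bsub>F\<^esub> p" using assms(1) unfolding T_eq by (rule TQ.Q_cases)
  obtain q where q: "q \<in> carrier F" "u = N +>\<^bsub>F\<^esub> q" using assms(2) unfolding T_eq by (rule TQ.Q_cases)
  obtain r where r: "r \<in> carrier F" "v = N +>\<^bsub>F\<^esub> r" using assms(3) unfolding T_eq by (rule TQ.Q_cases)
  have a: "(N +>\<^bsub>F\<^esub> x) \<oplus>\<^bsub>T\<^esub> (N +>\<^bsub>F\<^esub> y) = N +>\<^bsub>F\<^esub> (x + y)" for x y unfolding T_eq TQ.add_Q ..
  show "(t \<oplus>\<^bsub>T\<^esub> u) \<otimes>\<^bsub>T\<^esub> v = t \<otimes>\<^bsub>T\<^esub> v \<oplus>\<^bsub>T\<^esub> u \<otimes>\<^bsub>T\<^esub> v" "v \<otimes>\<^bsub>T\<^esub> (t \<oplus>\<^bsub>T\<^esub> u) = v \<otimes>\<^bsub>T\<^esub> t \<oplus>\<^bsub>T\<^esub> v \<otimes>\<^bsub>T\<^esub> u"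
    using p q r by (simp_all add: a mult_T F_add mult_F_add_left mult_F_add_right)
qed

lemma one_T: "\<one>\<^bsub>T\<^esub> = tens A B \<one>\<^bsub>A\<^esub> \<one>\<^bsub>B\<^esub>"
  unfolding T_eq TQ.one_Q by (simp add: tens_eq, simp add: tensor_free_def)

lemma functional_tens_mult:
  assumes h: "h \<in> functionals T" and c: "a \<in> carrier A" "b \<in> carrier B" "c \<in> carrier A" "d \<in> carrier B"
  shows "h (tens A B a b \<otimes>\<^bsub>T\<^esub> tens A B c d) =
    (\<Sum>i\<in>UNIV. \<Sum>j\<in>UNIV. koszul i j * h (tens A B (a \<otimes>\<^bsub>A\<^esub> component A j c) (component B i b \<otimes>\<^bsub>B\<^esub> d)))"
  unfolding tens_eq[of a b] tens_eq[of c d] using c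
  by (simp add: mult_T single_in_F mult_F_single coset_pure_mult functional_add[OF h] functional_smult[OF h]
      tens_closed sum_bit)

lemma mult_T_zero: assumes "u \<in> carrier T" shows "\<zero>\<^bsub>T\<^esub> \<otimes>\<^bsub>T\<^esub> u = \<zero>\<^bsub>T\<^esub>" "u \<otimes>\<^bsub>T\<^esub> \<zero>\<^bsub>T\<^esub> = \<zero>\<^bsub>T\<^esub>"
proof -
  obtain p where p: "p \<in> carrier F" "u = N +>\<^bsub>F\<^esub> p" using assms unfolding T_eq by (rule TQ.Q_cases)
  have z: "\<zero>\<^bsub>T\<^esub> = N +>\<^bsub>F\<^esub> 0" unfolding T_eq TQ.zero_Q ..
  show "\<zero>\<^bsub>T\<^esub> \<otimes>\<^bsub>T\<^esub> u = \<zero>\<^bsub>T\<^esub>" "u \<otimes>\<^bsub>T\<^esub> \<zero>\<^bsub>T\<^esub> = \<zero>\<^bsub>T\<^esub>"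
    unfolding z p(2) using p(1) by (simp_all add: mult_T zero_in_F) (simp_all add: mult_F)
qed

lemma functional_tsum_mult:
  assumes h: "h \<in> functionals T" and xs: "set xs \<subseteq> carrier A \<times> carrier B" and ys: "set ys \<subseteq> carrier A \<times> carrier B"
  shows "h (tsum A B xs \<otimes>\<^bsub>T\<^esub> tsum A B ys) = (\<Sum>(a, b)\<leftarrow>xs. \<Sum>(c, d)\<leftarrow>ys.
    \<Sum>i\<in>UNIV. \<Sum>j\<in>UNIV. koszul i j * h (tens A B (a \<otimes>\<^bsub>A\<^esub> component A j c) (component B i b \<otimes>\<^bsub>B\<^esub> d)))"
proof -
  have *: "h (tens A B a b \<otimes>\<^bsub>T\<^esub> tsum A B ys) = (\<Sum>(c, d)\<leftarrow>ys.
    \<Sum>i\<in>UNIV. \<Sum>j\<in>UNIV. koszul i j * h (tens A B (a \<otimes>\<^bsub>A\<^esub> component A j c) (component B i b \<otimes>\<^bsub>B\<^esub> d)))"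
    if ab: "a \<in> carrier A" "b \<in> carrier B" for a b
    using ys
    by (induction ys)
      (auto simp: tsum_Nil mult_T_zero tens_closed ab functional_zero[OF module_T h] tsum_Cons mult_T_add
        mult_T_closed tsum_closed functional_add[OF h] functional_tens_mult[OF h])
  show ?thesis using xs
    by (induction xs)
      (auto simp: tsum_Nil mult_T_zero tens_closed tsum_closed ys functional_zero[OF module_T h] tsum_Cons mult_T_add
        mult_T_closed functional_add[OF h] *)
qed

text \<open>Each summand is listed with the parity of its first factor, since a zero factor does not determine it.\<close>

lemma homog_rep:
  assumes "t \<in> homog T p"
  shows "\<exists>zs. (\<forall>(i, a, b)\<in>set zs. a \<in> homog A i \<and> b \<in> homog B (p + i)) \<and> t = tsum A B (map snd zs)"
proof -
  obtain q where q: "q \<in> homog F p" "t = N +>\<^bsub>F\<^esub> q" using assms unfolding T_eq TQ.homog_Q by blast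
  then have keys: "keys q \<subseteq> (\<Union>j. homog A j \<times> homog B (p + j))" by (simp add: tensor_free_def)
  then have "q \<in> carrier F" using A.homog_closed B.homog_closed by (auto simp: F_simps)
  from coset_rep[OF this] obtain xs where
    xs: "set xs \<subseteq> (\<lambda>(a, b). (lookup q (a, b) \<odot>\<^bsub>A\<^esub> a, b)) ` keys q" "t = tsum A B xs"
    using q by auto
  have "\<exists>i. a \<in> homog A i \<and> b \<in> homog B (p + i)" if ab: "(a, b) \<in> set xs" for a b
  proof -
    obtain a0 where a0: "(a0, b) \<in> keys q" "a = lookup q (a0, b) \<odot>\<^bsub>A\<^esub> a0"
      using subsetD[OF xs(1) ab] by auto
    obtain i where "a0 \<in> homog A i" "b \<in> homog B (p + i)" using subsetD[OF keys a0(1)] by auto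
    then show ?thesis using A.homog_smult a0(2) by auto
  qed
  then have "\<forall>(a, b)\<in>set xs. \<exists>i. a \<in> homog A i \<and> b \<in> homog B (p + i)" by auto
  then have "\<exists>zs. (\<forall>(i, a, b)\<in>set zs. a \<in> homog A i \<and> b \<in> homog B (p + i)) \<and> xs = map snd zs"
  proof (induction xs)
    case (Cons x xs)
    then obtain zs i where "\<forall>(i, a, b)\<in>set zs. a \<in> homog A i \<and> b \<in> homog B (p + i)" "xs = map snd zs"
      "fst x \<in> homog A i" "snd x \<in> homog B (p + i)" by auto
    then show ?case by (intro exI[where x = "(i, x) # zs"]) auto
  qed auto
  then show ?thesis using xs(2) by blast
qed

lemma tens_homog: "a \<in> homog A i \<Longrightarrow> b \<in> homog B (p + i) \<Longrightarrow> tens A B a b \<in> homog T p"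
  unfolding T_eq TQ.homog_Q tens_eq by (rule imageI) (auto simp: tensor_free_def)

lemma homog_T_zero: "\<zero>\<^bsub>T\<^esub> \<in> homog T p"
  unfolding T_eq TQ.homog_Q TQ.zero_Q by (rule imageI) (auto simp: tensor_free_def)

lemma homog_T_add: "t \<in> homog T p \<Longrightarrow> u \<in> homog T p \<Longrightarrow> t \<oplus>\<^bsub>T\<^esub> u \<in> homog T p"
proof -
  assume "t \<in> homog T p" "u \<in> homog T p"
  then obtain x y where xy: "x \<in> homog F p" "t = N +>\<^bsub>F\<^esub> x" "y \<in> homog F p" "u = N +>\<^bsub>F\<^esub> y"
    unfolding T_eq TQ.homog_Q by blast
  then have "x + y \<in> homog F p" using keys_add[of x y] by (auto simp: tensor_free_def)
  then show ?thesis unfolding xy T_eq TQ.homog_Q TQ.add_Q by (rule imageI)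
qed

lemma homog_T_closed: "t \<in> homog T p \<Longrightarrow> t \<in> carrier T"
proof -
  assume "t \<in> homog T p"
  then obtain zs where zs: "\<forall>(i, a, b)\<in>set zs. a \<in> homog A i \<and> b \<in> homog B (p + i)"
    "t = tsum A B (map snd zs)" using homog_rep by blast
  show ?thesis unfolding zs(2)
    by (rule tsum_closed) (use zs(1) A.homog_closed B.homog_closed in auto)
qed

lemma homog_T_decomp:
  assumes "t \<in> carrier T"
  shows "\<exists>x\<in>homog T p. \<exists>y\<in>homog T (p + 1). t = x \<oplus>\<^bsub>T\<^esub> y"
proof -
  obtain xs where xs: "set xs \<subseteq> carrier A \<times> carrier B" "t = tsum A B xs" using tensor_rep[OF assms] by blast
  note bil = bilinearD[OF tens_bilinear]
  have "\<exists>x\<in>homog T p. \<exists>y\<in>homog T (p + 1). tsum A B xs = x \<oplus>\<^bsub>T\<^esub> y" using xs(1)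
  proof (induction xs)
    case Nil
    have "\<zero>\<^bsub>T\<^esub> = \<zero>\<^bsub>T\<^esub> \<oplus>\<^bsub>T\<^esub> \<zero>\<^bsub>T\<^esub>" by simp
    then show ?case unfolding tsum_Nil using homog_T_zero by blast
  next
    case (Cons z xs)
    obtain a b where z: "z = (a, b)" "a \<in> carrier A" "b \<in> carrier B" using Cons by auto
    obtain x y where xy: "x \<in> homog T p" "y \<in> homog T (p + 1)" "tsum A B xs = x \<oplus>\<^bsub>T\<^esub> y" using Cons by auto
    let ?a = "\<lambda>i. component A i a" and ?b = "\<lambda>i. component B i b"
    define x' where "x' = tens A B (?a 0) (?b p) \<oplus>\<^bsub>T\<^esub> tens A B (?a 1) (?b (p + 1))"
    define y' where "y' = tens A B (?a 0) (?b (p + 1)) \<oplus>\<^bsub>T\<^esub> tens A B (?a 1) (?b p)"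
    have t: "tens A B (?a i) (?b (r + i)) \<in> homog T r" for i r
      by (rule tens_homog[where i = i]) (use z A.component_in B.component_in in auto)
    have h: "x' \<in> homog T p" "y' \<in> homog T (p + 1)"
      unfolding x'_def y'_def
      using homog_T_add[OF t[of 0 p] t[of 1 p]] homog_T_add[OF t[of 0 "p + 1"] t[of 1 "p + 1"]]
      by (simp_all add: add.assoc)
    have "tens A B a b = tens A B (?a 0 \<oplus>\<^bsub>A\<^esub> ?a 1) (?b p \<oplus>\<^bsub>B\<^esub> ?b (p + 1))"
      using z by (simp add: A.component_decomp_01 B.component_decomp)
    also have "\<dots> = x' \<oplus>\<^bsub>T\<^esub> y'"
      using z by (simp add: bil(4,5) x'_def y'_def tens_closed T.M.add.m_ac)
    finally have "tsum A B (z # xs) = (x' \<oplus>\<^bsub>T\<^esub> x) \<oplus>\<^bsub>T\<^esub> (y' \<oplus>\<^bsub>T\<^esub> y)"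
      using xy h by (simp add: tsum_Cons z homog_T_closed[of _ p] homog_T_closed[of _ "p + 1"] T.M.add.m_ac)
    then show ?case using homog_T_add[OF h(1) xy(1)] homog_T_add[OF h(2) xy(2)] by blast
  qed
  then show ?thesis using xs(2) by simp
qed

end

subsection \<open>Trilinear maps and iterated comultiplication\<close>

definition trilinear :: "('k::field, 'd, 'q) superspace_scheme \<Rightarrow> ('k, 'a, 'm) superspace_scheme \<Rightarrow>
    ('k, 'b, 'n) superspace_scheme \<Rightarrow> ('k, 'c, 'l) superspace_scheme \<Rightarrow> ('d \<Rightarrow> 'a \<Rightarrow> 'b \<Rightarrow> 'c) \<Rightarrow> bool" where
  "trilinear D A B C \<gamma> \<longleftrightarrow> (\<forall>d\<in>carrier D. bilinear A B C (\<gamma> d)) \<and>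
     (\<forall>a\<in>carrier A. \<forall>b\<in>carrier B. (\<lambda>d. \<gamma> d a b) \<in> linear_maps D C)"

lemma bilinear_flip: "bilinear A B C \<beta> \<Longrightarrow> bilinear B A C (\<lambda>b a. \<beta> a b)"
  by (auto simp: bilinear_def)

lemma linear_map_id: "(\<lambda>x. x) \<in> linear_maps A A"
  by (auto simp: linear_maps_def)

context tensor_spaces
begin

interpretation T: Module.module ground T by (rule module_T)

lemma linear_T_eqI:
  assumes C: "Module.module ground C" and h: "h \<in> linear_maps T C" "h' \<in> linear_maps T C" and t: "t \<in> carrier T"
    and eq: "\<And>a b. a \<in> carrier A \<Longrightarrow> b \<in> carrier B \<Longrightarrow> h (tens A B a b) = h' (tens A B a b)"
  shows "h t = h' t"
proof -
  interpret C: Module.module ground C by (rule C)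
  obtain xs where xs: "set xs \<subseteq> carrier A \<times> carrier B" "t = tsum A B xs" using tensor_rep[OF t] by blast
  have z: "h \<zero>\<^bsub>T\<^esub> = \<zero>\<^bsub>C\<^esub>" if "h \<in> linear_maps T C" for h
    using linear_map_smult[OF that T.zero_closed, of 0] linear_map_closed[OF that T.zero_closed]
    by (simp add: module_null[OF C] module_null[OF module_T])
  show ?thesis unfolding xs(2) using xs(1)
    by (induction xs)
      (auto simp: tsum_Nil tsum_Cons z h linear_map_add[OF h(1)] linear_map_add[OF h(2)] tens_closed tsum_closed eq)
qed

text \<open>Lets the universal property be used twice, for a triple tensor product.\<close>

lemma lift_trilinear:
  assumes D: "Module.module ground D" and C: "Module.module ground C" and tri: "trilinear D A B C \<gamma>"
  shows "bilinear D T C (\<lambda>d. tensor_lift C (\<gamma> d))"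
proof -
  interpret C: Module.module ground C by (rule C)
  interpret D: Module.module ground D by (rule D)
  have b: "bilinear A B C (\<gamma> d)" if "d \<in> carrier D" for d using tri that by (auto simp: trilinear_def)
  note lin = tensor_lift_linear[OF C b] and val = tensor_lift_tens[OF C b]
  have d: "(\<lambda>d. \<gamma> d x y) \<in> linear_maps D C" if "x \<in> carrier A" "y \<in> carrier B" for x y
    using tri that by (auto simp: trilinear_def)
  have "(\<lambda>d. tensor_lift C (\<gamma> d) t) \<in> linear_maps D C" if t: "t \<in> carrier T" for t
  proof -
    have "tensor_lift C (\<gamma> (d \<oplus>\<^bsub>D\<^esub> d')) t = tensor_lift C (\<gamma> d) t \<oplus>\<^bsub>C\<^esub> tensor_lift C (\<gamma> d') t"
      if dd: "d \<in> carrier D" "d' \<in> carrier D" "d \<oplus>\<^bsub>D\<^esub> d' \<in> carrier D" for d d'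
    proof (rule linear_T_eqI[OF C lin[OF dd(3)] _ t])
      show "(\<lambda>t. tensor_lift C (\<gamma> d) t \<oplus>\<^bsub>C\<^esub> tensor_lift C (\<gamma> d') t) \<in> linear_maps T C"
        using dd by (auto simp: linear_maps_def linear_map_closed[OF lin] linear_map_add[OF lin]
            linear_map_smult[OF lin] C.M.add.m_ac C.smult_r_distr)
      show "tensor_lift C (\<gamma> (d \<oplus>\<^bsub>D\<^esub> d')) (tens A B a b) =
          tensor_lift C (\<gamma> d) (tens A B a b) \<oplus>\<^bsub>C\<^esub> tensor_lift C (\<gamma> d') (tens A B a b)"
        if "a \<in> carrier A" "b \<in> carrier B" for a b
        using that dd linear_map_add[OF d[OF that] dd(1,2)] by (simp add: val)
    qed
    moreover have "tensor_lift C (\<gamma> (c \<odot>\<^bsub>D\<^esub> d)) t = c \<odot>\<^bsub>C\<^esub> tensor_lift C (\<gamma> d) t"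
      if dd: "d \<in> carrier D" "c \<odot>\<^bsub>D\<^esub> d \<in> carrier D" for c d
    proof (rule linear_T_eqI[OF C lin[OF dd(2)] _ t])
      have cc: "c \<odot>\<^bsub>C\<^esub> (e \<odot>\<^bsub>C\<^esub> x) = e \<odot>\<^bsub>C\<^esub> (c \<odot>\<^bsub>C\<^esub> x)" if "x \<in> carrier C" for e x
        using that C.smult_assoc1[of c e x] C.smult_assoc1[of e c x] by (simp add: mult.commute)
      show "(\<lambda>t. c \<odot>\<^bsub>C\<^esub> tensor_lift C (\<gamma> d) t) \<in> linear_maps T C"
        using dd by (auto simp: linear_maps_def linear_map_closed[OF lin] linear_map_add[OF lin]
            linear_map_smult[OF lin] C.smult_r_distr cc)
      show "tensor_lift C (\<gamma> (c \<odot>\<^bsub>D\<^esub> d)) (tens A B a b) = c \<odot>\<^bsub>C\<^esub> tensor_lift C (\<gamma> d) (tens A B a b)"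
        if "a \<in> carrier A" "b \<in> carrier B" for a b
        using that dd linear_map_smult[OF d[OF that] dd(1)] by (simp add: val)
    qed
    ultimately show ?thesis
      using D.smult_closed t by (auto simp: linear_maps_def linear_map_closed[OF lin])
  qed
  then show ?thesis by (auto simp: bilinear_def lin)
qed

end

locale linear_comult =
  fixes A :: "('k::field, 'a, 'm) superspace_scheme" and \<Delta> :: "'a \<Rightarrow> ('a \<times> 'a \<Rightarrow>\<^sub>0 'k) set"
  assumes A: "Module.module ground A" and Delta: "\<Delta> \<in> linear_maps A (tensor A A)"
begin

sublocale AA: tensor_spaces A A by (rule tensor_spaces.intro[OF A A])
sublocale AT: tensor_spaces A "tensor A A" by (rule tensor_spaces.intro[OF A AA.module_T])

abbreviation T3 where "T3 \<equiv> tensor A (tensor A A)"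

lemma lift_Delta:
  assumes "bilinear A A ground \<beta>" shows "(\<lambda>x. tensor_lift ground \<beta> (\<Delta> x)) \<in> functionals A"
proof -
  note l = AA.tensor_lift_linear[OF ground_module assms]
  show ?thesis unfolding functionals_iff
    by (simp add: linear_map_closed[OF Delta] linear_map_add[OF Delta] linear_map_smult[OF Delta]
      functional_add[OF l] functional_smult[OF l])
qed

text \<open>The two sides of coassociativity: \<open>(\<Delta> \<otimes> id) \<Delta>\<close> and \<open>(id \<otimes> \<Delta>) \<Delta>\<close>.\<close>

definition left_iterate where
  "left_iterate a = tensor_lift T3 (\<lambda>x y. tensor_lift T3 (\<lambda>u v. tens A (tensor A A) u (tens A A v y)) (\<Delta> x)) (\<Delta> a)"

definition right_iterate where
  "right_iterate a = tensor_lift T3 (\<lambda>x y. tens A (tensor A A) x (\<Delta> y)) (\<Delta> a)"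

text \<open>Triple tensors are tested by trilinear maps to the ground field, so that coassociativity becomes an identity of
  scalars.\<close>

definition eval3 :: "('a \<Rightarrow> 'a \<Rightarrow> 'a \<Rightarrow> 'k) \<Rightarrow> _ \<Rightarrow> 'k" where
  "eval3 \<gamma> = tensor_lift ground (\<lambda>u. tensor_lift ground (\<gamma> u))"

lemma right_bilinear: "bilinear A A T3 (\<lambda>x y. tens A (tensor A A) x (\<Delta> y))"
  by (rule linear_map_bilinear[OF AT.tens_bilinear linear_map_id Delta])

lemma tens3_trilinear: "trilinear A A A T3 (\<lambda>y u v. tens A (tensor A A) u (tens A A v y))"
proof -
  have "bilinear A A T3 (\<lambda>u v. tens A (tensor A A) u (tens A A v y))" if "y \<in> carrier A" for y
    by (rule linear_map_bilinear[OF AT.tens_bilinear linear_map_id])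
      (rule bilinearD(1)[OF AA.tens_bilinear that that])
  moreover have "(\<lambda>y. tens A (tensor A A) u (tens A A v y)) \<in> linear_maps A T3"
    if "u \<in> carrier A" "v \<in> carrier A" for u v
    using that bilinearD[OF AT.tens_bilinear AA.tens_closed] bilinearD[OF AA.tens_bilinear]
    by (auto simp: linear_maps_def AT.tens_closed AA.tens_closed)
  ultimately show ?thesis by (auto simp: trilinear_def)
qed

lemma left_bilinear:
  "bilinear A A T3 (\<lambda>x y. tensor_lift T3 (\<lambda>u v. tens A (tensor A A) u (tens A A v y)) (\<Delta> x))"
  by (rule linear_map_bilinear[OF bilinear_flip[OF AA.lift_trilinear[OF A AT.module_T tens3_trilinear]] Delta linear_map_id])

lemma iterate_closed:
  assumes "a \<in> carrier A" shows "left_iterate a \<in> carrier T3" "right_iterate a \<in> carrier T3"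
  unfolding left_iterate_def right_iterate_def
  using linear_map_closed[OF AA.tensor_lift_linear[OF AT.module_T left_bilinear]]
    linear_map_closed[OF AA.tensor_lift_linear[OF AT.module_T right_bilinear]]
    linear_map_closed[OF Delta assms] by auto

context
  fixes \<gamma> assumes g: "trilinear A A A ground \<gamma>"
begin

lemma eval3_functional: "eval3 \<gamma> \<in> functionals T3"
  unfolding eval3_def by (rule AT.tensor_lift_linear[OF ground_module AA.lift_trilinear[OF A ground_module g]])

lemma eval3_tens: "u \<in> carrier A \<Longrightarrow> t \<in> carrier (tensor A A) \<Longrightarrow>
    eval3 \<gamma> (tens A (tensor A A) u t) = tensor_lift ground (\<gamma> u) t"
  unfolding eval3_def by (rule AT.tensor_lift_tens[OF ground_module AA.lift_trilinear[OF A ground_module g]])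

lemma gamma_bilinear: "x \<in> carrier A \<Longrightarrow> bilinear A A ground (\<gamma> x)"
  using g by (auto simp: trilinear_def)

lemma eval3_left:
  assumes a: "a \<in> carrier A"
  shows "eval3 \<gamma> (left_iterate a) =
    tensor_lift ground (\<lambda>x y. tensor_lift ground (\<lambda>u v. \<gamma> u v y) (\<Delta> x)) (\<Delta> a)"
proof -
  have *: "eval3 \<gamma> (tensor_lift T3 (\<lambda>u v. tens A (tensor A A) u (tens A A v y)) (\<Delta> x)) =
      tensor_lift ground (\<lambda>u v. \<gamma> u v y) (\<Delta> x)" if xy: "x \<in> carrier A" "y \<in> carrier A" for x y
  proof -
    have b: "bilinear A A T3 (\<lambda>u v. tens A (tensor A A) u (tens A A v y))"
      using tens3_trilinear xy by (auto simp: trilinear_def)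
    have bg: "bilinear A A ground (\<lambda>u v. eval3 \<gamma> (tens A (tensor A A) u (tens A A v y)))"
      using eval3_functional
      by (intro bilinearI) (auto simp: bilinearD[OF b] functional_add functional_smult)
    show ?thesis
      by (subst AA.functional_lift[OF AT.module_T b eval3_functional linear_map_closed[OF Delta xy(1)]],
          rule AA.lift_cong[OF ground_module bg linear_map_closed[OF Delta xy(1)]])
        (auto simp: eval3_tens AA.tens_closed xy AA.tensor_lift_tens[OF ground_module gamma_bilinear])
  qed
  have bg: "bilinear A A ground (\<lambda>x y. eval3 \<gamma> (tensor_lift T3 (\<lambda>u v. tens A (tensor A A) u (tens A A v y)) (\<Delta> x)))"
    using eval3_functional
    by (intro bilinearI) (auto simp: bilinearD[OF left_bilinear] functional_add functional_smult)
  show ?thesis unfolding left_iterate_def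
    by (subst AA.functional_lift[OF AT.module_T left_bilinear eval3_functional linear_map_closed[OF Delta a]],
        rule AA.lift_cong[OF ground_module bg linear_map_closed[OF Delta a]]) (simp add: *)
qed

lemma eval3_right:
  assumes a: "a \<in> carrier A"
  shows "eval3 \<gamma> (right_iterate a) = tensor_lift ground (\<lambda>x y. tensor_lift ground (\<gamma> x) (\<Delta> y)) (\<Delta> a)"
proof -
  have bg: "bilinear A A ground (\<lambda>x y. eval3 \<gamma> (tens A (tensor A A) x (\<Delta> y)))"
    using eval3_functional
    by (intro bilinearI) (auto simp: bilinearD[OF right_bilinear] functional_add functional_smult)
  show ?thesis unfolding right_iterate_def
    by (subst AA.functional_lift[OF AT.module_T right_bilinear eval3_functional linear_map_closed[OF Delta a]],
        rule AA.lift_cong[OF ground_module bg linear_map_closed[OF Delta a]])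
      (simp add: eval3_tens linear_map_closed[OF Delta])
qed

lemma trilinear_left_bilinear:
  "bilinear A A ground (\<lambda>x y. tensor_lift ground (\<lambda>u v. \<gamma> u v y) (\<Delta> x))"
proof -
  have "trilinear A A A ground (\<lambda>y u v. \<gamma> u v y)"
    using g by (auto simp: trilinear_def bilinear_def)
  from linear_map_bilinear[OF bilinear_flip[OF AA.lift_trilinear[OF A ground_module this]] Delta linear_map_id]
  show ?thesis .
qed

lemma trilinear_right_bilinear:
  "bilinear A A ground (\<lambda>x y. tensor_lift ground (\<gamma> x) (\<Delta> y))"
  using linear_map_bilinear[OF AA.lift_trilinear[OF A ground_module g] linear_map_id Delta] .

end

end

section \<open>Convolution of functionals\<close>

lemma bilinear_mult: "\<phi> \<in> functionals A \<Longrightarrow> \<psi> \<in> functionals B \<Longrightarrow> bilinear A B ground (\<lambda>a b. \<phi> a * \<psi> b)"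
  by (rule bilinearI) (auto simp: functional_add functional_smult algebra_simps)

lemma bilinear_ground_add:
  "bilinear A B ground \<beta> \<Longrightarrow> bilinear A B ground \<beta>' \<Longrightarrow> bilinear A B ground (\<lambda>a b. \<beta> a b + \<beta>' a b)"
  using bilinear_sum[OF ground_module, of A B \<beta> \<beta>'] by simp

lemma bilinear_ground_scale: "bilinear A B ground \<beta> \<Longrightarrow> bilinear A B ground (\<lambda>a b. c * \<beta> a b)"
  using bilinear_scale[OF ground_module, of A B \<beta> c] by simp

lemma functionals_plus: "\<phi> \<in> functionals A \<Longrightarrow> \<psi> \<in> functionals A \<Longrightarrow> (\<lambda>a. \<phi> a + \<psi> a) \<in> functionals A"
  by (auto simp: functionals_iff algebra_simps)

lemma functionals_scale: "\<phi> \<in> functionals A \<Longrightarrow> (\<lambda>a. c * \<phi> a) \<in> functionals A"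
  by (auto simp: functionals_iff algebra_simps)

lemma functionals_scale_right: "\<phi> \<in> functionals A \<Longrightarrow> (\<lambda>a. \<phi> a * c) \<in> functionals A"
  by (auto simp: functionals_iff algebra_simps)

lemma functionals_comp: "\<phi> \<in> functionals B \<Longrightarrow> f \<in> linear_maps A B \<Longrightarrow> (\<lambda>a. \<phi> (f a)) \<in> functionals A"
  by (simp add: functionals_iff[of "\<lambda>a. \<phi> (f a)"] functional_add functional_smult linear_map_closed
      linear_map_add linear_map_smult)

lemma linear_map_comp: "g \<in> linear_maps B C \<Longrightarrow> f \<in> linear_maps A B \<Longrightarrow> (\<lambda>a. g (f a)) \<in> linear_maps A C"
  by (auto simp: linear_maps_def Pi_def)

lemma trilinear_plus:
  assumes "trilinear D A B ground \<gamma>" "trilinear D A B ground \<gamma>'"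
  shows "trilinear D A B ground (\<lambda>d a b. \<gamma> d a b + \<gamma>' d a b)"
  using assms by (auto simp: trilinear_def intro!: bilinear_ground_add functionals_plus)

lemma trilinear_scale:
  assumes "trilinear D A B ground \<gamma>" shows "trilinear D A B ground (\<lambda>d a b. c * \<gamma> d a b)"
  using assms by (auto simp: trilinear_def intro!: bilinear_ground_scale functionals_scale)

lemma trilinear_comp:
  assumes "trilinear D A B C \<gamma>" "e \<in> linear_maps D' D" "f \<in> linear_maps A' A" "g \<in> linear_maps B' B"
  shows "trilinear D' A' B' C (\<lambda>d a b. \<gamma> (e d) (f a) (g b))"
proof -
  have "(\<lambda>d. \<gamma> (e d) (f a) (g b)) \<in> linear_maps D' C" if "a \<in> carrier A'" "b \<in> carrier B'" for a b
  proof -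
    have "(\<lambda>d. \<gamma> d (f a) (g b)) \<in> linear_maps D C"
      using assms(1) linear_map_closed[OF assms(3) that(1)] linear_map_closed[OF assms(4) that(2)]
      by (auto simp: trilinear_def)
    from linear_map_comp[OF this assms(2)] show ?thesis .
  qed
  then show ?thesis
    using assms linear_map_closed[OF assms(2)] by (auto simp: trilinear_def intro!: linear_map_bilinear[OF _ assms(3,4)])
qed

lemma trilinear_mult:
  assumes "\<phi> \<in> functionals D" "\<psi> \<in> functionals A" "\<chi> \<in> functionals B"
  shows "trilinear D A B ground (\<lambda>d a b. \<phi> d * \<psi> a * \<chi> b)"
  using bilinear_ground_scale[OF bilinear_mult[OF assms(2,3)]] functionals_scale_right[OF assms(1)]
  by (auto simp: trilinear_def mult.assoc)

context hopf_superalgebra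
begin

sublocale XX: tensor_algebras A A
  by (rule tensor_algebras.intro[OF superalgebra_axioms superalgebra_axioms])

lemma comult_linear: "comult A \<in> linear_maps A (tensor A A)"
  using comult_hom by (auto simp: superalgebra_hom_def even_linear_maps_def)

lemma comult_ring_hom: "comult A \<in> ring_hom A (tensor A A)"
  using comult_hom by (simp add: superalgebra_hom_def)

sublocale XD: linear_comult A "comult A"
  by (rule linear_comult.intro[OF module_A comult_linear])

lemma counit_functional: "counit A \<in> functionals A"
  using counit_hom by (auto simp: superalgebra_hom_def even_linear_maps_def)

lemma counit_mult: "a \<in> carrier A \<Longrightarrow> b \<in> carrier A \<Longrightarrow> counit A (a \<otimes> b) = counit A a * counit A b"
  using counit_hom ring_hom_mult[of "counit A" A "ground"] by (auto simp: superalgebra_hom_def)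

lemma counit_one [simp]: "counit A \<one> = 1"
  using counit_hom ring_hom_one[of "counit A" A "ground"] by (auto simp: superalgebra_hom_def)

lemma counit_odd: "a \<in> homog A 1 \<Longrightarrow> counit A a = 0"
  using counit_hom by (force simp: superalgebra_hom_def even_linear_maps_def ground_homog)

lemma antipode_linear: "antipode A \<in> linear_maps A A"
  using antipode_even_linear by (auto simp: even_linear_maps_def)

lemma antipode_homog: "a \<in> homog A i \<Longrightarrow> antipode A a \<in> homog A i"
  using antipode_even_linear by (auto simp: even_linear_maps_def)

lemma antipode_closed: "a \<in> carrier A \<Longrightarrow> antipode A a \<in> carrier A"
  using linear_map_closed[OF antipode_linear] .

subsection \<open>The dual superspace\<close>

abbreviation dual where "dual \<equiv> dual_superspace A"
abbreviation Dual where "Dual \<equiv> carrier dual"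

lemma Dual_iff: "\<phi> \<in> Dual \<longleftrightarrow> \<phi> \<in> functionals A \<and> \<phi> \<in> extensional (carrier A)"
  by (auto simp: dual_superspace_def)

lemma DualD: "\<phi> \<in> Dual \<Longrightarrow> \<phi> \<in> functionals A" by (simp add: Dual_iff)

lemma dual_ops: "zero dual = (\<lambda>f\<in>carrier A. 0)"
  "add dual = (\<lambda>\<phi> \<psi>. \<lambda>f\<in>carrier A. \<phi> f + \<psi> f)"
  "smult dual = (\<lambda>c \<phi>. \<lambda>f\<in>carrier A. c * \<phi> f)"
  "homog dual i = {\<phi> \<in> Dual. \<forall>f\<in>homog A (i + 1). \<phi> f = 0}"
  by (auto simp: dual_superspace_def)

lemma restrict_functionals: "restrict \<phi> (carrier A) \<in> functionals A \<longleftrightarrow> \<phi> \<in> functionals A"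
  by (auto simp: functionals_iff)

lemma restrict_Dual: "\<phi> \<in> functionals A \<Longrightarrow> restrict \<phi> (carrier A) \<in> Dual"
  by (simp add: Dual_iff restrict_functionals)

lemma Dual_eqI_carrier:
  assumes "\<phi> \<in> Dual" "\<psi> \<in> Dual" "\<And>f. f \<in> carrier A \<Longrightarrow> \<phi> f = \<psi> f" shows "\<phi> = \<psi>"
  using assms by (auto simp: Dual_iff intro: extensionalityI)

lemma functionals_eqI:
  assumes "\<phi> \<in> functionals A" "\<psi> \<in> functionals A" "\<And>i f. f \<in> homog A i \<Longrightarrow> \<phi> f = \<psi> f" "f \<in> carrier A"
  shows "\<phi> f = \<psi> f"
  unfolding functional_components[OF assms(1,4)] functional_components[OF assms(2,4)]
  by (rule sum.cong[OF refl], rule assms(3)[OF component_in[OF assms(4)]])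

lemma Dual_eqI:
  assumes "\<phi> \<in> Dual" "\<psi> \<in> Dual" "\<And>i f. f \<in> homog A i \<Longrightarrow> \<phi> f = \<psi> f" shows "\<phi> = \<psi>"
  by (rule Dual_eqI_carrier[OF assms(1,2)], rule functionals_eqI[OF DualD[OF assms(1)] DualD[OF assms(2)] assms(3)])

lemma dual_module: "Module.module ground dual"
  by (rule moduleI_ground)
    (auto simp: dual_ops algebra_simps intro!: restrict_Dual functionals_plus functionals_scale
      intro: Dual_eqI_carrier dest: DualD simp: Dual_iff functionals_iff extensional_def fun_eq_iff)

lemma dual_component_in:
  assumes "\<psi> \<in> Dual" shows "(\<lambda>f\<in>carrier A. \<psi> (component A j f)) \<in> homog dual j"
proof -
  have "\<psi> (component A j f) = 0" if "f \<in> homog A (j + 1)" for f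
    using component_homog[OF that, of j] functional_zero[OF module_A DualD[OF assms]] by simp
  then show ?thesis
    using functionals_comp[OF DualD[OF assms] component_linear, of j]
    by (auto simp: dual_ops homog_closed intro!: restrict_Dual)
qed

lemma dual_decomp:
  assumes "\<psi> \<in> Dual"
  shows "\<psi> = (\<lambda>f\<in>carrier A. \<psi> (component A j f)) \<oplus>\<^bsub>dual\<^esub> (\<lambda>f\<in>carrier A. \<psi> (component A (j + 1) f))"
proof (rule Dual_eqI_carrier[OF assms])
  interpret D: Module.module ground "dual" by (rule dual_module)
  show "(\<lambda>f\<in>carrier A. \<psi> (component A j f)) \<oplus>\<^bsub>dual\<^esub> (\<lambda>f\<in>carrier A. \<psi> (component A (j + 1) f)) \<in> Dual"
    using dual_component_in[OF assms] by (intro D.a_closed) (auto simp: dual_ops(4))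
  fix f assume f: "f \<in> carrier A"
  show "\<psi> f = ((\<lambda>f\<in>carrier A. \<psi> (component A j f)) \<oplus>\<^bsub>dual\<^esub> (\<lambda>f\<in>carrier A. \<psi> (component A (j + 1) f))) f"
    using functional_components[OF DualD[OF assms] f] f by (cases j) (auto simp: dual_ops sum_bit)
qed

lemma dual_superspace: "superspace dual"
proof (intro superspace.intro superspace_axioms.intro)
  show "Module.module ground dual" by (rule dual_module)
  show "submodule (homog dual i) ground dual" for i
    by (rule submoduleI_ground[OF dual_module])
      (auto simp: dual_ops homog_closed functionals_iff intro!: restrict_Dual functionals_plus functionals_scale dest: DualD)
  show "\<exists>x\<in>homog dual 0. \<exists>y\<in>homog dual 1. \<psi> = x \<oplus>\<^bsub>dual\<^esub> y"
    if "\<psi> \<in> Dual" for \<psi>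
    using dual_decomp[OF that, of 0] dual_component_in[OF that] by auto
  have "\<psi> = (\<lambda>f\<in>carrier A. 0)" if p: "\<psi> \<in> homog dual 0" "\<psi> \<in> homog dual 1" for \<psi>
  proof (rule Dual_eqI)
    show "\<psi> \<in> Dual" using p by (simp add: dual_ops)
    show "(\<lambda>f\<in>carrier A. 0) \<in> Dual" by (rule restrict_Dual) (simp add: functionals_iff)
    show "\<psi> f = (\<lambda>f\<in>carrier A. 0) f" if "f \<in> homog A i" for i f
      using p that homog_closed[OF that] by (cases i) (auto simp: dual_ops)
  qed
  moreover have "(\<lambda>f\<in>carrier A. 0) \<in> homog dual i" for i
    by (auto simp: dual_ops homog_closed functionals_iff intro!: restrict_Dual)
  ultimately show "homog dual 0 \<inter> homog dual 1 = {\<zero>\<^bsub>dual\<^esub>}"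
    by (auto simp: dual_ops(1))
qed

sublocale DS: superspace "dual" by (rule dual_superspace)

lemma component_dual:
  assumes "\<psi> \<in> Dual" shows "component dual j \<psi> = (\<lambda>f\<in>carrier A. \<psi> (component A j f))"
  by (subst dual_decomp[OF assms, of j], rule DS.component_eqI) (rule dual_component_in[OF assms])+

subsection \<open>Homogeneous Sweedler representations\<close>

text \<open>For \<open>f\<close> of parity \<open>p\<close>, a list of triples \<open>(i, a, b)\<close> with \<open>|a| = i\<close>, \<open>|b| = p + i\<close> and
  \<open>\<delta>(f) = \<Sum> a \<otimes> b\<close>. The parities are recorded because they are not determined by the
  elements if these vanish.\<close>

definition sweedler :: "bit \<Rightarrow> 'a \<Rightarrow> (bit \<times> 'a \<times> 'a) list" where
  "sweedler p f = (SOME zs. (\<forall>(i, a, b)\<in>set zs. a \<in> homog A i \<and> b \<in> homog A (p + i)) \<and>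
     comult A f = tsum A A (map snd zs))"

lemma sweedler:
  assumes "f \<in> homog A p"
  shows "(i, a, b) \<in> set (sweedler p f) \<Longrightarrow> a \<in> homog A i \<and> b \<in> homog A (p + i)"
    "comult A f = tsum A A (map snd (sweedler p f))"
proof -
  have "comult A f \<in> homog (tensor A A) p"
    using comult_hom assms by (auto simp: superalgebra_hom_def even_linear_maps_def)
  from someI_ex[OF XX.homog_rep[OF this], folded sweedler_def]
  show "(i, a, b) \<in> set (sweedler p f) \<Longrightarrow> a \<in> homog A i \<and> b \<in> homog A (p + i)"
    "comult A f = tsum A A (map snd (sweedler p f))" by auto
qed

lemma sweedler_sum_cong:
  assumes "f \<in> homog A p" "\<And>i a b. a \<in> homog A i \<Longrightarrow> b \<in> homog A (p + i) \<Longrightarrow> \<beta> i a b = \<beta>' i a b"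
  shows "(\<Sum>(i, a, b)\<leftarrow>sweedler p f. \<beta> i a b) = (\<Sum>(i, a, b)\<leftarrow>sweedler p f. \<beta>' i a b)"
  by (rule sum_list_cong) (use sweedler(1)[OF assms(1)] assms(2) in auto)

lemma sweedler_carrier: "f \<in> homog A p \<Longrightarrow> set (map snd (sweedler p f)) \<subseteq> carrier A \<times> carrier A"
  using sweedler(1) homog_closed by fastforce

lemma sweedler_lift:
  assumes "f \<in> homog A p" "bilinear A A ground \<beta>"
  shows "tensor_lift ground \<beta> (comult A f) = (\<Sum>(i, a, b)\<leftarrow>sweedler p f. \<beta> a b)"
  unfolding sweedler(2)[OF assms(1)]
  by (subst XX.lift_tsum[OF assms(2) sweedler_carrier[OF assms(1)]]) (simp add: comp_def case_prod_unfold)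

text \<open>Sums over Sweedler representations may have coefficients that depend on the parities.\<close>

definition indexed :: "(bit \<Rightarrow> bit \<Rightarrow> 'a \<Rightarrow> 'a \<Rightarrow> 'k) \<Rightarrow> 'a \<Rightarrow> 'a \<Rightarrow> 'k" where
  "indexed \<beta> a b = (\<Sum>i\<in>UNIV. \<Sum>j\<in>UNIV. \<beta> i j (component A i a) (component A j b))"

lemma bilinear_zero_arg:
  assumes "bilinear A A ground \<beta>" "a \<in> carrier A" shows "\<beta> \<zero> a = 0" "\<beta> a \<zero> = 0"
  using bilinearD(6)[OF assms(1,2) zero_closed, of 0] bilinearD(7)[OF assms(1) zero_closed assms(2), of 0] by auto

lemma indexed_bilinear:
  assumes "\<And>i j. bilinear A A ground (\<beta> i j)" shows "bilinear A A ground (indexed \<beta>)"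
  unfolding indexed_def[abs_def] sum_bit
  by (intro bilinear_ground_add linear_map_bilinear[OF assms] component_linear)

lemma indexed_homog:
  assumes "\<And>i j. bilinear A A ground (\<beta> i j)" "a \<in> homog A i" "b \<in> homog A j"
  shows "indexed \<beta> a b = \<beta> i j a b"
proof -
  have "\<beta> i' j' (component A i' a) (component A j' b) = (if j' = j then if i' = i then \<beta> i j a b else 0 else 0)" for i' j'
    using bilinear_zero_arg[OF assms(1)] homog_closed assms(2,3)
    by (auto simp: component_homog[OF assms(2)] component_homog[OF assms(3)])
  then show ?thesis by (simp add: indexed_def)
qed

definition indexed3 :: "(bit \<Rightarrow> bit \<Rightarrow> bit \<Rightarrow> 'a \<Rightarrow> 'a \<Rightarrow> 'a \<Rightarrow> 'k) \<Rightarrow> 'a \<Rightarrow> 'a \<Rightarrow> 'a \<Rightarrow> 'k" where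
  "indexed3 \<gamma> a b c = (\<Sum>i\<in>UNIV. indexed (\<lambda>j k. \<gamma> i j k (component A i a)) b c)"

lemma indexed3_trilinear:
  assumes "\<And>i j k. trilinear A A A ground (\<gamma> i j k)" shows "trilinear A A A ground (indexed3 \<gamma>)"
proof -
  define \<tau> where "\<tau> = (\<lambda>i j k a b c. \<gamma> i j k (component A i a) (component A j b) (component A k c))"
  have t: "trilinear A A A ground (\<tau> i j k)" for i j k
    unfolding \<tau>_def by (rule trilinear_comp[OF assms component_linear component_linear component_linear])
  have "indexed3 \<gamma> = (\<lambda>a b c. (\<tau> 0 0 0 a b c + \<tau> 0 0 1 a b c + (\<tau> 0 1 0 a b c + \<tau> 0 1 1 a b c)) +
      (\<tau> 1 0 0 a b c + \<tau> 1 0 1 a b c + (\<tau> 1 1 0 a b c + \<tau> 1 1 1 a b c)))"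
    by (simp add: fun_eq_iff indexed3_def indexed_def sum_bit \<tau>_def)
  then show ?thesis using t by (simp add: trilinear_plus)
qed

lemma indexed3_homog:
  assumes g: "\<And>i j k. trilinear A A A ground (\<gamma> i j k)" and h: "a \<in> homog A i" "b \<in> homog A j" "c \<in> homog A k"
  shows "indexed3 \<gamma> a b c = \<gamma> i j k a b c"
proof -
  have *: "bilinear A A ground (\<gamma> i' j' k' x)" if "x \<in> carrier A" for i' j' k' x
    using g that by (auto simp: trilinear_def)
  have "indexed (\<lambda>j k. \<gamma> i' j k (component A i' a)) b c = \<gamma> i' j k (component A i' a) b c" for i'
    by (rule indexed_homog) (use * h homog_closed in auto)
  moreover have "\<gamma> i' j k \<zero> b c = 0" for i'
    using g[of i' j k] h homog_closed functional_zero[OF module_A, of "\<lambda>d. \<gamma> i' j k d b c"] by (auto simp: trilinear_def)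
  ultimately have "indexed (\<lambda>j k. \<gamma> i' j k (component A i' a)) b c = (if i' = i then \<gamma> i j k a b c else 0)" for i'
    by (simp add: component_homog[OF h(1)])
  then show ?thesis by (simp add: indexed3_def)
qed

lemma sweedler_coassoc:
  assumes g: "\<And>i j k. trilinear A A A ground (\<gamma> i j k)" and f: "f \<in> homog A p"
  shows "(\<Sum>(i, a, b)\<leftarrow>sweedler p f. \<Sum>(j, u, v)\<leftarrow>sweedler i a. \<gamma> j (i + j) (p + i) u v b) =
    (\<Sum>(i, a, b)\<leftarrow>sweedler p f. \<Sum>(j, u, v)\<leftarrow>sweedler (p + i) b. \<gamma> i j (p + i + j) a u v)"
proof -
  note g' = indexed3_trilinear[of \<gamma>, OF g]
  have fA: "f \<in> carrier A" using f homog_closed by auto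
  have b1: "bilinear A A ground (\<lambda>u v. indexed3 \<gamma> u v y)" if "y \<in> carrier A" for y
    using g' that by (auto simp: trilinear_def bilinear_def)
  have b2: "bilinear A A ground (indexed3 \<gamma> y)" if "y \<in> carrier A" for y
    using g' that by (auto simp: trilinear_def)
  have "XD.left_iterate f = XD.right_iterate f"
    unfolding XD.left_iterate_def XD.right_iterate_def by (rule coassoc[OF fA])
  then have "tensor_lift ground (\<lambda>x y. tensor_lift ground (\<lambda>u v. indexed3 \<gamma> u v y) (comult A x)) (comult A f) =
      tensor_lift ground (\<lambda>x y. tensor_lift ground (indexed3 \<gamma> x) (comult A y)) (comult A f)"
    using XD.eval3_left[OF g' fA] XD.eval3_right[OF g' fA] by simp
  then have "(\<Sum>(i, a, b)\<leftarrow>sweedler p f. tensor_lift ground (\<lambda>u v. indexed3 \<gamma> u v b) (comult A a)) =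
    (\<Sum>(i, a, b)\<leftarrow>sweedler p f. tensor_lift ground (indexed3 \<gamma> a) (comult A b))"
    by (simp add: sweedler_lift[OF f XD.trilinear_left_bilinear[OF g']] sweedler_lift[OF f XD.trilinear_right_bilinear[OF g']])
  moreover have "tensor_lift ground (\<lambda>u v. indexed3 \<gamma> u v b) (comult A a) =
      (\<Sum>(j, u, v)\<leftarrow>sweedler i a. \<gamma> j (i + j) (p + i) u v b)" if "a \<in> homog A i" "b \<in> homog A (p + i)" for i a b
    using that homog_closed
    by (subst sweedler_lift[OF that(1) b1]) (auto intro!: sweedler_sum_cong indexed3_homog g)
  moreover have "tensor_lift ground (indexed3 \<gamma> a) (comult A b) =
      (\<Sum>(j, u, v)\<leftarrow>sweedler (p + i) b. \<gamma> i j (p + i + j) a u v)" if "a \<in> homog A i" "b \<in> homog A (p + i)" for i a b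
    using that homog_closed
    by (subst sweedler_lift[OF that(2) b2]) (auto intro!: sweedler_sum_cong indexed3_homog g)
  ultimately show ?thesis
    using sweedler_sum_cong[OF f, of "\<lambda>i a b. tensor_lift ground (\<lambda>u v. indexed3 \<gamma> u v b) (comult A a)"
        "\<lambda>i a b. \<Sum>(j, u, v)\<leftarrow>sweedler i a. \<gamma> j (i + j) (p + i) u v b"]
      sweedler_sum_cong[OF f, of "\<lambda>i a b. tensor_lift ground (indexed3 \<gamma> a) (comult A b)"
        "\<lambda>i a b. \<Sum>(j, u, v)\<leftarrow>sweedler (p + i) b. \<gamma> i j (p + i + j) a u v"] by simp
qed

lemma sweedler_mult:
  assumes b: "\<And>i j. bilinear A A ground (\<beta> i j)" and f: "f \<in> homog A p" and h: "h \<in> homog A q"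
  shows "(\<Sum>(i, a, b)\<leftarrow>sweedler (p + q) (f \<otimes> h). \<beta> i (p + q + i) a b) =
    (\<Sum>(i, a, b)\<leftarrow>sweedler p f. \<Sum>(j, c, d)\<leftarrow>sweedler q h.
      koszul (p + i) j * \<beta> (i + j) (p + i + (q + j)) (a \<otimes> c) (b \<otimes> d))"
proof -
  have fh: "f \<otimes> h \<in> homog A (p + q)" using f h by (rule homog_mult)
  note b' = indexed_bilinear[of \<beta>, OF b]
  note L = XX.tensor_lift_linear[OF ground_module b']
  have c: "f \<in> carrier A" "h \<in> carrier A" using f h homog_closed by auto
  have *: "(\<Sum>i'\<in>UNIV. \<Sum>j'\<in>UNIV. koszul i' j' * tensor_lift ground (indexed \<beta>)
        (tens A A (a \<otimes> component A j' x) (component A i' y \<otimes> d))) =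
      koszul (p + i) j * \<beta> (i + j) (p + i + (q + j)) (a \<otimes> x) (y \<otimes> d)"
    if "a \<in> homog A i" "y \<in> homog A (p + i)" "x \<in> homog A j" "d \<in> homog A (q + j)" for i j a y x d
  proof -
    have cc: "a \<in> carrier A" "y \<in> carrier A" "x \<in> carrier A" "d \<in> carrier A" using that homog_closed by auto
    have "koszul i' j' * tensor_lift ground (indexed \<beta>) (tens A A (a \<otimes> component A j' x) (component A i' y \<otimes> d)) =
      (if j' = j then if i' = p + i then koszul (p + i) j * \<beta> (i + j) (p + i + (q + j)) (a \<otimes> x) (y \<otimes> d) else 0 else 0)" for i' j'
      using bilinear_zero_arg[OF b'] cc indexed_homog[OF b homog_mult[OF that(1,3)] homog_mult[OF that(2,4)]]
      by (auto simp: component_homog[OF that(2)] component_homog[OF that(3)] XX.tensor_lift_tens[OF ground_module b'])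
    then show ?thesis by simp
  qed
  have "(\<Sum>(i, a, b)\<leftarrow>sweedler (p + q) (f \<otimes> h). \<beta> i (p + q + i) a b) = tensor_lift ground (indexed \<beta>) (comult A (f \<otimes> h))"
    by (subst sweedler_lift[OF fh b']) (rule sweedler_sum_cong[OF fh], simp add: indexed_homog[OF b])
  also have "comult A (f \<otimes> h) = comult A f \<otimes>\<^bsub>tensor A A\<^esub> comult A h"
    using ring_hom_mult[OF comult_ring_hom c] .
  also have "tensor_lift ground (indexed \<beta>) \<dots> = (\<Sum>(i, a, b)\<leftarrow>sweedler p f. \<Sum>(j, x, d)\<leftarrow>sweedler q h.
      \<Sum>i'\<in>UNIV. \<Sum>j'\<in>UNIV. koszul i' j' * tensor_lift ground (indexed \<beta>)
        (tens A A (a \<otimes> component A j' x) (component A i' b \<otimes> d)))"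
    unfolding sweedler(2)[OF f] sweedler(2)[OF h]
    by (subst XX.functional_tsum_mult[OF L sweedler_carrier[OF f] sweedler_carrier[OF h]])
      (simp add: comp_def case_prod_unfold)
  also have "\<dots> = (\<Sum>(i, a, b)\<leftarrow>sweedler p f. \<Sum>(j, c, d)\<leftarrow>sweedler q h.
      koszul (p + i) j * \<beta> (i + j) (p + i + (q + j)) (a \<otimes> c) (b \<otimes> d))"
    by (intro sweedler_sum_cong[OF f] sweedler_sum_cong[OF h] *)
  finally show ?thesis .
qed

lemma sweedler_counit:
  assumes f: "f \<in> homog A p" and psi: "\<psi> \<in> functionals A"
  shows "(\<Sum>(i, a, b)\<leftarrow>sweedler p f. counit A a * \<psi> b) = \<psi> f"
    "(\<Sum>(i, a, b)\<leftarrow>sweedler p f. \<psi> a * counit A b) = \<psi> f"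
proof -
  have c: "f \<in> carrier A" "comult A f \<in> carrier (tensor A A)" using f homog_closed linear_map_closed[OF comult_linear] by auto
  have b: "bilinear A A A (\<lambda>x y. counit A x \<odot> y)"
    by (rule bilinearI) (auto simp: functional_add[OF counit_functional] functional_smult[OF counit_functional]
        scale_add scale_add_left scale_scale mult.commute)
  show "(\<Sum>(i, a, b)\<leftarrow>sweedler p f. counit A a * \<psi> b) = \<psi> f"
  proof -
    have "\<psi> f = tensor_lift ground (\<lambda>x y. \<psi> (counit A x \<odot> y)) (comult A f)"
      using XX.functional_lift[OF module_A b psi c(2)] counit_left[OF c(1)] by simp
    also have "\<dots> = tensor_lift ground (\<lambda>x y. counit A x * \<psi> y) (comult A f)"
      by (rule XX.lift_cong[OF ground_module _ c(2), symmetric])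
        (auto simp: functional_smult[OF psi] intro!: bilinear_mult counit_functional psi)
    finally show ?thesis by (simp add: sweedler_lift[OF f bilinear_mult[OF counit_functional psi]])
  qed
  show "(\<Sum>(i, a, b)\<leftarrow>sweedler p f. \<psi> a * counit A b) = \<psi> f"
  proof -
    have "\<psi> f = tensor_lift ground (\<lambda>x y. \<psi> (counit A y \<odot> x)) (comult A f)"
      using XX.functional_lift[OF module_A bilinear_flip[OF b] psi c(2)] counit_right[OF c(1)] by simp
    also have "\<dots> = tensor_lift ground (\<lambda>x y. \<psi> x * counit A y) (comult A f)"
      by (rule XX.lift_cong[OF ground_module _ c(2), symmetric])
        (auto simp: functional_smult[OF psi] mult.commute intro!: bilinear_mult counit_functional psi)
    finally show ?thesis by (simp add: sweedler_lift[OF f bilinear_mult[OF psi counit_functional]])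
  qed
qed

lemma mult_bilinear: "bilinear A A A (\<otimes>)"
  using mult_linear_left mult_linear_right by (auto simp: bilinear_def)

lemma functional_mult_bilinear: "\<psi> \<in> functionals A \<Longrightarrow> bilinear A A ground (\<lambda>a b. \<psi> (a \<otimes> b))"
  by (rule bilinearI) (auto simp: functional_add functional_smult l_distr r_distr smult_mult_left smult_mult_right)

lemma sweedler_antipode:
  assumes f: "f \<in> homog A p" and psi: "\<psi> \<in> functionals A"
  shows "(\<Sum>(i, a, b)\<leftarrow>sweedler p f. \<psi> (antipode A a \<otimes> b)) = counit A f * \<psi> \<one>"
    "(\<Sum>(i, a, b)\<leftarrow>sweedler p f. \<psi> (a \<otimes> antipode A b)) = counit A f * \<psi> \<one>"
proof -
  have c: "f \<in> carrier A" "comult A f \<in> carrier (tensor A A)" using f homog_closed linear_map_closed[OF comult_linear] by auto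
  have b: "bilinear A A A (\<lambda>x y. antipode A x \<otimes> y)" "bilinear A A A (\<lambda>x y. x \<otimes> antipode A y)"
    using linear_map_bilinear[OF mult_bilinear antipode_linear linear_map_id]
      linear_map_bilinear[OF mult_bilinear linear_map_id antipode_linear] by auto
  have b': "bilinear A A ground (\<lambda>x y. \<psi> (antipode A x \<otimes> y))" "bilinear A A ground (\<lambda>x y. \<psi> (x \<otimes> antipode A y))"
    using linear_map_bilinear[OF functional_mult_bilinear[OF psi] antipode_linear linear_map_id]
      linear_map_bilinear[OF functional_mult_bilinear[OF psi] linear_map_id antipode_linear] by auto
  have "\<psi> (counit A f \<odot> \<one>) = counit A f * \<psi> \<one>" by (simp add: functional_smult[OF psi])
  then show "(\<Sum>(i, a, b)\<leftarrow>sweedler p f. \<psi> (antipode A a \<otimes> b)) = counit A f * \<psi> \<one>"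
    "(\<Sum>(i, a, b)\<leftarrow>sweedler p f. \<psi> (a \<otimes> antipode A b)) = counit A f * \<psi> \<one>"
    using XX.functional_lift[OF module_A b(1) psi c(2)] antipode_left[OF c(1)]
      XX.functional_lift[OF module_A b(2) psi c(2)] antipode_right[OF c(1)]
    by (simp_all add: sweedler_lift[OF f b'(1)] sweedler_lift[OF f b'(2)])
qed

lemma sweedler_one:
  assumes "bilinear A A ground \<beta>" shows "(\<Sum>(i, a, b)\<leftarrow>sweedler 0 \<one>. \<beta> a b) = \<beta> \<one> \<one>"
proof -
  have "comult A \<one> = tens A A \<one> \<one>"
    using ring_hom_one[OF comult_ring_hom] XX.one_T by simp
  then show ?thesis
    using sweedler_lift[OF one_even assms] by (simp add: XX.tensor_lift_tens[OF ground_module assms])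
qed

subsection \<open>The convolution product\<close>

abbreviation conv (infixl \<open>\<star>\<close> 70) where "\<phi> \<star> \<psi> \<equiv> dist_mult A \<phi> \<psi>"

abbreviation unit_dual where "unit_dual \<equiv> restrict (counit A) (carrier A)"

lemma unit_dual: "unit_dual \<in> Dual" by (rule restrict_Dual[OF counit_functional])

text \<open>The kernel of the convolution product, with the sign expressed by the parities of the two Sweedler factors
  instead of the parities of \<open>\<psi>\<close> and the first factor; on each summand that contributes they agree.\<close>

lemma conv_kernel: "\<phi> \<in> Dual \<Longrightarrow> \<psi> \<in> Dual \<Longrightarrow>
    bilinear A A ground (indexed (\<lambda>i j a b. koszul i j * (\<phi> a * \<psi> b)))"
  by (intro indexed_bilinear bilinear_ground_scale bilinear_mult DualD)

lemma conv_eq: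
  assumes "\<phi> \<in> Dual" "\<psi> \<in> Dual" "f \<in> carrier A"
  shows "(\<phi> \<star> \<psi>) f = tensor_lift ground (indexed (\<lambda>i j a b. koszul i j * (\<phi> a * \<psi> b))) (comult A f)"
proof -
  have "tensor_lift ground (indexed (\<lambda>i j a b. koszul i j * (\<phi> a * \<psi> b))) (comult A f) =
      tensor_lift ground (\<lambda>f1 f2. \<Sum>(i, j)\<in>UNIV. koszul j i * \<phi> (component A i f1) *
        component dual j \<psi> f2) (comult A f)"
    by (rule XX.lift_cong[OF ground_module conv_kernel[OF assms(1,2)]])
      (use assms linear_map_closed[OF comult_linear] in
        \<open>auto simp: indexed_def sum_bit_pairs component_dual sum_bit\<close>)
  then show ?thesis using assms(3) by (simp add: dist_mult_def)
qed

lemma conv_sweedler: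
  assumes "\<phi> \<in> Dual" "\<psi> \<in> Dual" "f \<in> homog A p"
  shows "(\<phi> \<star> \<psi>) f = (\<Sum>(i, a, b)\<leftarrow>sweedler p f. koszul i (p + i) * (\<phi> a * \<psi> b))"
  unfolding conv_eq[OF assms(1,2) homog_closed[OF assms(3)]] sweedler_lift[OF assms(3) conv_kernel[OF assms(1,2)]]
  by (rule sweedler_sum_cong[OF assms(3)], subst indexed_homog)
    (use assms in \<open>auto intro!: bilinear_ground_scale bilinear_mult DualD\<close>)

lemma conv_Dual: assumes "\<phi> \<in> Dual" "\<psi> \<in> Dual" shows "\<phi> \<star> \<psi> \<in> Dual"
proof -
  have "(\<lambda>f. tensor_lift ground (indexed (\<lambda>i j a b. koszul i j * (\<phi> a * \<psi> b))) (comult A f)) \<in> functionals A"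
    by (rule XD.lift_Delta[OF conv_kernel[OF assms]])
  moreover have "\<phi> \<star> \<psi> = restrict (\<lambda>f. tensor_lift ground (indexed (\<lambda>i j a b. koszul i j * (\<phi> a * \<psi> b))) (comult A f)) (carrier A)"
    using conv_eq[OF assms] by (auto simp: dist_mult_def fun_eq_iff)
  ultimately show ?thesis using restrict_Dual by metis
qed

lemma conv_assoc:
  assumes d: "\<phi> \<in> Dual" "\<psi> \<in> Dual" "\<chi> \<in> Dual" shows "\<phi> \<star> \<psi> \<star> \<chi> = \<phi> \<star> (\<psi> \<star> \<chi>)"
proof (rule Dual_eqI)
  show "\<phi> \<star> \<psi> \<star> \<chi> \<in> Dual" "\<phi> \<star> (\<psi> \<star> \<chi>) \<in> Dual" using d by (auto intro!: conv_Dual)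
  fix p f assume f: "f \<in> homog A p"
  define \<gamma> where "\<gamma> = (\<lambda>i j k a b c. (koszul (i + j) k * koszul i j) * (\<phi> a * \<psi> b * \<chi> c))"
  have g: "trilinear A A A ground (\<gamma> i j k)" for i j k
    unfolding \<gamma>_def by (intro trilinear_scale trilinear_mult DualD d)
  have "(\<phi> \<star> \<psi> \<star> \<chi>) f = (\<Sum>(i, a, b)\<leftarrow>sweedler p f. \<Sum>(j, u, v)\<leftarrow>sweedler i a. \<gamma> j (i + j) (p + i) u v b)"
    unfolding conv_sweedler[OF conv_Dual[OF d(1,2)] d(3) f]
    by (rule sweedler_sum_cong[OF f])
      (auto simp: conv_sweedler[OF d(1,2)] \<gamma>_def case_prod_unfold algebra_simps
        simp flip: sum_list_const_mult intro!: sum_list_cong)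
  also have "\<dots> = (\<Sum>(i, a, b)\<leftarrow>sweedler p f. \<Sum>(j, u, v)\<leftarrow>sweedler (p + i) b. \<gamma> i j (p + i + j) a u v)"
    by (rule sweedler_coassoc[OF g f])
  also have "\<dots> = (\<phi> \<star> (\<psi> \<star> \<chi>)) f"
    unfolding conv_sweedler[OF d(1) conv_Dual[OF d(2,3)] f]
  proof (rule sweedler_sum_cong[OF f])
    fix i a b assume ab: "a \<in> homog A i" "b \<in> homog A (p + i)"
    have "koszul (i + j) (p + i + j) * koszul i j = (koszul i (p + i) * koszul j (p + i + j) :: 'k)" for j
      by (cases i; cases j; cases p; simp)
    then show "(\<Sum>(j, u, v)\<leftarrow>sweedler (p + i) b. \<gamma> i j (p + i + j) a u v) = koszul i (p + i) * (\<phi> a * (\<psi> \<star> \<chi>) b)"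
      unfolding conv_sweedler[OF d(2,3) ab(2)] \<gamma>_def
      by (auto simp: case_prod_unfold algebra_simps simp flip: sum_list_const_mult intro!: sum_list_cong)
  qed
  finally show "(\<phi> \<star> \<psi> \<star> \<chi>) f = (\<phi> \<star> (\<psi> \<star> \<chi>)) f" .
qed

lemma counit_parity: "a \<in> homog A i \<Longrightarrow> i = 0 \<or> counit A a = 0"
  using counit_odd by (cases i) auto

lemma conv_unit:
  assumes d: "\<phi> \<in> Dual" shows "unit_dual \<star> \<phi> = \<phi>" "\<phi> \<star> unit_dual = \<phi>"
proof -
  show "unit_dual \<star> \<phi> = \<phi>"
  proof (rule Dual_eqI[OF conv_Dual[OF unit_dual d] d])
    fix p f assume f: "f \<in> homog A p"
    have "(unit_dual \<star> \<phi>) f = (\<Sum>(i, a, b)\<leftarrow>sweedler p f. counit A a * \<phi> b)"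
      unfolding conv_sweedler[OF unit_dual d f]
    proof (rule sweedler_sum_cong[OF f])
      fix i a b assume *: "a \<in> homog A i" "b \<in> homog A (p + i)"
      show "koszul i (p + i) * (unit_dual a * \<phi> b) = counit A a * \<phi> b"
        using counit_parity[OF *(1)] by (elim disjE) (simp_all add: homog_closed[OF *(1)])
    qed
    then show "(unit_dual \<star> \<phi>) f = \<phi> f" using sweedler_counit(1)[OF f DualD[OF d]] by simp
  qed
  show "\<phi> \<star> unit_dual = \<phi>"
  proof (rule Dual_eqI[OF conv_Dual[OF d unit_dual] d])
    fix p f assume f: "f \<in> homog A p"
    have "(\<phi> \<star> unit_dual) f = (\<Sum>(i, a, b)\<leftarrow>sweedler p f. \<phi> a * counit A b)"
      unfolding conv_sweedler[OF d unit_dual f]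
    proof (rule sweedler_sum_cong[OF f])
      fix i a b assume *: "a \<in> homog A i" "b \<in> homog A (p + i)"
      show "koszul i (p + i) * (\<phi> a * unit_dual b) = \<phi> a * counit A b"
        using counit_parity[OF *(2)] by (elim disjE) (simp_all add: homog_closed[OF *(2)])
    qed
    then show "(\<phi> \<star> unit_dual) f = \<phi> f" using sweedler_counit(2)[OF f DualD[OF d]] by simp
  qed
qed

lemma dual_add_apply: "f \<in> carrier A \<Longrightarrow> (\<phi> \<oplus>\<^bsub>dual\<^esub> \<psi>) f = \<phi> f + \<psi> f"
  and dual_smult_apply: "f \<in> carrier A \<Longrightarrow> (c \<odot>\<^bsub>dual\<^esub> \<psi>) f = c * \<psi> f"
  and dual_zero_apply: "f \<in> carrier A \<Longrightarrow> \<zero>\<^bsub>dual\<^esub> f = 0"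
  by (simp_all add: dual_ops)

lemma dual_closed:
  "\<phi> \<in> Dual \<Longrightarrow> \<psi> \<in> Dual \<Longrightarrow> \<phi> \<oplus>\<^bsub>dual\<^esub> \<psi> \<in> Dual"
  "\<phi> \<in> Dual \<Longrightarrow> c \<odot>\<^bsub>dual\<^esub> \<phi> \<in> Dual" "\<zero>\<^bsub>dual\<^esub> \<in> Dual"
  using DS.a_closed DS.scale_simps(4) DS.M.zero_closed by auto

lemma conv_linear:
  assumes d: "\<phi> \<in> Dual" "\<psi> \<in> Dual"
  shows "\<chi> \<in> Dual \<Longrightarrow> (\<phi> \<oplus>\<^bsub>dual\<^esub> \<psi>) \<star> \<chi> = \<phi> \<star> \<chi> \<oplus>\<^bsub>dual\<^esub> \<psi> \<star> \<chi>"
    "\<chi> \<in> Dual \<Longrightarrow> \<chi> \<star> (\<phi> \<oplus>\<^bsub>dual\<^esub> \<psi>) = \<chi> \<star> \<phi> \<oplus>\<^bsub>dual\<^esub> \<chi> \<star> \<psi>"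
    "(c \<odot>\<^bsub>dual\<^esub> \<phi>) \<star> \<psi> = c \<odot>\<^bsub>dual\<^esub> (\<phi> \<star> \<psi>)"
    "\<phi> \<star> (c \<odot>\<^bsub>dual\<^esub> \<psi>) = c \<odot>\<^bsub>dual\<^esub> (\<phi> \<star> \<psi>)"
proof -
  note ev = dual_add_apply dual_smult_apply conv_sweedler homog_closed dual_closed
  { assume c: "\<chi> \<in> Dual"
    show "(\<phi> \<oplus>\<^bsub>dual\<^esub> \<psi>) \<star> \<chi> = \<phi> \<star> \<chi> \<oplus>\<^bsub>dual\<^esub> \<psi> \<star> \<chi>"
    proof (rule Dual_eqI)
      fix p f assume f: "f \<in> homog A p"
      have "((\<phi> \<oplus>\<^bsub>dual\<^esub> \<psi>) \<star> \<chi>) f =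
        (\<Sum>(i, a, b)\<leftarrow>sweedler p f. koszul i (p + i) * (\<phi> a * \<chi> b) + koszul i (p + i) * (\<psi> a * \<chi> b))"
        unfolding conv_sweedler[OF dual_closed(1)[OF d] c f]
        by (rule sweedler_sum_cong[OF f]) (simp add: ev algebra_simps)
      then show "((\<phi> \<oplus>\<^bsub>dual\<^esub> \<psi>) \<star> \<chi>) f = (\<phi> \<star> \<chi> \<oplus>\<^bsub>dual\<^esub> \<psi> \<star> \<chi>) f"
        using f d c by (simp add: ev conv_sweedler[OF _ _ f] case_prod_unfold sum_list_addf)
    qed (use d c in \<open>auto intro!: conv_Dual dual_closed\<close>)
    show "\<chi> \<star> (\<phi> \<oplus>\<^bsub>dual\<^esub> \<psi>) = \<chi> \<star> \<phi> \<oplus>\<^bsub>dual\<^esub> \<chi> \<star> \<psi>"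
    proof (rule Dual_eqI)
      fix p f assume f: "f \<in> homog A p"
      have "(\<chi> \<star> (\<phi> \<oplus>\<^bsub>dual\<^esub> \<psi>)) f =
        (\<Sum>(i, a, b)\<leftarrow>sweedler p f. koszul i (p + i) * (\<chi> a * \<phi> b) + koszul i (p + i) * (\<chi> a * \<psi> b))"
        unfolding conv_sweedler[OF c dual_closed(1)[OF d] f]
        by (rule sweedler_sum_cong[OF f]) (simp add: ev algebra_simps)
      then show "(\<chi> \<star> (\<phi> \<oplus>\<^bsub>dual\<^esub> \<psi>)) f = (\<chi> \<star> \<phi> \<oplus>\<^bsub>dual\<^esub> \<chi> \<star> \<psi>) f"
        using f d c by (simp add: ev conv_sweedler[OF _ _ f] case_prod_unfold sum_list_addf)
    qed (use d c in \<open>auto intro!: conv_Dual dual_closed\<close>) }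
  show "(c \<odot>\<^bsub>dual\<^esub> \<phi>) \<star> \<psi> = c \<odot>\<^bsub>dual\<^esub> (\<phi> \<star> \<psi>)"
  proof (rule Dual_eqI)
    fix p f assume f: "f \<in> homog A p"
    have "((c \<odot>\<^bsub>dual\<^esub> \<phi>) \<star> \<psi>) f = (\<Sum>(i, a, b)\<leftarrow>sweedler p f. c * (koszul i (p + i) * (\<phi> a * \<psi> b)))"
      unfolding conv_sweedler[OF dual_closed(2)[OF d(1)] d(2) f]
      by (rule sweedler_sum_cong[OF f]) (simp add: ev algebra_simps)
    then show "((c \<odot>\<^bsub>dual\<^esub> \<phi>) \<star> \<psi>) f = (c \<odot>\<^bsub>dual\<^esub> (\<phi> \<star> \<psi>)) f"
      using f d by (simp add: ev conv_sweedler[OF _ _ f] case_prod_unfold sum_list_const_mult)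
  qed (use d in \<open>auto intro!: conv_Dual dual_closed\<close>)
  show "\<phi> \<star> (c \<odot>\<^bsub>dual\<^esub> \<psi>) = c \<odot>\<^bsub>dual\<^esub> (\<phi> \<star> \<psi>)"
  proof (rule Dual_eqI)
    fix p f assume f: "f \<in> homog A p"
    have "(\<phi> \<star> (c \<odot>\<^bsub>dual\<^esub> \<psi>)) f = (\<Sum>(i, a, b)\<leftarrow>sweedler p f. c * (koszul i (p + i) * (\<phi> a * \<psi> b)))"
      unfolding conv_sweedler[OF d(1) dual_closed(2)[OF d(2)] f]
      by (rule sweedler_sum_cong[OF f]) (simp add: ev algebra_simps)
    then show "(\<phi> \<star> (c \<odot>\<^bsub>dual\<^esub> \<psi>)) f = (c \<odot>\<^bsub>dual\<^esub> (\<phi> \<star> \<psi>)) f"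
      using f d by (simp add: ev conv_sweedler[OF _ _ f] case_prod_unfold sum_list_const_mult)
  qed (use d in \<open>auto intro!: conv_Dual dual_closed\<close>)
qed

lemma conv_zero:
  assumes "\<phi> \<in> Dual" "\<psi> \<in> Dual" "\<And>f. f \<in> carrier A \<Longrightarrow> \<psi> f = 0" "f \<in> carrier A"
  shows "(\<phi> \<star> \<psi>) f = 0" "(\<psi> \<star> \<phi>) f = 0"
proof -
  have "\<psi> = 0 \<odot>\<^bsub>dual\<^esub> \<psi>"
    by (rule Dual_eqI_carrier) (use assms in \<open>auto simp: dual_smult_apply dual_zero_apply intro: dual_closed\<close>)
  then have "\<phi> \<star> \<psi> = 0 \<odot>\<^bsub>dual\<^esub> (\<phi> \<star> \<psi>)" "\<psi> \<star> \<phi> = 0 \<odot>\<^bsub>dual\<^esub> (\<psi> \<star> \<phi>)"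
    using conv_linear(3)[OF assms(2,1), of 0] conv_linear(4)[OF assms(1,2), of 0] by simp_all
  then have "(\<phi> \<star> \<psi>) f = (0 \<odot>\<^bsub>dual\<^esub> (\<phi> \<star> \<psi>)) f" "(\<psi> \<star> \<phi>) f = (0 \<odot>\<^bsub>dual\<^esub> (\<psi> \<star> \<phi>)) f"
    by metis+
  then show "(\<phi> \<star> \<psi>) f = 0" "(\<psi> \<star> \<phi>) f = 0" using assms(4) by (simp_all add: dual_smult_apply)
qed

lemma conv_one: "\<phi> \<in> Dual \<Longrightarrow> \<psi> \<in> Dual \<Longrightarrow> (\<phi> \<star> \<psi>) \<one> = \<phi> \<one> * \<psi> \<one>"
proof -
  assume d: "\<phi> \<in> Dual" "\<psi> \<in> Dual"
  note b = conv_kernel[OF d]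
  have "(\<phi> \<star> \<psi>) \<one> = indexed (\<lambda>i j a b. koszul i j * (\<phi> a * \<psi> b)) \<one> \<one>"
    by (simp add: conv_eq[OF d] sweedler_lift[OF one_even b] sweedler_one[OF b])
  also have "\<dots> = \<phi> \<one> * \<psi> \<one>"
    by (subst indexed_homog[OF _ one_even one_even]) (use d in \<open>auto intro!: bilinear_ground_scale bilinear_mult DualD\<close>)
  finally show ?thesis .
qed

lemma homog_dual_iff: "\<phi> \<in> homog dual i \<longleftrightarrow> \<phi> \<in> Dual \<and> (\<forall>f\<in>homog A (i + 1). \<phi> f = 0)"
  by (simp add: dual_ops)

lemma homog_dual_zero: "\<phi> \<in> homog dual i \<Longrightarrow> f \<in> homog A j \<Longrightarrow> j \<noteq> i \<Longrightarrow> \<phi> f = 0"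
  by (cases i; cases j) (auto simp: homog_dual_iff)

lemma conv_homog:
  assumes "\<phi> \<in> homog dual i" "\<psi> \<in> homog dual j"
  shows "\<phi> \<star> \<psi> \<in> homog dual (i + j)"
proof -
  have d: "\<phi> \<in> Dual" "\<psi> \<in> Dual" using assms by (auto simp: homog_dual_iff)
  have "(\<phi> \<star> \<psi>) f = 0" if f: "f \<in> homog A (i + j + 1)" for f
  proof -
    have "(\<phi> \<star> \<psi>) f = (\<Sum>(k, a, b)\<leftarrow>sweedler (i + j + 1) f. 0)"
      unfolding conv_sweedler[OF d f]
    proof (rule sweedler_sum_cong[OF f])
      fix k a b assume *: "a \<in> homog A k" "b \<in> homog A (i + j + 1 + k)"
      have "k \<noteq> i \<or> i + j + 1 + k \<noteq> j" by (cases i; cases j; cases k; simp)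
      then have "\<phi> a = 0 \<or> \<psi> b = 0"
        by (rule disjE) (use homog_dual_zero[OF assms(1) *(1)] homog_dual_zero[OF assms(2) *(2)] in \<open>blast+\<close>)
      then show "koszul k (i + j + 1 + k) * (\<phi> a * \<psi> b) = 0" by auto
    qed
    then show ?thesis by (simp add: case_prod_unfold)
  qed
  then show ?thesis using conv_Dual[OF d] by (auto simp: homog_dual_iff)
qed

lemma unit_dual_even: "unit_dual \<in> homog dual 0"
  using unit_dual counit_odd homog_closed by (auto simp: homog_dual_iff)

subsection \<open>Primitive functionals act as derivations\<close>

definition translate_right :: "('a \<Rightarrow> 'k) \<Rightarrow> 'a \<Rightarrow> 'a \<Rightarrow> 'k" where
  "translate_right \<psi> h = (\<lambda>a\<in>carrier A. \<psi> (a \<otimes> h))"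

definition translate_left :: "'a \<Rightarrow> ('a \<Rightarrow> 'k) \<Rightarrow> 'a \<Rightarrow> 'k" where
  "translate_left f \<psi> = (\<lambda>a\<in>carrier A. \<psi> (f \<otimes> a))"

text \<open>The sign that arises when \<open>\<phi>\<close> moves past an element of parity \<open>q\<close>.\<close>

definition twist :: "bit \<Rightarrow> ('a \<Rightarrow> 'k) \<Rightarrow> 'a \<Rightarrow> 'k" where
  "twist q \<phi> = (\<lambda>a\<in>carrier A. \<Sum>i\<in>UNIV. koszul i q * \<phi> (component A i a))"

definition primitive :: "('a \<Rightarrow> 'k) \<Rightarrow> bool" where
  "primitive x \<longleftrightarrow> x \<in> Dual \<and>
    (\<forall>a\<in>carrier A. \<forall>b\<in>carrier A. x (a \<otimes> b) = x a * counit A b + counit A a * x b)"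

lemma translate_Dual: "\<psi> \<in> Dual \<Longrightarrow> h \<in> carrier A \<Longrightarrow> translate_right \<psi> h \<in> Dual"
  "\<psi> \<in> Dual \<Longrightarrow> h \<in> carrier A \<Longrightarrow> translate_left h \<psi> \<in> Dual"
  unfolding translate_right_def translate_left_def
  by (auto intro!: restrict_Dual functionals_comp[OF DualD] mult_linear_left mult_linear_right)

lemma translate_apply: "a \<in> carrier A \<Longrightarrow> translate_right \<psi> h a = \<psi> (a \<otimes> h)"
  "a \<in> carrier A \<Longrightarrow> translate_left h \<psi> a = \<psi> (h \<otimes> a)"
  by (auto simp: translate_right_def translate_left_def)

lemma twist_homog: "x \<in> Dual \<Longrightarrow> a \<in> homog A i \<Longrightarrow> twist q x a = koszul i q * x a"
proof -
  assume x: "x \<in> Dual" and a: "a \<in> homog A i"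
  have "koszul j q * x (component A j a) = (if j = i then koszul i q * x a else 0)" for j
    using functional_zero[OF module_A DualD[OF x]] by (auto simp: component_homog[OF a])
  then show ?thesis using homog_closed[OF a] by (simp add: twist_def)
qed

lemma twist_Dual: "x \<in> Dual \<Longrightarrow> twist q x \<in> Dual"
  unfolding twist_def sum_bit
  by (intro restrict_Dual functionals_plus functionals_scale functionals_comp[OF DualD] component_linear)

lemma twist_of_homog:
  assumes "x \<in> homog dual i"
  shows "twist q x = koszul i q \<odot>\<^bsub>dual\<^esub> x"
proof (rule Dual_eqI)
  have d: "x \<in> Dual" using assms by (simp add: homog_dual_iff)
  then show "twist q x \<in> Dual" "koszul i q \<odot>\<^bsub>dual\<^esub> x \<in> Dual" by (auto intro: twist_Dual dual_closed)
  fix j f assume f: "f \<in> homog A j"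
  show "twist q x f = (koszul i q \<odot>\<^bsub>dual\<^esub> x) f"
    using twist_homog[OF d f] homog_dual_zero[OF assms f] homog_closed[OF f] by (cases "j = i") (auto simp: dual_smult_apply)
qed

lemma primitive_twist: "primitive x \<Longrightarrow> primitive (twist q x)"
proof -
  assume x: "primitive x"
  then have d: "x \<in> Dual" by (simp add: primitive_def)
  note t = twist_Dual[OF d]
  have hom: "twist q x (a \<otimes> b) = twist q x a * counit A b + counit A a * twist q x b"
    if "a \<in> homog A i" "b \<in> homog A j" for a b i j
  proof -
    have c: "a \<in> carrier A" "b \<in> carrier A" using that homog_closed by auto
    have "koszul (i + j) q * (x a * counit A b + counit A a * x b) = koszul i q * x a * counit A b + counit A a * (koszul j q * x b)"
      using that counit_odd by (cases i; cases j) (auto simp: algebra_simps)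
    then show ?thesis
      using x c by (simp add: twist_homog[OF d homog_mult[OF that]] twist_homog[OF d that(1)] twist_homog[OF d that(2)] primitive_def)
  qed
  note t' = DualD[OF t]
  have fun1: "(\<lambda>a. twist q x (a \<otimes> b)) \<in> functionals A" "(\<lambda>a. twist q x a * counit A b + counit A a * twist q x b) \<in> functionals A"
    if "b \<in> carrier A" for b
    by (intro functionals_comp[OF t'] mult_linear_left that)
      (intro functionals_plus functionals_scale_right counit_functional t')
  have fun2: "(\<lambda>b. twist q x (a \<otimes> b)) \<in> functionals A" "(\<lambda>b. twist q x a * counit A b + counit A a * twist q x b) \<in> functionals A"
    if "a \<in> carrier A" for a
    by (intro functionals_comp[OF t'] mult_linear_right that)
      (intro functionals_plus functionals_scale counit_functional t')
  have h1: "twist q x (a \<otimes> b) = twist q x a * counit A b + counit A a * twist q x b" if "b \<in> homog A j" "a \<in> carrier A" for a b j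
    using functionals_eqI[OF fun1[OF homog_closed[OF that(1)]] hom[OF _ that(1)] that(2)] .
  have "twist q x (a \<otimes> b) = twist q x a * counit A b + counit A a * twist q x b" if "a \<in> carrier A" "b \<in> carrier A" for a b
    using functionals_eqI[OF fun2[OF that(1)] h1[OF _ that(1)] that(2)] .
  then show ?thesis using t by (auto simp: primitive_def)
qed

text \<open>For primitive \<open>x\<close> the map \<open>D\<^sub>x\<close> with \<open>x \<psi> = \<psi> \<circ> D\<^sub>x\<close> is a superderivation; the lemma is
  this Leibniz rule, read off on the functionals.\<close>

lemma conv_derivation:
  assumes x: "primitive x" and psi: "\<psi> \<in> Dual" and h: "h \<in> homog A q" and f: "f \<in> carrier A"
  shows "(x \<star> \<psi>) (f \<otimes> h) = (twist q x \<star> translate_right \<psi> h) f + (x \<star> translate_left f \<psi>) h"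
proof -
  have d: "x \<in> Dual" using x by (simp add: primitive_def)
  have hc: "h \<in> carrier A" using h homog_closed by auto
  have hom: "(x \<star> \<psi>) (f \<otimes> h) = (twist q x \<star> translate_right \<psi> h) f + (x \<star> translate_left f \<psi>) h" if f: "f \<in> homog A p" for p f
  proof -
    have fc: "f \<in> carrier A" using f homog_closed by auto
    have b: "bilinear A A ground (\<lambda>a b. koszul i j * (x a * \<psi> b))" for i j
      using d psi by (auto intro!: bilinear_ground_scale bilinear_mult DualD)
    have "(x \<star> \<psi>) (f \<otimes> h) = (\<Sum>(i, a, b)\<leftarrow>sweedler (p + q) (f \<otimes> h). koszul i (p + q + i) * (x a * \<psi> b))"
      by (rule conv_sweedler[OF d psi homog_mult[OF f h]])
    also have "\<dots> = (\<Sum>(i, a, b)\<leftarrow>sweedler p f. \<Sum>(j, c, e)\<leftarrow>sweedler q h.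
        koszul (p + i) j * (koszul (i + j) (p + i + (q + j)) * (x (a \<otimes> c) * \<psi> (b \<otimes> e))))"
      by (rule sweedler_mult[OF b f h])
    also have "\<dots> = (\<Sum>(i, a, b)\<leftarrow>sweedler p f. \<Sum>(j, c, e)\<leftarrow>sweedler q h.
        koszul i (p + i + q) * x a * (counit A c * \<psi> (b \<otimes> e)) + counit A a * (koszul j (q + j) * (x c * \<psi> (b \<otimes> e))))"
    proof (intro sweedler_sum_cong[OF f] sweedler_sum_cong[OF h])
      fix i a b j c e assume *: "a \<in> homog A i" "b \<in> homog A (p + i)" "c \<in> homog A j" "e \<in> homog A (q + j)"
      have "x (a \<otimes> c) = x a * counit A c + counit A a * x c"
        using x * homog_closed by (auto simp: primitive_def)
      moreover have "koszul (p + i) j * (koszul (i + j) (p + i + (q + j)) * (x a * counit A c)) =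
          koszul i (p + i + q) * x a * counit A c"
        using counit_parity[OF *(3)] by (elim disjE) simp_all
      moreover have "koszul (p + i) j * (koszul (i + j) (p + i + (q + j)) * (counit A a * x c)) =
          counit A a * (koszul j (q + j) * x c)"
        using counit_parity[OF *(1)] by (elim disjE, simp_all) (cases p; cases j; cases q; simp)
      ultimately show "koszul (p + i) j * (koszul (i + j) (p + i + (q + j)) * (x (a \<otimes> c) * \<psi> (b \<otimes> e))) =
          koszul i (p + i + q) * x a * (counit A c * \<psi> (b \<otimes> e)) + counit A a * (koszul j (q + j) * (x c * \<psi> (b \<otimes> e)))"
        by (simp only: distrib_left distrib_right mult.assoc[symmetric])
    qed
    also have "\<dots> = (\<Sum>(i, a, b)\<leftarrow>sweedler p f. koszul i (p + i + q) * x a * (\<Sum>(j, c, e)\<leftarrow>sweedler q h. counit A c * \<psi> (b \<otimes> e))) +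
        (\<Sum>(i, a, b)\<leftarrow>sweedler p f. \<Sum>(j, c, e)\<leftarrow>sweedler q h. counit A a * (koszul j (q + j) * (x c * \<psi> (b \<otimes> e))))"
      by (simp add: case_prod_unfold sum_list_addf sum_list_const_mult)
    also have "(\<Sum>(i, a, b)\<leftarrow>sweedler p f. koszul i (p + i + q) * x a * (\<Sum>(j, c, e)\<leftarrow>sweedler q h. counit A c * \<psi> (b \<otimes> e))) =
        (twist q x \<star> translate_right \<psi> h) f"
      unfolding conv_sweedler[OF twist_Dual[OF d] translate_Dual(1)[OF psi hc] f]
    proof (rule sweedler_sum_cong[OF f])
      fix i a b assume *: "a \<in> homog A i" "b \<in> homog A (p + i)"
      have "b \<in> carrier A" using * homog_closed by auto
      then show "koszul i (p + i + q) * x a * (\<Sum>(j, c, e)\<leftarrow>sweedler q h. counit A c * \<psi> (b \<otimes> e)) =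
          koszul i (p + i) * (twist q x a * translate_right \<psi> h b)"
        by (subst sweedler_counit(1)[OF h functionals_comp[OF DualD[OF psi] mult_linear_right]])
          (simp_all add: twist_homog[OF d *(1)] translate_apply koszul_add)
    qed
    also have "(\<Sum>(i, a, b)\<leftarrow>sweedler p f. \<Sum>(j, c, e)\<leftarrow>sweedler q h. counit A a * (koszul j (q + j) * (x c * \<psi> (b \<otimes> e)))) =
        (\<Sum>(j, c, e)\<leftarrow>sweedler q h. \<Sum>(i, a, b)\<leftarrow>sweedler p f. counit A a * (koszul j (q + j) * (x c * \<psi> (b \<otimes> e))))"
      unfolding case_prod_unfold by (rule sum_list_swap)
    also have "\<dots> = (x \<star> translate_left f \<psi>) h"
      unfolding conv_sweedler[OF d translate_Dual(2)[OF psi fc] h]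
    proof (rule sweedler_sum_cong[OF h])
      fix j c e assume *: "c \<in> homog A j" "e \<in> homog A (q + j)"
      have e: "e \<in> carrier A" using * homog_closed by auto
      have "(\<lambda>b. koszul j (q + j) * (x c * \<psi> (b \<otimes> e))) \<in> functionals A"
        by (intro functionals_scale functionals_comp[OF DualD[OF psi] mult_linear_left[OF e]])
      from sweedler_counit(1)[OF f this]
      show "(\<Sum>(i, a, b)\<leftarrow>sweedler p f. counit A a * (koszul j (q + j) * (x c * \<psi> (b \<otimes> e)))) =
          koszul j (q + j) * (x c * translate_left f \<psi> e)" using e by (simp add: translate_apply)
    qed
    finally show ?thesis .
  qed
  have F: "(\<lambda>f. (x \<star> translate_left f \<psi>) h) \<in> functionals A"
  proof -
    have "translate_left (f \<oplus> g) \<psi> = translate_left f \<psi> \<oplus>\<^bsub>dual\<^esub> translate_left g \<psi>" if "f \<in> carrier A" "g \<in> carrier A" for f g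
      using that by (auto simp: translate_left_def dual_ops l_distr functional_add[OF DualD[OF psi]])
    moreover have "translate_left (c \<odot> f) \<psi> = c \<odot>\<^bsub>dual\<^esub> translate_left f \<psi>" if "f \<in> carrier A" for c f
      using that by (auto simp: translate_left_def dual_ops smult_mult_left functional_smult[OF DualD[OF psi]])
    ultimately show ?thesis
      by (auto simp: functionals_iff[of "\<lambda>f. (x \<star> translate_left f \<psi>) h"] conv_linear(2)[OF _ _ d] conv_linear(4)[OF d] translate_Dual psi dual_add_apply dual_smult_apply hc)
  qed
  show ?thesis
    by (rule functionals_eqI[OF _ _ hom f])
      (intro functionals_comp[OF DualD[OF conv_Dual[OF d psi]] mult_linear_left[OF hc]],
       intro functionals_plus F DualD[OF conv_Dual] twist_Dual d translate_Dual psi hc)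
qed

end

section \<open>Powers of the augmentation ideal\<close>

context hopf_superalgebra
begin

abbreviation aug where "aug \<equiv> augmentation_ideal A"

abbreviation aug_pow where "aug_pow \<equiv> ideal_pow A aug"

lemma aug_iff: "a \<in> aug \<longleftrightarrow> a \<in> carrier A \<and> counit A a = 0"
  by (simp add: augmentation_ideal_def a_kernel_def kernel_def)

lemma aug_ideal: "ideal aug A"
proof (rule idealI[OF ring_axioms])
  have "\<ominus> x \<in> aug" if "x \<in> aug" for x
    using that functional_smult[OF counit_functional, of x "- 1"] module_minus[OF module_A, of x] by (auto simp: aug_iff)
  then show "subgroup aug (add_monoid A)"
    using functional_zero[OF module_A counit_functional]
    by (intro subgroup.intro) (auto simp: aug_iff functional_add[OF counit_functional] simp flip: a_inv_def)
qed (auto simp: aug_iff counit_mult)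

lemma aug_pow_ideal: "ideal (aug_pow k) A"
  by (induction k) (auto intro: oneideal ideal_prod_is_ideal aug_ideal)

lemma aug_pow_closed: "x \<in> aug_pow k \<Longrightarrow> x \<in> carrier A"
  using ideal.Icarr[OF aug_pow_ideal] .

lemma aug_pow_add: "x \<in> aug_pow k \<Longrightarrow> y \<in> aug_pow k \<Longrightarrow> x \<oplus> y \<in> aug_pow k"
  using additive_subgroup.a_closed[OF ideal.axioms(1)[OF aug_pow_ideal]] .

lemma aug_pow_zero: "\<zero> \<in> aug_pow k"
  using additive_subgroup.zero_closed[OF ideal.axioms(1)[OF aug_pow_ideal]] .

lemma aug_pow_mult: "x \<in> aug_pow k \<Longrightarrow> a \<in> carrier A \<Longrightarrow> x \<otimes> a \<in> aug_pow k"
  "x \<in> aug_pow k \<Longrightarrow> a \<in> carrier A \<Longrightarrow> a \<otimes> x \<in> aug_pow k"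
  using ideal.I_l_closed[OF aug_pow_ideal] ideal.I_r_closed[OF aug_pow_ideal] by auto

lemma aug_pow_smult: "x \<in> aug_pow k \<Longrightarrow> c \<odot> x \<in> aug_pow k"
proof -
  assume x: "x \<in> aug_pow k"
  then have "c \<odot> x = (c \<odot> \<one>) \<otimes> x" using aug_pow_closed by (simp add: smult_mult_left)
  then show ?thesis using aug_pow_mult(2)[OF x, of "c \<odot> \<one>"] by simp
qed

lemma aug_pow_1: "aug_pow 1 = aug"
proof
  show "aug_pow 1 \<subseteq> aug"
  proof
    fix x assume "x \<in> aug_pow 1"
    then have "x \<in> ideal_prod A aug (carrier A)" by simp
    then show "x \<in> aug"
      by (induction x rule: ideal_prod.induct)
        (auto simp: aug_iff counit_mult functional_add[OF counit_functional])
  qed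
  show "aug \<subseteq> aug_pow 1"
  proof
    fix x assume x: "x \<in> aug"
    then have "x \<otimes> \<one> \<in> ideal_prod A aug (carrier A)" by (intro ideal_prod.prod) auto
    then show "x \<in> aug_pow 1" using x by (simp add: aug_iff)
  qed
qed

lemma component_mult:
  assumes "a \<in> carrier A" "b \<in> carrier A"
  shows "component A i (a \<otimes> b) = component A 0 a \<otimes> component A i b \<oplus> component A 1 a \<otimes> component A (i + 1) b"
proof -
  let ?a = "\<lambda>i. component A i a" and ?b = "\<lambda>i. component A i b"
  have "a \<otimes> b = (?a 0 \<oplus> ?a 1) \<otimes> (?b i \<oplus> ?b (i + 1))"
    using assms by (simp add: component_decomp_01 component_decomp)
  also have "\<dots> = (?a 0 \<otimes> ?b i \<oplus> ?a 1 \<otimes> ?b (i + 1)) \<oplus> (?a 0 \<otimes> ?b (i + 1) \<oplus> ?a 1 \<otimes> ?b i)"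
    using assms by (simp add: l_distr r_distr a_ac)
  finally have e: "a \<otimes> b = (?a 0 \<otimes> ?b i \<oplus> ?a 1 \<otimes> ?b (i + 1)) \<oplus> (?a 0 \<otimes> ?b (i + 1) \<oplus> ?a 1 \<otimes> ?b i)" .
  have m: "?a j \<otimes> ?b k \<in> homog A (j + k)" for j k using assms component_in homog_mult by auto
  show ?thesis unfolding e
  proof (rule component_eqI)
    show "?a 0 \<otimes> ?b i \<oplus> ?a 1 \<otimes> ?b (i + 1) \<in> homog A i"
      using m[of 0 i] m[of 1 "i + 1"] by (intro homog_add) (auto simp: add.commute)
    show "?a 0 \<otimes> ?b (i + 1) \<oplus> ?a 1 \<otimes> ?b i \<in> homog A (i + 1)"
      using m[of 0 "i + 1"] m[of 1 i] by (intro homog_add) (auto simp: add.commute)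
  qed
qed

lemma component_aug: "a \<in> aug \<Longrightarrow> component A i a \<in> aug"
proof -
  assume a: "a \<in> aug"
  then have c: "a \<in> carrier A" "counit A a = 0" by (auto simp: aug_iff)
  have "counit A (component A 1 a) = 0" using counit_odd component_in[OF c(1)] by auto
  moreover have "counit A (component A 0 a) = 0"
    using functional_components[OF counit_functional c(1)] c(2) calculation by (simp add: sum_bit)
  ultimately show ?thesis using c by (cases i) (auto simp: aug_iff)
qed

lemma component_aug_pow: "x \<in> aug_pow k \<Longrightarrow> component A i x \<in> aug_pow k"
proof (induction k arbitrary: x i)
  case (Suc k)
  have "x \<in> ideal_prod A aug (aug_pow k)" using Suc by simp
  then have "component A i x \<in> ideal_prod A aug (aug_pow k) \<and> x \<in> carrier A"
  proof (induction x rule: ideal_prod.induct)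
    case (prod m g)
    then have "m \<in> carrier A" "g \<in> carrier A" using aug_pow_closed by (auto simp: aug_iff)
    then show ?case using prod Suc.IH component_aug
      by (auto simp: component_mult intro!: ideal_prod.sum ideal_prod.prod)
  next
    case (sum x y)
    then show ?case by (auto simp: component_add intro!: ideal_prod.sum)
  qed
  then show ?case by simp
qed auto

lemma minus_counit_aug: "a \<in> carrier A \<Longrightarrow> a \<oplus> (- counit A a) \<odot> \<one> \<in> aug"
  by (auto simp: aug_iff functional_add[OF counit_functional] functional_smult[OF counit_functional])

lemma counit_decomp: "a \<in> carrier A \<Longrightarrow> a = (a \<oplus> (- counit A a) \<odot> \<one>) \<oplus> counit A a \<odot> \<one>"
  by (simp add: a_assoc flip: scale_add_left)

lemma dist_filt_iff: "\<phi> \<in> dist_filt A n \<longleftrightarrow> \<phi> \<in> Dual \<and> (\<forall>f\<in>aug_pow (Suc n). \<phi> f = 0)"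
  by (simp add: dist_filt_def)

lemma dist_filt_closed: "\<phi> \<in> dist_filt A n \<Longrightarrow> \<psi> \<in> dist_filt A n \<Longrightarrow> \<phi> \<oplus>\<^bsub>dual\<^esub> \<psi> \<in> dist_filt A n"
  "\<phi> \<in> dist_filt A n \<Longrightarrow> c \<odot>\<^bsub>dual\<^esub> \<phi> \<in> dist_filt A n"
  "\<phi> \<in> dist_filt A n \<Longrightarrow> component dual i \<phi> \<in> dist_filt A n"
proof -
  show "\<phi> \<oplus>\<^bsub>dual\<^esub> \<psi> \<in> dist_filt A n" if "\<phi> \<in> dist_filt A n" "\<psi> \<in> dist_filt A n"
    unfolding dist_filt_iff
  proof (intro conjI ballI)
    show "\<phi> \<oplus>\<^bsub>dual\<^esub> \<psi> \<in> Dual" using that dual_closed(1) unfolding dist_filt_iff by blast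
    show "(\<phi> \<oplus>\<^bsub>dual\<^esub> \<psi>) f = 0" if "f \<in> aug_pow (Suc n)" for f
      using that \<open>\<phi> \<in> dist_filt A n\<close> \<open>\<psi> \<in> dist_filt A n\<close> dual_add_apply[OF aug_pow_closed[OF that]]
      unfolding dist_filt_iff by simp
  qed
  show "c \<odot>\<^bsub>dual\<^esub> \<phi> \<in> dist_filt A n" if "\<phi> \<in> dist_filt A n"
    unfolding dist_filt_iff
  proof (intro conjI ballI)
    show "c \<odot>\<^bsub>dual\<^esub> \<phi> \<in> Dual" using that dual_closed(2) unfolding dist_filt_iff by blast
    show "(c \<odot>\<^bsub>dual\<^esub> \<phi>) f = 0" if "f \<in> aug_pow (Suc n)" for f
      using that \<open>\<phi> \<in> dist_filt A n\<close> dual_smult_apply[OF aug_pow_closed[OF that]] unfolding dist_filt_iff by simp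
  qed
  show "component dual i \<phi> \<in> dist_filt A n" if "\<phi> \<in> dist_filt A n"
    unfolding dist_filt_iff
  proof (intro conjI ballI)
    have d: "\<phi> \<in> Dual" using that unfolding dist_filt_iff by blast
    then show "component dual i \<phi> \<in> Dual" by (rule DS.component_closed)
    show "component dual i \<phi> f = 0" if "f \<in> aug_pow (Suc n)" for f
      using component_aug_pow[OF that] \<open>\<phi> \<in> dist_filt A n\<close> aug_pow_closed[OF that]
      unfolding dist_filt_iff component_dual[OF d] by simp
  qed
qed

lemma lie_space_iff: "x \<in> lie_space A \<longleftrightarrow> x \<in> Dual \<and> (\<forall>f\<in>aug_pow 2. x f = 0) \<and> x \<one> = 0"
  by (auto simp: lie_space_def dist_filt_iff numeral_2_eq_2)

lemma aug_mult_aug: "a \<in> aug \<Longrightarrow> b \<in> aug \<Longrightarrow> a \<otimes> b \<in> aug_pow 2"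
  using aug_pow_1 by (auto simp: numeral_2_eq_2 intro!: ideal_prod.prod)

lemma mult_shifted:
  assumes "u \<in> carrier A" "v \<in> carrier A"
  shows "(u \<oplus> c \<odot> \<one>) \<otimes> (v \<oplus> d \<odot> \<one>) = (u \<otimes> v \<oplus> d \<odot> u) \<oplus> (c \<odot> v \<oplus> (c * d) \<odot> \<one>)"
  using assms by (simp add: l_distr r_distr smult_mult_left smult_mult_right scale_scale scale_add
      a_ac mult.commute)

text \<open>Write \<open>a = a' + \<epsilon>(a)\<close> and \<open>b = b' + \<epsilon>(b)\<close>: the product \<open>a' b'\<close> lies in the square of the augmentation
  ideal, where the functional vanishes.\<close>

lemma lie_space_primitive: assumes x: "x \<in> lie_space A" shows "primitive x"
proof -
  have d: "x \<in> Dual" and v: "\<And>f. f \<in> aug_pow 2 \<Longrightarrow> x f = 0" "x \<one> = 0" using x by (auto simp: lie_space_iff)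
  note ev = functional_add[OF DualD[OF d]] functional_smult[OF DualD[OF d]]
  have "x (a \<otimes> b) = x a * counit A b + counit A a * x b" if ab: "a \<in> carrier A" "b \<in> carrier A" for a b
  proof -
    let ?a = "a \<oplus> (- counit A a) \<odot> \<one>" and ?b = "b \<oplus> (- counit A b) \<odot> \<one>"
    have c: "?a \<in> carrier A" "?b \<in> carrier A" using ab by auto
    have "a \<otimes> b = (?a \<oplus> counit A a \<odot> \<one>) \<otimes> (?b \<oplus> counit A b \<odot> \<one>)"
      using counit_decomp[OF ab(1)] counit_decomp[OF ab(2)] by simp
    also have "\<dots> = (?a \<otimes> ?b \<oplus> counit A b \<odot> ?a) \<oplus> (counit A a \<odot> ?b \<oplus> (counit A a * counit A b) \<odot> \<one>)"
      by (rule mult_shifted[OF c])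
    finally have "x (a \<otimes> b) = x (?a \<otimes> ?b) + counit A b * x ?a + (counit A a * x ?b)"
      using c v(2) by (simp add: ev)
    then show ?thesis
      using ab v(2) v(1)[OF aug_mult_aug[OF minus_counit_aug minus_counit_aug]] by (simp add: ev mult.commute)
  qed
  then show ?thesis using d by (simp add: primitive_def)
qed

lemma lie_space_twist: "x \<in> lie_space A \<Longrightarrow> twist q x \<in> lie_space A"
proof -
  assume x: "x \<in> lie_space A"
  then have d: "x \<in> Dual" and v: "\<And>f. f \<in> aug_pow 2 \<Longrightarrow> x f = 0" "x \<one> = 0" by (auto simp: lie_space_iff)
  have "twist q x f = 0" if "f \<in> aug_pow 2" for f
    using v(1)[OF component_aug_pow[OF that]] aug_pow_closed[OF that] by (simp add: twist_def)
  moreover have "twist q x \<one> = 0" using twist_homog[OF d one_even] v(2) by simp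
  ultimately show ?thesis using twist_Dual[OF d] by (auto simp: lie_space_iff)
qed

lemma lie_space_Dual: "x \<in> lie_space A \<Longrightarrow> x \<in> Dual" by (simp add: lie_space_iff)

lemma lie_space_closed: "x \<in> lie_space A \<Longrightarrow> y \<in> lie_space A \<Longrightarrow> x \<oplus>\<^bsub>dual\<^esub> y \<in> lie_space A"
  "x \<in> lie_space A \<Longrightarrow> c \<odot>\<^bsub>dual\<^esub> x \<in> lie_space A"
  "x \<in> lie_space A \<Longrightarrow> component dual i x \<in> lie_space A"
  "\<zero>\<^bsub>dual\<^esub> \<in> lie_space A"
proof -
  have z: "component A i \<one> = (if i = 0 then \<one> else \<zero>)" for i by (rule component_homog[OF one_even])
  show "x \<oplus>\<^bsub>dual\<^esub> y \<in> lie_space A" if "x \<in> lie_space A" "y \<in> lie_space A"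
    using that by (auto simp: lie_space_def dual_add_apply intro: dist_filt_closed)
  show "c \<odot>\<^bsub>dual\<^esub> x \<in> lie_space A" if "x \<in> lie_space A"
    using that by (auto simp: lie_space_def dual_smult_apply intro: dist_filt_closed)
  show "component dual i x \<in> lie_space A" if x: "x \<in> lie_space A"
  proof -
    have "component dual i x \<in> dist_filt A 1"
      by (rule dist_filt_closed(3)) (use x in \<open>simp add: lie_space_def\<close>)
    moreover have "component dual i x \<one> = 0"
      using x functional_zero[OF module_A DualD[OF lie_space_Dual[OF x]]]
      by (simp add: component_dual[OF lie_space_Dual[OF x]] z lie_space_iff)
    ultimately show ?thesis by (simp add: lie_space_def)
  qed
  show "\<zero>\<^bsub>dual\<^esub> \<in> lie_space A"
    using dual_closed(3) by (auto simp: lie_space_iff dual_zero_apply aug_pow_closed)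
qed

lemma minus_counit_split:
  assumes phi: "\<phi> \<in> functionals A" and a: "a \<in> carrier A"
  shows "\<phi> a = \<phi> (a \<oplus> (- counit A a) \<odot> \<one>) + counit A a * \<phi> \<one>"
  using a by (simp add: functional_add[OF phi] functional_smult[OF phi])

text \<open>Such a \<open>\<psi>\<close> is a multiple of the counit.\<close>

lemma conv_vanish_aug:
  assumes x: "x \<in> Dual" and psi: "\<psi> \<in> Dual" and v: "\<And>a. a \<in> aug \<Longrightarrow> \<psi> a = 0" and f: "f \<in> carrier A"
  shows "(x \<star> \<psi>) f = \<psi> \<one> * x f"
proof -
  have "\<psi> = \<psi> \<one> \<odot>\<^bsub>dual\<^esub> unit_dual"
  proof (rule Dual_eqI_carrier[OF psi dual_closed(2)[OF unit_dual]])
    fix a assume a: "a \<in> carrier A"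
    show "\<psi> a = (\<psi> \<one> \<odot>\<^bsub>dual\<^esub> unit_dual) a"
      unfolding dual_smult_apply[OF a] using minus_counit_split[OF DualD[OF psi] a] v[OF minus_counit_aug[OF a]] a
      by simp
  qed
  then have "x \<star> \<psi> = \<psi> \<one> \<odot>\<^bsub>dual\<^esub> x"
    using conv_linear(4)[OF x unit_dual, of "\<psi> \<one>"] conv_unit(2)[OF x] by simp
  then show ?thesis using f by (simp add: dual_smult_apply)
qed

end

context algebraic_supergroup
begin

abbreviation convolution (infixl \<open>\<star>\<close> 70) where "\<phi> \<star> \<psi> \<equiv> dist_mult X \<phi> \<psi>"

lemma aug_pow_mult_aug: "g \<in> aug_pow k \<Longrightarrow> m \<in> aug \<Longrightarrow> g \<otimes> m \<in> aug_pow (Suc k)"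
proof -
  assume g: "g \<in> aug_pow k" and m: "m \<in> aug"
  have gc: "g \<in> carrier X" and mc: "m \<in> carrier X" using g m aug_pow_closed by (auto simp: aug_iff)
  have *: "component X i g \<otimes> component X j m \<in> aug_pow (Suc k)" for i j
    using supercommutative[OF component_in[OF gc, of i] component_in[OF mc, of j]]
      ideal_prod.prod[OF component_aug[OF m, of j] component_aug_pow[OF g, of i], of X]
      aug_pow_smult[of "component X j m \<otimes> component X i g" "Suc k"] by simp
  have "g \<otimes> m = (component X 0 g \<oplus> component X 1 g) \<otimes> (component X 0 m \<oplus> component X 1 m)"
    by (simp add: component_decomp_01 gc mc)
  also have "\<dots> \<in> aug_pow (Suc k)"
    using gc mc by (simp only: l_distr r_distr component_closed a_closed) (intro aug_pow_add *)
  finally show ?thesis .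
qed

text \<open>The ideal powers are built by multiplication on the left. By supercommutativity the new factor can be put on the
  right, where the Leibniz rule of \<open>conv_derivation\<close> applies to it.\<close>

lemma aug_pow_Suc_induct [consumes 1, case_names mult add]:
  assumes "x \<in> aug_pow (Suc k)"
    and mult: "\<And>g m i j. g \<in> aug_pow k \<Longrightarrow> g \<in> homog X i \<Longrightarrow> m \<in> aug \<Longrightarrow> m \<in> homog X j \<Longrightarrow> P (g \<otimes> m)"
    and add: "\<And>x y. x \<in> carrier X \<Longrightarrow> y \<in> carrier X \<Longrightarrow> P x \<Longrightarrow> P y \<Longrightarrow> P (x \<oplus> y)"
  shows "P x"
proof -
  have "x \<in> ideal_prod X aug (aug_pow k)" using assms(1) by simp
  then have "P x \<and> x \<in> carrier X"
  proof (induction x rule: ideal_prod.induct)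
    case (prod m g)
    have gc: "g \<in> carrier X" and mc: "m \<in> carrier X" using prod aug_pow_closed by (auto simp: aug_iff)
    have *: "P (component X i m \<otimes> component X j g)" for i j
    proof -
      have "component X i m \<otimes> component X j g = koszul i j \<odot> (component X j g \<otimes> component X i m)"
        by (rule supercommutative[OF component_in[OF mc] component_in[OF gc]])
      also have "\<dots> = (koszul i j \<odot> component X j g) \<otimes> component X i m"
        using gc mc by (simp add: smult_mult_left)
      finally show ?thesis
        using mult[of "koszul i j \<odot> component X j g" j "component X i m" i]
          aug_pow_smult[OF component_aug_pow[OF prod(2)]] homog_smult[OF component_in[OF gc]]
          component_aug[OF prod(1)] component_in[OF mc] by simp
    qed
    have "m \<otimes> g = (component X 0 m \<otimes> component X 0 g \<oplus> component X 0 m \<otimes> component X 1 g) \<oplus>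
        (component X 1 m \<otimes> component X 0 g \<oplus> component X 1 m \<otimes> component X 1 g)"
    proof -
      have "m \<otimes> g = (component X 0 m \<oplus> component X 1 m) \<otimes> (component X 0 g \<oplus> component X 1 g)"
        by (simp add: component_decomp_01 gc mc)
      then show ?thesis using gc mc by (simp add: l_distr r_distr a_ac)
    qed
    then show ?case using gc mc by (auto intro!: add *)
  next
    case (sum x y)
    then show ?case by (auto intro: add)
  qed
  then show ?thesis by simp
qed

lemma aug_pow_mult_pow: "g \<in> aug_pow j \<Longrightarrow> r \<in> aug_pow k \<Longrightarrow> g \<otimes> r \<in> aug_pow (j + k)"
proof (induction k arbitrary: r)
  case (Suc k)
  from Suc(3) have "g \<otimes> r \<in> aug_pow (Suc (j + k))"
  proof (induction r rule: aug_pow_Suc_induct)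
    case (mult h m i i')
    have c: "g \<in> carrier X" "h \<in> carrier X" "m \<in> carrier X" using Suc(2) mult aug_pow_closed by (auto simp: aug_iff)
    have "(g \<otimes> h) \<otimes> m \<in> aug_pow (Suc (j + k))" by (intro aug_pow_mult_aug Suc mult)
    then show ?case using c by (simp add: m_assoc)
  next
    case (add x y)
    then show ?case using Suc(2) aug_pow_closed by (simp add: r_distr aug_pow_add del: ideal_pow.simps)
  qed
  then show ?case by simp
qed (simp add: aug_pow_mult)

lemma aug_pow_Suc_subset: "x \<in> aug_pow (Suc k) \<Longrightarrow> x \<in> aug_pow k"
proof -
  assume "x \<in> aug_pow (Suc k)"
  then have "x \<in> ideal_prod X aug (aug_pow k)" by simp
  then show ?thesis by (induction x rule: ideal_prod.induct) (auto simp: aug_iff intro: aug_pow_mult aug_pow_add)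
qed

lemma dist_filt_mono: "\<phi> \<in> dist_filt X n \<Longrightarrow> \<phi> \<in> dist_filt X (Suc n)"
  unfolding dist_filt_iff using aug_pow_Suc_subset[of _ "Suc n"] by blast

text \<open>By the Leibniz rule, each summand of \<open>x \<psi>\<close> on a product of \<open>k + 1\<close> factors differentiates one of them, and \<open>\<psi>\<close>
  still sees the \<open>k\<close> others.\<close>

lemma conv_vanish:
  assumes "primitive x" "\<psi> \<in> Dual" "\<And>f. f \<in> aug_pow k \<Longrightarrow> \<psi> f = 0" "f \<in> aug_pow (Suc k)"
  shows "(x \<star> \<psi>) f = 0"
  using assms
proof (induction k arbitrary: x \<psi> f)
  case 0
  then show ?case using conv_zero(1)[of x \<psi> f] aug_pow_closed[of f "Suc 0"] by (auto simp: primitive_def simp del: ideal_pow.simps(2))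
next
  case (Suc k)
  have d: "x \<in> Dual" using Suc(2) by (simp add: primitive_def)
  from Suc(5) show ?case
  proof (induction f rule: aug_pow_Suc_induct)
    case (add f g)
    then show ?case using functional_add[OF DualD[OF conv_Dual[OF d Suc(3)]]] by simp
  next
    case (mult g m i j)
    have c: "g \<in> carrier X" "m \<in> carrier X" using mult aug_pow_closed by (auto simp: aug_iff simp del: ideal_pow.simps)
    have "(twist j x \<star> translate_right \<psi> m) g = 0"
    proof (rule Suc.IH[OF primitive_twist[OF Suc(2)] translate_Dual(1)[OF Suc(3) c(2)] _ mult(1)])
      fix f assume f: "f \<in> aug_pow k"
      then show "translate_right \<psi> m f = 0"
        using Suc(4)[OF aug_pow_mult_aug[OF f mult(3)]] aug_pow_closed[OF f] by (simp add: translate_apply)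
    qed
    moreover have "(x \<star> translate_left g \<psi>) m = 0"
      by (rule conv_zero(1)[OF d translate_Dual(2)[OF Suc(3) c(1)] _ c(2)])
        (use Suc(4) aug_pow_mult(1)[OF mult(1)] in \<open>simp add: translate_apply\<close>)
    ultimately show ?case using conv_derivation[OF Suc(2,3) mult(4) c(1)] by simp
  qed
qed

end

section \<open>Dual bases of the cotangent space\<close>

text \<open>Vectors are adjoined to \<open>N\<close> one at a time, which gives an induction on the number of generators of a quotient.\<close>

fun span_over :: "('k::field, 'a, 'm) superspace_scheme \<Rightarrow> 'a list \<Rightarrow> 'a set \<Rightarrow> 'a set" where
  "span_over A [] N = N"
| "span_over A (s # S) N = span_over A S {n \<oplus>\<^bsub>A\<^esub> c \<odot>\<^bsub>A\<^esub> s | n c. n \<in> N}"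

definition subspace :: "('k::field, 'a, 'm) superspace_scheme \<Rightarrow> 'a set \<Rightarrow> bool" where
  "subspace A N \<longleftrightarrow> N \<subseteq> carrier A \<and> \<zero>\<^bsub>A\<^esub> \<in> N \<and> (\<forall>x\<in>N. \<forall>y\<in>N. x \<oplus>\<^bsub>A\<^esub> y \<in> N) \<and> (\<forall>c. \<forall>x\<in>N. c \<odot>\<^bsub>A\<^esub> x \<in> N)"

context
  fixes A :: "('k::field, 'a, 'm) superspace_scheme" (structure)
  assumes A: "Module.module ground A"
begin

interpretation A: Module.module ground A by (rule A)

lemma smult_rules: "x \<in> carrier A \<Longrightarrow> y \<in> carrier A \<Longrightarrow> c \<odot> (x \<oplus> y) = c \<odot> x \<oplus> c \<odot> y"
  "x \<in> carrier A \<Longrightarrow> (c + d) \<odot> x = c \<odot> x \<oplus> d \<odot> x"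
  "x \<in> carrier A \<Longrightarrow> c \<odot> (d \<odot> x) = (c * d) \<odot> x"
  "x \<in> carrier A \<Longrightarrow> 0 \<odot> x = \<zero>" "x \<in> carrier A \<Longrightarrow> 1 \<odot> x = x" "x \<in> carrier A \<Longrightarrow> c \<odot> x \<in> carrier A"
  "c \<odot> \<zero> = \<zero>"
  using A.smult_r_distr[of c x y] A.smult_l_distr[of c d x] A.smult_assoc1[of c d x] module_null[OF A, of x]
    A.smult_one[of x] A.smult_closed[of c x] A.smult_r_null[of c] by auto

lemma subspace_adjoin:
  assumes N: "subspace A N" and s: "s \<in> carrier A" shows "subspace A {n \<oplus> c \<odot> s | n c. n \<in> N}"
proof -
  have c: "n \<in> carrier A" if "n \<in> N" for n using N that by (auto simp: subspace_def)
  have z: "\<zero> = \<zero> \<oplus> 0 \<odot> s" using s by (simp add: smult_rules)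
  have p: "(n \<oplus> c \<odot> s) \<oplus> (n' \<oplus> c' \<odot> s) = (n \<oplus> n') \<oplus> (c + c') \<odot> s" if "n \<in> N" "n' \<in> N" for n n' c c'
    using that s c by (simp add: smult_rules A.M.add.m_ac)
  have m: "d \<odot> (n \<oplus> c \<odot> s) = d \<odot> n \<oplus> (d * c) \<odot> s" if "n \<in> N" for n c d
    using that s c by (simp add: smult_rules)
  show ?thesis unfolding subspace_def
  proof (intro conjI ballI allI)
    show "{n \<oplus> c \<odot> s | n c. n \<in> N} \<subseteq> carrier A" using c s by (auto simp: smult_rules)
    show "\<zero> \<in> {n \<oplus> c \<odot> s | n c. n \<in> N}" using z N by (auto simp: subspace_def)
  next
    fix x y assume "x \<in> {n \<oplus> c \<odot> s | n c. n \<in> N}" "y \<in> {n \<oplus> c \<odot> s | n c. n \<in> N}"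
    then obtain n c n' c' where xy: "n \<in> N" "n' \<in> N" "x = n \<oplus> c \<odot> s" "y = n' \<oplus> c' \<odot> s" by blast
    have "n \<oplus> n' \<in> N" using N xy by (simp add: subspace_def)
    then show "x \<oplus> y \<in> {n \<oplus> c \<odot> s | n c. n \<in> N}" unfolding xy p[OF xy(1,2)] by blast
  next
    fix d x assume "x \<in> {n \<oplus> c \<odot> s | n c. n \<in> N}"
    then obtain n c where x: "n \<in> N" "x = n \<oplus> c \<odot> s" by blast
    have "d \<odot> n \<in> N" using N x by (simp add: subspace_def)
    then show "d \<odot> x \<in> {n \<oplus> c \<odot> s | n c. n \<in> N}" unfolding x m[OF x(1)] by blast
  qed
qed

lemma adjoin_contains:
  assumes N: "subspace A N" and s: "s \<in> carrier A"
  shows "N \<subseteq> {n \<oplus> c \<odot> s | n c. n \<in> N}" "s \<in> {n \<oplus> c \<odot> s | n c. n \<in> N}"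
proof -
  have "n = n \<oplus> 0 \<odot> s" if "n \<in> N" for n using that N s by (auto simp: subspace_def smult_rules)
  then show "N \<subseteq> {n \<oplus> c \<odot> s | n c. n \<in> N}" by blast
  have "s = \<zero> \<oplus> 1 \<odot> s" using s by (simp add: smult_rules)
  then show "s \<in> {n \<oplus> c \<odot> s | n c. n \<in> N}" using N unfolding subspace_def by blast
qed

lemma span_over_props:
  "subspace A N \<Longrightarrow> set S \<subseteq> carrier A \<Longrightarrow>
    subspace A (span_over A S N) \<and> N \<subseteq> span_over A S N \<and> set S \<subseteq> span_over A S N"
proof (induction S arbitrary: N)
  case (Cons s S)
  then have "s \<in> carrier A" "set S \<subseteq> carrier A" by auto
  then show ?case
    using Cons.IH[OF subspace_adjoin[OF Cons(2), of s]] adjoin_contains[OF Cons(2), of s]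
    unfolding span_over.simps list.set insert_subset by blast
qed auto

text \<open>Coordinates with respect to a basis of the quotient by \<open>N\<close>, which is selected from a finite
  family that spans the quotient.\<close>

lemma coordinates_modulo:
  assumes "subspace A N" "set S \<subseteq> carrier A" "carrier A \<subseteq> span_over A S N"
  shows "\<exists>D. (\<forall>(x, f)\<in>set D. x \<in> functionals A \<and> (\<forall>n\<in>N. x n = 0) \<and> f \<in> set S) \<and>
    (\<forall>a\<in>carrier A. \<exists>r\<in>N. a = lsum A (map (\<lambda>(x, f). x a \<odot> f) D) \<oplus> r)"
  using assms
proof (induction S arbitrary: N)
  case Nil
  then have "\<exists>r\<in>N. a = \<zero> \<oplus> r" if "a \<in> carrier A" for a
    by (intro bexI[where x = a]) (use that in auto)
  then show ?case by (intro exI[where x = "[]"]) auto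
next
  case (Cons s S)
  let ?N = "{n \<oplus> c \<odot> s | n c. n \<in> N}"
  have s: "s \<in> carrier A" "set S \<subseteq> carrier A" using Cons by auto
  have Nc: "n \<in> carrier A" if "n \<in> N" for n using Cons(2) that by (auto simp: subspace_def)
  obtain D where D: "\<forall>(x, f)\<in>set D. x \<in> functionals A \<and> (\<forall>n\<in>?N. x n = 0) \<and> f \<in> set S"
    and rep: "\<forall>a\<in>carrier A. \<exists>r\<in>?N. a = lsum A (map (\<lambda>(x, f). x a \<odot> f) D) \<oplus> r"
    using Cons.IH[OF subspace_adjoin[OF Cons(2) s(1)] s(2)] Cons(4) by auto
  define E where "E = (\<lambda>a. lsum A (map (\<lambda>(x, f). x a \<odot> f) D))"
  have DN: "\<forall>(x, f)\<in>set D. x \<in> functionals A \<and> (\<forall>n\<in>N. x n = 0) \<and> f \<in> set (s # S)"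
    using D adjoin_contains(1)[OF Cons(2) s(1)] by fastforce
  show ?case
  proof (cases "s \<in> N")
    case True
    then have sub: "?N \<subseteq> N" using Cons(2) unfolding subspace_def by blast
    show ?thesis
    proof (intro exI[where x = D] conjI ballI)
      fix a assume "a \<in> carrier A"
      then obtain r where r: "r \<in> ?N" "a = lsum A (map (\<lambda>(x, f). x a \<odot> f) D) \<oplus> r" using bspec[OF rep] by blast
      show "\<exists>r\<in>N. a = lsum A (map (\<lambda>(x, f). x a \<odot> f) D) \<oplus> r"
        by (rule bexI[where x = r]) (rule r(2), rule subsetD[OF sub r(1)])
    qed (rule bspec[OF DN])
  next
    case False
    have fD: "f \<in> carrier A" "x \<in> functionals A" if "(x, f) \<in> set D" for x f using D s that by auto
    have Ec: "E a \<in> carrier A" for a unfolding E_def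
      by (rule lsum_closed[OF A]) (use fD in \<open>auto simp: smult_rules\<close>)
    have Eadd: "E (a \<oplus> b) = E a \<oplus> E b" if "a \<in> carrier A" "b \<in> carrier A" for a b
    proof -
      have "lsum A (map (\<lambda>(x, f). x (a \<oplus> b) \<odot> f) D') =
         lsum A (map (\<lambda>(x, f). x a \<odot> f) D') \<oplus> lsum A (map (\<lambda>(x, f). x b \<odot> f) D')" if "set D' \<subseteq> set D" for D'
        using that
      proof (induction D')
        case (Cons xf D')
        obtain x f where xf: "xf = (x, f)" by (cases xf)
        have c: "f \<in> carrier A" "x \<in> functionals A" using Cons xf fD by auto
        have l: "lsum A (map (\<lambda>(x, f). x a \<odot> f) D') \<in> carrier A" for a
          by (rule lsum_closed[OF A]) (use Cons fD in \<open>auto simp: smult_rules\<close>)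
        show ?case using Cons c l \<open>a \<in> carrier A\<close> \<open>b \<in> carrier A\<close>
          by (simp add: xf functional_add[OF c(2)] smult_rules A.M.add.m_ac)
      qed auto
      then show ?thesis unfolding E_def by simp
    qed
    have Esm: "E (d \<odot> a) = d \<odot> E a" if "a \<in> carrier A" for a d
    proof -
      have "lsum A (map (\<lambda>(x, f). x (d \<odot> a) \<odot> f) D') = d \<odot> lsum A (map (\<lambda>(x, f). x a \<odot> f) D')" if "set D' \<subseteq> set D" for D'
        using that
      proof (induction D')
        case (Cons xf D')
        obtain x f where xf: "xf = (x, f)" by (cases xf)
        have c: "f \<in> carrier A" "x \<in> functionals A" using Cons xf fD by auto
        have l: "lsum A (map (\<lambda>(x, f). x a \<odot> f) D') \<in> carrier A" for a
          by (rule lsum_closed[OF A]) (use Cons fD in \<open>auto simp: smult_rules\<close>)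
        show ?case using Cons c l \<open>a \<in> carrier A\<close>
          by (simp add: xf functional_smult[OF c(2)] smult_rules)
      qed (simp add: smult_rules)
      then show ?thesis unfolding E_def by simp
    qed
    have E0: "E n = \<zero>" if "n \<in> N" for n
    proof -
      have "lsum A (map (\<lambda>(x, f). x n \<odot> f) D') = \<zero>" if "set D' \<subseteq> set D" for D'
        using that by (induction D') (use DN \<open>n \<in> N\<close> fD in \<open>auto simp: smult_rules\<close>)
      then show ?thesis unfolding E_def by simp
    qed
    have uniq: "c = c'" if e: "E a \<oplus> (n \<oplus> c \<odot> s) = E a \<oplus> (n' \<oplus> c' \<odot> s)" and n: "n \<in> N" "n' \<in> N" for a n n' c c'
    proof (rule ccontr)
      assume ne: "c \<noteq> c'"
      have eq: "n \<oplus> c \<odot> s = n' \<oplus> c' \<odot> s"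
        using e Ec Nc n s by (simp add: smult_rules)
      have "(n \<oplus> c \<odot> s) \<oplus> ((- 1) \<odot> n \<oplus> (- c') \<odot> s) = (n' \<oplus> c' \<odot> s) \<oplus> ((- 1) \<odot> n \<oplus> (- c') \<odot> s)"
        by (simp only: eq)
      moreover have "(n \<oplus> c \<odot> s) \<oplus> ((- 1) \<odot> n \<oplus> (- c') \<odot> s) = (n \<oplus> (- 1) \<odot> n) \<oplus> (c \<odot> s \<oplus> (- c') \<odot> s)"
        using Nc n s by (simp add: smult_rules A.M.add.m_ac)
      moreover have "n \<oplus> (- 1) \<odot> n = \<zero>" using smult_rules(2)[of n 1 "- 1"] Nc[OF n(1)] by (simp add: smult_rules)
      moreover have "c \<odot> s \<oplus> (- c') \<odot> s = (c - c') \<odot> s" using smult_rules(2)[of s c "- c'"] s by simp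
      moreover have "(n' \<oplus> c' \<odot> s) \<oplus> ((- 1) \<odot> n \<oplus> (- c') \<odot> s) = (n' \<oplus> (- 1) \<odot> n) \<oplus> (c' \<odot> s \<oplus> (- c') \<odot> s)"
        using Nc n s by (simp add: smult_rules A.M.add.m_ac)
      moreover have "c' \<odot> s \<oplus> (- c') \<odot> s = \<zero>" using smult_rules(2)[of s c' "- c'"] s by (simp add: smult_rules)
      ultimately have *: "(c - c') \<odot> s = n' \<oplus> (- 1) \<odot> n" using Nc n s by (simp add: smult_rules)
      have "n' \<oplus> (- 1) \<odot> n \<in> N" using Cons(2) n by (simp add: subspace_def)
      then have "inverse (c - c') \<odot> ((c - c') \<odot> s) \<in> N" using * Cons(2) by (simp add: subspace_def)
      moreover have "inverse (c - c') \<odot> ((c - c') \<odot> s) = s" using ne s by (simp add: smult_rules)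
      ultimately show False using False by simp
    qed
    have ex: "\<exists>c. \<exists>n\<in>N. a = E a \<oplus> (n \<oplus> c \<odot> s)" if "a \<in> carrier A" for a
      using rep that unfolding E_def by blast
    define y where "y = (\<lambda>a. SOME c. \<exists>n\<in>N. a = E a \<oplus> (n \<oplus> c \<odot> s))"
    have y: "\<exists>n\<in>N. a = E a \<oplus> (n \<oplus> y a \<odot> s)" if "a \<in> carrier A" for a
      unfolding y_def using someI_ex[OF ex[OF that]] .
    have yI: "y a = c" if "a \<in> carrier A" "n \<in> N" "a = E a \<oplus> (n \<oplus> c \<odot> s)" for a n c
      using y[OF that(1)] uniq[of a _ "y a" n c] that by metis
    have yfun: "y \<in> functionals A" unfolding functionals_iff
    proof (intro conjI ballI allI)
      fix a b assume ab: "a \<in> carrier A" "b \<in> carrier A"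
      obtain n where n: "n \<in> N" "a = E a \<oplus> (n \<oplus> y a \<odot> s)" using y[OF ab(1)] by blast
      obtain m where m: "m \<in> N" "b = E b \<oplus> (m \<oplus> y b \<odot> s)" using y[OF ab(2)] by blast
      have "a \<oplus> b = (E a \<oplus> (n \<oplus> y a \<odot> s)) \<oplus> (E b \<oplus> (m \<oplus> y b \<odot> s))" using n(2) m(2) by simp
      also have "\<dots> = (E a \<oplus> E b) \<oplus> ((n \<oplus> m) \<oplus> (y a \<odot> s \<oplus> y b \<odot> s))"
        using Ec Nc n(1) m(1) s by (simp only: A.M.add.m_ac A.a_closed smult_rules(6))
      finally have "a \<oplus> b = E (a \<oplus> b) \<oplus> ((n \<oplus> m) \<oplus> (y a + y b) \<odot> s)"
        using Eadd[OF ab] s by (simp only: smult_rules(2))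
      then show "y (a \<oplus> b) = y a + y b"
        by (intro yI[where n = "n \<oplus> m"]) (use ab n(1) m(1) Cons(2) in \<open>auto simp: subspace_def\<close>)
    next
      fix d a assume a: "a \<in> carrier A"
      obtain n where n: "n \<in> N" "a = E a \<oplus> (n \<oplus> y a \<odot> s)" using y[OF a] by blast
      have "d \<odot> a = d \<odot> (E a \<oplus> (n \<oplus> y a \<odot> s))" using n(2) by simp
      also have "\<dots> = E (d \<odot> a) \<oplus> (d \<odot> n \<oplus> (d * y a) \<odot> s)"
        using Ec Nc n(1) s Esm[OF a] by (simp only: smult_rules A.a_closed)
      finally show "y (d \<odot> a) = d * y a"
        by (intro yI[where n = "d \<odot> n"]) (use a n(1) Cons(2) in \<open>auto simp: subspace_def smult_rules\<close>)
    qed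
    have yN: "y n = 0" if "n \<in> N" for n
      by (rule yI[OF Nc[OF that] that]) (use that E0 Nc s in \<open>simp add: smult_rules\<close>)
    show ?thesis
    proof (intro exI[where x = "(y, s) # D"] conjI ballI)
      show "case z of (x, f) \<Rightarrow> x \<in> functionals A \<and> (\<forall>n\<in>N. x n = 0) \<and> f \<in> set (s # S)" if "z \<in> set ((y, s) # D)" for z
        using that DN yfun yN by auto
      fix a assume a: "a \<in> carrier A"
      obtain n where n: "n \<in> N" "a = E a \<oplus> (n \<oplus> y a \<odot> s)" using y[OF a] by blast
      have "E a \<oplus> (n \<oplus> y a \<odot> s) = (y a \<odot> s \<oplus> E a) \<oplus> n"
        using Ec Nc n(1) s by (simp only: A.M.add.m_ac A.a_closed smult_rules(6))
      then have "a = lsum A (map (\<lambda>(x, f). x a \<odot> f) ((y, s) # D)) \<oplus> n" using n(2) by (simp add: E_def)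
      then show "\<exists>r\<in>N. a = lsum A (map (\<lambda>(x, f). x a \<odot> f) ((y, s) # D)) \<oplus> r" using n(1) by blast
    qed
  qed
qed

end

context algebraic_supergroup
begin

text \<open>For linearly independent \<open>f\<close>, dual homogeneous bases of the Lie superalgebra and of the cotangent space; the parity
  \<open>q\<close> is the common parity of \<open>x\<close> and \<open>f\<close>.\<close>

definition dual_basis :: "(bit \<times> ('a \<Rightarrow> 'k) \<times> 'a) list \<Rightarrow> bool" where
  "dual_basis D \<longleftrightarrow>
     (\<forall>(q, x, f)\<in>set D. f \<in> homog X q \<and> f \<in> aug \<and> x \<in> lie_space X \<and> x \<in> homog dual q) \<and>
     (\<forall>a\<in>aug. \<exists>r\<in>aug_pow 2. a = lsum X (map (\<lambda>(q, x, f). x a \<odot> f) D) \<oplus> r)"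

text \<open>If the \<open>s\<close> generate \<open>K[X]\<close>, the homogeneous components of the \<open>s - \<epsilon>(s)\<close> span the cotangent space: together
  with the constants and the square of the augmentation ideal they span a subspace that is closed under
  multiplication.\<close>

lemma finite_cotangent:
  "\<exists>S. set S \<subseteq> aug \<and> (\<forall>s\<in>set S. \<exists>i. s \<in> homog X i) \<and>
     carrier X \<subseteq> span_over X S {r \<oplus> c \<odot> \<one> | r c. r \<in> aug_pow 2}"
proof -
  obtain S0 where S0: "finite S0" "S0 \<subseteq> carrier X" "carrier X = generated_subalgebra X S0"
    using finitely_generated by blast
  define shift where "shift = (\<lambda>s. s \<oplus> (- counit X s) \<odot> \<one>)"
  define S1 where "S1 = (\<lambda>(i, s). component X i (shift s)) ` ((UNIV :: bit set) \<times> S0)"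
  \<comment> \<open>Generators are shifted to vanish at the identity and split by parity.\<close>
  have "finite S1" unfolding S1_def using S0(1) by (simp add: bit_UNIV)
  then obtain S where S: "set S = S1" using finite_list by blast
  have sh: "shift s \<in> aug" if "s \<in> carrier X" for s unfolding shift_def by (rule minus_counit_aug[OF that])
  have S1_elem: "s \<in> aug \<and> (\<exists>i. s \<in> homog X i)" if s: "s \<in> S1" for s
  proof -
    obtain i t where t: "t \<in> S0" "s = component X i (shift t)" using s unfolding S1_def by auto
    have "shift t \<in> aug" using sh t(1) S0(2) by auto
    then show ?thesis using component_aug component_in[of "shift t" i] t(2) by (auto simp: aug_iff)
  qed
  then have S1: "S1 \<subseteq> aug" "\<forall>s\<in>S1. \<exists>i. s \<in> homog X i" by auto
  let ?N = "{r \<oplus> c \<odot> \<one> | r c. r \<in> aug_pow 2}" 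
  define W where "W = span_over X S ?N"
  have N2: "subspace X (aug_pow 2)"
    unfolding subspace_def using aug_pow_closed aug_pow_zero aug_pow_add aug_pow_smult by blast
  have Sc: "set S \<subseteq> carrier X" using S S1(1) aug_iff by auto
  note W = span_over_props[OF module_A subspace_adjoin[OF module_A N2 one_closed] Sc, folded W_def]
  note adj = adjoin_contains[OF module_A N2 one_closed]
  have Wadd: "x \<oplus> y \<in> W" if "x \<in> W" "y \<in> W" for x y using W that by (simp add: subspace_def)
  have Wsm: "c \<odot> x \<in> W" if "x \<in> W" for c x using W that by (simp add: subspace_def)
  have Wc: "x \<in> carrier X" if "x \<in> W" for x using W that by (auto simp: subspace_def)
  have W1: "\<one> \<in> W" and W2: "aug_pow 2 \<subseteq> W" using W adj by blast+
  have "x \<in> W" if "x \<in> generated_subalgebra X S0" for x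
    using that
  proof (induction x rule: generated_subalgebra.induct)
    case (incl s)
    then have s: "s \<in> carrier X" "shift s \<in> carrier X" using S0(2) sh aug_iff by auto
    have "component X i (shift s) \<in> W" for i
    proof -
      have "component X i (shift s) \<in> S1"
        unfolding S1_def using incl by (intro image_eqI[where x = "(i, s)"]) auto
      then show ?thesis using W S by blast
    qed
    then have "component X 0 (shift s) \<oplus> component X 1 (shift s) \<in> W" by (intro Wadd)
    then have "shift s \<oplus> counit X s \<odot> \<one> \<in> W" using s by (simp add: component_decomp_01 Wadd Wsm W1)
    then show ?case using counit_decomp[OF s(1)] by (simp add: shift_def)
  next
    case (mult x y)
    have c: "x \<in> carrier X" "y \<in> carrier X" "shift x \<in> carrier X" "shift y \<in> carrier X"
      using mult Wc sh aug_iff by auto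
    have sW: "shift z \<in> W" if "z \<in> W" for z unfolding shift_def using that by (intro Wadd Wsm W1)
    have "x \<otimes> y = (shift x \<oplus> counit X x \<odot> \<one>) \<otimes> (shift y \<oplus> counit X y \<odot> \<one>)"
      using counit_decomp[OF c(1)] counit_decomp[OF c(2)] by (simp add: shift_def)
    also have "\<dots> = (shift x \<otimes> shift y \<oplus> counit X y \<odot> shift x) \<oplus> (counit X x \<odot> shift y \<oplus> (counit X x * counit X y) \<odot> \<one>)"
      by (rule mult_shifted[OF c(3,4)])
    also have "\<dots> \<in> W"
      using aug_mult_aug[OF sh[OF c(1)] sh[OF c(2)]] W2 sW mult by (intro Wadd Wsm W1) auto
    finally show ?case .
  qed (use W1 Wadd Wsm in auto)
  then show ?thesis using S S1 S0(3) unfolding W_def by (intro exI[where x = S]) auto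
qed

text \<open>Replacing each coordinate functional by its component of the parity of the corresponding vector amounts to
  projecting the even and the odd part of a vector separately.\<close>

lemma lsum_components:
  assumes D: "\<And>x f. (x, f) \<in> set D \<Longrightarrow> x \<in> functionals X \<and> f \<in> homog X (par (x, f))" and a: "a \<in> carrier X"
  shows "lsum X (map (\<lambda>(x, f). x (component X (par (x, f)) a) \<odot> f) D) =
    component X 0 (lsum X (map (\<lambda>(x, f). x (component X 0 a) \<odot> f) D)) \<oplus>
    component X 1 (lsum X (map (\<lambda>(x, f). x (component X 1 a) \<odot> f) D))"
  using D
proof (induction D)
  case Nil
  then show ?case by (simp add: component_homog[OF homog_zero, of _ 0])
next
  case (Cons xf D)
  obtain x f where xf: "xf = (x, f)" by (cases xf)
  have x: "x \<in> functionals X" and f: "f \<in> homog X (par (x, f))" using Cons(2) xf by auto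
  have fc: "f \<in> carrier X" using f homog_closed by auto
  have Dc: "f \<in> carrier X" if "(x, f) \<in> set D" for x f
    using Cons(2)[of x f] that homog_closed by auto
  have l: "lsum X (map (\<lambda>(x, f). c x f \<odot> f) D) \<in> carrier X" for c
    by (rule lsum_closed[OF module_A]) (use Dc in auto)
  have cf: "component X i (x b \<odot> f) = (if i = par (x, f) then x b \<odot> f else \<zero>)" for b i
    by (rule component_homog[OF homog_smult[OF f]])
  have IH: "lsum X (map (\<lambda>(x, f). x (component X (par (x, f)) a) \<odot> f) D) =
    component X 0 (lsum X (map (\<lambda>(x, f). x (component X 0 a) \<odot> f) D)) \<oplus>
    component X 1 (lsum X (map (\<lambda>(x, f). x (component X 1 a) \<odot> f) D))" using Cons by auto
  show ?case
    using l[of "\<lambda>x f. x (component X 0 a)"] l[of "\<lambda>x f. x (component X 1 a)"] fc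
    by (cases "par (x, f)") (simp_all add: xf IH component_add cf a_ac)
qed

lemma dual_basis_exists: "\<exists>D. dual_basis D"
proof -
  let ?N = "{r \<oplus> c \<odot> \<one> | r c. r \<in> aug_pow 2}"
  obtain S where S: "set S \<subseteq> aug" "\<forall>s\<in>set S. \<exists>i. s \<in> homog X i" "carrier X \<subseteq> span_over X S ?N"
    using finite_cotangent by blast
  have N2: "subspace X (aug_pow 2)"
    unfolding subspace_def using aug_pow_closed aug_pow_zero aug_pow_add aug_pow_smult by blast
  note N = subspace_adjoin[OF module_A N2 one_closed] and adj = adjoin_contains[OF module_A N2 one_closed]
  have Sc: "set S \<subseteq> carrier X" using S aug_iff by auto
  obtain D0 where D0: "\<forall>(x, f)\<in>set D0. x \<in> functionals X \<and> (\<forall>n\<in>?N. x n = 0) \<and> f \<in> set S"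
    and rep: "\<forall>a\<in>carrier X. \<exists>r\<in>?N. a = lsum X (map (\<lambda>(x, f). x a \<odot> f) D0) \<oplus> r"
    using coordinates_modulo[OF module_A N Sc S(3)] by blast
  define par where "par = (\<lambda>(x::'a \<Rightarrow> 'k, f). SOME i. f \<in> homog X i)"
  have par: "f \<in> homog X (par (x, f))" if "(x, f) \<in> set D0" for x f
    unfolding par_def using S(2) D0 that someI_ex[of "\<lambda>i. f \<in> homog X i"] by fastforce
  define D where "D = map (\<lambda>(x, f). (par (x, f), component dual (par (x, f)) (restrict x (carrier X)), f)) D0"
  have entry: "f \<in> homog X q \<and> f \<in> aug \<and> x \<in> lie_space X \<and> x \<in> homog dual q" if "(q, x, f) \<in> set D" for q x f
  proof -
    obtain x0 where x0: "(x0, f) \<in> set D0" "q = par (x0, f)" "x = component dual q (restrict x0 (carrier X))"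
      using \<open>(q, x, f) \<in> set D\<close> unfolding D_def by auto
    have xf: "x0 \<in> functionals X" "\<forall>n\<in>?N. x0 n = 0" "f \<in> set S"
      using bspec[OF D0 x0(1), unfolded prod.case] by blast+
    have d: "restrict x0 (carrier X) \<in> Dual" by (rule restrict_Dual[OF xf(1)])
    have "restrict x0 (carrier X) \<in> lie_space X"
      unfolding lie_space_iff
    proof (intro conjI ballI d)
      show "restrict x0 (carrier X) g = 0" if "g \<in> aug_pow 2" for g
        using bspec[OF xf(2) subsetD[OF adj(1) that]] aug_pow_closed[OF that] by simp
      show "restrict x0 (carrier X) \<one> = 0" using bspec[OF xf(2) adj(2)] by simp
    qed
    then have "x \<in> lie_space X" unfolding x0(3) by (rule lie_space_closed(3))
    then show ?thesis using x0 par xf(3) S(1) DS.component_in[OF d] by auto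
  qed
  have expand: "\<exists>r\<in>aug_pow 2. a = lsum X (map (\<lambda>(q, x, f). x a \<odot> f) D) \<oplus> r" if a: "a \<in> aug" for a
  proof -
    have ac: "a \<in> carrier X" using a aug_iff by auto
    have f0: "x \<in> functionals X" "f \<in> carrier X" "f \<in> aug" if "(x, f) \<in> set D0" for x f
      using D0 that S(1) aug_iff by auto
    have L: "lsum X (map (\<lambda>(x, f). x b \<odot> f) D0) \<in> carrier X" for b
      by (rule lsum_closed[OF module_A]) (use f0 in auto)
    have r: "\<exists>r\<in>aug_pow 2. b = lsum X (map (\<lambda>(x, f). x b \<odot> f) D0) \<oplus> r" if b: "b \<in> aug" for b
    proof -
      obtain r c where rc: "r \<in> aug_pow 2" "b = lsum X (map (\<lambda>(x, f). x b \<odot> f) D0) \<oplus> (r \<oplus> c \<odot> \<one>)"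
        using rep b aug_iff by blast
      have "counit X (lsum X (map (\<lambda>(x, f). x b \<odot> f) D0)) = 0"
      proof -
        have "counit X (lsum X (map (\<lambda>(x, f). x b \<odot> f) D0)) = sum_list (map (counit X) (map (\<lambda>(x, f). x b \<odot> f) D0))"
          by (rule functional_lsum[OF module_A counit_functional]) (use f0 in auto)
        also have "map (counit X) (map (\<lambda>(x, f). x b \<odot> f) D0) = map (\<lambda>_. 0) D0"
          using f0 by (auto simp: functional_smult[OF counit_functional] aug_iff)
        finally show ?thesis by simp
      qed
      moreover have "counit X r = 0"
        using rc(1) aug_pow_Suc_subset[of r 1] aug_pow_1 aug_iff by (auto simp: numeral_2_eq_2 simp del: ideal_pow.simps)
      moreover have "counit X b = counit X (lsum X (map (\<lambda>(x, f). x b \<odot> f) D0)) + (counit X r + c)"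
        using arg_cong[OF rc(2), of "counit X"] L aug_pow_closed[OF rc(1)]
        by (simp add: functional_add[OF counit_functional] functional_smult[OF counit_functional])
      ultimately have "c = 0" using b aug_iff by simp
      then show ?thesis using rc aug_pow_closed[OF rc(1)] by auto
    qed
    obtain r0 where r0: "r0 \<in> aug_pow 2" "component X 0 a = lsum X (map (\<lambda>(x, f). x (component X 0 a) \<odot> f) D0) \<oplus> r0"
      using r[OF component_aug[OF a, of 0]] by blast
    obtain r1 where r1: "r1 \<in> aug_pow 2" "component X 1 a = lsum X (map (\<lambda>(x, f). x (component X 1 a) \<odot> f) D0) \<oplus> r1"
      using r[OF component_aug[OF a, of 1]] by blast
    have rc: "r0 \<in> carrier X" "r1 \<in> carrier X" using r0 r1 aug_pow_closed by auto
    let ?L = "\<lambda>i. lsum X (map (\<lambda>(x, f). x (component X i a) \<odot> f) D0)"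
    have c0: "component X 0 a = component X 0 (?L 0) \<oplus> component X 0 r0"
      using arg_cong[OF r0(2), of "component X 0"] component_homog[OF component_in[OF ac, of 0], of 0] L rc
      by (simp add: component_add)
    have c1: "component X 1 a = component X 1 (?L 1) \<oplus> component X 1 r1"
      using arg_cong[OF r1(2), of "component X 1"] component_homog[OF component_in[OF ac, of 1], of 1] L rc
      by (simp add: component_add)
    have "a = component X 0 a \<oplus> component X 1 a" using component_decomp_01[OF ac] by simp
    also have "\<dots> = (component X 0 (?L 0) \<oplus> component X 0 r0) \<oplus> (component X 1 (?L 1) \<oplus> component X 1 r1)"
      by (subst c0, subst c1) (rule refl)
    also have "\<dots> = (component X 0 (?L 0) \<oplus> component X 1 (?L 1)) \<oplus> (component X 0 r0 \<oplus> component X 1 r1)"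
      using L rc by (simp add: a_ac)
    also have "component X 0 (?L 0) \<oplus> component X 1 (?L 1) = lsum X (map (\<lambda>(x, f). x (component X (par (x, f)) a) \<odot> f) D0)"
      by (rule lsum_components[symmetric]) (use f0 par ac in auto)
    also have "\<dots> = lsum X (map (\<lambda>(q, x, f). x a \<odot> f) D)"
    proof -
      have "component dual (par (x, f)) (restrict x (carrier X)) a = x (component X (par (x, f)) a)"
        if "(x, f) \<in> set D0" for x f
        using component_dual[OF restrict_Dual[OF f0(1)[OF that]]] ac by simp
      then have "map (\<lambda>(x, f). x (component X (par (x, f)) a) \<odot> f) D0 = map (\<lambda>(q, x, f). x a \<odot> f) D"
        unfolding D_def by auto
      then show ?thesis by simp
    qed
    finally show ?thesis using aug_pow_add[OF component_aug_pow[OF r0(1), of 0] component_aug_pow[OF r1(1), of 1]] by blast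
  qed
  show ?thesis unfolding dual_basis_def using entry expand by (intro exI[where x = D]) auto
qed

end

section \<open>Distributions are combinations of products of primitive functionals\<close>

context algebraic_supergroup
begin

lemma dual_basisD:
  assumes "dual_basis D" "(q, x, f) \<in> set D"
  shows "f \<in> homog X q" "f \<in> aug" "x \<in> lie_space X" "x \<in> homog dual q" "x \<in> Dual"
    "f \<in> carrier X" "primitive x"
  using assms lie_space_iff lie_space_primitive by (auto simp: dual_basis_def homog_closed)

text \<open>Modulo the square of the augmentation ideal, the basis elements have the functionals as coordinates.\<close>

lemma dual_basis_expand:
  assumes D: "dual_basis D" and a: "a \<in> aug" and phi: "\<phi> \<in> functionals X" and v: "\<And>r. r \<in> aug_pow 2 \<Longrightarrow> \<phi> r = 0"
  shows "\<phi> a = (\<Sum>(q, x, f)\<leftarrow>D. x a * \<phi> f)"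
proof -
  obtain r where r: "r \<in> aug_pow 2" "a = lsum X (map (\<lambda>(q, x, f). x a \<odot> f) D) \<oplus> r"
    using D a unfolding dual_basis_def by blast
  have c: "set (map (\<lambda>(q, x, f). x a \<odot> f) D) \<subseteq> carrier X" using dual_basisD(6)[OF D] by auto
  have "\<phi> a = \<phi> (lsum X (map (\<lambda>(q, x, f). x a \<odot> f) D)) + \<phi> r"
    using arg_cong[OF r(2), of \<phi>] functional_add[OF phi lsum_closed[OF module_A c] aug_pow_closed[OF r(1)]] by simp
  also have "\<dots> = (\<Sum>(q, x, f)\<leftarrow>D. x a * \<phi> f)"
    unfolding functional_lsum[OF module_A phi c]
    using v[OF r(1)] dual_basisD(6)[OF D] by (auto simp: functional_smult[OF phi] intro!: sum_list_cong)
  finally show ?thesis .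
qed

lemma dual_basis_lie:
  assumes D: "dual_basis D" and y: "y \<in> lie_space X" and a: "a \<in> carrier X"
  shows "y a = (\<Sum>(q, x, f)\<leftarrow>D. y f * x a)"
proof -
  let ?a = "a \<oplus> (- counit X a) \<odot> \<one>"
  have l: "z ?a = z a" if "z \<in> lie_space X" for z
    using minus_counit_split[of z a] that a DualD by (auto simp: lie_space_iff)
  have "y a = (\<Sum>(q, x, f)\<leftarrow>D. x ?a * y f)"
    using dual_basis_expand[OF D minus_counit_aug[OF a], of y] y l[OF y] DualD by (auto simp: lie_space_iff)
  also have "\<dots> = (\<Sum>(q, x, f)\<leftarrow>D. y f * x a)"
    by (rule sum_list_cong) (use l dual_basisD(3)[OF D] in auto)
  finally show ?thesis .
qed

lemma translate_right_vanish:
  assumes "\<psi> \<in> Dual" "\<And>r. r \<in> aug_pow (Suc k) \<Longrightarrow> \<psi> r = 0" "f \<in> aug" "r \<in> aug_pow k"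
  shows "translate_right \<psi> f r = 0"
  using assms aug_pow_mult_aug[OF assms(4,3)] aug_pow_closed[OF assms(4)] by (simp add: translate_apply del: ideal_pow.simps)

text \<open>The operator \<open>\<phi> \<mapsto> \<Sum> x\<^sub>j (\<phi>(\<sqdot> f\<^sub>j))\<close> is dual to the Euler vector field \<open>\<Sum> f\<^sub>j D\<^sub>x\<^sub>j\<close>,
  a derivation that is the identity on the cotangent space and therefore multiplication by \<open>k\<close> on
  the quotient of the \<open>k\<close>-th by the next power of the augmentation ideal.\<close>

lemma euler:
  assumes D: "dual_basis D" and phi: "\<phi> \<in> Dual" and v: "\<And>f. f \<in> aug_pow (Suc k) \<Longrightarrow> \<phi> f = 0" and F: "F \<in> aug_pow k"
  shows "(\<Sum>(q, x, f)\<leftarrow>D. (x \<star> translate_right \<phi> f) F) = of_nat k * \<phi> F"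
  using phi v F
proof (induction k arbitrary: \<phi> F)
  case 0
  have Fc: "F \<in> carrier X" using 0 by simp
  have "(\<Sum>(q, x, f)\<leftarrow>D. (x \<star> translate_right \<phi> f) F) = (\<Sum>(q, x, f)\<leftarrow>D. 0)"
  proof (rule sum_list_cong, clarify)
    fix q x f assume "(q, x, f) \<in> set D"
    note d = dual_basisD[OF D this]
    show "(x \<star> translate_right \<phi> f) F = 0"
      by (rule conv_zero(1)[OF d(5) translate_Dual(1)[OF 0(1) d(6)] _ Fc])
        (rule translate_right_vanish[where k = 0, OF 0(1,2) d(2)], simp_all)
  qed
  then show ?case by (simp add: case_prod_unfold)
next
  case (Suc k)
  have cd: "(x \<star> translate_right \<phi> f) \<in> functionals X" if "(q, x, f) \<in> set D" for q x f
    using dual_basisD[OF D that] Suc(2) by (intro DualD conv_Dual translate_Dual)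
  from Suc(4) show ?case
  proof (induction F rule: aug_pow_Suc_induct)
    case (add F G)
    have "(\<Sum>(q, x, f)\<leftarrow>D. (x \<star> translate_right \<phi> f) (F \<oplus> G)) =
        (\<Sum>(q, x, f)\<leftarrow>D. (x \<star> translate_right \<phi> f) F + (x \<star> translate_right \<phi> f) G)"
      by (rule sum_list_cong) (use functional_add[OF cd add(1,2)] in auto)
    then show ?case using add functional_add[OF DualD[OF Suc(2)] add(1,2)]
      by (simp add: case_prod_unfold sum_list_addf algebra_simps)
  next
    case (mult g m i j)
    have c: "g \<in> carrier X" "m \<in> carrier X" using mult aug_pow_closed by (auto simp: aug_iff)
    have "(\<Sum>(q, x, f)\<leftarrow>D. (x \<star> translate_right \<phi> f) (g \<otimes> m)) =
        (\<Sum>(q, x, f)\<leftarrow>D. (x \<star> translate_right (translate_right \<phi> m) f) g + x m * translate_left g \<phi> f)"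
    proof (rule sum_list_cong, clarify)
      fix q x f assume "(q, x, f) \<in> set D"
      note d = dual_basisD[OF D this]
      note tr = translate_Dual(1)[OF Suc(2) d(6)]
      have "translate_right (translate_right \<phi> f) m =
          koszul q j \<odot>\<^bsub>dual\<^esub> translate_right (translate_right \<phi> m) f"
      proof (rule Dual_eqI_carrier)
        fix a assume a: "a \<in> carrier X"
        have "(a \<otimes> m) \<otimes> f = koszul q j \<odot> ((a \<otimes> f) \<otimes> m)"
          using a c d(6) supercommutative[OF mult(4) d(1)] by (simp add: m_assoc smult_mult_right koszul_sym)
        then show "translate_right (translate_right \<phi> f) m a =
            (koszul q j \<odot>\<^bsub>dual\<^esub> translate_right (translate_right \<phi> m) f) a"
          using a c d(6) by (simp add: translate_apply dual_smult_apply functional_smult[OF DualD[OF Suc(2)]])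
      qed (use d c Suc(2) in \<open>auto intro!: translate_Dual dual_closed\<close>)
      then have "twist j x \<star> translate_right (translate_right \<phi> f) m = x \<star> translate_right (translate_right \<phi> m) f"
        unfolding twist_of_homog[OF d(4)] using d c Suc(2)
        by (simp add: conv_linear(3,4) translate_Dual dual_closed DS.scale_scale conv_Dual)
      moreover have "(x \<star> translate_left g (translate_right \<phi> f)) m = translate_left g (translate_right \<phi> f) \<one> * x m"
      proof (rule conv_vanish_aug[OF d(5) translate_Dual(2)[OF tr c(1)] _ c(2)])
        fix b assume b: "b \<in> aug"
        have "(g \<otimes> b) \<otimes> f \<in> aug_pow (Suc (Suc k))" by (intro aug_pow_mult_aug mult b d)
        then show "translate_left g (translate_right \<phi> f) b = 0"
          using b c d(6) Suc(3) by (simp add: translate_apply aug_iff del: ideal_pow.simps)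
      qed
      ultimately show "(x \<star> translate_right \<phi> f) (g \<otimes> m) =
          (x \<star> translate_right (translate_right \<phi> m) f) g + x m * translate_left g \<phi> f"
        using conv_derivation[OF d(7) tr mult(4) c(1)] c d(6) by (simp add: translate_apply)
    qed
    also have "\<dots> = (\<Sum>(q, x, f)\<leftarrow>D. (x \<star> translate_right (translate_right \<phi> m) f) g) + (\<Sum>(q, x, f)\<leftarrow>D. x m * translate_left g \<phi> f)"
      by (simp add: case_prod_unfold sum_list_addf)
    also have "(\<Sum>(q, x, f)\<leftarrow>D. (x \<star> translate_right (translate_right \<phi> m) f) g) = of_nat k * translate_right \<phi> m g"
      by (rule Suc.IH[OF translate_Dual(1)[OF Suc(2) c(2)] translate_right_vanish[OF Suc(2,3) mult(3)] mult(1)])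
    also have "(\<Sum>(q, x, f)\<leftarrow>D. x m * translate_left g \<phi> f) = translate_left g \<phi> m"
    proof (rule dual_basis_expand[OF D mult(3) DualD[OF translate_Dual(2)[OF Suc(2) c(1)]], symmetric])
      fix r assume r: "r \<in> aug_pow 2"
      then have "g \<otimes> r \<in> aug_pow (k + 2)" using aug_pow_mult_pow[OF mult(1)] by blast
      then show "translate_left g \<phi> r = 0"
        using Suc(3) r aug_pow_closed by (simp add: translate_apply del: ideal_pow.simps)
    qed
    finally show ?case using c by (simp add: translate_apply algebra_simps)
  qed
qed

subsection \<open>Evaluation of the free algebra\<close>

abbreviation free_carrier where "free_carrier \<equiv> carrier (ue_free (Lie X))"

lemma Lie_simps: "carrier (Lie X) = lie_space X" "add (Lie X) = add dual"
  "zero (Lie X) = zero dual" "smult (Lie X) = smult dual"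
  "homog (Lie X) i = lie_space X \<inter> homog dual i"
  "bracket (Lie X) = supercommutator (dist_alg X)"
  by (auto simp: Lie_def superspace.defs lie_superalg.defs)

lemma free_carrier_iff: "p \<in> free_carrier \<longleftrightarrow> (\<forall>w\<in>keys p. set (letters w) \<subseteq> lie_space X)"
  by (simp add: ue_free_def Lie_simps)

lemma free_carrier_keys: "free_carrier = {p. keys p \<subseteq> {w. set (letters w) \<subseteq> lie_space X}}"
  unfolding set_eq_iff mem_Collect_eq free_carrier_iff by blast

definition word_product :: "('a \<Rightarrow> 'k) list \<Rightarrow> 'a \<Rightarrow> 'k" where
  "word_product ws = foldr (\<lambda>x \<phi>. x \<star> \<phi>) ws unit_dual"

lemma word_product_simps [simp]: "word_product [] = unit_dual" "word_product (x # ws) = x \<star> word_product ws"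
  by (simp_all add: word_product_def)

lemma word_product_Dual: "set ws \<subseteq> lie_space X \<Longrightarrow> word_product ws \<in> Dual"
  by (induction ws) (auto intro!: conv_Dual unit_dual simp: lie_space_iff)

lemma word_product_append:
  "set us \<subseteq> lie_space X \<Longrightarrow> set ws \<subseteq> lie_space X \<Longrightarrow> word_product (us @ ws) = word_product us \<star> word_product ws"
  by (induction us) (auto simp: conv_unit word_product_Dual conv_assoc lie_space_iff)

lemma word_product_vanish:
  "set ws \<subseteq> lie_space X \<Longrightarrow> f \<in> aug_pow (Suc (length ws)) \<Longrightarrow> word_product ws f = 0"
proof (induction ws arbitrary: f)
  case Nil
  then show ?case using aug_pow_1 by (simp add: aug_iff del: ideal_pow.simps)
next
  case (Cons x ws)
  show ?case unfolding word_product_simps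
    by (rule conv_vanish[OF _ word_product_Dual, of _ _ "Suc (length ws)"])
      (use Cons lie_space_primitive in \<open>auto simp del: ideal_pow.simps\<close>)
qed

definition eval_free :: "(('a \<Rightarrow> 'k) free_monoid \<Rightarrow>\<^sub>0 'k) \<Rightarrow> 'a \<Rightarrow> 'k" where
  "eval_free p = linear_extension dual (\<lambda>w. word_product (letters w)) p"

lemma word_closed: "p \<in> free_carrier \<Longrightarrow> k \<in> keys p \<Longrightarrow> word_product (letters k) \<in> Dual"
  by (auto simp: free_carrier_iff intro: word_product_Dual)

lemma eval_free_Dual: "p \<in> free_carrier \<Longrightarrow> eval_free p \<in> Dual"
  unfolding eval_free_def by (rule linear_extension_closed[OF dual_module]) (rule word_closed)

lemma eval_free_add: "p \<in> free_carrier \<Longrightarrow> q \<in> free_carrier \<Longrightarrow>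
    eval_free (p + q) = eval_free p \<oplus>\<^bsub>dual\<^esub> eval_free q"
  unfolding eval_free_def by (rule linear_extension_add[OF dual_module]) (auto intro: word_closed)

lemma eval_free_scale: "p \<in> free_carrier \<Longrightarrow> eval_free (pm_scale c p) = c \<odot>\<^bsub>dual\<^esub> eval_free p"
  unfolding eval_free_def by (rule linear_extension_scale[OF dual_module]) (rule word_closed)

lemma eval_free_single: "set w \<subseteq> lie_space X \<Longrightarrow>
    eval_free (single (Word w) c) = c \<odot>\<^bsub>dual\<^esub> word_product w"
  unfolding eval_free_def by (subst linear_extension_single[OF dual_module]) (auto intro: word_product_Dual)

lemma free_add: "p \<in> free_carrier \<Longrightarrow> q \<in> free_carrier \<Longrightarrow> p + q \<in> free_carrier"
  using keys_add[of p q] by (auto simp: free_carrier_iff)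

lemma free_scale: "p \<in> free_carrier \<Longrightarrow> pm_scale c p \<in> free_carrier"
  using keys_pm_scale[of c p] by (auto simp: free_carrier_iff)

lemma free_single: "set w \<subseteq> lie_space X \<Longrightarrow> single (Word w) c \<in> free_carrier"
  by (auto simp: free_carrier_iff)

lemma free_zero: "0 \<in> free_carrier" by (simp add: free_carrier_iff)

lemma free_one: "1 \<in> free_carrier" by (simp add: free_carrier_iff zero_free_monoid_def)

lemma free_mult: "p \<in> free_carrier \<Longrightarrow> q \<in> free_carrier \<Longrightarrow> p * q \<in> free_carrier"
  unfolding free_carrier_iff using keys_mult[of p q] by (fastforce simp: plus_free_monoid_def)

lemma free_letter: "x \<in> lie_space X \<Longrightarrow> letter x \<in> free_carrier"
  by (simp add: letter_def free_single)

lemma free_uminus: "p \<in> free_carrier \<Longrightarrow> - p \<in> free_carrier"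
  using free_scale[of p "- 1"] by (simp add: pm_scale_minus_one)

lemma free_diff: "p \<in> free_carrier \<Longrightarrow> q \<in> free_carrier \<Longrightarrow> p - q \<in> free_carrier"
  using free_add[of p "- q"] free_uminus by simp

lemma free_induct [consumes 1, case_names zero single add]:
  assumes "p \<in> free_carrier" "P 0" "\<And>w c. set w \<subseteq> lie_space X \<Longrightarrow> P (single (Word w) c)"
    "\<And>p q. p \<in> free_carrier \<Longrightarrow> q \<in> free_carrier \<Longrightarrow> P p \<Longrightarrow> P q \<Longrightarrow> P (p + q)"
  shows "P p"
proof (rule pm_induct[of p "{w. set (letters w) \<subseteq> lie_space X}"])
  show "keys p \<subseteq> {w. set (letters w) \<subseteq> lie_space X}" using assms(1) free_carrier_keys by auto
  show "P (single k c)" if "k \<in> {w. set (letters w) \<subseteq> lie_space X}" for k c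
    using that assms(3)[of "letters k" c] by simp
qed (use assms free_carrier_keys in auto)

lemma eval_free_zero: "eval_free 0 = \<zero>\<^bsub>dual\<^esub>"
  by (simp add: eval_free_def linear_extension_def)

lemma single_word_mult: "single (Word u) c * single (Word w) d = single (Word (u @ w)) (c * d)"
  by (simp add: mult_single plus_free_monoid_def)

lemma eval_free_mult:
  assumes "p \<in> free_carrier" "q \<in> free_carrier" shows "eval_free (p * q) = eval_free p \<star> eval_free q"
  using assms
proof (induction p rule: free_induct)
  case zero
  have "eval_free 0 \<star> eval_free q = \<zero>\<^bsub>dual\<^esub>"
    using conv_zero(2)[OF eval_free_Dual[OF zero] dual_closed(3)] conv_Dual[OF dual_closed(3) eval_free_Dual[OF zero]]
    by (intro Dual_eqI_carrier) (auto simp: eval_free_zero dual_zero_apply dual_closed(3))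
  then show ?case by (simp add: eval_free_zero)
next
  case (add p p')
  then show ?case
    by (simp add: distrib_right eval_free_add free_mult conv_linear(1) eval_free_Dual)
next
  case (single u c)
  from single(2) show ?case
  proof (induction q rule: free_induct)
    case zero
    have s: "single (Word u) c \<in> free_carrier" using single free_single by auto
    have "eval_free (single (Word u) c) \<star> eval_free 0 = \<zero>\<^bsub>dual\<^esub>"
      using conv_zero(1)[OF eval_free_Dual[OF s] dual_closed(3)] conv_Dual[OF eval_free_Dual[OF s] dual_closed(3)]
      by (intro Dual_eqI_carrier) (auto simp: eval_free_zero dual_zero_apply dual_closed(3))
    then show ?case by (simp add: eval_free_zero)
  next
    case (add p p')
    then show ?case using single(1)
      by (simp add: distrib_left eval_free_add free_mult free_single conv_linear(2) eval_free_Dual)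
  next
    case (single w d)
    then show ?case using \<open>set u \<subseteq> lie_space X\<close>
      by (simp add: single_word_mult eval_free_single word_product_append conv_linear(3,4) word_product_Dual
          dual_closed conv_Dual DS.scale_scale mult.commute)
  qed
qed

lemma eval_free_letter: "x \<in> lie_space X \<Longrightarrow> eval_free (letter x) = x"
  unfolding letter_def by (subst eval_free_single) (auto simp: conv_unit lie_space_iff)

lemma eval_free_one: "eval_free 1 = unit_dual"
proof -
  have "(1 :: ('a \<Rightarrow> 'k) free_monoid \<Rightarrow>\<^sub>0 'k) = single (Word []) 1"
    by (simp flip: single_one zero_free_monoid_def)
  then show ?thesis using eval_free_single[of "[]" 1] unit_dual by simp
qed

definition free_filt :: "nat \<Rightarrow> (('a \<Rightarrow> 'k) free_monoid \<Rightarrow>\<^sub>0 'k) set" where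
  "free_filt k = {p \<in> free_carrier. \<forall>w\<in>keys p. length (letters w) \<le> k}"

lemma free_filt_add: "p \<in> free_filt k \<Longrightarrow> q \<in> free_filt k \<Longrightarrow> p + q \<in> free_filt k"
  unfolding free_filt_def using keys_add[of p q] free_add by blast

lemma free_filt_scale: "p \<in> free_filt k \<Longrightarrow> pm_scale c p \<in> free_filt k"
  unfolding free_filt_def using keys_pm_scale[of c p] free_scale by blast

lemma free_filt_carrier: "p \<in> free_filt k \<Longrightarrow> p \<in> free_carrier" by (simp add: free_filt_def)

lemma free_filt_mono: "p \<in> free_filt k \<Longrightarrow> k \<le> l \<Longrightarrow> p \<in> free_filt l" by (auto simp: free_filt_def)

lemma free_filt_single: "set w \<subseteq> lie_space X \<Longrightarrow> length w \<le> k \<Longrightarrow> single (Word w) c \<in> free_filt k"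
  by (auto simp: free_filt_def free_single)

lemma free_filt_mult: "p \<in> free_filt k \<Longrightarrow> q \<in> free_filt l \<Longrightarrow> p * q \<in> free_filt (k + l)"
  unfolding free_filt_def using keys_mult[of p q] free_mult by (fastforce simp: plus_free_monoid_def intro: add_mono)

lemma free_filt_letter: "x \<in> lie_space X \<Longrightarrow> letter x \<in> free_filt 1"
  by (simp add: letter_def free_filt_single)

lemma free_filt_zero: "0 \<in> free_filt k" by (simp add: free_filt_def free_zero)

lemma free_filt_induct [consumes 1, case_names zero single add]:
  assumes "p \<in> free_filt k" "P 0" "\<And>w c. set w \<subseteq> lie_space X \<Longrightarrow> length w \<le> k \<Longrightarrow> P (single (Word w) c)"
    "\<And>p q. p \<in> free_filt k \<Longrightarrow> q \<in> free_filt k \<Longrightarrow> P p \<Longrightarrow> P q \<Longrightarrow> P (p + q)"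
  shows "P p"
proof (rule pm_induct[of p "{w. set (letters w) \<subseteq> lie_space X \<and> length (letters w) \<le> k}"])
  show "keys p \<subseteq> {w. set (letters w) \<subseteq> lie_space X \<and> length (letters w) \<le> k}"
    using assms(1) by (auto simp: free_filt_def free_carrier_iff)
  show "P (single l c)" if "l \<in> {w. set (letters w) \<subseteq> lie_space X \<and> length (letters w) \<le> k}" for l c
    using that assms(3)[of "letters l" c] by simp
  show "P (p + q)" if "keys p \<subseteq> {w. set (letters w) \<subseteq> lie_space X \<and> length (letters w) \<le> k}"
    "keys q \<subseteq> {w. set (letters w) \<subseteq> lie_space X \<and> length (letters w) \<le> k}" "P p" "P q" for p q
    using that by (intro assms(4)) (auto simp: free_filt_def free_carrier_iff)
qed (use assms in auto)

lemma dist_filt_mono_le: "m \<le> n \<Longrightarrow> \<phi> \<in> dist_filt X m \<Longrightarrow> \<phi> \<in> dist_filt X n"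
  by (induction rule: dec_induct) (auto intro: dist_filt_mono)

lemma eval_free_dist_filt: "p \<in> free_filt n \<Longrightarrow> eval_free p \<in> dist_filt X n"
proof (induction p rule: free_filt_induct)
  case zero
  then show ?case unfolding dist_filt_iff eval_free_zero using dual_closed(3) dual_zero_apply aug_pow_closed by blast
next
  case (add p q)
  then show ?case by (simp add: eval_free_add free_filt_carrier dist_filt_closed)
next
  case (single w c)
  have "word_product w \<in> dist_filt X (length w)"
    unfolding dist_filt_iff using word_product_Dual[OF single(1)] word_product_vanish[OF single(1)] by blast
  then have "word_product w \<in> dist_filt X n"
    using dist_filt_mono_le single(2) by blast
  then show ?case by (simp add: eval_free_single single dist_filt_closed)
qed

end

locale char_zero_supergroup = algebraic_supergroup X
  for X :: "('k::field, 'a, 'm) hopf_superalg_scheme" (structure) +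
  assumes char_zero: "of_nat (Suc n) \<noteq> (0 :: 'k)"
begin

text \<open>Apply the Euler operator: by induction \<open>E(\<phi>)\<close> is a combination of words, and subtracting
  \<open>E(\<phi>) / (n + 1)\<close> from \<open>\<phi>\<close> lowers the order.\<close>

lemma dist_filt_generated:
  assumes "\<phi> \<in> dist_filt X n" shows "\<exists>p\<in>free_filt n. eval_free p = \<phi>"
  using assms
proof (induction n arbitrary: \<phi>)
  case 0
  then have phi: "\<phi> \<in> Dual" "\<And>f. f \<in> aug \<Longrightarrow> \<phi> f = 0" using aug_pow_1 by (auto simp: dist_filt_iff simp del: ideal_pow.simps)
  have "eval_free (single (Word []) (\<phi> \<one>)) = \<phi>"
  proof (rule Dual_eqI_carrier[OF eval_free_Dual[OF free_single] phi(1)])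
    fix a assume a: "a \<in> carrier X"
    show "eval_free (single (Word []) (\<phi> \<one>)) a = \<phi> a"
      using minus_counit_split[OF DualD[OF phi(1)] a] phi(2)[OF minus_counit_aug[OF a]] a
      by (subst eval_free_single) (auto simp: dual_smult_apply)
  qed simp
  then show ?case using free_filt_single[of "[]" 0] by (intro bexI) auto
next
  case (Suc n)
  obtain D where D: "dual_basis D" using dual_basis_exists by blast
  have phi: "\<phi> \<in> Dual" "\<And>f. f \<in> aug_pow (Suc (Suc n)) \<Longrightarrow> \<phi> f = 0"
    using Suc(2) unfolding dist_filt_iff by blast+
  have "\<exists>p\<in>free_filt (Suc n). \<forall>a\<in>carrier X. eval_free p a = (\<Sum>(q, x, f)\<leftarrow>E. (x \<star> translate_right \<phi> f) a)"
    if "set E \<subseteq> set D" for E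
    using that
  proof (induction E)
    case Nil
    then show ?case using free_filt_zero by (intro bexI[where x = 0]) (auto simp: eval_free_zero dual_zero_apply)
  next
    case (Cons e E)
    obtain q x f where e: "e = (q, x, f)" by (cases e)
    then have "(q, x, f) \<in> set D" using Cons by auto
    note d = dual_basisD[OF D this]
    have "translate_right \<phi> f \<in> dist_filt X n"
      unfolding dist_filt_iff using translate_Dual(1)[OF phi(1) d(6)] translate_right_vanish[OF phi d(2)] by blast
    then obtain r where r: "r \<in> free_filt n" "eval_free r = translate_right \<phi> f" using Suc.IH by blast
    obtain p where p: "p \<in> free_filt (Suc n)" "\<forall>a\<in>carrier X. eval_free p a = (\<Sum>(q, x, f)\<leftarrow>E. (x \<star> translate_right \<phi> f) a)"
      using Cons by auto
    have xr: "letter x * r \<in> free_filt (Suc n)" using free_filt_mult[OF free_filt_letter[OF d(3)] r(1)] by simp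
    have "eval_free (letter x * r + p) = (x \<star> translate_right \<phi> f) \<oplus>\<^bsub>dual\<^esub> eval_free p"
      using xr p(1) r d(3) free_filt_carrier by (simp add: eval_free_add eval_free_mult free_letter eval_free_letter)
    then show ?case using p(2) free_filt_add[OF xr p(1)]
      by (intro bexI[where x = "letter x * r + p"]) (auto simp: e dual_add_apply)
  qed
  then obtain p where p: "p \<in> free_filt (Suc n)" "\<forall>a\<in>carrier X. eval_free p a = (\<Sum>(q, x, f)\<leftarrow>D. (x \<star> translate_right \<phi> f) a)"
    by blast
  have pc: "p \<in> free_carrier" using p free_filt_carrier by auto
  \<comment> \<open>The Euler operator acts as \<open>n + 1\<close> here; this is where characteristic zero enters.\<close>
  let ?c = "inverse (of_nat (Suc n)) :: 'k"
  define \<psi> where "\<psi> = \<phi> \<oplus>\<^bsub>dual\<^esub> (- ?c) \<odot>\<^bsub>dual\<^esub> eval_free p"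
  have psiD: "\<psi> \<in> Dual" unfolding \<psi>_def using phi(1) eval_free_Dual[OF pc] by (intro dual_closed)
  have "\<psi> f = 0" if f: "f \<in> aug_pow (Suc n)" for f
  proof -
    have fc: "f \<in> carrier X" using f aug_pow_closed by blast
    have "eval_free p f = of_nat (Suc n) * \<phi> f"
      using bspec[OF p(2) fc] euler[OF D phi f] by simp
    then show ?thesis using fc by (simp add: \<psi>_def dual_add_apply dual_smult_apply char_zero del: of_nat_Suc)
  qed
  then have "\<psi> \<in> dist_filt X n" using psiD unfolding dist_filt_iff by blast
  then obtain r where r: "r \<in> free_filt n" "eval_free r = \<psi>" using Suc.IH by blast
  have rS: "r \<in> free_filt (Suc n)" using free_filt_mono[OF r(1)] by simp
  have "eval_free (r + pm_scale ?c p) = \<phi>"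
  proof (rule Dual_eqI_carrier)
    have cc: "r \<in> free_carrier" "pm_scale ?c p \<in> free_carrier" using r(1) p(1) free_filt_carrier free_filt_scale by blast+
    show "eval_free (r + pm_scale ?c p) \<in> Dual" by (rule eval_free_Dual[OF free_add[OF cc]])
    show "eval_free (r + pm_scale ?c p) a = \<phi> a" if "a \<in> carrier X" for a
      using that cc pc by (simp add: eval_free_add eval_free_scale r(2) \<psi>_def dual_add_apply dual_smult_apply)
  qed (rule phi)
  then show ?case using free_filt_add[OF rS free_filt_scale[OF p(1)]] by blast
qed

end

section \<open>Hopf superalgebras of functionals\<close>

lemma bilinear_functional:
  assumes "bilinear A B C \<beta>" "h \<in> functionals C" shows "bilinear A B ground (\<lambda>a b. h (\<beta> a b))"
  by (rule bilinearI) (auto simp: bilinearD[OF assms(1)] functional_add[OF assms(2)] functional_smult[OF assms(2)])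

text \<open>A superspace \<open>B\<close> whose elements are realized faithfully as functionals on the Hopf
  superalgebra \<open>A\<close>, compatibly with convolution. All axioms are inherited from the dual of \<open>A\<close>; both
  the distributions and the enveloping superalgebra are instances.\<close>

locale functional_model = hopf_superalgebra A
  for A :: "('k::field, 'a, 'm) hopf_superalg_scheme" (structure) +
  fixes B :: "('k, 'b, 'n) superspace_scheme" and g :: "'b \<Rightarrow> 'a \<Rightarrow> 'k"
  assumes g_Dual: "b \<in> carrier B \<Longrightarrow> g b \<in> Dual"
    and g_inj: "inj_on g (carrier B)"
    and B_zero: "\<zero>\<^bsub>B\<^esub> \<in> carrier B" and g_zero: "g \<zero>\<^bsub>B\<^esub> = \<zero>\<^bsub>dual\<^esub>"
    and B_one: "\<one>\<^bsub>B\<^esub> \<in> carrier B" and g_one: "g \<one>\<^bsub>B\<^esub> = unit_dual"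
    and B_add: "x \<in> carrier B \<Longrightarrow> y \<in> carrier B \<Longrightarrow> x \<oplus>\<^bsub>B\<^esub> y \<in> carrier B"
    and g_add: "x \<in> carrier B \<Longrightarrow> y \<in> carrier B \<Longrightarrow> g (x \<oplus>\<^bsub>B\<^esub> y) = g x \<oplus>\<^bsub>dual\<^esub> g y"
    and B_smult: "x \<in> carrier B \<Longrightarrow> c \<odot>\<^bsub>B\<^esub> x \<in> carrier B"
    and g_smult: "x \<in> carrier B \<Longrightarrow> g (c \<odot>\<^bsub>B\<^esub> x) = c \<odot>\<^bsub>dual\<^esub> g x"
    and B_mult: "x \<in> carrier B \<Longrightarrow> y \<in> carrier B \<Longrightarrow> x \<otimes>\<^bsub>B\<^esub> y \<in> carrier B"
    and g_mult: "x \<in> carrier B \<Longrightarrow> y \<in> carrier B \<Longrightarrow> g (x \<otimes>\<^bsub>B\<^esub> y) = dist_mult A (g x) (g y)"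
    and B_homog: "homog B i = {b \<in> carrier B. g b \<in> homog dual i}"
    and B_decomp: "b \<in> carrier B \<Longrightarrow> \<exists>x\<in>homog B 0. \<exists>y\<in>homog B 1. b = x \<oplus>\<^bsub>B\<^esub> y"
begin

lemma B_eqI: "x \<in> carrier B \<Longrightarrow> y \<in> carrier B \<Longrightarrow> g x = g y \<Longrightarrow> x = y"
  using g_inj by (auto dest: inj_onD)

lemma B_module: "Module.module ground B"
  by (rule moduleI_ground)
    (auto intro!: B_eqI B_add B_zero B_smult simp: B_add B_zero B_smult g_add g_smult g_zero g_Dual DS.M.add.m_ac
      DS.scale_add DS.scale_add_left DS.scale_scale)

lemma B_superspace: "superspace B"
proof (intro superspace.intro superspace_axioms.intro B_module B_decomp)
  show "submodule (homog B i) ground B" for i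
    by (rule submoduleI_ground[OF B_module])
      (auto simp: B_homog B_add B_zero B_smult g_add g_smult g_zero intro: DS.homog_add DS.homog_smult DS.homog_zero)
  have "b = \<zero>\<^bsub>B\<^esub>" if "b \<in> homog B 0" "b \<in> homog B 1" for b
    using that DS.homog_both[of "g b" 0] by (intro B_eqI) (auto simp: B_homog g_zero B_zero)
  moreover have "\<zero>\<^bsub>B\<^esub> \<in> homog B i" for i by (simp add: B_homog B_zero g_zero DS.homog_zero)
  ultimately show "homog B 0 \<inter> homog B 1 = {\<zero>\<^bsub>B\<^esub>}" by blast
qed

lemma B_superalgebra: "superalgebra B"
proof (intro superalgebra.intro superalgebra_axioms.intro B_superspace)
  interpret B: superspace B by (rule B_superspace)
  show "ring B"
  proof (rule ringI)
    show "abelian_group B" by (rule B.abelian_group_axioms)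
    show "Group.monoid B"
      by (rule monoidI) (auto intro!: B_eqI simp: B_mult B_one g_mult g_one g_Dual conv_assoc conv_unit)
  qed (auto intro!: B_eqI simp: B_mult B_add g_mult g_add g_Dual conv_linear(1,2))
  show "c \<odot>\<^bsub>B\<^esub> x \<otimes>\<^bsub>B\<^esub> y = c \<odot>\<^bsub>B\<^esub> (x \<otimes>\<^bsub>B\<^esub> y)" "x \<otimes>\<^bsub>B\<^esub> (c \<odot>\<^bsub>B\<^esub> y) = c \<odot>\<^bsub>B\<^esub> (x \<otimes>\<^bsub>B\<^esub> y)"
    if "x \<in> carrier B" "y \<in> carrier B" for x y c
    using that by (auto intro!: B_eqI simp: B_mult B_smult g_mult g_smult g_Dual conv_linear(3,4))
  show "\<one>\<^bsub>B\<^esub> \<in> homog B 0" by (simp add: B_homog B_one g_one unit_dual_even)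
  show "x \<otimes>\<^bsub>B\<^esub> y \<in> homog B (i + j)" if "x \<in> homog B i" "y \<in> homog B j" for x y i j
    using that by (auto simp: B_homog B_mult g_mult intro: conv_homog)
qed

lemma g_component:
  assumes b: "b \<in> carrier B" shows "g (component B i b) = component dual i (g b)"
proof -
  interpret B: superspace B by (rule B_superspace)
  have "g b = g (component B i b) \<oplus>\<^bsub>dual\<^esub> g (component B (i + 1) b)"
    using B.component_decomp[OF b, of i] g_add[of "component B i b" "component B (i + 1) b"] b by simp
  moreover have "g (component B i b) \<in> homog dual i" for i
    using B.component_in[OF b, of i] by (simp add: B_homog)
  ultimately show ?thesis using DS.component_eqI by metis
qed

lemma component_eval:
  assumes "x \<in> carrier B" "e \<in> homog A r" shows "g (component B j x) e = (if j = r then g x e else 0)"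
  using homog_closed[OF assms(2)] functional_zero[OF module_A DualD[OF g_Dual[OF assms(1)]]] assms
  by (simp add: g_component component_dual g_Dual component_homog[OF assms(2)])

lemma g_functional: "f \<in> carrier A \<Longrightarrow> (\<lambda>b. g b f) \<in> functionals B"
  by (auto simp: functionals_iff g_add g_smult dual_add_apply dual_smult_apply)

definition evaluations :: "('b \<Rightarrow> 'k) set" where
  "evaluations = {\<lambda>b. g b f | f i. f \<in> homog A i}"

lemma evaluations: "evaluations \<subseteq> functionals B"
  "b \<in> carrier B \<Longrightarrow> (\<And>\<phi>. \<phi> \<in> evaluations \<Longrightarrow> \<phi> b = 0) \<Longrightarrow> b = \<zero>\<^bsub>B\<^esub>"
proof -
  show "evaluations \<subseteq> functionals B" using g_functional homog_closed by (auto simp: evaluations_def)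
  assume b: "b \<in> carrier B" and z: "\<And>\<phi>. \<phi> \<in> evaluations \<Longrightarrow> \<phi> b = 0"
  have "g b = \<zero>\<^bsub>dual\<^esub>"
  proof (rule Dual_eqI[OF g_Dual[OF b] dual_closed(3)])
    fix i f assume f: "f \<in> homog A i"
    then have "(\<lambda>b. g b f) \<in> evaluations" by (auto simp: evaluations_def)
    from z[OF this] show "g b f = \<zero>\<^bsub>dual\<^esub> f" using homog_closed[OF f] by (simp add: dual_zero_apply)
  qed
  then show "b = \<zero>\<^bsub>B\<^esub>" using b by (intro B_eqI) (auto simp: B_zero g_zero)
qed

sublocale BB: tensor_algebras B B
  by (rule tensor_algebras.intro[OF B_superalgebra B_superalgebra])

definition pairing :: "'a \<Rightarrow> 'a \<Rightarrow> ('b \<times> 'b \<Rightarrow>\<^sub>0 'k) set \<Rightarrow> 'k" where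
  "pairing f h = tensor_lift ground (\<lambda>x y. g x f * g y h)"

lemma pairing_bilinear: "f \<in> carrier A \<Longrightarrow> h \<in> carrier A \<Longrightarrow> bilinear B B ground (\<lambda>x y. g x f * g y h)"
  by (intro bilinear_mult g_functional)

lemma pairing_functional: "f \<in> carrier A \<Longrightarrow> h \<in> carrier A \<Longrightarrow> pairing f h \<in> functionals (tensor B B)"
  unfolding pairing_def by (rule BB.tensor_lift_linear[OF ground_module pairing_bilinear])

lemma pairing_tens: "f \<in> carrier A \<Longrightarrow> h \<in> carrier A \<Longrightarrow> x \<in> carrier B \<Longrightarrow> y \<in> carrier B \<Longrightarrow>
    pairing f h (tens B B x y) = g x f * g y h"
  unfolding pairing_def by (rule BB.tensor_lift_tens[OF ground_module pairing_bilinear])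

lemma pairing_eqI:
  assumes "t \<in> carrier (tensor B B)" "u \<in> carrier (tensor B B)"
    "\<And>f h p q. f \<in> homog A p \<Longrightarrow> h \<in> homog A q \<Longrightarrow> pairing f h t = pairing f h u"
  shows "t = u"
proof (rule BB.tensor_eqI[OF evaluations evaluations assms(1,2)])
  fix \<phi> \<psi> assume "\<phi> \<in> evaluations" "\<psi> \<in> evaluations"
  then obtain f h p q where "f \<in> homog A p" "h \<in> homog A q" "\<phi> = (\<lambda>b. g b f)" "\<psi> = (\<lambda>b. g b h)"
    by (auto simp: evaluations_def)
  then show "tensor_lift ground (\<lambda>a b. \<phi> a * \<psi> b) t = tensor_lift ground (\<lambda>a b. \<phi> a * \<psi> b) u"
    using assms(3) by (simp add: pairing_def)
qed

text \<open>The comultiplication dual to the product of \<open>A\<close>, as a relation, since its existence is only known in the two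
  cases of interest.\<close>

definition dual_comult :: "'b \<Rightarrow> ('b \<times> 'b \<Rightarrow>\<^sub>0 'k) set \<Rightarrow> bool" where
  "dual_comult b t \<longleftrightarrow> t \<in> carrier (tensor B B) \<and>
     (\<forall>p q. \<forall>f\<in>homog A p. \<forall>h\<in>homog A q. pairing f h t = koszul p q * g b (f \<otimes> h))"

lemma dual_comult_unique: "dual_comult b t \<Longrightarrow> dual_comult b u \<Longrightarrow> t = u"
  by (rule pairing_eqI) (auto simp: dual_comult_def)

lemma dual_comult_one: "dual_comult \<one>\<^bsub>B\<^esub> (tens B B \<one>\<^bsub>B\<^esub> \<one>\<^bsub>B\<^esub>)"
  unfolding dual_comult_def
proof (intro conjI allI ballI)
  show "tens B B \<one>\<^bsub>B\<^esub> \<one>\<^bsub>B\<^esub> \<in> carrier (tensor B B)" by (rule BB.tens_closed[OF B_one B_one])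
  fix p q f h assume fh: "f \<in> homog A p" "h \<in> homog A q"
  have c: "f \<in> carrier A" "h \<in> carrier A" using fh homog_closed by auto
  have "koszul p q * (counit A f * counit A h) = counit A f * counit A h"
    using counit_parity[OF fh(1)] by (elim disjE) simp_all
  then show "pairing f h (tens B B \<one>\<^bsub>B\<^esub> \<one>\<^bsub>B\<^esub>) = koszul p q * g \<one>\<^bsub>B\<^esub> (f \<otimes> h)"
    using c by (simp add: pairing_tens B_one g_one counit_mult)
qed

lemma dual_comult_add:
  assumes "dual_comult a t" "dual_comult b u" "a \<in> carrier B" "b \<in> carrier B"
  shows "dual_comult (a \<oplus>\<^bsub>B\<^esub> b) (t \<oplus>\<^bsub>tensor B B\<^esub> u)"
proof -
  interpret T: Module.module ground "tensor B B" by (rule BB.module_T)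
  show ?thesis using assms homog_closed
    by (auto simp: dual_comult_def functional_add[OF pairing_functional] g_add dual_add_apply algebra_simps)
qed

lemma dual_comult_smult:
  assumes "dual_comult a t" "a \<in> carrier B"
  shows "dual_comult (c \<odot>\<^bsub>B\<^esub> a) (c \<odot>\<^bsub>tensor B B\<^esub> t)"
proof -
  interpret T: Module.module ground "tensor B B" by (rule BB.module_T)
  show ?thesis using assms homog_closed
    by (auto simp: dual_comult_def functional_smult[OF pairing_functional] g_smult dual_smult_apply)
qed

lemma sum_list_mult_sum_list:
  "(\<Sum>x\<leftarrow>xs. u x) * (\<Sum>y\<leftarrow>ys. v y) = (\<Sum>x\<leftarrow>xs. \<Sum>y\<leftarrow>ys. u x * (v y :: 'k))"
  by (induction xs) (auto simp: algebra_simps sum_list_const_mult)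

text \<open>Both sides are expanded in Sweedler representations of \<open>f\<close> and \<open>h\<close>; the comultiplication of \<open>A\<close>
  is multiplicative, and the signs match.\<close>

lemma dual_comult_mult:
  assumes t: "dual_comult a t" and u: "dual_comult b u" and a: "a \<in> carrier B" and b: "b \<in> carrier B"
  shows "dual_comult (a \<otimes>\<^bsub>B\<^esub> b) (t \<otimes>\<^bsub>tensor B B\<^esub> u)"
  unfolding dual_comult_def
proof (intro conjI allI ballI)
  have tc: "t \<in> carrier (tensor B B)" "u \<in> carrier (tensor B B)" using t u by (auto simp: dual_comult_def)
  show "t \<otimes>\<^bsub>tensor B B\<^esub> u \<in> carrier (tensor B B)" by (rule BB.mult_T_closed[OF tc])
  obtain xs where xs: "set xs \<subseteq> carrier B \<times> carrier B" "t = tsum B B xs" using BB.tensor_rep[OF tc(1)] by blast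
  obtain ys where ys: "set ys \<subseteq> carrier B \<times> carrier B" "u = tsum B B ys" using BB.tensor_rep[OF tc(2)] by blast
  fix p q f h assume f: "f \<in> homog A p" and h: "h \<in> homog A q"
  have c: "f \<in> carrier A" "h \<in> carrier A" using f h homog_closed by auto
  define \<sigma> where "\<sigma> = (\<lambda>k l. koszul l (p + k) * (koszul k (p + k) * koszul l (q + l)) :: 'k)"
  have summand: "(\<Sum>i\<in>UNIV. \<Sum>j\<in>UNIV. koszul i j * pairing f h (tens B B (x \<otimes>\<^bsub>B\<^esub> component B j x') (component B i y \<otimes>\<^bsub>B\<^esub> y'))) =
      (\<Sum>(k, f1, f2)\<leftarrow>sweedler p f. \<Sum>(l, h1, h2)\<leftarrow>sweedler q h.
        \<sigma> k l * (g x f1 * g y h1) * (g x' f2 * g y' h2))"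
    if xy: "x \<in> carrier B" "y \<in> carrier B" "x' \<in> carrier B" "y' \<in> carrier B" for x y x' y'
  proof -
    have cc: "component B j x' \<in> carrier B" "component B i y \<in> carrier B" for i j using xy by auto
    have 1: "g (x \<otimes>\<^bsub>B\<^esub> component B j x') f = (\<Sum>(k, f1, f2)\<leftarrow>sweedler p f. if j = p + k then koszul k (p + k) * (g x f1 * g x' f2) else 0)" for j
      unfolding g_mult[OF xy(1) cc(1)] conv_sweedler[OF g_Dual[OF xy(1)] g_Dual[OF cc(1)] f]
      by (rule sweedler_sum_cong[OF f]) (simp add: component_eval[OF xy(3)])
    have 2: "g (component B i y \<otimes>\<^bsub>B\<^esub> y') h = (\<Sum>(l, h1, h2)\<leftarrow>sweedler q h. if i = l then koszul l (q + l) * (g y h1 * g y' h2) else 0)" for i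
      unfolding g_mult[OF cc(2) xy(4)] conv_sweedler[OF g_Dual[OF cc(2)] g_Dual[OF xy(4)] h]
      by (rule sweedler_sum_cong[OF h]) (simp add: component_eval[OF xy(2)])
    have "koszul i j * pairing f h (tens B B (x \<otimes>\<^bsub>B\<^esub> component B j x') (component B i y \<otimes>\<^bsub>B\<^esub> y')) =
      (\<Sum>(k, f1, f2)\<leftarrow>sweedler p f. \<Sum>(l, h1, h2)\<leftarrow>sweedler q h.
        if j = p + k then if i = l then \<sigma> k l * (g x f1 * g y h1) * (g x' f2 * g y' h2) else 0 else 0)" for i j
      unfolding pairing_tens[OF c B_mult[OF xy(1) cc(1)] B_mult[OF cc(2) xy(4)]] 1 2 sum_list_mult_sum_list case_prod_unfold
      by (auto simp flip: sum_list_const_mult simp: \<sigma>_def algebra_simps intro!: sum_list_cong)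
    then have "(\<Sum>i\<in>UNIV. \<Sum>j\<in>UNIV. koszul i j * pairing f h (tens B B (x \<otimes>\<^bsub>B\<^esub> component B j x') (component B i y \<otimes>\<^bsub>B\<^esub> y'))) =
      (\<Sum>i\<in>UNIV. \<Sum>j\<in>UNIV. (\<Sum>(k, f1, f2)\<leftarrow>sweedler p f. \<Sum>(l, h1, h2)\<leftarrow>sweedler q h.
        if j = p + k then if i = l then \<sigma> k l * (g x f1 * g y h1) * (g x' f2 * g y' h2) else 0 else 0))" by simp
    also have "\<dots> = (\<Sum>(k, f1, f2)\<leftarrow>sweedler p f. \<Sum>(l, h1, h2)\<leftarrow>sweedler q h. \<Sum>i\<in>UNIV. \<Sum>j\<in>UNIV.
        if j = p + k then if i = l then \<sigma> k l * (g x f1 * g y h1) * (g x' f2 * g y' h2) else 0 else 0)"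
      by (simp only: sum_bit case_prod_unfold sum_list_addf)
    also have "\<dots> = (\<Sum>(k, f1, f2)\<leftarrow>sweedler p f. \<Sum>(l, h1, h2)\<leftarrow>sweedler q h.
        \<sigma> k l * (g x f1 * g y h1) * (g x' f2 * g y' h2))"
      by simp
    finally show ?thesis .
  qed
  have A1: "g a (f1 \<otimes> h1) = koszul k l * (\<Sum>(x, y)\<leftarrow>xs. g x f1 * g y h1)" if "f1 \<in> homog A k" "h1 \<in> homog A l" for f1 h1 k l
  proof -
    have "pairing f1 h1 t = koszul k l * g a (f1 \<otimes> h1)" using t that unfolding dual_comult_def by blast
    moreover have "pairing f1 h1 t = (\<Sum>(x, y)\<leftarrow>xs. g x f1 * g y h1)"
      unfolding pairing_def xs(2) by (rule BB.lift_tsum[OF pairing_bilinear xs(1)]) (use that homog_closed in auto)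
    ultimately show ?thesis by simp
  qed
  have A2: "g b (f1 \<otimes> h1) = koszul k l * (\<Sum>(x, y)\<leftarrow>ys. g x f1 * g y h1)" if "f1 \<in> homog A k" "h1 \<in> homog A l" for f1 h1 k l
  proof -
    have "pairing f1 h1 u = koszul k l * g b (f1 \<otimes> h1)" using u that unfolding dual_comult_def by blast
    moreover have "pairing f1 h1 u = (\<Sum>(x, y)\<leftarrow>ys. g x f1 * g y h1)"
      unfolding pairing_def ys(2) by (rule BB.lift_tsum[OF pairing_bilinear ys(1)]) (use that homog_closed in auto)
    ultimately show ?thesis by simp
  qed
  have "pairing f h (t \<otimes>\<^bsub>tensor B B\<^esub> u) = (\<Sum>(x, y)\<leftarrow>xs. \<Sum>(x', y')\<leftarrow>ys.
      \<Sum>(k, f1, f2)\<leftarrow>sweedler p f. \<Sum>(l, h1, h2)\<leftarrow>sweedler q h.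
        \<sigma> k l * (g x f1 * g y h1) * (g x' f2 * g y' h2))"
    unfolding xs(2) ys(2) BB.functional_tsum_mult[OF pairing_functional[OF c] xs(1) ys(1)]
    by (rule sum_list_cong, clarify, rule sum_list_cong, clarify, rule summand) (use xs(1) ys(1) in auto)
  also have "\<dots> = (\<Sum>(k, f1, f2)\<leftarrow>sweedler p f. \<Sum>(l, h1, h2)\<leftarrow>sweedler q h.
        \<sigma> k l * ((\<Sum>(x, y)\<leftarrow>xs. g x f1 * g y h1) * (\<Sum>(x', y')\<leftarrow>ys. g x' f2 * g y' h2)))"
  proof -
    have "(\<Sum>x\<leftarrow>xs. \<Sum>x'\<leftarrow>ys. \<Sum>k\<leftarrow>S. \<Sum>l\<leftarrow>S'. F x x' k l) = (\<Sum>k\<leftarrow>S. \<Sum>l\<leftarrow>S'. \<Sum>x\<leftarrow>xs. \<Sum>x'\<leftarrow>ys. F x x' k l)"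
      for S S' and F :: "'b \<times> 'b \<Rightarrow> 'b \<times> 'b \<Rightarrow> bit \<times> 'a \<times> 'a \<Rightarrow> bit \<times> 'a \<times> 'a \<Rightarrow> 'k"
    proof -
      have "(\<Sum>x'\<leftarrow>ys. \<Sum>k\<leftarrow>S. \<Sum>l\<leftarrow>S'. F x x' k l) = (\<Sum>k\<leftarrow>S. \<Sum>l\<leftarrow>S'. \<Sum>x'\<leftarrow>ys. F x x' k l)" for x
        by (subst sum_list_swap, subst sum_list_swap) (rule refl)
      then show ?thesis by (simp, subst sum_list_swap, subst sum_list_swap) (rule refl)
    qed
    then show ?thesis
      unfolding case_prod_unfold sum_list_mult_sum_list
      by (simp add: mult.assoc flip: sum_list_const_mult)
  qed
  also have "\<dots> = koszul p q * (\<Sum>(k, f1, f2)\<leftarrow>sweedler p f. \<Sum>(l, h1, h2)\<leftarrow>sweedler q h.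
      koszul (p + k) l * (koszul (k + l) (p + k + (q + l)) * (g a (f1 \<otimes> h1) * g b (f2 \<otimes> h2))))"
    (is "?L = koszul p q * ?R")
  proof -
    have s: "koszul p q * (koszul (p + k) l * (koszul (k + l) (p + k + (q + l)) * (koszul k l * koszul (p + k) (q + l)))) = \<sigma> k l" for k l
      unfolding \<sigma>_def by (cases p; cases q; cases k; cases l; simp)
    have "koszul p q * ?R = (\<Sum>(k, f1, f2)\<leftarrow>sweedler p f. koszul p q * (\<Sum>(l, h1, h2)\<leftarrow>sweedler q h.
      koszul (p + k) l * (koszul (k + l) (p + k + (q + l)) * (g a (f1 \<otimes> h1) * g b (f2 \<otimes> h2)))))"
      by (simp add: case_prod_unfold sum_list_const_mult)
    also have "\<dots> = ?L"
    proof (rule sweedler_sum_cong[OF f])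
      fix k f1 f2 assume f12: "f1 \<in> homog A k" "f2 \<in> homog A (p + k)"
      have "koszul p q * (\<Sum>(l, h1, h2)\<leftarrow>sweedler q h. koszul (p + k) l * (koszul (k + l) (p + k + (q + l)) * (g a (f1 \<otimes> h1) * g b (f2 \<otimes> h2)))) =
        (\<Sum>(l, h1, h2)\<leftarrow>sweedler q h. koszul p q * (koszul (p + k) l * (koszul (k + l) (p + k + (q + l)) * (g a (f1 \<otimes> h1) * g b (f2 \<otimes> h2)))))"
        by (simp add: case_prod_unfold sum_list_const_mult)
      also have "\<dots> = (\<Sum>(l, h1, h2)\<leftarrow>sweedler q h. \<sigma> k l * ((\<Sum>(x, y)\<leftarrow>xs. g x f1 * g y h1) * (\<Sum>(x', y')\<leftarrow>ys. g x' f2 * g y' h2)))"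
      proof (rule sweedler_sum_cong[OF h])
        fix l h1 h2 assume h12: "h1 \<in> homog A l" "h2 \<in> homog A (q + l)"
        show "koszul p q * (koszul (p + k) l * (koszul (k + l) (p + k + (q + l)) * (g a (f1 \<otimes> h1) * g b (f2 \<otimes> h2)))) =
          \<sigma> k l * ((\<Sum>(x, y)\<leftarrow>xs. g x f1 * g y h1) * (\<Sum>(x', y')\<leftarrow>ys. g x' f2 * g y' h2))"
          unfolding A1[OF f12(1) h12(1)] A2[OF f12(2) h12(2)] s[of k l, symmetric] by (simp only: mult.assoc mult.left_commute)
      qed
      finally show "koszul p q * (\<Sum>(l, h1, h2)\<leftarrow>sweedler q h. koszul (p + k) l * (koszul (k + l) (p + k + (q + l)) * (g a (f1 \<otimes> h1) * g b (f2 \<otimes> h2)))) =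
        (\<Sum>(l, h1, h2)\<leftarrow>sweedler q h. \<sigma> k l * ((\<Sum>(x, y)\<leftarrow>xs. g x f1 * g y h1) * (\<Sum>(x', y')\<leftarrow>ys. g x' f2 * g y' h2)))" .
    qed
    finally show ?thesis by simp
  qed
  also have "\<dots> = koszul p q * (g a \<star> g b) (f \<otimes> h)"
  proof -
    have bl: "bilinear A A ground (\<lambda>x y. koszul i j * (g a x * g b y))" for i j
      using a b by (intro bilinear_ground_scale bilinear_mult DualD g_Dual)
    show ?thesis
      unfolding conv_sweedler[OF g_Dual[OF a] g_Dual[OF b] homog_mult[OF f h]]
      by (rule arg_cong[where f = "(*) (koszul p q)"], rule sweedler_mult[OF bl f h, symmetric])
  qed
  finally show "pairing f h (t \<otimes>\<^bsub>tensor B B\<^esub> u) = koszul p q * g (a \<otimes>\<^bsub>B\<^esub> b) (f \<otimes> h)"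
    by (simp add: g_mult[OF a b])
qed

lemma pairing_homog_zero:
  assumes t: "t \<in> homog (tensor B B) i" and f: "f \<in> homog A p" and h: "h \<in> homog A q" and ne: "p + q \<noteq> i"
  shows "pairing f h t = 0"
proof -
  obtain zs where zs: "\<forall>(j, a, b)\<in>set zs. a \<in> homog B j \<and> b \<in> homog B (i + j)" "t = tsum B B (map snd zs)"
    using BB.homog_rep[OF t] by blast
  have c: "set (map snd zs) \<subseteq> carrier B \<times> carrier B" using zs(1) by (auto simp: B_homog)
  have z: "g a f * g b h = 0" if "(j, a, b) \<in> set zs" for j a b
  proof -
    have ab: "g a \<in> homog dual j" "g b \<in> homog dual (i + j)"
      using zs(1) that by (auto simp: B_homog)
    have "p \<noteq> j \<or> q \<noteq> i + j" using ne by (cases i; cases j; cases p; cases q) auto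
    then have "g a f = 0 \<or> g b h = 0"
      by (rule disjE) (use homog_dual_zero[OF ab(1) f] homog_dual_zero[OF ab(2) h] in blast)+
    then show ?thesis by auto
  qed
  have "pairing f h t = (\<Sum>(a, b)\<leftarrow>map snd zs. g a f * g b h)"
    unfolding pairing_def zs(2) by (rule BB.lift_tsum[OF pairing_bilinear c]) (use f h homog_closed in auto)
  also have "\<dots> = (\<Sum>z\<leftarrow>zs. 0)" unfolding list.map_comp by (rule sum_list_cong) (use z in auto)
  finally show ?thesis by simp
qed

text \<open>The component of the wrong parity pairs to zero with everything.\<close>

lemma dual_comult_even:
  assumes t: "dual_comult b t" and b: "b \<in> homog B i" shows "t \<in> homog (tensor B B) i"
proof -
  interpret T: Module.module ground "tensor B B" by (rule BB.module_T)
  have tc: "t \<in> carrier (tensor B B)" using t by (simp add: dual_comult_def)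
  obtain x y where xy: "x \<in> homog (tensor B B) i" "y \<in> homog (tensor B B) (i + 1)" "t = x \<oplus>\<^bsub>tensor B B\<^esub> y"
    using BB.homog_T_decomp[OF tc] by blast
  have c: "x \<in> carrier (tensor B B)" "y \<in> carrier (tensor B B)" using xy BB.homog_T_closed by auto
  have "y = \<zero>\<^bsub>tensor B B\<^esub>"
  proof (rule pairing_eqI[OF c(2) T.zero_closed])
    fix f h p q assume f: "f \<in> homog A p" and h: "h \<in> homog A q"
    note pf = pairing_functional[OF homog_closed[OF f] homog_closed[OF h]]
    have "pairing f h y = 0"
    proof (cases "p + q = i")
      case True
      then show ?thesis by (intro pairing_homog_zero[OF xy(2) f h]) simp
    next
      case False
      have "g b (f \<otimes> h) = 0"
        by (rule homog_dual_zero[OF _ homog_mult[OF f h] False]) (use b in \<open>simp add: B_homog\<close>)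
      then have "pairing f h t = 0" using t f h by (simp add: dual_comult_def)
      then show ?thesis using functional_add[OF pf c] pairing_homog_zero[OF xy(1) f h False] xy(3) by simp
    qed
    then show "pairing f h y = pairing f h \<zero>\<^bsub>tensor B B\<^esub>" using functional_zero[OF BB.module_T pf] by simp
  qed
  then show ?thesis using xy c by simp
qed

lemma lift_scaled_pairing:
  assumes "f \<in> carrier A" "h \<in> carrier A" "t \<in> carrier (tensor B B)"
    "\<And>x y. x \<in> carrier B \<Longrightarrow> y \<in> carrier B \<Longrightarrow> \<beta> x y = c * (g x f * g y h)"
  shows "tensor_lift ground \<beta> t = c * pairing f h t"
proof -
  note bl = bilinear_ground_scale[OF pairing_bilinear[OF assms(1,2)], of c]
  have "tensor_lift ground \<beta> t = tensor_lift ground (\<lambda>x y. c * (g x f * g y h)) t"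
    by (rule BB.lift_cong[OF ground_module bl assms(3), symmetric]) (simp add: assms(4))
  also have "\<dots> = c * pairing f h t"
    by (rule BB.functional_T_eqI[OF BB.tensor_lift_linear[OF ground_module bl]
          functionals_scale[OF pairing_functional[OF assms(1,2)]] assms(3)])
      (simp add: BB.tensor_lift_tens[OF ground_module bl] pairing_tens assms)
  finally show ?thesis .
qed

text \<open>The signs of the super-opposite product and of the convolution product cancel.\<close>

lemma g_opposite_mult:
  assumes x: "x \<in> carrier B" and y: "y \<in> carrier B" and f: "f \<in> homog A r"
  shows "x \<otimes>\<^bsub>super_opposite B\<^esub> y \<in> carrier B"
    and "g (x \<otimes>\<^bsub>super_opposite B\<^esub> y) f = (\<Sum>(k, a, b)\<leftarrow>sweedler r f. g y a * g x b)"
proof -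
  define T where "T = (\<lambda>(i, j). koszul i j \<odot>\<^bsub>B\<^esub> (component B j y \<otimes>\<^bsub>B\<^esub> component B i x))"
  have eq: "x \<otimes>\<^bsub>super_opposite B\<^esub> y = finsum B T UNIV" by (simp add: super_opposite_def T_def)
  have c: "component B i x \<in> carrier B" "component B j y \<in> carrier B" for i j using x y by auto
  have T: "T k \<in> carrier B" for k unfolding T_def by (cases k) (auto intro: B_smult B_mult c)
  show "x \<otimes>\<^bsub>super_opposite B\<^esub> y \<in> carrier B" unfolding eq by (rule BB.A.finsum_closed) (use T in auto)
  have fc: "f \<in> carrier A" using f homog_closed by auto
  have summand: "g (T (i, j)) f = (\<Sum>(k, a, b)\<leftarrow>sweedler r f. if j = k then if i = r + k then g y a * g x b else 0 else 0)" for i j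
  proof -
    have "g (T (i, j)) f = koszul i j * (\<Sum>(k, a, b)\<leftarrow>sweedler r f. koszul k (r + k) * (g (component B j y) a * g (component B i x) b))"
      unfolding T_def by (simp add: g_smult B_mult c dual_smult_apply fc g_mult conv_sweedler[OF g_Dual[OF c(2)] g_Dual[OF c(1)] f])
    also have "\<dots> = (\<Sum>(k, a, b)\<leftarrow>sweedler r f. koszul i j * (koszul k (r + k) * (g (component B j y) a * g (component B i x) b)))"
      by (simp add: case_prod_unfold sum_list_const_mult)
    also have "\<dots> = (\<Sum>(k, a, b)\<leftarrow>sweedler r f. if j = k then if i = r + k then g y a * g x b else 0 else 0)"
      by (rule sweedler_sum_cong[OF f]) (auto simp: component_eval[OF x] component_eval[OF y] koszul_sym)
    finally show ?thesis .
  qed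
  have "g (finsum B T UNIV) f = (\<Sum>k\<in>UNIV. g (T k) f)"
    by (rule functional_finsum[OF B_module g_functional[OF fc]]) (use T in auto)
  also have "\<dots> = (\<Sum>i\<in>UNIV. \<Sum>j\<in>UNIV. g (T (i, j)) f)"
    using sum_bit_pairs[of "\<lambda>i j. g (T (i, j)) f"] by (simp add: case_prod_unfold)
  also have "\<dots> = (\<Sum>(k, a, b)\<leftarrow>sweedler r f. \<Sum>i\<in>UNIV. \<Sum>j\<in>UNIV. if j = k then if i = r + k then g y a * g x b else 0 else 0)"
    unfolding summand by (simp only: sum_bit case_prod_unfold sum_list_addf)
  also have "\<dots> = (\<Sum>(k, a, b)\<leftarrow>sweedler r f. g y a * g x b)" by simp
  finally show "g (x \<otimes>\<^bsub>super_opposite B\<^esub> y) f = (\<Sum>(k, a, b)\<leftarrow>sweedler r f. g y a * g x b)" unfolding eq .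
qed

end

locale functional_hopf_model = functional_model A B g
  for A :: "('k::field, 'a, 'm) hopf_superalg_scheme" (structure)
    and B :: "('k, 'b, 'n) hopf_superalg_scheme" and g :: "'b \<Rightarrow> 'a \<Rightarrow> 'k" +
  assumes B_comult: "b \<in> carrier B \<Longrightarrow> dual_comult b (comult B b)"
    and B_counit: "b \<in> carrier B \<Longrightarrow> counit B b = g b \<one>"
    and B_antipode: "b \<in> carrier B \<Longrightarrow> antipode B b \<in> carrier B"
    and g_antipode: "b \<in> carrier B \<Longrightarrow> f \<in> carrier A \<Longrightarrow> g (antipode B b) f = g b (antipode A f)"
begin

lemma B_comult_linear: "comult B \<in> linear_maps B (tensor B B)"
proof -
  have "comult B (a \<oplus>\<^bsub>B\<^esub> b) = comult B a \<oplus>\<^bsub>tensor B B\<^esub> comult B b" if "a \<in> carrier B" "b \<in> carrier B" for a b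
    using that by (intro dual_comult_unique[OF B_comult dual_comult_add] B_comult B_add)
  moreover have "comult B (c \<odot>\<^bsub>B\<^esub> a) = c \<odot>\<^bsub>tensor B B\<^esub> comult B a" if "a \<in> carrier B" for a c
    using that by (intro dual_comult_unique[OF B_comult dual_comult_smult] B_comult B_smult)
  ultimately show ?thesis using B_comult by (auto simp: linear_maps_def dual_comult_def)
qed

sublocale BD: linear_comult B "comult B"
  by (rule linear_comult.intro[OF B_module B_comult_linear])

lemma pairing_comult: "b \<in> carrier B \<Longrightarrow> f \<in> homog A p \<Longrightarrow> h \<in> homog A q \<Longrightarrow>
    pairing f h (comult B b) = koszul p q * g b (f \<otimes> h)"
  using B_comult unfolding dual_comult_def by blast

lemma B_coassoc: assumes b: "b \<in> carrier B" shows "BD.left_iterate b = BD.right_iterate b"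
proof (rule BD.AT.tensor_eqI[OF evaluations, where \<Psi> = "{pairing h k | h k q r. h \<in> homog A q \<and> k \<in> homog A r}"])
  show "{pairing h k | h k q r. h \<in> homog A q \<and> k \<in> homog A r} \<subseteq> functionals (tensor B B)"
    using pairing_functional homog_closed by blast
  show "t = \<zero>\<^bsub>tensor B B\<^esub>" if t: "t \<in> carrier (tensor B B)"
    and z: "\<And>\<psi>. \<psi> \<in> {pairing h k | h k q r. h \<in> homog A q \<and> k \<in> homog A r} \<Longrightarrow> \<psi> t = 0" for t
  proof -
    interpret T: Module.module ground "tensor B B" by (rule BB.module_T)
    show ?thesis
    proof (rule pairing_eqI[OF t T.zero_closed])
      fix f h p q assume f: "f \<in> homog A p" and h: "h \<in> homog A q"
      have "pairing f h t = 0" by (rule z) (use f h in blast)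
      then show "pairing f h t = pairing f h \<zero>\<^bsub>tensor B B\<^esub>"
        using functional_zero[OF BB.module_T pairing_functional[OF homog_closed[OF f] homog_closed[OF h]]] by simp
    qed
  qed
  show "BD.left_iterate b \<in> carrier (tensor B (tensor B B))" "BD.right_iterate b \<in> carrier (tensor B (tensor B B))"
    using BD.iterate_closed[OF b] by auto
  fix \<phi> \<psi> assume "\<phi> \<in> evaluations" "\<psi> \<in> {pairing h k | h k q r. h \<in> homog A q \<and> k \<in> homog A r}"
  then obtain f p h k q r where f: "f \<in> homog A p" "\<phi> = (\<lambda>b. g b f)"
    and h: "h \<in> homog A q" and k: "k \<in> homog A r" and psi: "\<psi> = pairing h k"
    by (auto simp: evaluations_def)
  have c: "f \<in> carrier A" "h \<in> carrier A" "k \<in> carrier A" using f(1) h k homog_closed by auto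
  define \<gamma> where "\<gamma> = (\<lambda>u v w. g u f * g v h * g w k)"
  have tri: "trilinear B B B ground \<gamma>"
    unfolding \<gamma>_def by (intro trilinear_mult g_functional c)
  have Dc: "x \<in> carrier B \<Longrightarrow> comult B x \<in> carrier (tensor B B)" for x using B_comult by (auto simp: dual_comult_def)
  have ev: "tensor_lift ground (\<lambda>x t. \<phi> x * \<psi> t) t = BD.eval3 \<gamma> t" if "t \<in> carrier (tensor B (tensor B B))" for t
    unfolding BD.eval3_def f(2) psi
  proof (rule BD.AT.lift_cong[OF ground_module _ that])
    show "bilinear B (tensor B B) ground (\<lambda>x t. g x f * pairing h k t)"
      by (intro bilinear_mult g_functional pairing_functional c)
    show "g x f * pairing h k t = tensor_lift ground (\<gamma> x) t" if "x \<in> carrier B" "t \<in> carrier (tensor B B)" for x t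
      by (rule lift_scaled_pairing[OF c(2,3) that(2), symmetric]) (simp add: \<gamma>_def)
  qed
  have L: "BD.eval3 \<gamma> (BD.left_iterate b) = koszul p q * (koszul (p + q) r * g b ((f \<otimes> h) \<otimes> k))"
  proof -
    have "BD.eval3 \<gamma> (BD.left_iterate b) = koszul p q * pairing (f \<otimes> h) k (comult B b)"
      unfolding BD.eval3_left[OF tri b]
    proof (rule lift_scaled_pairing[OF _ c(3) Dc[OF b]])
      fix x y assume xy: "x \<in> carrier B" "y \<in> carrier B"
      have "tensor_lift ground (\<lambda>u v. \<gamma> u v y) (comult B x) = g y k * pairing f h (comult B x)"
        by (rule lift_scaled_pairing[OF c(1,2) Dc[OF xy(1)]]) (simp add: \<gamma>_def)
      then show "tensor_lift ground (\<lambda>u v. \<gamma> u v y) (comult B x) = koszul p q * (g x (f \<otimes> h) * g y k)"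
        using pairing_comult[OF xy(1) f(1) h] by simp
    qed (use c in simp)
    then show ?thesis using pairing_comult[OF b homog_mult[OF f(1) h] k] by simp
  qed
  have R: "BD.eval3 \<gamma> (BD.right_iterate b) = koszul q r * (koszul p (q + r) * g b (f \<otimes> (h \<otimes> k)))"
  proof -
    have "BD.eval3 \<gamma> (BD.right_iterate b) = koszul q r * pairing f (h \<otimes> k) (comult B b)"
      unfolding BD.eval3_right[OF tri b]
    proof (rule lift_scaled_pairing[OF c(1) _ Dc[OF b]])
      fix x y assume xy: "x \<in> carrier B" "y \<in> carrier B"
      have "tensor_lift ground (\<gamma> x) (comult B y) = g x f * pairing h k (comult B y)"
        by (rule lift_scaled_pairing[OF c(2,3) Dc[OF xy(2)]]) (simp add: \<gamma>_def)
      then show "tensor_lift ground (\<gamma> x) (comult B y) = koszul q r * (g x f * g y (h \<otimes> k))"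
        using pairing_comult[OF xy(2) h k] by simp
    qed (use c in simp)
    then show ?thesis using pairing_comult[OF b f(1) homog_mult[OF h k]] by simp
  qed
  show "tensor_lift ground (\<lambda>x t. \<phi> x * \<psi> t) (BD.left_iterate b) = tensor_lift ground (\<lambda>x t. \<phi> x * \<psi> t) (BD.right_iterate b)"
    unfolding ev[OF BD.iterate_closed(1)[OF b]] ev[OF BD.iterate_closed(2)[OF b]] L R
    using c by (simp add: m_assoc koszul_add mult_ac)
qed

lemma B_eqI_eval:
  assumes "x \<in> carrier B" "y \<in> carrier B" "\<And>f i. f \<in> homog A i \<Longrightarrow> g x f = g y f" shows "x = y"
  by (rule B_eqI[OF assms(1,2)], rule Dual_eqI[OF g_Dual[OF assms(1)] g_Dual[OF assms(2)] assms(3)])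

lemma B_antipode_linear: "antipode B \<in> linear_maps B B"
proof -
  have "antipode B (x \<oplus>\<^bsub>B\<^esub> y) = antipode B x \<oplus>\<^bsub>B\<^esub> antipode B y" if xy: "x \<in> carrier B" "y \<in> carrier B" for x y
  proof (rule B_eqI_eval)
    fix f i assume "f \<in> homog A i"
    then have f: "f \<in> carrier A" "antipode A f \<in> carrier A" using homog_closed antipode_closed by auto
    show "g (antipode B (x \<oplus>\<^bsub>B\<^esub> y)) f = g (antipode B x \<oplus>\<^bsub>B\<^esub> antipode B y) f"
      by (simp add: g_antipode[OF B_add[OF xy] f(1)] g_add[OF xy] g_add[OF B_antipode[OF xy(1)] B_antipode[OF xy(2)]]
          dual_add_apply[OF f(1)] dual_add_apply[OF f(2)] g_antipode[OF xy(1) f(1)] g_antipode[OF xy(2) f(1)])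
  qed (intro B_antipode B_add xy)+
  moreover have "antipode B (c \<odot>\<^bsub>B\<^esub> x) = c \<odot>\<^bsub>B\<^esub> antipode B x" if x: "x \<in> carrier B" for c x
  proof (rule B_eqI_eval)
    fix f i assume "f \<in> homog A i"
    then have f: "f \<in> carrier A" "antipode A f \<in> carrier A" using homog_closed antipode_closed by auto
    show "g (antipode B (c \<odot>\<^bsub>B\<^esub> x)) f = g (c \<odot>\<^bsub>B\<^esub> antipode B x) f"
      by (simp add: g_antipode[OF B_smult[OF x] f(1)] g_smult[OF x] g_smult[OF B_antipode[OF x]]
          dual_smult_apply[OF f(1)] dual_smult_apply[OF f(2)] g_antipode[OF x f(1)])
  qed (intro B_antipode B_smult x)+
  ultimately show ?thesis using B_antipode unfolding linear_maps_def by blast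
qed

lemma pairing_list:
  assumes t: "t \<in> carrier (tensor B B)" and S: "\<And>i f h. (i, f, h) \<in> set S \<Longrightarrow> f \<in> carrier A \<and> h \<in> carrier A"
    and eq: "\<And>x y. x \<in> carrier B \<Longrightarrow> y \<in> carrier B \<Longrightarrow> \<beta> x y = (\<Sum>(i, f, h)\<leftarrow>S. c i f h * (g x f * g y h))"
    and bl: "bilinear B B ground \<beta>"
  shows "tensor_lift ground \<beta> t = (\<Sum>(i, f, h)\<leftarrow>S. c i f h * pairing f h t)"
proof -
  obtain xs where xs: "set xs \<subseteq> carrier B \<times> carrier B" "t = tsum B B xs" using BB.tensor_rep[OF t] by blast
  have "tensor_lift ground \<beta> t = (\<Sum>(x, y)\<leftarrow>xs. \<Sum>(i, f, h)\<leftarrow>S. c i f h * (g x f * g y h))"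
    unfolding xs(2) BB.lift_tsum[OF bl xs(1)] by (rule sum_list_cong) (use xs(1) eq in auto)
  also have "\<dots> = (\<Sum>(i, f, h)\<leftarrow>S. \<Sum>(x, y)\<leftarrow>xs. c i f h * (g x f * g y h))"
    unfolding case_prod_unfold by (rule sum_list_swap)
  also have "\<dots> = (\<Sum>(i, f, h)\<leftarrow>S. c i f h * pairing f h t)"
  proof (rule sum_list_cong, clarify)
    fix i f h assume "(i, f, h) \<in> set S"
    then have "pairing f h t = (\<Sum>(x, y)\<leftarrow>xs. g x f * g y h)"
      unfolding pairing_def xs(2) using S by (intro BB.lift_tsum[OF pairing_bilinear xs(1)]) auto
    then show "(\<Sum>(x, y)\<leftarrow>xs. c i f h * (g x f * g y h)) = c i f h * pairing f h t"
      by (simp add: case_prod_unfold sum_list_const_mult)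
  qed
  finally show ?thesis .
qed

lemma B_mult_bilinear: "bilinear B B B (\<lambda>x y. x \<otimes>\<^bsub>B\<^esub> y)"
  using BB.A.mult_linear_left BB.A.mult_linear_right by (auto simp: bilinear_def)

text \<open>If \<open>S\<close> and \<open>T\<close> are the transposes of \<open>s\<close> and \<open>t\<close>, then \<open>b \<mapsto> \<Sum> S(b\<^sub>1) T(b\<^sub>2)\<close> is the
  transpose of \<open>f \<mapsto> \<Sum> s(f\<^sub>1) t(f\<^sub>2)\<close>. With \<open>S\<close> or \<open>T\<close> the antipode this gives the antipode axioms.\<close>

lemma transpose_convolution:
  assumes a: "a \<in> carrier B" and f: "f \<in> homog A p"
    and S: "S \<in> linear_maps B B" and T: "T \<in> linear_maps B B"
    and s: "\<And>u i. u \<in> homog A i \<Longrightarrow> s u \<in> homog A i" and t: "\<And>u i. u \<in> homog A i \<Longrightarrow> t u \<in> homog A i"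
    and gS: "\<And>x u. x \<in> carrier B \<Longrightarrow> u \<in> carrier A \<Longrightarrow> g (S x) u = g x (s u)"
    and gT: "\<And>x u. x \<in> carrier B \<Longrightarrow> u \<in> carrier A \<Longrightarrow> g (T x) u = g x (t u)"
  shows "g (tensor_lift B (\<lambda>x y. S x \<otimes>\<^bsub>B\<^esub> T y) (comult B a)) f = (\<Sum>(i, u, v)\<leftarrow>sweedler p f. g a (s u \<otimes> t v))"
proof -
  have fc: "f \<in> carrier A" using f homog_closed by auto
  have Dc: "comult B a \<in> carrier (tensor B B)" using B_comult[OF a] by (simp add: dual_comult_def)
  note b = linear_map_bilinear[OF B_mult_bilinear S T]
  define L where "L = map (\<lambda>(i, u, v). (i, s u, t v)) (sweedler p f)"
  have "g (tensor_lift B (\<lambda>x y. S x \<otimes>\<^bsub>B\<^esub> T y) (comult B a)) f = tensor_lift ground (\<lambda>x y. g (S x \<otimes>\<^bsub>B\<^esub> T y) f) (comult B a)"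
    by (rule BB.functional_lift[OF B_module b g_functional[OF fc] Dc])
  also have "\<dots> = (\<Sum>(i, u, v)\<leftarrow>L. koszul i (p + i) * pairing u v (comult B a))"
  proof (rule pairing_list[OF Dc _ _ bilinear_functional[OF b g_functional[OF fc]]])
    show "u \<in> carrier A \<and> v \<in> carrier A" if "(i, u, v) \<in> set L" for i u v
      using that sweedler(1)[OF f] homog_closed[OF s] homog_closed[OF t] unfolding L_def by fastforce
    fix x y assume x: "x \<in> carrier B" and y: "y \<in> carrier B"
    note c = linear_map_closed[OF S x] linear_map_closed[OF T y]
    have "g (S x \<otimes>\<^bsub>B\<^esub> T y) f = (\<Sum>(i, u, v)\<leftarrow>sweedler p f. koszul i (p + i) * (g x (s u) * g y (t v)))"
      unfolding g_mult[OF c] conv_sweedler[OF g_Dual[OF c(1)] g_Dual[OF c(2)] f]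
      by (rule sweedler_sum_cong[OF f]) (simp add: gS gT x y homog_closed)
    then show "g (S x \<otimes>\<^bsub>B\<^esub> T y) f = (\<Sum>(i, u, v)\<leftarrow>L. koszul i (p + i) * (g x u * g y v))"
      by (simp add: L_def comp_def case_prod_unfold)
  qed
  also have "\<dots> = (\<Sum>(i, u, v)\<leftarrow>sweedler p f. koszul i (p + i) * pairing (s u) (t v) (comult B a))"
    by (simp add: L_def comp_def case_prod_unfold)
  also have "\<dots> = (\<Sum>(i, u, v)\<leftarrow>sweedler p f. g a (s u \<otimes> t v))"
    by (rule sweedler_sum_cong[OF f]) (simp add: pairing_comult[OF a s t])
  finally show ?thesis .
qed

theorem B_hopf_superalgebra: "hopf_superalgebra B"
proof -
  have Dc: "x \<in> carrier B \<Longrightarrow> comult B x \<in> carrier (tensor B B)" for x using B_comult by (auto simp: dual_comult_def)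
  have counit_fun: "counit B \<in> functionals B"
    using B_counit B_add B_smult by (auto simp: functionals_iff g_add g_smult dual_add_apply dual_smult_apply)
  show ?thesis
  proof (intro hopf_superalgebra.intro B_superalgebra hopf_superalgebra_axioms.intro)
    have "comult B (a \<otimes>\<^bsub>B\<^esub> b) = comult B a \<otimes>\<^bsub>tensor B B\<^esub> comult B b" if "a \<in> carrier B" "b \<in> carrier B" for a b
      using that by (intro dual_comult_unique[OF B_comult dual_comult_mult] B_comult B_mult)
    moreover have "comult B \<one>\<^bsub>B\<^esub> = \<one>\<^bsub>tensor B B\<^esub>"
      unfolding BB.one_T by (rule dual_comult_unique[OF B_comult[OF B_one] dual_comult_one])
    moreover have "comult B x \<in> homog (tensor B B) i" if "x \<in> homog B i" for x i
      using dual_comult_even[OF B_comult that] that by (simp add: B_homog)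
    ultimately show "comult B \<in> superalgebra_hom B (tensor B B)"
      using B_comult_linear linear_map_add[OF B_comult_linear] Dc
      by (auto simp: superalgebra_hom_def even_linear_maps_def ring_hom_def)
    have "counit B x = 0" if "x \<in> homog B 1" for x
      using that one_even by (auto simp: B_homog B_counit homog_dual_iff)
    then show "counit B \<in> superalgebra_hom B ground"
      using counit_fun functional_add[OF counit_fun]
      by (auto simp: superalgebra_hom_def even_linear_maps_def ring_hom_def B_counit B_mult B_one g_mult g_one conv_one g_Dual ground_homog)
    have "antipode B x \<in> homog B i" if "x \<in> homog B i" for x i
      using that antipode_homog homog_closed
      by (auto simp: B_homog B_antipode homog_dual_iff g_Dual g_antipode)
    then show "antipode B \<in> even_linear_maps B B"
      using B_antipode_linear by (auto simp: even_linear_maps_def)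
  next
    fix a assume a: "a \<in> carrier B"
    show "tensor_lift (tensor B (tensor B B))
        (\<lambda>x y. tensor_lift (tensor B (tensor B B)) (\<lambda>u v. tens B (tensor B B) u (tens B B v y)) (comult B x)) (comult B a) =
        tensor_lift (tensor B (tensor B B)) (\<lambda>x y. tens B (tensor B B) x (comult B y)) (comult B a)"
      using B_coassoc[OF a] unfolding BD.left_iterate_def BD.right_iterate_def .
    have bl: "bilinear B B B (\<lambda>x y. counit B x \<odot>\<^bsub>B\<^esub> y)"
      by (rule bilinearI) (auto simp: functional_add[OF counit_fun] functional_smult[OF counit_fun] BB.A.scale_add BB.A.scale_add_left BB.A.scale_scale mult.commute)
    show "tensor_lift B (\<lambda>x y. counit B x \<odot>\<^bsub>B\<^esub> y) (comult B a) = a"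
    proof (rule B_eqI_eval[OF linear_map_closed[OF BB.tensor_lift_linear[OF B_module bl] Dc[OF a]] a])
      fix f p assume f: "f \<in> homog A p"
      have fc: "f \<in> carrier A" using f homog_closed by auto
      have "g (tensor_lift B (\<lambda>x y. counit B x \<odot>\<^bsub>B\<^esub> y) (comult B a)) f = tensor_lift ground (\<lambda>x y. g (counit B x \<odot>\<^bsub>B\<^esub> y) f) (comult B a)"
        by (rule BB.functional_lift[OF B_module bl g_functional[OF fc] Dc[OF a]])
      also have "\<dots> = 1 * pairing \<one> f (comult B a)"
        by (rule lift_scaled_pairing[OF one_closed fc Dc[OF a]]) (simp add: g_smult dual_smult_apply fc B_counit)
      finally show "g (tensor_lift B (\<lambda>x y. counit B x \<odot>\<^bsub>B\<^esub> y) (comult B a)) f = g a f"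
        using pairing_comult[OF a one_even f] fc by simp
    qed
    show "tensor_lift B (\<lambda>x y. counit B y \<odot>\<^bsub>B\<^esub> x) (comult B a) = a"
    proof (rule B_eqI_eval[OF linear_map_closed[OF BB.tensor_lift_linear[OF B_module bilinear_flip[OF bl]] Dc[OF a]] a])
      fix f p assume f: "f \<in> homog A p"
      have fc: "f \<in> carrier A" using f homog_closed by auto
      have "g (tensor_lift B (\<lambda>x y. counit B y \<odot>\<^bsub>B\<^esub> x) (comult B a)) f = tensor_lift ground (\<lambda>x y. g (counit B y \<odot>\<^bsub>B\<^esub> x) f) (comult B a)"
        by (rule BB.functional_lift[OF B_module bilinear_flip[OF bl] g_functional[OF fc] Dc[OF a]])
      also have "\<dots> = 1 * pairing f \<one> (comult B a)"
        by (rule lift_scaled_pairing[OF fc one_closed Dc[OF a]]) (simp add: g_smult dual_smult_apply fc B_counit)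
      finally show "g (tensor_lift B (\<lambda>x y. counit B y \<odot>\<^bsub>B\<^esub> x) (comult B a)) f = g a f"
        using pairing_comult[OF a f one_even] fc by simp
    qed
    note bs = linear_map_bilinear[OF B_mult_bilinear B_antipode_linear linear_map_id] linear_map_bilinear[OF B_mult_bilinear linear_map_id B_antipode_linear]
    have target: "counit B a \<odot>\<^bsub>B\<^esub> \<one>\<^bsub>B\<^esub> \<in> carrier B" by (intro B_smult B_one)
    have gt: "g (counit B a \<odot>\<^bsub>B\<^esub> \<one>\<^bsub>B\<^esub>) f = counit A f * g a \<one>" if "f \<in> carrier A" for f
      using that a by (simp add: g_smult B_one dual_smult_apply g_one B_counit mult.commute)
    show "tensor_lift B (\<lambda>x y. antipode B x \<otimes>\<^bsub>B\<^esub> y) (comult B a) = counit B a \<odot>\<^bsub>B\<^esub> \<one>\<^bsub>B\<^esub>"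
    proof (rule B_eqI_eval[OF linear_map_closed[OF BB.tensor_lift_linear[OF B_module bs(1)] Dc[OF a]] target])
      fix f p assume f: "f \<in> homog A p"
      show "g (tensor_lift B (\<lambda>x y. antipode B x \<otimes>\<^bsub>B\<^esub> y) (comult B a)) f = g (counit B a \<odot>\<^bsub>B\<^esub> \<one>\<^bsub>B\<^esub>) f"
        unfolding gt[OF homog_closed[OF f]]
        by (rule trans[OF transpose_convolution[OF a f B_antipode_linear linear_map_id antipode_homog _ g_antipode refl]
              sweedler_antipode(1)[OF f DualD[OF g_Dual[OF a]]]])
    qed
    show "tensor_lift B (\<lambda>x y. x \<otimes>\<^bsub>B\<^esub> antipode B y) (comult B a) = counit B a \<odot>\<^bsub>B\<^esub> \<one>\<^bsub>B\<^esub>"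
    proof (rule B_eqI_eval[OF linear_map_closed[OF BB.tensor_lift_linear[OF B_module bs(2)] Dc[OF a]] target])
      fix f p assume f: "f \<in> homog A p"
      show "g (tensor_lift B (\<lambda>x y. x \<otimes>\<^bsub>B\<^esub> antipode B y) (comult B a)) f = g (counit B a \<odot>\<^bsub>B\<^esub> \<one>\<^bsub>B\<^esub>) f"
        unfolding gt[OF homog_closed[OF f]]
        by (rule trans[OF transpose_convolution[OF a f linear_map_id B_antipode_linear _ antipode_homog refl g_antipode]
              sweedler_antipode(2)[OF f DualD[OF g_Dual[OF a]]]])
    qed
  qed
qed

end

section \<open>The superalgebra of distributions and the Lie bracket\<close>

lemma dist_alg_simps: "carrier (dist_alg X) = (\<Union>n. dist_filt X n)" "mult (dist_alg X) = dist_mult X"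
  "one (dist_alg X) = restrict (counit X) (carrier X)" "zero (dist_alg X) = zero (dual_superspace X)"
  "add (dist_alg X) = add (dual_superspace X)" "smult (dist_alg X) = smult (dual_superspace X)"
  "homog (dist_alg X) i = (\<Union>n. dist_filt X n) \<inter> homog (dual_superspace X) i"
  by (simp_all add: dist_alg_def)

lemma (in abelian_monoid) finsum_bit_pairs:
  assumes "\<And>i j. f (i, j) \<in> carrier G"
  shows "finsum G f (UNIV :: (bit \<times> bit) set) = f (0, 0) \<oplus> (f (0, 1) \<oplus> (f (1, 0) \<oplus> f (1, 1)))"
proof -
  have U: "(UNIV :: (bit \<times> bit) set) = {(0, 0), (0, 1), (1, 0), (1, 1)}"
    using bit_UNIV by (auto simp flip: UNIV_Times_UNIV)
  show ?thesis unfolding U using assms by (simp add: Pi_def)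
qed

context char_zero_supergroup
begin

lemma dist_carrier_Dual: "\<phi> \<in> carrier (dist_alg X) \<Longrightarrow> \<phi> \<in> Dual"
  by (auto simp: dist_alg_simps dist_filt_iff)

lemma dist_carrier_generated: "\<phi> \<in> carrier (dist_alg X) \<longleftrightarrow> (\<exists>p\<in>free_carrier. eval_free p = \<phi>)"
proof
  assume "\<phi> \<in> carrier (dist_alg X)"
  then show "\<exists>p\<in>free_carrier. eval_free p = \<phi>"
    unfolding dist_alg_simps using dist_filt_generated free_filt_carrier by blast
next
  assume "\<exists>p\<in>free_carrier. eval_free p = \<phi>"
  then obtain p where p: "p \<in> free_carrier" "eval_free p = \<phi>" by blast
  define n where "n = Max (insert 0 ((\<lambda>w. length (letters w)) ` keys p))"
  have "length (letters w) \<le> n" if "w \<in> keys p" for w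
    unfolding n_def by (rule Max_ge) (use that in auto)
  then have "p \<in> free_filt n" using p(1) by (simp add: free_filt_def)
  from eval_free_dist_filt[OF this] show "\<phi> \<in> carrier (dist_alg X)" unfolding dist_alg_simps p(2) by blast
qed

lemma dist_alg_component:
  assumes "\<phi> \<in> carrier (dist_alg X)" shows "component dual i \<phi> \<in> homog (dist_alg X) i"
  using assms dist_filt_closed(3) DS.component_in[OF dist_carrier_Dual[OF assms], of i]
  unfolding dist_alg_simps by blast

sublocale DM: functional_model X "dist_alg X" "\<lambda>\<phi>. \<phi>"
proof unfold_locales
  show "b \<in> carrier (dist_alg X) \<Longrightarrow> b \<in> Dual" for b by (rule dist_carrier_Dual)
  show "inj_on (\<lambda>\<phi>. \<phi>) (carrier (dist_alg X))" by (rule inj_onI)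
  have I: "eval_free p \<in> carrier (dist_alg X)" if "p \<in> free_carrier" for p
    unfolding dist_carrier_generated using that by blast
  show "\<zero>\<^bsub>dist_alg X\<^esub> \<in> carrier (dist_alg X)"
    using I[OF free_zero] unfolding eval_free_zero dist_alg_simps(4) .
  show "\<one>\<^bsub>dist_alg X\<^esub> \<in> carrier (dist_alg X)"
    using I[OF free_one] unfolding eval_free_one dist_alg_simps(3) .
  fix x y c assume x: "x \<in> carrier (dist_alg X)"
  obtain p where p: "p \<in> free_carrier" "x = eval_free p" using x unfolding dist_carrier_generated by blast
  show "c \<odot>\<^bsub>dist_alg X\<^esub> x \<in> carrier (dist_alg X)"
    using I[OF free_scale[OF p(1)]] unfolding eval_free_scale[OF p(1)] p(2) dist_alg_simps(6) .
  assume y: "y \<in> carrier (dist_alg X)"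
  obtain q where q: "q \<in> free_carrier" "y = eval_free q" using y unfolding dist_carrier_generated by blast
  show "x \<oplus>\<^bsub>dist_alg X\<^esub> y \<in> carrier (dist_alg X)"
    using I[OF free_add[OF p(1) q(1)]] unfolding eval_free_add[OF p(1) q(1)] p(2) q(2) dist_alg_simps(5) .
  show "x \<otimes>\<^bsub>dist_alg X\<^esub> y \<in> carrier (dist_alg X)"
    using I[OF free_mult[OF p(1) q(1)]] unfolding eval_free_mult[OF p(1) q(1)] p(2) q(2) dist_alg_simps(2) .
next
  show "homog (dist_alg X) i = {b \<in> carrier (dist_alg X). b \<in> homog dual i}" for i
    unfolding dist_alg_simps by blast
  show "\<exists>x\<in>homog (dist_alg X) 0. \<exists>y\<in>homog (dist_alg X) 1. b = x \<oplus>\<^bsub>dist_alg X\<^esub> y" if "b \<in> carrier (dist_alg X)" for b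
    using dist_alg_component[OF that, of 0] dist_alg_component[OF that, of 1] DS.component_decomp_01[OF dist_carrier_Dual[OF that]]
    unfolding dist_alg_simps(5) by metis
qed (simp_all add: dist_alg_simps(2-6))

lemma lie_space_dist: "x \<in> lie_space X \<Longrightarrow> x \<in> carrier (dist_alg X)"
  unfolding dist_alg_simps lie_space_def by blast

lemma bracket_eq:
  assumes x: "x \<in> lie_space X" "x \<in> homog dual i" and y: "y \<in> lie_space X" "y \<in> homog dual j"
  shows "bracket (Lie X) x y = (x \<star> y) \<oplus>\<^bsub>dual\<^esub> (- koszul i j) \<odot>\<^bsub>dual\<^esub> (y \<star> x)"
proof -
  have c: "x \<in> carrier (dist_alg X)" "y \<in> carrier (dist_alg X)" using x y lie_space_dist by auto
  have h: "x \<in> homog (dist_alg X) i" "y \<in> homog (dist_alg X) j" using x y c by (auto simp: DM.B_homog)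
  let ?f = "\<lambda>(a, b). component (dist_alg X) a x \<otimes>\<^bsub>dist_alg X\<^esub> component (dist_alg X) b y \<ominus>\<^bsub>dist_alg X\<^esub>
      koszul a b \<odot>\<^bsub>dist_alg X\<^esub> (component (dist_alg X) b y \<otimes>\<^bsub>dist_alg X\<^esub> component (dist_alg X) a x)"
  define u where "u = x \<otimes>\<^bsub>dist_alg X\<^esub> y \<ominus>\<^bsub>dist_alg X\<^esub> koszul i j \<odot>\<^bsub>dist_alg X\<^esub> (y \<otimes>\<^bsub>dist_alg X\<^esub> x)"
  have u: "u \<in> carrier (dist_alg X)" unfolding u_def using c by simp
  have f: "?f (a, b) = (if a = i \<and> b = j then u else \<zero>\<^bsub>dist_alg X\<^esub>)" for a b
    using c by (auto simp: u_def DM.BB.A.component_homog[OF h(1)] DM.BB.A.component_homog[OF h(2)] a_minus_def)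
  have "supercommutator (dist_alg X) x y = finsum (dist_alg X) ?f UNIV" by (simp add: supercommutator_def)
  also have "\<dots> = ?f (0, 0) \<oplus>\<^bsub>dist_alg X\<^esub> (?f (0, 1) \<oplus>\<^bsub>dist_alg X\<^esub> (?f (1, 0) \<oplus>\<^bsub>dist_alg X\<^esub> ?f (1, 1)))"
    by (rule abelian_monoid.finsum_bit_pairs[OF abelian_group.axioms(1)[OF module.axioms(2)[OF DM.B_module]]]) (unfold f, use u in simp)
  also have "\<dots> = u" unfolding f using u by (cases i; cases j) simp_all
  also have "u = x \<otimes>\<^bsub>dist_alg X\<^esub> y \<oplus>\<^bsub>dist_alg X\<^esub> (- koszul i j) \<odot>\<^bsub>dist_alg X\<^esub> (y \<otimes>\<^bsub>dist_alg X\<^esub> x)"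
    using c module_minus[OF DM.BB.A.module_A, of "koszul i j \<odot>\<^bsub>dist_alg X\<^esub> (y \<otimes>\<^bsub>dist_alg X\<^esub> x)"]
    by (simp add: u_def a_minus_def DM.BB.A.scale_scale)
  finally show ?thesis unfolding Lie_simps by (simp add: dist_alg_simps)
qed

text \<open>A second order differential operator on a product of two functions that vanish at the identity.\<close>

lemma conv_primitive_square:
  assumes x: "x \<in> lie_space X" and y: "y \<in> lie_space X" and g: "g \<in> aug" "g \<in> homog X p" and m: "m \<in> aug" "m \<in> homog X q"
  shows "(x \<star> y) (g \<otimes> m) = koszul p q * x g * y m + x m * y g"
proof -
  have d: "x \<in> Dual" "y \<in> Dual" using x y by (auto simp: lie_space_iff)
  have c: "g \<in> carrier X" "m \<in> carrier X" using g m by (auto simp: aug_iff)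
  have py: "y (a \<otimes> b) = y a * counit X b + counit X a * y b" if "a \<in> carrier X" "b \<in> carrier X" for a b
    using lie_space_primitive[OF y] that by (simp add: primitive_def)
  have "(twist q x \<star> translate_right y m) g = translate_right y m \<one> * twist q x g"
    by (rule conv_vanish_aug[OF twist_Dual[OF d(1)] translate_Dual(1)[OF d(2) c(2)] _ c(1)])
      (use m c in \<open>auto simp: translate_apply py aug_iff\<close>)
  moreover have "(x \<star> translate_left g y) m = translate_left g y \<one> * x m"
    by (rule conv_vanish_aug[OF d(1) translate_Dual(2)[OF d(2) c(1)] _ c(2)])
      (use g c in \<open>auto simp: translate_apply py aug_iff\<close>)
  ultimately show ?thesis
    using conv_derivation[OF lie_space_primitive[OF x] d(2) m(2) c(1)] twist_homog[OF d(1) g(2), of q] c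
    by (simp add: translate_apply algebra_simps)
qed

text \<open>The values in the preceding lemma cancel in the supercommutator, so it vanishes on the square of the augmentation
  ideal.\<close>

lemma bracket_lie:
  assumes x: "x \<in> lie_space X" "x \<in> homog dual i" and y: "y \<in> lie_space X" "y \<in> homog dual j"
  shows "bracket (Lie X) x y \<in> lie_space X"
proof -
  have d: "x \<in> Dual" "y \<in> Dual" using x y by (auto simp: lie_space_iff)
  define z where "z = (x \<star> y) \<oplus>\<^bsub>dual\<^esub> (- koszul i j) \<odot>\<^bsub>dual\<^esub> (y \<star> x)"
  have zD: "z \<in> Dual" unfolding z_def using d by (intro dual_closed conv_Dual)
  have za: "z a = (x \<star> y) a - koszul i j * (y \<star> x) a" if "a \<in> carrier X" for a
    using that by (simp add: z_def dual_add_apply dual_smult_apply)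
  have "z f = 0" if f: "f \<in> aug_pow 2" for f
  proof -
    have "f \<in> aug_pow (Suc 1)" using f by (simp add: numeral_2_eq_2)
    then show ?thesis
    proof (induction f rule: aug_pow_Suc_induct)
      case (add f h)
      then show ?case using functional_add[OF DualD[OF zD]] by simp
    next
      case (mult g m p q)
      have g: "g \<in> aug" using mult(1) aug_pow_1 by auto
      have gm: "g \<otimes> m \<in> carrier X" using g mult(3) by (auto simp: aug_iff)
      have "p \<noteq> i \<Longrightarrow> x g = 0" "p \<noteq> j \<Longrightarrow> y g = 0" "q \<noteq> i \<Longrightarrow> x m = 0" "q \<noteq> j \<Longrightarrow> y m = 0"
        using homog_dual_zero[OF x(2) mult(2)] homog_dual_zero[OF y(2) mult(2)]
          homog_dual_zero[OF x(2) mult(4)] homog_dual_zero[OF y(2) mult(4)] by auto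
      then show ?case
        unfolding za[OF gm] conv_primitive_square[OF x(1) y(1) g mult(2,3,4)] conv_primitive_square[OF y(1) x(1) g mult(2,3,4)]
        by (cases i; cases j; cases p; cases q; simp)
    qed
  qed
  moreover have "z \<one> = 0" using x y conv_one[OF d] conv_one[OF d(2,1)] za[OF one_closed] by (simp add: lie_space_iff)
  ultimately have "z \<in> lie_space X" using zD by (simp add: lie_space_iff)
  then show ?thesis unfolding bracket_eq[OF assms] z_def .
qed

section \<open>Faithfulness on the enveloping superalgebra\<close>

abbreviation rels where "rels \<equiv> ue_ideal (Lie X)"

lemma free_simps: "mult (ue_free (Lie X)) = (*)" "one (ue_free (Lie X)) = 1" "zero (ue_free (Lie X)) = 0"
  "add (ue_free (Lie X)) = (+)" "smult (ue_free (Lie X)) = pm_scale"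
  by (simp_all add: ue_free_def)

lemma free_ring: "ring (ue_free (Lie X))"
proof (rule ringI)
  show "abelian_group (ue_free (Lie X))"
  proof (rule abelian_groupI)
    show "\<exists>y\<in>free_carrier. y \<oplus>\<^bsub>ue_free (Lie X)\<^esub> x = \<zero>\<^bsub>ue_free (Lie X)\<^esub>" if "x \<in> free_carrier" for x
      using free_uminus[OF that] by (intro bexI[where x = "- x"]) (auto simp: free_simps)
  qed (auto simp: free_simps free_add free_zero add.assoc add.commute)
  show "Group.monoid (ue_free (Lie X))"
    by (rule monoidI) (auto simp: free_simps free_mult free_one mult.assoc)
qed (auto simp: free_simps distrib_left distrib_right)

lemma free_module: "Module.module ground (ue_free (Lie X))"
  by (rule moduleI_ground)
    (auto simp: free_simps free_add free_zero free_scale pm_scale_add pm_scale_add_left pm_scale_scale add.assoc add.commute)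

lemma relators_free: "ue_relators (Lie X) \<subseteq> free_carrier"
proof
  fix p assume "p \<in> ue_relators (Lie X)"
  then consider x y where "p = letter (x \<oplus>\<^bsub>Lie X\<^esub> y) - letter x - letter y" "x \<in> lie_space X" "y \<in> lie_space X"
    | c x where "p = letter (c \<odot>\<^bsub>Lie X\<^esub> x) - pm_scale c (letter x)" "x \<in> lie_space X"
    | i j x y where "p = letter x * letter y - pm_scale (koszul i j) (letter y * letter x) - letter (bracket (Lie X) x y)"
      "x \<in> homog (Lie X) i" "y \<in> homog (Lie X) j"
    unfolding ue_relators_def Lie_simps(1) by blast
  then show "p \<in> free_carrier"
  proof cases
    case 1
    then show ?thesis unfolding Lie_simps by (simp add: free_diff free_letter lie_space_closed)
  next
    case 2
    then show ?thesis unfolding Lie_simps by (simp add: free_diff free_letter free_scale lie_space_closed)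
  next
    case 3
    then have "bracket (Lie X) x y \<in> lie_space X" "x \<in> lie_space X" "y \<in> lie_space X"
      using bracket_lie[of x i y j] unfolding Lie_simps(5) by auto
    then show ?thesis unfolding 3(1) by (simp add: free_diff free_letter free_scale free_mult)
  qed
qed

lemma rels_ideal: "ideal rels (ue_free (Lie X))"
  unfolding ue_ideal_def by (rule ring.genideal_ideal[OF free_ring relators_free])

lemma relator_in_rels: "ue_relators (Lie X) \<subseteq> rels"
  unfolding ue_ideal_def by (rule ring.genideal_self[OF free_ring relators_free])

lemma rels_free: "p \<in> rels \<Longrightarrow> p \<in> free_carrier"
  by (rule ideal.Icarr[OF rels_ideal])

lemma rels_add: "p \<in> rels \<Longrightarrow> q \<in> rels \<Longrightarrow> p + q \<in> rels"
  using additive_subgroup.a_closed[OF ideal.axioms(1)[OF rels_ideal]] by (simp add: free_simps)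

lemma rels_zero: "0 \<in> rels"
  using additive_subgroup.zero_closed[OF ideal.axioms(1)[OF rels_ideal]] by (simp add: free_simps)

lemma rels_mult: "p \<in> rels \<Longrightarrow> q \<in> free_carrier \<Longrightarrow> q * p \<in> rels" "p \<in> rels \<Longrightarrow> q \<in> free_carrier \<Longrightarrow> p * q \<in> rels"
  using ideal.I_l_closed[OF rels_ideal] ideal.I_r_closed[OF rels_ideal] by (simp_all add: free_simps)

lemma single_nil_mult: "single (Word []) c * p = pm_scale c (p :: 'b free_monoid \<Rightarrow>\<^sub>0 'k)"
proof -
  have "keys p \<subseteq> UNIV" by simp
  then show ?thesis
    by (induction p rule: pm_induct)
      (auto simp: distrib_left pm_scale_add mult_single pm_scale_single plus_free_monoid_def)
qed

lemma rels_scale: "p \<in> rels \<Longrightarrow> pm_scale c p \<in> rels"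
  using rels_mult(1)[of p "single (Word []) c"] by (simp add: single_nil_mult free_single)

lemma rels_uminus: "p \<in> rels \<Longrightarrow> - p \<in> rels"
  using rels_scale[of p "- 1"] by (simp add: pm_scale_minus_one)

lemma rels_diff: "p \<in> rels \<Longrightarrow> q \<in> rels \<Longrightarrow> p - q \<in> rels"
  using rels_add[OF _ rels_uminus, of p q] by simp

lemma eval_free_uminus: "p \<in> free_carrier \<Longrightarrow> a \<in> carrier X \<Longrightarrow> eval_free (- p) a = - eval_free p a"
  using eval_free_scale[of p "- 1"] by (simp add: pm_scale_minus_one dual_smult_apply)

lemma eval_free_diff: "p \<in> free_carrier \<Longrightarrow> q \<in> free_carrier \<Longrightarrow> a \<in> carrier X \<Longrightarrow>
    eval_free (p - q) a = eval_free p a - eval_free q a"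
  using eval_free_add[of p "- q"] free_uminus[of q] by (simp add: dual_add_apply eval_free_uminus)

text \<open>The combinations that evaluate to zero form an ideal, which contains the relators.\<close>

lemma eval_free_rels: assumes "p \<in> rels" "a \<in> carrier X" shows "eval_free p a = 0"
proof -
  define K where "K = {p \<in> free_carrier. \<forall>a\<in>carrier X. eval_free p a = 0}"
  have "ideal K (ue_free (Lie X))"
  proof (rule idealI[OF free_ring])
    have inv: "\<ominus>\<^bsub>ue_free (Lie X)\<^esub> x = - x" if "x \<in> free_carrier" for x
      using module_minus[OF free_module that] by (simp add: free_simps pm_scale_minus_one)
    show "subgroup K (add_monoid (ue_free (Lie X)))"
    proof (rule subgroup.intro)
      fix x assume x: "x \<in> K"
      show "inv\<^bsub>add_monoid (ue_free (Lie X))\<^esub> x \<in> K"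
        unfolding a_inv_def[symmetric] using x by (auto simp: K_def inv free_uminus eval_free_uminus)
    qed (auto simp: K_def free_simps free_add free_zero eval_free_add dual_add_apply eval_free_zero dual_zero_apply)
    show "x \<otimes>\<^bsub>ue_free (Lie X)\<^esub> a \<in> K" "a \<otimes>\<^bsub>ue_free (Lie X)\<^esub> x \<in> K" if "a \<in> K" "x \<in> free_carrier" for a x
      using that conv_zero[of "eval_free x" "eval_free a"]
      by (auto simp: K_def free_simps free_mult eval_free_mult eval_free_Dual)
  qed
  moreover have "ue_relators (Lie X) \<subseteq> K"
  proof
    fix p assume p: "p \<in> ue_relators (Lie X)"
    then consider x y where "p = letter (x \<oplus>\<^bsub>Lie X\<^esub> y) - letter x - letter y" "x \<in> lie_space X" "y \<in> lie_space X"
      | c x where "p = letter (c \<odot>\<^bsub>Lie X\<^esub> x) - pm_scale c (letter x)" "x \<in> lie_space X"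
      | i j x y where "p = letter x * letter y - pm_scale (koszul i j) (letter y * letter x) - letter (bracket (Lie X) x y)"
        "x \<in> homog (Lie X) i" "y \<in> homog (Lie X) j"
      unfolding ue_relators_def Lie_simps(1) by blast
    then have "\<forall>a\<in>carrier X. eval_free p a = 0"
    proof cases
      case 1
      then show ?thesis unfolding Lie_simps
        by (auto simp: free_diff free_letter lie_space_closed eval_free_diff eval_free_letter dual_add_apply)
    next
      case 2
      then show ?thesis unfolding Lie_simps
        by (auto simp: free_letter free_scale lie_space_closed eval_free_diff eval_free_letter eval_free_scale dual_smult_apply)
    next
      case 3
      then have h: "x \<in> lie_space X" "x \<in> homog dual i" "y \<in> lie_space X" "y \<in> homog dual j"
        unfolding Lie_simps(5) by auto
      then show ?thesis unfolding 3(1) using bracket_lie[OF h]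
        by (auto simp: free_diff free_letter free_scale free_mult eval_free_diff eval_free_letter eval_free_mult
            eval_free_scale dual_smult_apply dual_add_apply bracket_eq[OF h])
    qed
    then show "p \<in> K" using p relators_free by (auto simp: K_def)
  qed
  ultimately have "rels \<subseteq> K" unfolding ue_ideal_def genideal_def by blast
  then show ?thesis using assms by (auto simp: K_def)
qed

lemma letter_add_rels:
  assumes "x \<in> lie_space X" "y \<in> lie_space X"
  shows "letter (x \<oplus>\<^bsub>dual\<^esub> y) - letter x - letter y \<in> rels"
proof -
  have "letter (x \<oplus>\<^bsub>dual\<^esub> y) - letter x - letter y \<in> ue_relators (Lie X)"
    unfolding ue_relators_def Lie_simps(1,2)
    by (rule UnI1, rule UnI1, rule CollectI, intro exI conjI, rule refl) (use assms in auto)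
  then show ?thesis using relator_in_rels by (rule subsetD[rotated])
qed

lemma letter_smult_rels:
  assumes "x \<in> lie_space X"
  shows "letter (c \<odot>\<^bsub>dual\<^esub> x) - pm_scale c (letter x) \<in> rels"
proof -
  have "letter (c \<odot>\<^bsub>dual\<^esub> x) - pm_scale c (letter x) \<in> ue_relators (Lie X)"
    unfolding ue_relators_def Lie_simps(1,4)
    by (rule UnI1, rule UnI2, rule CollectI, intro exI conjI, rule refl) (use assms in auto)
  then show ?thesis using relator_in_rels by (rule subsetD[rotated])
qed

lemma letter_bracket_rels:
  assumes "x \<in> lie_space X" "x \<in> homog dual i" "y \<in> lie_space X" "y \<in> homog dual j"
  shows "letter x * letter y - pm_scale (koszul i j) (letter y * letter x) - letter (bracket (Lie X) x y) \<in> rels"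
proof -
  have h: "x \<in> homog (Lie X) i" "y \<in> homog (Lie X) j" using assms by (auto simp: Lie_simps(5))
  have "letter x * letter y - pm_scale (koszul i j) (letter y * letter x) - letter (bracket (Lie X) x y) \<in> ue_relators (Lie X)"
    unfolding ue_relators_def by (rule UnI2, rule CollectI, intro exI conjI, rule refl, rule h(1), rule h(2))
  then show ?thesis using relator_in_rels by (rule subsetD[rotated])
qed

lemma pm_scale_mult: "pm_scale c p * q = pm_scale c (p * q)" "p * pm_scale c q = pm_scale c (p * (q :: 'b free_monoid \<Rightarrow>\<^sub>0 'k))"
proof -
  show "pm_scale c p * q = pm_scale c (p * q)" by (simp add: mult.assoc flip: single_nil_mult)
  have "keys p \<subseteq> UNIV" by simp
  then show "p * pm_scale c q = pm_scale c (p * q)"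
  proof (induction p rule: pm_induct)
    case (single k d)
    have "keys q \<subseteq> UNIV" by simp
    then show ?case
      by (induction q rule: pm_induct) (auto simp: pm_scale_add distrib_left pm_scale_single mult_single mult_ac)
  qed (auto simp: distrib_right pm_scale_add)
qed

lemma twist_components:
  assumes y: "y \<in> Dual"
  shows "twist q y = koszul 0 q \<odot>\<^bsub>dual\<^esub> component dual 0 y \<oplus>\<^bsub>dual\<^esub>
    koszul 1 q \<odot>\<^bsub>dual\<^esub> component dual 1 y"
proof (rule Dual_eqI_carrier)
  fix a assume "a \<in> carrier X"
  then show "twist q y a = (koszul 0 q \<odot>\<^bsub>dual\<^esub> component dual 0 y \<oplus>\<^bsub>dual\<^esub>
      koszul 1 q \<odot>\<^bsub>dual\<^esub> component dual 1 y) a"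
    using y by (simp add: twist_def dual_add_apply dual_smult_apply component_dual sum_bit)
qed (intro twist_Dual dual_closed DS.component_closed y)+

text \<open>The sign in the relators depends on the parity of \<open>y\<close>; for an arbitrary \<open>y\<close> it is carried by \<^const>\<open>twist\<close>, and
  the brackets with the two components of \<open>y\<close> make up the remainder.\<close>

lemma commute_letters:
  assumes x: "x \<in> lie_space X" "x \<in> homog dual q" and y: "y \<in> lie_space X"
  shows "\<exists>r\<in>free_filt 1. letter x * letter (twist q y) - letter y * letter x - r \<in> rels"
proof -
  have yD: "y \<in> Dual" using y by (simp add: lie_space_iff)
  define y0 where "y0 = component dual 0 y"
  define y1 where "y1 = component dual 1 y"
  have y0: "y0 \<in> lie_space X" "y0 \<in> homog dual 0" and y1: "y1 \<in> lie_space X" "y1 \<in> homog dual 1"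
    unfolding y0_def y1_def using lie_space_closed(3)[OF y] DS.component_in[OF yD] by auto
  define s where "s = (koszul 1 q :: 'k)"
  define r where "r = letter (bracket (Lie X) x y0) + pm_scale s (letter (bracket (Lie X) x y1))"
  have rf: "r \<in> free_filt 1" unfolding r_def
    using bracket_lie[OF x y0] bracket_lie[OF x y1] by (intro free_filt_add free_filt_scale free_filt_letter)
  note lx = free_letter[OF x(1)]
  have ty: "twist q y = y0 \<oplus>\<^bsub>dual\<^esub> s \<odot>\<^bsub>dual\<^esub> y1"
    using twist_components[OF yD, of q] y0(1) by (simp add: y0_def y1_def s_def lie_space_iff)
  define e1 :: "('a \<Rightarrow> 'k) free_monoid \<Rightarrow>\<^sub>0 'k" where "e1 = letter (twist q y) - letter y0 - letter (s \<odot>\<^bsub>dual\<^esub> y1)"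
  define e2 :: "('a \<Rightarrow> 'k) free_monoid \<Rightarrow>\<^sub>0 'k" where "e2 = letter (s \<odot>\<^bsub>dual\<^esub> y1) - pm_scale s (letter y1)"
  define e3 :: "('a \<Rightarrow> 'k) free_monoid \<Rightarrow>\<^sub>0 'k" where "e3 = letter y - letter y0 - letter y1"
  define b0 :: "('a \<Rightarrow> 'k) free_monoid \<Rightarrow>\<^sub>0 'k" where "b0 = letter x * letter y0 - letter y0 * letter x - letter (bracket (Lie X) x y0)"
  define b1 :: "('a \<Rightarrow> 'k) free_monoid \<Rightarrow>\<^sub>0 'k" where "b1 = letter x * letter y1 - pm_scale s (letter y1 * letter x) - letter (bracket (Lie X) x y1)"
  have e1: "e1 \<in> rels" unfolding e1_def ty by (rule letter_add_rels[OF y0(1) lie_space_closed(2)[OF y1(1)]])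
  have e2: "e2 \<in> rels" unfolding e2_def by (rule letter_smult_rels[OF y1(1)])
  have e3: "e3 \<in> rels" unfolding e3_def
    using letter_add_rels[OF y0(1) y1(1)] DS.component_decomp_01[OF yD] by (simp add: y0_def y1_def)
  have b0: "b0 \<in> rels" unfolding b0_def using letter_bracket_rels[OF x y0] by simp
  have b1: "b1 \<in> rels" unfolding b1_def s_def using letter_bracket_rels[OF x y1] by (simp add: koszul_sym)
  have ss: "s * s = 1" by (simp add: s_def)
  have t: "letter (twist q y) = e1 + letter y0 + (e2 + pm_scale s (letter y1))" by (simp add: e1_def e2_def)
  have l: "letter y = e3 + letter y0 + letter y1" by (simp add: e3_def)
  have p0: "letter x * letter y0 = b0 + letter y0 * letter x + letter (bracket (Lie X) x y0)" by (simp add: b0_def)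
  have p1: "letter x * letter y1 = b1 + pm_scale s (letter y1 * letter x) + letter (bracket (Lie X) x y1)" by (simp add: b1_def)
  have "letter x * letter (twist q y) - letter y * letter x - r =
      letter x * e1 + letter x * e2 + b0 + pm_scale s b1 - e3 * letter x"
    unfolding t l distrib_left distrib_right pm_scale_mult p0 p1 r_def pm_scale_add
    by (simp add: ss flip: pm_scale_scale)
  also have "\<dots> \<in> rels"
    by (intro rels_diff rels_add rels_mult[OF _ lx] rels_scale e1 e2 e3 b0 b1)
  finally show ?thesis using rf by blast
qed

text \<open>Combinations of words of length less than \<open>k\<close>, modulo the relations; there are none for \<open>k = 0\<close>.\<close>

definition shorter :: "nat \<Rightarrow> (('a \<Rightarrow> 'k) free_monoid \<Rightarrow>\<^sub>0 'k) set" where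
  "shorter k = (case k of 0 \<Rightarrow> rels | Suc n \<Rightarrow> {p + r | p r. p \<in> free_filt n \<and> r \<in> rels})"

lemma shorter_simps: "shorter 0 = rels" "shorter (Suc n) = {p + r | p r. p \<in> free_filt n \<and> r \<in> rels}"
  by (simp_all add: shorter_def)

lemma rels_shorter: "r \<in> rels \<Longrightarrow> r \<in> shorter k"
proof (cases k)
  case (Suc n)
  assume r: "r \<in> rels"
  have "r = 0 + r" by simp
  then show ?thesis unfolding Suc shorter_simps using free_filt_zero r by blast
qed (simp add: shorter_simps)

lemma free_filt_shorter: "p \<in> free_filt n \<Longrightarrow> n < k \<Longrightarrow> p \<in> shorter k"
proof (cases k)
  case (Suc l)
  assume "p \<in> free_filt n" "n < k"
  then have p: "p \<in> free_filt l" using free_filt_mono[of p n l] Suc by simp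
  have "p = p + 0" by simp
  then show ?thesis unfolding Suc shorter_simps using p rels_zero by blast
qed simp

lemma shorter_add: "p \<in> shorter k \<Longrightarrow> q \<in> shorter k \<Longrightarrow> p + q \<in> shorter k"
proof (cases k)
  case (Suc n)
  assume "p \<in> shorter k" "q \<in> shorter k"
  then obtain a r b s where *: "a \<in> free_filt n" "r \<in> rels" "p = a + r" "b \<in> free_filt n" "s \<in> rels" "q = b + s"
    unfolding Suc shorter_simps by blast
  have "p + q = (a + b) + (r + s)" using * by (simp add: algebra_simps)
  then show ?thesis unfolding Suc shorter_simps using free_filt_add[OF *(1,4)] rels_add[OF *(2,5)] by blast
qed (simp add: shorter_simps rels_add)

lemma shorter_scale: "p \<in> shorter k \<Longrightarrow> pm_scale c p \<in> shorter k"
proof (cases k)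
  case (Suc n)
  assume "p \<in> shorter k"
  then obtain a r where *: "a \<in> free_filt n" "r \<in> rels" "p = a + r" unfolding Suc shorter_simps by blast
  have "pm_scale c p = pm_scale c a + pm_scale c r" using * by (simp add: pm_scale_add)
  then show ?thesis unfolding Suc shorter_simps using free_filt_scale[OF *(1)] rels_scale[OF *(2)] by blast
qed (simp add: shorter_simps rels_scale)

lemma shorter_diff: "p \<in> shorter k \<Longrightarrow> q \<in> shorter k \<Longrightarrow> p - q \<in> shorter k"
  using shorter_add[OF _ shorter_scale, of p k q "- 1"] by (simp add: pm_scale_minus_one)

lemma shorter_mono: "p \<in> shorter k \<Longrightarrow> k \<le> l \<Longrightarrow> p \<in> shorter l"
proof (cases k)
  case (Suc n)
  assume p: "p \<in> shorter k" and kl: "k \<le> l"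
  then obtain a r where *: "a \<in> free_filt n" "r \<in> rels" "p = a + r" unfolding Suc shorter_simps by blast
  show ?thesis unfolding *(3) by (rule shorter_add[OF free_filt_shorter[OF *(1)] rels_shorter[OF *(2)]]) (use Suc kl in simp)
qed (simp add: shorter_simps rels_shorter)

lemma shorter_letter: "p \<in> shorter k \<Longrightarrow> x \<in> lie_space X \<Longrightarrow> letter x * p \<in> shorter (Suc k)"
proof (cases k)
  case 0
  assume "p \<in> shorter k" "x \<in> lie_space X"
  then show ?thesis using rels_shorter[OF rels_mult(1)[OF _ free_letter]] by (simp add: 0 shorter_simps(1))
next
  case (Suc n)
  assume "p \<in> shorter k" and x: "x \<in> lie_space X"
  then obtain a r where *: "a \<in> free_filt n" "r \<in> rels" "p = a + r" unfolding Suc shorter_simps by blast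
  have "letter x * a \<in> free_filt (1 + n)" by (rule free_filt_mult[OF free_filt_letter[OF x] *(1)])
  then show ?thesis unfolding *(3) distrib_left Suc
    by (intro shorter_add free_filt_shorter[of _ "1 + n"] rels_shorter rels_mult(1)[OF *(2) free_letter[OF x]]) auto
qed

lemma shorter_sum_list: "(\<And>z. z \<in> set zs \<Longrightarrow> F z \<in> shorter k) \<Longrightarrow> (\<Sum>z\<leftarrow>zs. F z) \<in> shorter k"
  by (induction zs) (auto intro: shorter_add rels_shorter rels_zero)

subsection \<open>Contraction\<close>

text \<open>Contraction with \<open>f\<close> lifts to words the operation \<open>\<phi> \<mapsto> \<phi>(\<sqdot> f)\<close> on functionals, in leading order.\<close>

primrec contract :: "bit \<Rightarrow> 'a \<Rightarrow> ('a \<Rightarrow> 'k) list \<Rightarrow> (('a \<Rightarrow> 'k) free_monoid \<Rightarrow>\<^sub>0 'k)" where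
  "contract q f [] = 0"
| "contract q f (x # w) = single (Word w) (x f) + letter (twist q x) * contract q f w"

lemma contract_filt: "set w \<subseteq> lie_space X \<Longrightarrow> contract q f w \<in> free_filt (length w - 1)"
proof (induction w)
  case (Cons x w)
  have "letter (twist q x) * contract q f w \<in> free_filt (length w)"
  proof (cases w)
    case (Cons z v)
    then show ?thesis
      using free_filt_mult[OF free_filt_letter[OF lie_space_twist[of x q]], of "contract q f w" "length w - 1"]
        Cons.IH Cons.prems by simp
  qed (simp add: free_filt_zero)
  then show ?case using Cons.prems by (auto intro!: free_filt_add free_filt_single)
qed (simp add: free_filt_zero)

lemma contract_free: "set w \<subseteq> lie_space X \<Longrightarrow> contract q f w \<in> free_carrier"
  using contract_filt free_filt_carrier by blast

text \<open>By \<open>conv_vanish\<close>, applied to the difference.\<close>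

lemma conv_agree:
  assumes x: "primitive x" and d: "\<phi> \<in> Dual" "\<psi> \<in> Dual" and agree: "\<And>F. F \<in> aug_pow (n - 1) \<Longrightarrow> \<phi> F = \<psi> F"
    and F: "F \<in> aug_pow n"
  shows "(x \<star> \<phi>) F = (x \<star> \<psi>) F"
proof (cases n)
  case 0
  then have "\<phi> = \<psi>" using agree by (intro Dual_eqI_carrier[OF d]) simp
  then show ?thesis by simp
next
  case (Suc k)
  have xD: "x \<in> Dual" using x by (simp add: primitive_def)
  have Fc: "F \<in> carrier X" using F aug_pow_closed by blast
  define \<delta> where "\<delta> = \<phi> \<oplus>\<^bsub>dual\<^esub> (- 1) \<odot>\<^bsub>dual\<^esub> \<psi>"
  have dD: "\<delta> \<in> Dual" unfolding \<delta>_def using d by (intro dual_closed)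
  have "\<delta> f = 0" if "f \<in> aug_pow k" for f
    using agree[of f] that aug_pow_closed[OF that] Suc by (simp add: \<delta>_def dual_add_apply dual_smult_apply)
  then have "(x \<star> \<delta>) F = 0" using conv_vanish[OF x dD, of k F] F Suc by blast
  moreover have "x \<star> \<delta> = x \<star> \<phi> \<oplus>\<^bsub>dual\<^esub> (- 1) \<odot>\<^bsub>dual\<^esub> (x \<star> \<psi>)"
    unfolding \<delta>_def using conv_linear(2)[OF d(1) dual_closed(2)[OF d(2)] xD] conv_linear(4)[OF xD d(2)] by simp
  ultimately show ?thesis using Fc by (simp add: dual_add_apply dual_smult_apply)
qed

lemma eval_contract:
  assumes f: "f \<in> aug" "f \<in> homog X q" and w: "set w \<subseteq> lie_space X" and F: "F \<in> aug_pow (length w - 1)"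
  shows "eval_free (contract q f w) F = word_product w (F \<otimes> f)"
  using w F
proof (induction w arbitrary: F)
  case Nil
  then show ?case using f by (simp add: eval_free_zero dual_zero_apply aug_iff counit_mult)
next
  case (Cons x w)
  have x: "x \<in> lie_space X" "twist q x \<in> lie_space X" and w: "set w \<subseteq> lie_space X" using Cons lie_space_twist by auto
  have xD: "x \<in> Dual" "twist q x \<in> Dual" using x by (auto simp: lie_space_iff)
  have F: "F \<in> aug_pow (length w)" using Cons by simp
  have Fc: "F \<in> carrier X" using F aug_pow_closed by blast
  have fc: "f \<in> carrier X" using f by (simp add: aug_iff)
  note W = word_product_Dual[OF w]
  have 1: "(twist q x \<star> eval_free (contract q f w)) F = (twist q x \<star> translate_right (word_product w) f) F"
  proof (rule conv_agree[OF lie_space_primitive[OF x(2)] eval_free_Dual[OF contract_free[OF w]] translate_Dual(1)[OF W fc] _ F])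
    fix G assume G: "G \<in> aug_pow (length w - 1)"
    show "eval_free (contract q f w) G = translate_right (word_product w) f G"
      unfolding translate_apply(1)[OF aug_pow_closed[OF G]] by (rule Cons.IH[OF w G])
  qed
  have 2: "(x \<star> translate_left F (word_product w)) f = word_product w F * x f"
  proof -
    have "(x \<star> translate_left F (word_product w)) f = translate_left F (word_product w) \<one> * x f"
    proof (rule conv_vanish_aug[OF xD(1) translate_Dual(2)[OF W Fc] _ fc])
      fix b assume b: "b \<in> aug"
      have "word_product w (F \<otimes> b) = 0" by (rule word_product_vanish[OF w aug_pow_mult_aug[OF F b]])
      then show "translate_left F (word_product w) b = 0" using b by (simp add: translate_apply aug_iff)
    qed
    then show ?thesis using Fc by (simp add: translate_apply)
  qed
  have "eval_free (contract q f (x # w)) F = x f * word_product w F + (twist q x \<star> eval_free (contract q f w)) F"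
    using w x contract_free[OF w] Fc
    by (simp add: eval_free_add free_single free_mult free_letter eval_free_mult eval_free_letter eval_free_single dual_add_apply dual_smult_apply)
  then show ?case
    using conv_derivation[OF lie_space_primitive[OF x(1)] W f(2) Fc] 1 2 by simp
qed

text \<open>Expanding the last contraction step, the terms that remove the first letter \<open>y\<close> add up to the word itself, since
  \<open>\<Sum> y(f\<^sub>j) x\<^sub>j = y\<close>. In the other terms the letter \<open>x\<^sub>j\<close> is moved past \<open>y\<close>, at the cost of a
  shorter word (\<open>commute_letters\<close>), and induction applies to the rest of the word.\<close>

lemma euler_word:
  assumes D: "dual_basis D" and w: "set w \<subseteq> lie_space X"
  shows "(\<Sum>(q, x, f)\<leftarrow>D. letter x * contract q f w) - single (Word w) (of_nat (length w)) \<in> shorter (length w)"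
  using w
proof (induction w)
  case Nil
  then show ?case by (simp add: case_prod_unfold shorter_simps rels_zero)
next
  case (Cons y w)
  have y: "y \<in> lie_space X" and w: "set w \<subseteq> lie_space X" using Cons by auto
  let ?W = "single (Word w) (1 :: 'k)"
  have Wf: "?W \<in> free_carrier" using free_single[OF w] .
  have yexp: "letter y - (\<Sum>(q, x, f)\<leftarrow>D. pm_scale (y f) (letter x)) \<in> rels"
  proof -
    have "\<exists>z\<in>lie_space X. (\<forall>a\<in>carrier X. z a = (\<Sum>(q, x, f)\<leftarrow>E. y f * x a)) \<and>
        letter z - (\<Sum>(q, x, f)\<leftarrow>E. pm_scale (y f) (letter x)) \<in> rels" if "set E \<subseteq> set D" for E
      using that
    proof (induction E)
      case Nil
      have z: "\<zero>\<^bsub>dual\<^esub> \<in> lie_space X" by (rule lie_space_closed(4))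
      have "letter \<zero>\<^bsub>dual\<^esub> \<in> rels" using letter_smult_rels[OF z, of 0] by simp
      then show ?case using z by (intro bexI[OF _ z]) (auto simp: dual_zero_apply)
    next
      case (Cons e E)
      obtain q x f where e: "e = (q, x, f)" by (cases e)
      then have "(q, x, f) \<in> set D" using Cons by auto
      note d = dual_basisD[OF D this]
      obtain z where z: "z \<in> lie_space X" "\<forall>a\<in>carrier X. z a = (\<Sum>(q, x, f)\<leftarrow>E. y f * x a)"
        "letter z - (\<Sum>(q, x, f)\<leftarrow>E. pm_scale (y f) (letter x)) \<in> rels" using Cons by auto
      let ?u = "y f \<odot>\<^bsub>dual\<^esub> x"
      have u: "?u \<in> lie_space X" by (rule lie_space_closed(2)[OF d(3)])
      have "letter (?u \<oplus>\<^bsub>dual\<^esub> z) - (\<Sum>(q, x, f)\<leftarrow>e # E. pm_scale (y f) (letter x)) =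
          (letter (?u \<oplus>\<^bsub>dual\<^esub> z) - letter ?u - letter z) + (letter ?u - pm_scale (y f) (letter x)) +
          (letter z - (\<Sum>(q, x, f)\<leftarrow>E. pm_scale (y f) (letter x)))" by (simp add: e)
      also have "\<dots> \<in> rels"
        by (intro rels_add letter_add_rels[OF u z(1)] letter_smult_rels[OF d(3)] z(3))
      finally show ?case using z(2) lie_space_closed(1)[OF u z(1)]
        by (intro bexI[where x = "?u \<oplus>\<^bsub>dual\<^esub> z"]) (auto simp: e dual_add_apply dual_smult_apply)
    qed
    then obtain z where z: "z \<in> lie_space X" "\<forall>a\<in>carrier X. z a = (\<Sum>(q, x, f)\<leftarrow>D. y f * x a)"
        "letter z - (\<Sum>(q, x, f)\<leftarrow>D. pm_scale (y f) (letter x)) \<in> rels" by blast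
    have "z = y" using z(1,2) y dual_basis_lie[OF D y] by (intro Dual_eqI_carrier) (auto simp: lie_space_iff)
    then show ?thesis using z(3) by simp
  qed
  have comm: "letter x * letter (twist q y) * contract q f w - letter y * (letter x * contract q f w) \<in> shorter (Suc (length w))"
    if "(q, x, f) \<in> set D" for q x f
  proof -
    note d = dual_basisD[OF D that]
    obtain r where r: "r \<in> free_filt 1" "letter x * letter (twist q y) - letter y * letter x - r \<in> rels"
      using commute_letters[OF d(3,4) y] by blast
    have "r * contract q f w \<in> free_filt (length w)"
      using free_filt_mult[OF r(1) contract_filt[OF w, of q f]] by (cases w) (auto simp: free_filt_zero)
    then have "r * contract q f w \<in> shorter (Suc (length w))" by (rule free_filt_shorter) simp
    moreover have "(letter x * letter (twist q y) - letter y * letter x - r) * contract q f w \<in> shorter (Suc (length w))"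
      by (rule rels_shorter[OF rels_mult(2)[OF r(2) contract_free[OF w]]])
    ultimately have "(letter x * letter (twist q y) - letter y * letter x - r) * contract q f w + r * contract q f w \<in> shorter (Suc (length w))"
      by (intro shorter_add)
    then show ?thesis by (simp add: left_diff_distrib mult.assoc)
  qed
  have e: "(\<Sum>(q, x, f)\<leftarrow>D. letter x * contract q f (y # w)) - single (Word (y # w)) (of_nat (length (y # w))) =
      - ((letter y - (\<Sum>(q, x, f)\<leftarrow>D. pm_scale (y f) (letter x))) * ?W) +
      (\<Sum>(q, x, f)\<leftarrow>D. letter x * letter (twist q y) * contract q f w - letter y * (letter x * contract q f w)) +
      letter y * ((\<Sum>(q, x, f)\<leftarrow>D. letter x * contract q f w) - single (Word w) (of_nat (length w)))"
  proof -
    have s: "single (Word w) c = pm_scale c ?W" for c by (simp add: pm_scale_single)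
    have a: "(\<Sum>(q, x, f)\<leftarrow>E. letter x * contract q f (y # w)) =
        (\<Sum>(q, x, f)\<leftarrow>E. pm_scale (y f) (letter x)) * ?W +
        (\<Sum>(q, x, f)\<leftarrow>E. letter x * letter (twist q y) * contract q f w - letter y * (letter x * contract q f w)) +
        letter y * (\<Sum>(q, x, f)\<leftarrow>E. letter x * contract q f w)" for E :: "(bit \<times> ('a \<Rightarrow> 'k) \<times> 'a) list"
    proof (induction E)
      case (Cons e E)
      obtain q x f where "e = (q, x, f)" by (cases e)
      then show ?case
        using Cons by (simp add: distrib_left distrib_right s[of "y f"] pm_scale_mult mult.assoc)
    qed simp
    have l: "single (Word (y # w)) c = letter y * single (Word w) c" for c
      using single_word_mult[of "[y]" 1 w c] by (simp add: letter_def)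
    have n: "single (Word (y # w)) (of_nat (length (y # w))) =
        letter y * ?W + letter y * single (Word w) (of_nat (length w))"
      unfolding l by (simp add: single_add distrib_left)
    show ?thesis unfolding a n by (simp add: left_diff_distrib right_diff_distrib)
  qed
  have S: "(\<Sum>(q, x, f)\<leftarrow>D. letter x * letter (twist q y) * contract q f w - letter y * (letter x * contract q f w)) \<in> shorter (Suc (length w))"
    by (rule shorter_sum_list) (use comm in auto)
  have L: "length (y # w) = Suc (length w)" by simp
  show ?case unfolding e unfolding L
    by (intro shorter_add S shorter_letter[OF Cons.IH[OF w] y] rels_shorter[OF rels_uminus[OF rels_mult(2)[OF yexp Wf]]])
qed

definition contraction :: "bit \<Rightarrow> 'a \<Rightarrow> (('a \<Rightarrow> 'k) free_monoid \<Rightarrow>\<^sub>0 'k) \<Rightarrow> (('a \<Rightarrow> 'k) free_monoid \<Rightarrow>\<^sub>0 'k)" where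
  "contraction q f = linear_extension (ue_free (Lie X)) (\<lambda>w. contract q f (letters w))"

lemma contract_word_free: "p \<in> free_carrier \<Longrightarrow> k \<in> keys p \<Longrightarrow> contract q f (letters k) \<in> free_carrier"
proof -
  assume "p \<in> free_carrier" "k \<in> keys p"
  then have "set (letters k) \<subseteq> lie_space X" by (simp add: free_carrier_iff)
  then show ?thesis by (rule contract_free)
qed

lemma contraction_add: "p \<in> free_carrier \<Longrightarrow> p' \<in> free_carrier \<Longrightarrow>
    contraction q f (p + p') = contraction q f p + contraction q f p'"
  unfolding contraction_def
  by (subst linear_extension_add[OF free_module]) (auto simp: free_simps intro: contract_word_free)

lemma contraction_single: "set w \<subseteq> lie_space X \<Longrightarrow>
    contraction q f (single (Word w) c) = pm_scale c (contract q f w)"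
  unfolding contraction_def
  using linear_extension_single[OF free_module, of "\<lambda>w. contract q f (letters w)" "Word w" c] contract_free
  by (simp add: free_simps)

lemma contraction_zero: "contraction q f 0 = 0"
  by (simp add: contraction_def linear_extension_def free_simps abelian_monoid.finsum_empty[OF abelian_group.axioms(1)[OF ring.is_abelian_group[OF free_ring]]])

lemma contraction_filt: "p \<in> free_filt (Suc k) \<Longrightarrow> contraction q f p \<in> free_filt k"
proof (induction p rule: free_filt_induct)
  case (single w c)
  have "contract q f w \<in> free_filt k"
    by (rule free_filt_mono[OF contract_filt[OF single(1)]]) (use single(2) in simp)
  then show ?case using single by (simp add: contraction_single free_filt_scale)
qed (auto simp: contraction_zero contraction_add free_filt_zero free_filt_add free_filt_carrier)

lemma eval_contraction:
  assumes f: "f \<in> aug" "f \<in> homog X q" and p: "p \<in> free_filt (Suc k)" and F: "F \<in> aug_pow k"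
  shows "eval_free (contraction q f p) F = eval_free p (F \<otimes> f)"
  using p
proof (induction p rule: free_filt_induct)
  have c: "F \<in> carrier X" "F \<otimes> f \<in> carrier X" using F f aug_pow_closed by (auto simp: aug_iff)
  {
    case zero
    then show ?case using c by (simp add: contraction_zero eval_free_zero dual_zero_apply)
  next
    case (single w d)
    have "F \<in> aug_pow (length w - 1)"
    proof -
      have "length w - 1 \<le> k" using single by simp
      then show ?thesis using F by (induction k rule: dec_induct) (auto dest: aug_pow_Suc_subset simp del: ideal_pow.simps)
    qed
    from eval_contract[OF f single(1) this] show ?case
      using c single(1) contract_free[OF single(1)]
      by (simp add: contraction_single eval_free_scale eval_free_single dual_smult_apply)
  next
    case (add p p')
    then show ?case using c
      by (simp add: contraction_add free_filt_carrier eval_free_add contraction_filt[THEN free_filt_carrier] dual_add_apply)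
  }
qed

lemma euler_free:
  assumes D: "dual_basis D" and p: "p \<in> free_filt (Suc k)"
  shows "(\<Sum>(q, x, f)\<leftarrow>D. letter x * contraction q f p) - pm_scale (of_nat (Suc k)) p \<in> shorter (Suc k)"
  using p
proof (induction p rule: free_filt_induct)
  case zero
  then show ?case by (simp add: contraction_zero case_prod_unfold rels_shorter rels_zero)
next
  case (add p p')
  have "(\<Sum>(q, x, f)\<leftarrow>D. letter x * contraction q f (p + p')) - pm_scale (of_nat (Suc k)) (p + p') =
      ((\<Sum>(q, x, f)\<leftarrow>D. letter x * contraction q f p) - pm_scale (of_nat (Suc k)) p) +
      ((\<Sum>(q, x, f)\<leftarrow>D. letter x * contraction q f p') - pm_scale (of_nat (Suc k)) p')"
    using add(1,2) by (simp add: contraction_add free_filt_carrier distrib_left case_prod_unfold sum_list_addf pm_scale_add del: of_nat_Suc)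
  then show ?case using shorter_add[OF add(3,4)] by simp
next
  case (single w c)
  let ?W = "single (Word w) (1 :: 'k)"
  have sum: "(\<Sum>(q, x, f)\<leftarrow>E. letter x * contraction q f (single (Word w) c)) =
      pm_scale c (\<Sum>(q, x, f)\<leftarrow>E. letter x * contract q f w)" for E
    by (induction E) (auto simp: contraction_single single(1) pm_scale_mult pm_scale_add)
  have e: "(\<Sum>(q, x, f)\<leftarrow>D. letter x * contraction q f (single (Word w) c)) - pm_scale (of_nat (Suc k)) (single (Word w) c) =
      pm_scale c ((\<Sum>(q, x, f)\<leftarrow>D. letter x * contract q f w) - single (Word w) (of_nat (length w))) +
      pm_scale (c * (of_nat (length w) - of_nat (Suc k))) ?W"
    unfolding sum pm_scale_diff by (simp add: pm_scale_single algebra_simps single_diff[symmetric] single_add[symmetric] del: of_nat_Suc)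
  have "pm_scale c ((\<Sum>(q, x, f)\<leftarrow>D. letter x * contract q f w) - single (Word w) (of_nat (length w))) \<in> shorter (Suc k)"
    by (rule shorter_scale[OF shorter_mono[OF euler_word[OF D single(1)] single(2)]])
  moreover have "pm_scale (c * (of_nat (length w) - of_nat (Suc k))) ?W \<in> shorter (Suc k)"
  proof (cases "length w = Suc k")
    case False
    then have "length w < Suc k" using single(2) by simp
    then show ?thesis by (intro shorter_scale free_filt_shorter[OF free_filt_single[OF single(1) order_refl]])
  qed (simp add: rels_shorter rels_zero)
  ultimately show ?case unfolding e by (rule shorter_add)
qed

text \<open>The contractions of \<open>p\<close> vanish one power lower, so by induction they are shorter; the Euler identity turns this
  into the claim for a multiple of \<open>p\<close>.\<close>

lemma vanishing_shorter:
  "p \<in> free_filt n \<Longrightarrow> (\<And>F. F \<in> aug_pow n \<Longrightarrow> eval_free p F = 0) \<Longrightarrow> p \<in> shorter n"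
proof (induction n arbitrary: p)
  case 0
  have "keys p \<subseteq> {Word []}"
    using 0(1) by (auto simp: free_filt_def) (metis free_monoid.collapse)
  then have p: "p = single (Word []) (lookup p (Word []))"
    by (intro poly_mapping_eqI) (auto simp: lookup_single when_def in_keys_iff)
  have "eval_free p \<one> = lookup p (Word [])"
    by (subst p, subst eval_free_single) (auto simp: dual_smult_apply)
  then have "lookup p (Word []) = 0" using 0(2)[of \<one>] by simp
  then have "p = 0" using p by simp
  then show ?case by (simp add: shorter_simps rels_zero)
next
  case (Suc k)
  obtain D where D: "dual_basis D" using dual_basis_exists by blast
  have "letter x * contraction q f p \<in> shorter (Suc k)" if "(q, x, f) \<in> set D" for q x f
  proof (rule shorter_letter)
    note d = dual_basisD[OF D that]
    show "x \<in> lie_space X" by (rule d(3))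
    show "contraction q f p \<in> shorter k"
    proof (rule Suc.IH[OF contraction_filt[OF Suc(2)]])
      fix F assume F: "F \<in> aug_pow k"
      show "eval_free (contraction q f p) F = 0"
        unfolding eval_contraction[OF d(2,1) Suc(2) F] by (rule Suc(3)[OF aug_pow_mult_aug[OF F d(2)]])
    qed
  qed
  then have "(\<Sum>(q, x, f)\<leftarrow>D. letter x * contraction q f p) \<in> shorter (Suc k)" by (intro shorter_sum_list) auto
  from shorter_diff[OF this euler_free[OF D Suc(2)]]
  have "pm_scale (of_nat (Suc k)) p \<in> shorter (Suc k)" by simp
  \<comment> \<open>Characteristic zero enters a second time.\<close>
  from shorter_scale[OF this, of "inverse (of_nat (Suc k))"]
  show ?case using char_zero[of k] by (simp del: of_nat_Suc flip: pm_scale_scale)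
qed

theorem eval_free_kernel:
  assumes "p \<in> free_carrier" "\<And>F. F \<in> carrier X \<Longrightarrow> eval_free p F = 0" shows "p \<in> rels"
proof -
  have *: "p \<in> rels" if "p \<in> free_filt n" "\<And>F. F \<in> carrier X \<Longrightarrow> eval_free p F = 0" for n p
    using that
  proof (induction n arbitrary: p rule: nat_less_induct)
    case (1 n)
    have "p \<in> shorter n" using vanishing_shorter[OF 1(2)] 1(3) aug_pow_closed by blast
    then show ?case
    proof (cases n)
      case (Suc k)
      then obtain a r where ar: "a \<in> free_filt k" "r \<in> rels" "p = a + r"
        using \<open>p \<in> shorter n\<close> unfolding Suc shorter_simps by blast
      have "eval_free a F = 0" if F: "F \<in> carrier X" for F
        using 1(3)[OF F] ar rels_free free_filt_carrier eval_free_rels[OF ar(2) F] F by (simp add: eval_free_add dual_add_apply)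
      then have "a \<in> rels" using 1(1) ar(1) Suc by blast
      then show ?thesis unfolding ar(3) by (rule rels_add[OF _ ar(2)])
    qed (simp add: shorter_simps)
  qed
  define n where "n = Max (insert 0 ((\<lambda>w. length (letters w)) ` keys p))"
  have "length (letters w) \<le> n" if "w \<in> keys p" for w
    unfolding n_def by (rule Max_ge) (use that in auto)
  then have "p \<in> free_filt n" using assms(1) by (simp add: free_filt_def)
  then show ?thesis using * assms(2) by blast
qed

end

section \<open>The antipode on products with primitive functionals\<close>

context hopf_superalgebra
begin

text \<open>Inversion exchanges left and right invariant derivations. \<open>leibniz_defect\<close> is the failure of this,
  paired with \<open>\<psi>\<close> after right multiplication by \<open>c\<close>.\<close>

definition leibniz_defect :: "('a \<Rightarrow> 'k) \<Rightarrow> ('a \<Rightarrow> 'k) \<Rightarrow> 'a \<Rightarrow> 'a \<Rightarrow> 'k" where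
  "leibniz_defect \<psi> x c a = (x \<star> translate_right \<psi> c) (antipode A a) +
     tensor_lift ground (\<lambda>u v. \<psi> (antipode A u \<otimes> c) * x v) (comult A a)"

lemma twist_twist: "x \<in> Dual \<Longrightarrow> twist p (twist q x) = twist (p + q) x"
  by (rule Dual_eqI) (auto intro!: twist_Dual simp: twist_homog twist_Dual koszul_add)

lemma twist_zero: "x \<in> Dual \<Longrightarrow> twist 0 x = x"
  by (rule Dual_eqI) (auto intro!: twist_Dual simp: twist_homog)

context
  fixes \<psi> assumes psi: "\<psi> \<in> Dual"
begin

lemma defect_kernel:
  assumes "x \<in> Dual" "c \<in> carrier A"
  shows "bilinear A A ground (\<lambda>u v. \<psi> (antipode A u \<otimes> c) * x v)"
  by (rule bilinear_mult[OF functionals_comp[OF DualD[OF psi] linear_map_comp[OF mult_linear_left[OF assms(2)] antipode_linear]] DualD[OF assms(1)]])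

lemma defect_functional: 
  assumes x: "x \<in> Dual"
  shows "c \<in> carrier A \<Longrightarrow> leibniz_defect \<psi> x c \<in> functionals A"
    and "a \<in> carrier A \<Longrightarrow> (\<lambda>c. leibniz_defect \<psi> x c a) \<in> functionals A"
proof -
  show "leibniz_defect \<psi> x c \<in> functionals A" if c: "c \<in> carrier A"
    unfolding leibniz_defect_def
    by (intro functionals_plus functionals_comp[OF DualD[OF conv_Dual[OF x translate_Dual(1)[OF psi c]]] antipode_linear]
        XD.lift_Delta defect_kernel x c)
  assume a: "a \<in> carrier A"
  have sa: "antipode A a \<in> carrier A" by (rule antipode_closed[OF a])
  have t: "comult A a \<in> carrier (tensor A A)" by (rule linear_map_closed[OF comult_linear a])
  have "translate_right \<psi> (c \<oplus> d) = translate_right \<psi> c \<oplus>\<^bsub>dual\<^esub> translate_right \<psi> d"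
    if "c \<in> carrier A" "d \<in> carrier A" for c d
    using that by (auto simp: translate_right_def dual_ops r_distr functional_add[OF DualD[OF psi]])
  moreover have "translate_right \<psi> (k \<odot> c) = k \<odot>\<^bsub>dual\<^esub> translate_right \<psi> c" if "c \<in> carrier A" for k c
    using that by (auto simp: translate_right_def dual_ops smult_mult_right functional_smult[OF DualD[OF psi]])
  ultimately have 1: "(\<lambda>c. (x \<star> translate_right \<psi> c) (antipode A a)) \<in> functionals A"
    using sa by (auto simp: functionals_iff[of "\<lambda>c. (x \<star> translate_right \<psi> c) (antipode A a)"]
        conv_linear(2)[OF _ _ x] conv_linear(4)[OF x] translate_Dual psi dual_add_apply dual_smult_apply)
  have "trilinear A A A ground (\<lambda>c u v. \<psi> (antipode A u \<otimes> c) * x v)"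
    unfolding trilinear_def
  proof (intro conjI ballI)
    fix u v assume uv: "u \<in> carrier A" "v \<in> carrier A"
    show "(\<lambda>c. \<psi> (antipode A u \<otimes> c) * x v) \<in> functionals A"
      by (intro functionals_scale_right functionals_comp[OF DualD[OF psi] mult_linear_right] antipode_closed uv)
  qed (rule defect_kernel[OF x])
  from XX.lift_trilinear[OF module_A ground_module this]
  have 2: "(\<lambda>c. tensor_lift ground (\<lambda>u v. \<psi> (antipode A u \<otimes> c) * x v) (comult A a)) \<in> functionals A"
    using t by (auto simp: bilinear_def)
  show "(\<lambda>c. leibniz_defect \<psi> x c a) \<in> functionals A"
    unfolding leibniz_defect_def by (rule functionals_plus[OF 1 2])
qed

lemma primitive_one: "primitive x \<Longrightarrow> x \<one> = 0"
proof -
  assume "primitive x"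
  then have "x (\<one> \<otimes> \<one>) = x \<one> * counit A \<one> + counit A \<one> * x \<one>" unfolding primitive_def by blast
  then have "x \<one> = x \<one> + x \<one>" by (simp only: l_one[OF one_closed] counit_one mult_1_left mult_1_right)
  then show ?thesis by (metis add_cancel_right_right)
qed

text \<open>Apply \<open>x \<psi>\<close> to \<open>\<Sum> s(f\<^sub>1) f\<^sub>2 = \<epsilon>(f)\<close>, where it gives zero because \<open>x\<close> vanishes at the
  identity, and expand by the Leibniz rule.\<close>

lemma defect_sum:
  assumes x: "primitive x" and f: "f \<in> homog A r" and c: "c \<in> carrier A"
  shows "(\<Sum>(i, a, b)\<leftarrow>sweedler r f. leibniz_defect \<psi> (twist (r + i) x) (b \<otimes> c) a) = 0"
proof -
  have xD: "x \<in> Dual" using x by (simp add: primitive_def)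
  define \<psi>' where "\<psi>' = translate_right \<psi> c"
  have p': "\<psi>' \<in> Dual" unfolding \<psi>'_def by (rule translate_Dual(1)[OF psi c])
  define \<gamma> :: "bit \<Rightarrow> bit \<Rightarrow> bit \<Rightarrow> 'a \<Rightarrow> 'a \<Rightarrow> 'a \<Rightarrow> 'k"
    where "\<gamma> = (\<lambda>i j k a u v. koszul j k * (\<psi>' (antipode A a \<otimes> v) * x u))"
  have g: "trilinear A A A ground (\<gamma> i j k)" for i j k
  proof -
    have "trilinear A A A ground (\<lambda>a u v. \<psi>' (antipode A a \<otimes> v) * x u)"
      unfolding trilinear_def
    proof (intro conjI ballI)
      fix a assume a: "a \<in> carrier A"
      show "bilinear A A ground (\<lambda>u v. \<psi>' (antipode A a \<otimes> v) * x u)"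
        by (rule bilinear_flip, rule bilinear_mult[OF functionals_comp[OF DualD[OF p'] mult_linear_right[OF antipode_closed[OF a]]] DualD[OF xD]])
    next
      fix u v assume uv: "u \<in> carrier A" "v \<in> carrier A"
      show "(\<lambda>a. \<psi>' (antipode A a \<otimes> v) * x u) \<in> functionals A"
        by (intro functionals_scale_right functionals_comp[OF DualD[OF p'] linear_map_comp[OF mult_linear_left[OF uv(2)] antipode_linear]])
    qed
    then show ?thesis unfolding \<gamma>_def by (rule trilinear_scale)
  qed
  have "(\<Sum>(i, a, b)\<leftarrow>sweedler r f. (x \<star> \<psi>') (antipode A a \<otimes> b)) = counit A f * (x \<star> \<psi>') \<one>"
    by (rule sweedler_antipode(1)[OF f DualD[OF conv_Dual[OF xD p']]])
  then have "0 = (\<Sum>(i, a, b)\<leftarrow>sweedler r f. (x \<star> \<psi>') (antipode A a \<otimes> b))"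
    using conv_one[OF xD p'] primitive_one[OF x] by simp
  also have "\<dots> = (\<Sum>(i, a, b)\<leftarrow>sweedler r f. (twist (r + i) x \<star> translate_right \<psi>' b) (antipode A a) +
      (\<Sum>(j, u, v)\<leftarrow>sweedler (r + i) b. \<gamma> i j (r + i + j) a u v))"
  proof (rule sweedler_sum_cong[OF f])
    fix i a b assume ab: "a \<in> homog A i" "b \<in> homog A (r + i)"
    have sa: "antipode A a \<in> carrier A" using ab(1) homog_closed antipode_closed by blast
    have "(x \<star> translate_left (antipode A a) \<psi>') b = (\<Sum>(j, u, v)\<leftarrow>sweedler (r + i) b. \<gamma> i j (r + i + j) a u v)"
      unfolding conv_sweedler[OF xD translate_Dual(2)[OF p' sa] ab(2)]
      by (rule sweedler_sum_cong[OF ab(2)]) (simp add: \<gamma>_def translate_apply homog_closed mult.commute)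
    then show "(x \<star> \<psi>') (antipode A a \<otimes> b) = (twist (r + i) x \<star> translate_right \<psi>' b) (antipode A a) +
        (\<Sum>(j, u, v)\<leftarrow>sweedler (r + i) b. \<gamma> i j (r + i + j) a u v)"
      using conv_derivation[OF x p' ab(2) sa] by simp
  qed
  also have "\<dots> = (\<Sum>(i, a, b)\<leftarrow>sweedler r f. (twist (r + i) x \<star> translate_right \<psi>' b) (antipode A a)) +
      (\<Sum>(i, a, b)\<leftarrow>sweedler r f. \<Sum>(j, u, v)\<leftarrow>sweedler (r + i) b. \<gamma> i j (r + i + j) a u v)"
    by (simp add: case_prod_unfold sum_list_addf)
  also have "(\<Sum>(i, a, b)\<leftarrow>sweedler r f. \<Sum>(j, u, v)\<leftarrow>sweedler (r + i) b. \<gamma> i j (r + i + j) a u v) =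
      (\<Sum>(i, a, b)\<leftarrow>sweedler r f. \<Sum>(j, u, v)\<leftarrow>sweedler i a. \<gamma> j (i + j) (r + i) u v b)"
    by (rule sweedler_coassoc[OF g f, symmetric])
  also have "(\<Sum>(i, a, b)\<leftarrow>sweedler r f. (twist (r + i) x \<star> translate_right \<psi>' b) (antipode A a)) +
      (\<Sum>(i, a, b)\<leftarrow>sweedler r f. \<Sum>(j, u, v)\<leftarrow>sweedler i a. \<gamma> j (i + j) (r + i) u v b) =
      (\<Sum>(i, a, b)\<leftarrow>sweedler r f. (twist (r + i) x \<star> translate_right \<psi>' b) (antipode A a) +
        (\<Sum>(j, u, v)\<leftarrow>sweedler i a. \<gamma> j (i + j) (r + i) u v b))"
    by (simp add: case_prod_unfold sum_list_addf)
  also have "\<dots> = (\<Sum>(i, a, b)\<leftarrow>sweedler r f. leibniz_defect \<psi> (twist (r + i) x) (b \<otimes> c) a)"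
  proof (rule sweedler_sum_cong[OF f])
    fix i a b assume ab: "a \<in> homog A i" "b \<in> homog A (r + i)"
    have cc: "a \<in> carrier A" "b \<in> carrier A" using ab homog_closed by auto
    have "translate_right \<psi>' b = translate_right \<psi> (b \<otimes> c)"
      unfolding \<psi>'_def translate_right_def using cc c by (auto simp: m_assoc)
    moreover have "tensor_lift ground (\<lambda>u v. \<psi> (antipode A u \<otimes> (b \<otimes> c)) * twist (r + i) x v) (comult A a) =
        (\<Sum>(j, u, v)\<leftarrow>sweedler i a. \<gamma> j (i + j) (r + i) u v b)"
      unfolding sweedler_lift[OF ab(1) defect_kernel[OF twist_Dual[OF xD] m_closed[OF cc(2) c]]]
    proof (rule sweedler_sum_cong[OF ab(1)])
      fix j u v assume uv: "u \<in> homog A j" "v \<in> homog A (i + j)"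
      have su: "antipode A u \<in> carrier A" using uv(1) homog_closed antipode_closed by blast
      show "\<psi> (antipode A u \<otimes> (b \<otimes> c)) * twist (r + i) x v = \<gamma> j (i + j) (r + i) u v b"
        using su cc c by (simp add: \<gamma>_def twist_homog[OF xD uv(2)] \<psi>'_def translate_apply m_assoc)
    qed
    ultimately show "(twist (r + i) x \<star> translate_right \<psi>' b) (antipode A a) +
        (\<Sum>(j, u, v)\<leftarrow>sweedler i a. \<gamma> j (i + j) (r + i) u v b) = leibniz_defect \<psi> (twist (r + i) x) (b \<otimes> c) a"
      by (simp add: leibniz_defect_def)
  qed
  finally show ?thesis by simp
qed

text \<open>Convolving the previous identity with the antipode removes the summation.\<close>

lemma defect_zero:
  assumes x: "primitive x" and f: "f \<in> homog A r" shows "leibniz_defect \<psi> x \<one> f = 0"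
proof -
  have xD: "x \<in> Dual" using x by (simp add: primitive_def)
  define \<gamma> :: "bit \<Rightarrow> bit \<Rightarrow> bit \<Rightarrow> 'a \<Rightarrow> 'a \<Rightarrow> 'a \<Rightarrow> 'k"
    where "\<gamma> = (\<lambda>i j k u v b. leibniz_defect \<psi> (twist j (twist k x)) (v \<otimes> antipode A b) u)"
  have g: "trilinear A A A ground (\<gamma> i j k)" for i j k
    unfolding trilinear_def \<gamma>_def
  proof (intro conjI ballI)
    fix u assume u: "u \<in> carrier A"
    show "bilinear A A ground (\<lambda>v b. leibniz_defect \<psi> (twist j (twist k x)) (v \<otimes> antipode A b) u)"
      by (rule linear_map_bilinear[OF functional_mult_bilinear[OF defect_functional(2)[OF twist_Dual[OF twist_Dual[OF xD]] u]] linear_map_id antipode_linear])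
  next
    fix v b assume vb: "v \<in> carrier A" "b \<in> carrier A"
    show "leibniz_defect \<psi> (twist j (twist k x)) (v \<otimes> antipode A b) \<in> functionals A"
      by (rule defect_functional(1)[OF twist_Dual[OF twist_Dual[OF xD]] m_closed[OF vb(1) antipode_closed[OF vb(2)]]])
  qed
  have "(\<Sum>(i, a, b)\<leftarrow>sweedler r f. \<Sum>(j, u, v)\<leftarrow>sweedler i a. \<gamma> j (i + j) (r + i) u v b) = (\<Sum>(i, a, b)\<leftarrow>sweedler r f. 0)"
  proof (rule sweedler_sum_cong[OF f])
    fix i a b assume ab: "a \<in> homog A i" "b \<in> homog A (r + i)"
    have sb: "antipode A b \<in> carrier A" using ab(2) homog_closed antipode_closed by blast
    show "(\<Sum>(j, u, v)\<leftarrow>sweedler i a. \<gamma> j (i + j) (r + i) u v b) = 0"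
      unfolding \<gamma>_def by (rule defect_sum[OF primitive_twist[OF x] ab(1) sb])
  qed
  from trans[OF sweedler_coassoc[OF g f, symmetric] this]
  have "0 = (\<Sum>(i, a, b)\<leftarrow>sweedler r f. \<Sum>(j, u, v)\<leftarrow>sweedler (r + i) b. \<gamma> i j (r + i + j) a u v)"
    by (simp add: case_prod_unfold)
  also have "\<dots> = (\<Sum>(i, a, b)\<leftarrow>sweedler r f. leibniz_defect \<psi> x \<one> a * counit A b)"
  proof (rule sweedler_sum_cong[OF f])
    fix i a b assume ab: "a \<in> homog A i" "b \<in> homog A (r + i)"
    have ac: "a \<in> carrier A" using ab homog_closed by auto
    have "(\<Sum>(j, u, v)\<leftarrow>sweedler (r + i) b. \<gamma> i j (r + i + j) a u v) =
        (\<Sum>(j, u, v)\<leftarrow>sweedler (r + i) b. leibniz_defect \<psi> (twist (r + i) x) (u \<otimes> antipode A v) a)"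
    proof (rule sweedler_sum_cong[OF ab(2)])
      fix j u v
      have "j + (r + i + j) = r + i" by (cases i; cases j; cases r; simp)
      then show "\<gamma> i j (r + i + j) a u v = leibniz_defect \<psi> (twist (r + i) x) (u \<otimes> antipode A v) a"
        by (simp add: \<gamma>_def twist_twist[OF xD])
    qed
    also have "\<dots> = counit A b * leibniz_defect \<psi> (twist (r + i) x) \<one> a"
      by (rule sweedler_antipode(2)[OF ab(2) defect_functional(2)[OF twist_Dual[OF xD] ac]])
    also have "\<dots> = leibniz_defect \<psi> x \<one> a * counit A b"
      using counit_parity[OF ab(2)] by (elim disjE) (simp_all add: twist_zero[OF xD])
    finally show "(\<Sum>(j, u, v)\<leftarrow>sweedler (r + i) b. \<gamma> i j (r + i + j) a u v) = leibniz_defect \<psi> x \<one> a * counit A b" .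
  qed
  also have "\<dots> = leibniz_defect \<psi> x \<one> f"
    by (rule sweedler_counit(2)[OF f defect_functional(1)[OF xD one_closed]])
  finally show ?thesis by simp
qed

text \<open>On the left a left invariant, on the right a right invariant derivation is applied.\<close>

lemma conv_antipode:
  assumes x: "primitive x" and f: "f \<in> homog A r"
  shows "(x \<star> \<psi>) (antipode A f) = - (\<Sum>(i, a, b)\<leftarrow>sweedler r f. \<psi> (antipode A a) * x b)"
proof -
  have xD: "x \<in> Dual" using x by (simp add: primitive_def)
  have t: "translate_right \<psi> \<one> = \<psi>"
    by (rule Dual_eqI_carrier[OF translate_Dual(1)[OF psi one_closed] psi]) (simp add: translate_apply)
  have "tensor_lift ground (\<lambda>u v. \<psi> (antipode A u \<otimes> \<one>) * x v) (comult A f) = (\<Sum>(i, a, b)\<leftarrow>sweedler r f. \<psi> (antipode A a) * x b)"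
    unfolding sweedler_lift[OF f defect_kernel[OF xD one_closed]]
    by (rule sweedler_sum_cong[OF f]) (simp add: homog_closed antipode_closed)
  then show ?thesis using defect_zero[OF x f] by (simp add: leibniz_defect_def t add_eq_0_iff)
qed

end

end

section \<open>The enveloping superalgebra as an algebra of functionals\<close>

lemma Dist_simps: "carrier (Dist X) = carrier (dist_alg X)" "mult (Dist X) = mult (dist_alg X)"
  "one (Dist X) = one (dist_alg X)" "zero (Dist X) = zero (dist_alg X)" "add (Dist X) = add (dist_alg X)"
  "smult (Dist X) = smult (dist_alg X)" "homog (Dist X) = homog (dist_alg X)"
  "comult (Dist X) = dist_comult X" "counit (Dist X) = (\<lambda>\<phi>. \<phi> \<one>\<^bsub>X\<^esub>)"
  "antipode (Dist X) = (\<lambda>\<phi>. \<lambda>f\<in>carrier X. \<phi> (antipode X f))"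
  by (simp_all add: Dist_def superspace.defs hopf_superalg.defs)

lemma UE_simps: "carrier (UE L) = carrier (ue_alg L)" "mult (UE L) = mult (ue_alg L)"
  "one (UE L) = one (ue_alg L)" "zero (UE L) = zero (ue_alg L)" "add (UE L) = add (ue_alg L)"
  "smult (UE L) = smult (ue_alg L)" "homog (UE L) = homog (ue_alg L)"
  "comult (UE L) = ue_lift (tensor (ue_alg L) (ue_alg L))
     (\<lambda>x. tens (ue_alg L) (ue_alg L) (ue_incl L x) \<one>\<^bsub>ue_alg L\<^esub> \<oplus>\<^bsub>tensor (ue_alg L) (ue_alg L)\<^esub>
       tens (ue_alg L) (ue_alg L) \<one>\<^bsub>ue_alg L\<^esub> (ue_incl L x))"
  "counit (UE L) = ue_lift ground (\<lambda>x. 0)"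
  "antipode (UE L) = ue_lift (super_opposite (ue_alg L)) (\<lambda>x. \<ominus>\<^bsub>ue_alg L\<^esub> ue_incl L x)"
  by (simp_all add: UE_def Let_def superspace.defs hopf_superalg.defs)

lemma tensor_cong:
  fixes A :: "('k::field, 'a, 'm) superspace_scheme" and A' :: "('k, 'a, 'n) superspace_scheme"
  assumes "carrier A = carrier A'" "mult A = mult A'" "one A = one A'" "zero A = zero A'" "add A = add A'"
    "smult A = smult A'" "homog A = homog A'"
  shows "tensor A A = tensor A' A'" "tens A A = tens A' A'"
proof -
  have c: "component A = component A'" by (simp add: component_def[abs_def] assms)
  have F: "tensor_free A A = tensor_free A' A'" by (simp add: tensor_free_def assms c)
  have R: "tensor_relators A A = tensor_relators A' A'" by (simp add: tensor_relators_def assms)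
  have N: "tensor_null A A = tensor_null A' A'" by (simp add: tensor_null_def F R)
  show "tensor A A = tensor A' A'" "tens A A = tens A' A'"
    by (simp_all add: tensor_def tens_def[abs_def] F N)
qed

text \<open>Only the superalgebra part of a record matters; this moves results between \<^const>\<open>ue_alg\<close> and
  \<^const>\<open>UE\<close>, and between \<^const>\<open>dist_alg\<close> and \<^const>\<open>Dist\<close>.\<close>

lemma functional_model_cong:
  assumes "functional_model A B g" "carrier B' = carrier B" "mult B' = mult B" "one B' = one B" "zero B' = zero B"
    "add B' = add B" "smult B' = smult B" "homog B' = homog B"
  shows "functional_model A B' g"
  using assms(1) unfolding functional_model_def functional_model_axioms_def assms(2-) .

lemma dual_comult_cong:
  assumes m: "functional_model A B g" and e: "carrier B' = carrier B" "mult B' = mult B" "one B' = one B" "zero B' = zero B"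
    "add B' = add B" "smult B' = smult B" "homog B' = homog B"
  shows "functional_model.dual_comult A B' g = functional_model.dual_comult A B g"
proof -
  note m' = functional_model_cong[OF assms]
  have "tensor B' B' = tensor B B" by (rule tensor_cong) (simp_all add: e)
  then show ?thesis
    by (simp add: fun_eq_iff functional_model.dual_comult_def[OF m] functional_model.dual_comult_def[OF m']
        functional_model.pairing_def[OF m] functional_model.pairing_def[OF m'])
qed

context char_zero_supergroup
begin

abbreviation U where "U \<equiv> ue_alg (Lie X)"

abbreviation coset where "coset p \<equiv> rels +>\<^bsub>ue_free (Lie X)\<^esub> p"

sublocale UQ: pm_quotient "ue_free (Lie X)" rels
  by unfold_locales (auto simp: free_simps free_add free_scale rels_free rels_zero rels_add rels_scale)

lemma U_eq: "U = UQ.Q" by (simp add: ue_alg_def)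

lemma coset_in_U: "p \<in> free_carrier \<Longrightarrow> coset p \<in> carrier U"
  unfolding U_eq by (rule UQ.coset_in_Q)

lemma U_cases: assumes "u \<in> carrier U" obtains p where "p \<in> free_carrier" "u = coset p"
  using assms unfolding U_eq by (rule UQ.Q_cases)

lemma U_add: "coset p \<oplus>\<^bsub>U\<^esub> coset q = coset (p + q)" unfolding U_eq UQ.add_Q ..

lemma U_smult: "c \<odot>\<^bsub>U\<^esub> coset p = coset (pm_scale c p)" unfolding U_eq UQ.smult_Q ..

lemma U_zero: "\<zero>\<^bsub>U\<^esub> = coset 0" unfolding U_eq UQ.zero_Q ..

lemma U_one: "\<one>\<^bsub>U\<^esub> = coset 1" unfolding U_eq UQ.one_Q free_simps ..

lemma U_mult: "p \<in> free_carrier \<Longrightarrow> q \<in> free_carrier \<Longrightarrow> coset p \<otimes>\<^bsub>U\<^esub> coset q = coset (p * q)"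
  unfolding U_eq using UQ.mult_Q[of p q] by (simp add: free_simps rels_mult distrib_left distrib_right)

lemma ue_incl_eq: "ue_incl (Lie X) x = coset (letter x)"
  by (simp add: ue_incl_def)

abbreviation word_image :: "('k, 'c, 'l) superspace_scheme \<Rightarrow> (('a \<Rightarrow> 'k) \<Rightarrow> 'c) \<Rightarrow> ('a \<Rightarrow> 'k) list \<Rightarrow> 'c" where
  "word_image B F w \<equiv> foldr (\<lambda>x b. F x \<otimes>\<^bsub>B\<^esub> b) w \<one>\<^bsub>B\<^esub>"

lemma linear_extension_eval:
  assumes C: "Module.module ground C" and g: "\<And>w. set w \<subseteq> lie_space X \<Longrightarrow> \<gamma> w \<in> carrier C" and h: "h \<in> functionals C"
    and eq: "\<And>w. set w \<subseteq> lie_space X \<Longrightarrow> h (\<gamma> w) = word_product w a" and a: "a \<in> carrier X" and p: "p \<in> free_carrier"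
  shows "h (linear_extension C (\<lambda>w. \<gamma> (letters w)) p) = eval_free p a"
proof -
  have k: "set (letters w) \<subseteq> lie_space X" if "w \<in> keys p" for w using p that by (simp add: free_carrier_iff)
  have ev: "(\<lambda>\<phi>. \<phi> a) \<in> functionals dual"
    using a by (simp add: functionals_iff dual_add_apply dual_smult_apply)
  show ?thesis
    unfolding eval_free_def
    by (rule trans[OF functional_linear_extension[OF C h g[OF k]] trans[OF sum.cong[OF refl]
          functional_linear_extension[OF dual_module ev word_product_Dual[OF k], symmetric]]]) (auto simp: eq k)
qed

lemma Dist_model: "functional_model X (Dist X) (\<lambda>\<phi>. \<phi>)"
  by (rule functional_model_cong[OF DM.functional_model_axioms]) (simp_all add: Dist_simps)

lemma word_product_dist: "set w \<subseteq> lie_space X \<Longrightarrow> word_product w \<in> carrier (Dist X)"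
  unfolding Dist_simps dist_carrier_generated
  by (rule bexI[where x = "single (Word w) 1"])
    (use word_product_Dual in \<open>simp_all add: eval_free_single free_single\<close>)

lemma eval_free_eqI: "p \<in> free_carrier \<Longrightarrow> q \<in> free_carrier \<Longrightarrow> p - q \<in> rels \<Longrightarrow> eval_free p = eval_free q"
  using eval_free_rels[of "p - q"] eval_free_diff by (intro Dual_eqI_carrier eval_free_Dual) auto

lemma rels_shift: "n \<in> rels \<Longrightarrow> p \<in> free_carrier \<Longrightarrow> n + p \<in> free_carrier \<and> coset (n + p) = coset p"
  using rels_free free_add by (simp add: UQ.coset_eq_iff)

text \<open>The extension of a map on generators is well defined as soon as its values on the free algebra are
  determined by the cosets.\<close>

lemma ue_lift_coset:
  assumes p: "p \<in> free_carrier"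
    and const: "\<And>q. q \<in> free_carrier \<Longrightarrow> coset q = coset p \<Longrightarrow>
      linear_extension B (\<lambda>w. word_image B F (letters w)) q =
      linear_extension B (\<lambda>w. word_image B F (letters w)) p"
  shows "ue_lift B F (coset p) = linear_extension B (\<lambda>w. word_image B F (letters w)) p"
proof -
  have "ue_lift B F (coset p) = the_elem (linear_extension B (\<lambda>w. word_image B F (letters w)) ` coset p)"
    unfolding ue_lift_def linear_extension_def ..
  also have "\<dots> = linear_extension B (\<lambda>w. word_image B F (letters w)) p"
  proof (rule UQ.the_elem_coset[OF p])
    fix n assume "n \<in> rels"
    from rels_shift[OF this p]
    show "linear_extension B (\<lambda>w. word_image B F (letters w)) (n + p) =
      linear_extension B (\<lambda>w. word_image B F (letters w)) p" by (intro const) auto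
  qed
  finally show ?thesis .
qed

text \<open>This is where injectivity enters: the enveloping superalgebra is identified with an algebra of functionals.\<close>

lemma coset_eval: "p \<in> free_carrier \<Longrightarrow> q \<in> free_carrier \<Longrightarrow> coset q = coset p \<longleftrightarrow> eval_free q = eval_free p"
proof
  assume c: "p \<in> free_carrier" "q \<in> free_carrier"
  show "eval_free q = eval_free p" if "coset q = coset p"
    using eval_free_eqI[OF c(2,1)] that by (simp add: UQ.coset_eq_iff)
  show "coset q = coset p" if "eval_free q = eval_free p"
    unfolding UQ.coset_eq_iff using that c by (intro eval_free_kernel) (auto simp: free_diff eval_free_diff)
qed

lemma canonical_morphism_coset:
  assumes p: "p \<in> free_carrier" shows "canonical_morphism X (coset p) = eval_free p"
proof -
  note M = functional_model.B_module[OF Dist_model]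
  have f: "word_image (Dist X) (\<lambda>x. x) w = word_product w" for w
    by (simp add: word_product_def Dist_simps dist_alg_simps)
  have E: "linear_extension (Dist X) (\<lambda>w. word_image (Dist X) (\<lambda>x. x) (letters w)) q = eval_free q"
    if q: "q \<in> free_carrier" for q
  proof (rule Dual_eqI_carrier)
    have "linear_extension (Dist X) (\<lambda>w. word_product (letters w)) q \<in> carrier (Dist X)"
      by (rule linear_extension_closed[OF M], rule word_product_dist) (use q in \<open>simp add: free_carrier_iff\<close>)
    then show "linear_extension (Dist X) (\<lambda>w. word_image (Dist X) (\<lambda>x. x) (letters w)) q \<in> Dual"
      unfolding f by (rule functional_model.g_Dual[OF Dist_model])
    fix a assume a: "a \<in> carrier X"
    show "linear_extension (Dist X) (\<lambda>w. word_image (Dist X) (\<lambda>x. x) (letters w)) q a = eval_free q a"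
      unfolding f
      by (rule linear_extension_eval[OF M word_product_dist _ _ a q, where h = "\<lambda>\<phi>. \<phi> a"])
        (use a in \<open>auto simp: functionals_iff Dist_simps dist_alg_simps dual_add_apply dual_smult_apply\<close>)
  qed (rule eval_free_Dual[OF q])
  show ?thesis unfolding canonical_morphism_def
    by (subst ue_lift_coset[OF p]) (auto simp: E p coset_eval)
qed

subsection \<open>The grading\<close>

lemma free_homog_iff: "p \<in> homog (ue_free (Lie X)) i \<longleftrightarrow> (\<forall>w\<in>keys p.
    \<exists>js. list_all2 (\<lambda>x j. x \<in> homog (Lie X) j) (letters w) js \<and> sum_list js = i)"
  by (simp add: ue_free_def)

lemma free_homog_add: "p \<in> homog (ue_free (Lie X)) i \<Longrightarrow> q \<in> homog (ue_free (Lie X)) i \<Longrightarrow> p + q \<in> homog (ue_free (Lie X)) i"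
  unfolding free_homog_iff using keys_add[of p q] by blast

lemma free_homog_zero: "0 \<in> homog (ue_free (Lie X)) i" by (simp add: free_homog_iff)

lemma free_homog_letter:
  assumes x: "x \<in> homog (Lie X) i" and p: "p \<in> homog (ue_free (Lie X)) j"
  shows "letter x * p \<in> homog (ue_free (Lie X)) (i + j)"
  unfolding free_homog_iff
proof
  fix w assume "w \<in> keys (letter x * p)"
  then obtain u where u: "u \<in> keys p" "w = Word [x] + u"
    using keys_mult[of "letter x" p] by (auto simp: letter_def)
  then obtain js where "list_all2 (\<lambda>x j. x \<in> homog (Lie X) j) (letters u) js" "sum_list js = j" using p unfolding free_homog_iff by blast
  then show "\<exists>js. list_all2 (\<lambda>x j. x \<in> homog (Lie X) j) (letters w) js \<and> sum_list js = i + j"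
    using x u(2) by (intro exI[where x = "i # js"]) (simp add: plus_free_monoid_def)
qed

lemma word_homog:
  "list_all2 (\<lambda>x j. x \<in> homog (Lie X) j) w js \<Longrightarrow>
    set w \<subseteq> lie_space X \<and> word_product w \<in> homog dual (sum_list js)"
proof (induction rule: list_all2_induct)
  case (Cons x w j js)
  then show ?case using conv_homog[of x j "word_product w" "sum_list js"] by (auto simp: Lie_simps)
qed (simp add: unit_dual_even del: restrict_apply)

lemma free_homog_eval:
  assumes p: "p \<in> homog (ue_free (Lie X)) i"
  shows "p \<in> free_carrier \<and> eval_free p \<in> homog dual i"
proof -
  define S where "S = {w. \<exists>js. list_all2 (\<lambda>x j. x \<in> homog (Lie X) j) (letters w) js \<and> sum_list js = i}"
  have "keys p \<subseteq> S" using p unfolding free_homog_iff S_def by blast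
  then show ?thesis
  proof (induction p rule: pm_induct)
    case zero
    then show ?case by (simp add: free_zero eval_free_zero DS.homog_zero)
  next
    case (single k c)
    then obtain js where "list_all2 (\<lambda>x j. x \<in> homog (Lie X) j) (letters k) js" "sum_list js = i" unfolding S_def by blast
    from word_homog[OF this(1)] this(2)
    show ?case using free_single[of "letters k" c] eval_free_single[of "letters k" c] by (auto intro: DS.homog_smult)
  next
    case (add p q)
    then show ?case by (auto simp: free_add eval_free_add intro: DS.homog_add)
  qed
qed

text \<open>Only modulo the relations: a letter that is not homogeneous is not the sum of its components in the free
  algebra.\<close>

lemma free_homog_decomp:
  assumes "p \<in> free_carrier"
  shows "\<exists>p0\<in>homog (ue_free (Lie X)) 0. \<exists>p1\<in>homog (ue_free (Lie X)) 1. p - (p0 + p1) \<in> rels"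
  using assms
proof (induction p rule: free_induct)
  case zero
  show ?case by (intro bexI[where x = 0] free_homog_zero) (simp add: rels_zero)
next
  case (add p q)
  then obtain p0 p1 q0 q1 where *: "p0 \<in> homog (ue_free (Lie X)) 0" "p1 \<in> homog (ue_free (Lie X)) 1" "p - (p0 + p1) \<in> rels"
    "q0 \<in> homog (ue_free (Lie X)) 0" "q1 \<in> homog (ue_free (Lie X)) 1" "q - (q0 + q1) \<in> rels" by blast
  have "p + q - ((p0 + q0) + (p1 + q1)) = (p - (p0 + p1)) + (q - (q0 + q1))" by simp
  then have "p + q - ((p0 + q0) + (p1 + q1)) \<in> rels" using rels_add[OF *(3,6)] by (simp only:)
  then show ?case using free_homog_add[OF *(1,4)] free_homog_add[OF *(2,5)] by blast
next
  case (single w c)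
  have "\<exists>p0\<in>homog (ue_free (Lie X)) 0. \<exists>p1\<in>homog (ue_free (Lie X)) 1. single (Word w) c - (p0 + p1) \<in> rels"
    using single
  proof (induction w)
    case Nil
    have "single (Word []) c \<in> homog (ue_free (Lie X)) 0" by (auto simp: free_homog_iff)
    then show ?case by (rule bexI[rotated]) (rule bexI[OF _ free_homog_zero], simp add: rels_zero)
  next
    case (Cons x w)
    then obtain p0 p1 where p: "p0 \<in> homog (ue_free (Lie X)) 0" "p1 \<in> homog (ue_free (Lie X)) 1"
      "single (Word w) c - (p0 + p1) \<in> rels" by auto
    have xl: "x \<in> lie_space X" and w: "set w \<subseteq> lie_space X" using Cons by auto
    have xD: "x \<in> Dual" using xl by (simp add: lie_space_iff)
    define x0 where "x0 = component dual 0 x"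
    define x1 where "x1 = component dual 1 x"
    have x01: "x0 \<in> homog (Lie X) 0" "x1 \<in> homog (Lie X) 1" "x0 \<in> lie_space X" "x1 \<in> lie_space X"
      unfolding x0_def x1_def Lie_simps using lie_space_closed(3)[OF xl] DS.component_in[OF xD] by auto
    have pf: "p0 \<in> free_carrier" "p1 \<in> free_carrier" using p free_homog_eval by auto
    have ex: "letter x - letter x0 - letter x1 \<in> rels"
      using letter_add_rels[OF x01(3,4)] DS.component_decomp_01[OF xD] by (simp add: x0_def x1_def)
    have h: "letter x0 * p0 + letter x1 * p1 \<in> homog (ue_free (Lie X)) 0" "letter x1 * p0 + letter x0 * p1 \<in> homog (ue_free (Lie X)) 1"
      using free_homog_letter[OF x01(1) p(1)] free_homog_letter[OF x01(2) p(2)]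
        free_homog_letter[OF x01(2) p(1)] free_homog_letter[OF x01(1) p(2)] by (auto intro!: free_homog_add)
    have s: "single (Word (x # w)) c = letter x * single (Word w) c"
      using single_word_mult[of "[x]" 1 w c] by (simp add: letter_def)
    have "single (Word (x # w)) c - ((letter x0 * p0 + letter x1 * p1) + (letter x1 * p0 + letter x0 * p1)) =
        letter x * (single (Word w) c - (p0 + p1)) + (letter x - letter x0 - letter x1) * (p0 + p1)"
      unfolding s by (simp add: algebra_simps)
    also have "\<dots> \<in> rels"
      by (intro rels_add rels_mult(1)[OF p(3)] rels_mult(2)[OF ex] free_letter xl free_add pf)
    finally show ?case using h by blast
  qed
  then show ?case .
qed

lemma U_homog_image: "homog U i = coset ` homog (ue_free (Lie X)) i"
  unfolding U_eq UQ.homog_Q ..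

text \<open>The parity of a functional coming from the enveloping superalgebra is that of its preimage, because even and odd
  parts of a word are again combinations of words.\<close>

sublocale UM: functional_model X U "canonical_morphism X"
proof unfold_locales
  show "inj_on (canonical_morphism X) (carrier U)"
  proof (rule inj_onI)
    fix u v assume u: "u \<in> carrier U" and v: "v \<in> carrier U" and e: "canonical_morphism X u = canonical_morphism X v"
    obtain p where p: "p \<in> free_carrier" "u = coset p" using u by (rule U_cases)
    obtain q where q: "q \<in> free_carrier" "v = coset q" using v by (rule U_cases)
    show "u = v" using e p q coset_eval[OF q(1) p(1)] by (simp add: canonical_morphism_coset)
  qed
  show "\<zero>\<^bsub>U\<^esub> \<in> carrier U" "canonical_morphism X \<zero>\<^bsub>U\<^esub> = \<zero>\<^bsub>dual\<^esub>"
    unfolding U_zero by (simp_all add: coset_in_U free_zero canonical_morphism_coset eval_free_zero)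
  show "\<one>\<^bsub>U\<^esub> \<in> carrier U" "canonical_morphism X \<one>\<^bsub>U\<^esub> = unit_dual"
    unfolding U_one by (simp_all add: coset_in_U free_one canonical_morphism_coset eval_free_one)
  fix u v c assume u: "u \<in> carrier U"
  obtain p where p: "p \<in> free_carrier" "u = coset p" using u by (rule U_cases)
  show "canonical_morphism X u \<in> Dual" using p by (simp add: canonical_morphism_coset eval_free_Dual)
  show "c \<odot>\<^bsub>U\<^esub> u \<in> carrier U" "canonical_morphism X (c \<odot>\<^bsub>U\<^esub> u) = c \<odot>\<^bsub>dual\<^esub> canonical_morphism X u"
    using p by (simp_all add: U_smult coset_in_U free_scale canonical_morphism_coset eval_free_scale)
  show "\<exists>x\<in>homog U 0. \<exists>y\<in>homog U 1. u = x \<oplus>\<^bsub>U\<^esub> y"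
  proof -
    obtain p0 p1 where d: "p0 \<in> homog (ue_free (Lie X)) 0" "p1 \<in> homog (ue_free (Lie X)) 1" "p - (p0 + p1) \<in> rels"
      using free_homog_decomp[OF p(1)] by blast
    have "u = coset p0 \<oplus>\<^bsub>U\<^esub> coset p1" unfolding U_add p(2) UQ.coset_eq_iff by (rule d(3))
    then show ?thesis unfolding U_homog_image using d(1,2) by blast
  qed
  assume v: "v \<in> carrier U"
  obtain q where q: "q \<in> free_carrier" "v = coset q" using v by (rule U_cases)
  show "u \<oplus>\<^bsub>U\<^esub> v \<in> carrier U" "canonical_morphism X (u \<oplus>\<^bsub>U\<^esub> v) = canonical_morphism X u \<oplus>\<^bsub>dual\<^esub> canonical_morphism X v"
    using p q by (simp_all add: U_add coset_in_U free_add canonical_morphism_coset eval_free_add)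
  show "u \<otimes>\<^bsub>U\<^esub> v \<in> carrier U" "canonical_morphism X (u \<otimes>\<^bsub>U\<^esub> v) = canonical_morphism X u \<star> canonical_morphism X v"
    using p q by (simp_all add: U_mult coset_in_U free_mult canonical_morphism_coset eval_free_mult)
next
  fix i
  show "homog U i = {b \<in> carrier U. canonical_morphism X b \<in> homog dual i}"
  proof
    show "homog U i \<subseteq> {b \<in> carrier U. canonical_morphism X b \<in> homog dual i}"
      unfolding U_homog_image using free_homog_eval by (auto simp: coset_in_U canonical_morphism_coset)
    show "{b \<in> carrier U. canonical_morphism X b \<in> homog dual i} \<subseteq> homog U i"
    proof clarify
      fix u assume u: "u \<in> carrier U" "canonical_morphism X u \<in> homog dual i"
      obtain p where p: "p \<in> free_carrier" "u = coset p" using u(1) by (rule U_cases)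
      obtain p0 p1 where d: "p0 \<in> homog (ue_free (Lie X)) 0" "p1 \<in> homog (ue_free (Lie X)) 1" "p - (p0 + p1) \<in> rels"
        using free_homog_decomp[OF p(1)] by blast
      define r where "r = (\<lambda>k :: bit. if k = 0 then p0 else p1)"
      have r: "r k \<in> homog (ue_free (Lie X)) k" for k unfolding r_def using d by (cases k) auto
      have rs: "r i + r (i + 1) = p0 + p1" unfolding r_def by (cases i) (auto simp: add.commute)
      note rh = free_homog_eval[OF r]
      have rf: "r k \<in> free_carrier" for k using rh by auto
      have "eval_free p = eval_free (r i + r (i + 1))"
        by (rule eval_free_eqI[OF p(1) free_add[OF rf rf]]) (use d(3) rs in simp)
      also have "\<dots> = eval_free (r i) \<oplus>\<^bsub>dual\<^esub> eval_free (r (i + 1))" by (rule eval_free_add[OF rf rf])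
      finally have e: "eval_free p = eval_free (r i) \<oplus>\<^bsub>dual\<^esub> eval_free (r (i + 1))" .
      have "component dual i (eval_free p) = eval_free (r i)"
        unfolding e by (rule DS.component_eqI) (use rh in auto)
      moreover have "component dual i (eval_free p) = eval_free p"
        using u(2) p DS.component_homog[of "eval_free p" i i] by (simp add: canonical_morphism_coset)
      ultimately have "coset p = coset (r i)" using coset_eval[OF rf p(1)] by metis
      then show "u \<in> homog U i" unfolding U_homog_image p(2) using r by blast
    qed
  qed
qed

end

section \<open>The structure maps of the enveloping superalgebra\<close>

lemma (in hopf_superalgebra) counit_antipode: "f \<in> carrier A \<Longrightarrow> counit A (antipode A f) = counit A f"
proof (rule functionals_eqI[OF functionals_comp[OF counit_functional antipode_linear] counit_functional])
  fix i f assume f: "f \<in> homog A i"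
  have "counit A (antipode A f) = (\<Sum>(k, a, b)\<leftarrow>sweedler i f. counit A (antipode A a) * counit A b)"
    by (rule sweedler_counit(2)[OF f functionals_comp[OF counit_functional antipode_linear], symmetric])
  also have "\<dots> = (\<Sum>(k, a, b)\<leftarrow>sweedler i f. counit A (antipode A a \<otimes> b))"
    by (rule sweedler_sum_cong[OF f]) (simp add: counit_mult antipode_closed homog_closed)
  also have "\<dots> = counit A f" using sweedler_antipode(1)[OF f counit_functional] by simp
  finally show "counit A (antipode A f) = counit A f" .
qed

context char_zero_supergroup
begin

definition generator_comult :: "('a \<Rightarrow> 'k) \<Rightarrow> _" where
  "generator_comult x = tens U U (ue_incl (Lie X) x) \<one>\<^bsub>U\<^esub> \<oplus>\<^bsub>tensor U U\<^esub> tens U U \<one>\<^bsub>U\<^esub> (ue_incl (Lie X) x)"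

lemma letter_in_U: "x \<in> lie_space X \<Longrightarrow> coset (letter x) \<in> carrier U"
  by (rule coset_in_U[OF free_letter])

lemma canonical_letter: "x \<in> lie_space X \<Longrightarrow> canonical_morphism X (coset (letter x)) = x"
  by (simp only: canonical_morphism_coset[OF free_letter] eval_free_letter)

text \<open>The pairing with \<open>x \<otimes> 1 + 1 \<otimes> x\<close> is the Leibniz rule at the identity. If \<open>f\<close> and \<open>h\<close> are both odd,
  the sign in the pairing is harmless because their counits vanish.\<close>

lemma dual_comult_generator:
  assumes x: "x \<in> lie_space X" shows "UM.dual_comult (coset (letter x)) (generator_comult x)"
  unfolding UM.dual_comult_def
proof (intro conjI allI ballI)
  note G = letter_in_U[OF x]
  interpret T: Module.module ground "tensor U U" by (rule UM.BB.module_T)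
  have t: "tens U U (coset (letter x)) \<one>\<^bsub>U\<^esub> \<in> carrier (tensor U U)" "tens U U \<one>\<^bsub>U\<^esub> (coset (letter x)) \<in> carrier (tensor U U)"
    by (intro UM.BB.tens_closed G UM.B_one)+
  show "generator_comult x \<in> carrier (tensor U U)" unfolding generator_comult_def ue_incl_eq using t by simp
  fix p q f h assume f: "f \<in> homog X p" and h: "h \<in> homog X q"
  have c: "f \<in> carrier X" "h \<in> carrier X" using f h homog_closed by auto
  have "UM.pairing f h (generator_comult x) = x f * counit X h + counit X f * x h"
    unfolding generator_comult_def ue_incl_eq functional_add[OF UM.pairing_functional[OF c] t]
      UM.pairing_tens[OF c G UM.B_one] UM.pairing_tens[OF c UM.B_one G] canonical_letter[OF x] UM.g_one using c by simp
  also have "\<dots> = koszul p q * (x f * counit X h + counit X f * x h)"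
    using counit_parity[OF f] counit_parity[OF h] by (elim disjE) simp_all
  also have "\<dots> = koszul p q * x (f \<otimes> h)"
    using lie_space_primitive[OF x] c by (simp add: primitive_def)
  finally show "UM.pairing f h (generator_comult x) = koszul p q * canonical_morphism X (coset (letter x)) (f \<otimes> h)"
    unfolding canonical_letter[OF x] .
qed

lemma dual_comult_word:
  "set w \<subseteq> lie_space X \<Longrightarrow> UM.dual_comult (coset (single (Word w) 1))
    (word_image (tensor U U) generator_comult w)"
proof (induction w)
  case Nil
  have "coset (single (Word []) 1) = \<one>\<^bsub>U\<^esub>"
    unfolding U_one by (simp flip: zero_free_monoid_def)
  then show ?case using UM.dual_comult_one unfolding UM.BB.one_T by simp
next
  case (Cons x w)
  then have x: "x \<in> lie_space X" and w: "set w \<subseteq> lie_space X" by auto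
  have "coset (single (Word (x # w)) 1) = coset (letter x) \<otimes>\<^bsub>U\<^esub> coset (single (Word w) 1)"
    unfolding U_mult[OF free_letter[OF x] free_single[OF w]] by (simp add: letter_def single_word_mult)
  then show ?case
    using UM.dual_comult_mult[OF dual_comult_generator[OF x] Cons.IH[OF w] letter_in_U[OF x] coset_in_U[OF free_single[OF w]]] by simp
qed

lemma dual_comult_coset:
  assumes "p \<in> free_carrier"
  shows "UM.dual_comult (coset p) (linear_extension (tensor U U)
    (\<lambda>w. word_image (tensor U U) generator_comult (letters w)) p)"
proof -
  note M = UM.BB.module_T
  have closed: "word_image (tensor U U) generator_comult (letters k) \<in> carrier (tensor U U)"
    if "p \<in> free_carrier" "k \<in> keys p" for p k
    using dual_comult_word[of "letters k"] that by (simp add: free_carrier_iff UM.dual_comult_def)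
  have single: "UM.dual_comult (coset (single (Word w) c)) (linear_extension (tensor U U)
    (\<lambda>w. word_image (tensor U U) generator_comult (letters w)) (single (Word w) c))"
    if w: "set w \<subseteq> lie_space X" for w c
  proof -
    have "coset (single (Word w) c) = c \<odot>\<^bsub>U\<^esub> coset (single (Word w) 1)"
      by (simp add: U_smult pm_scale_single)
    moreover have "linear_extension (tensor U U)
      (\<lambda>w. word_image (tensor U U) generator_comult (letters w)) (single (Word w) c) =
      c \<odot>\<^bsub>tensor U U\<^esub> word_image (tensor U U) generator_comult w"
      by (subst linear_extension_single[OF M]) (use dual_comult_word[OF w] in \<open>auto simp: UM.dual_comult_def\<close>)
    ultimately show ?thesis
      using UM.dual_comult_smult[OF dual_comult_word[OF w] coset_in_U[OF free_single[OF w]]] by simp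
  qed
  show ?thesis using assms
  proof (induction p rule: free_induct)
    case zero
    show ?case using single[of "[]" 0] by simp
  next
    case (add p q)
    have "linear_extension (tensor U U)
        (\<lambda>w. word_image (tensor U U) generator_comult (letters w)) (p + q) =
      linear_extension (tensor U U) (\<lambda>w. word_image (tensor U U) generator_comult (letters w)) p \<oplus>\<^bsub>tensor U U\<^esub>
      linear_extension (tensor U U) (\<lambda>w. word_image (tensor U U) generator_comult (letters w)) q"
      by (rule linear_extension_add[OF M]) (use closed add(1,2) in blast)
    then show ?case
      using UM.dual_comult_add[OF add(3,4) coset_in_U[OF add(1)] coset_in_U[OF add(2)]] by (simp add: U_add)
  qed (rule single)
qed

lemma UE_comult:
  assumes u: "u \<in> carrier U" shows "UM.dual_comult u (comult (UE (Lie X)) u)"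
proof -
  obtain p where p: "p \<in> free_carrier" "u = coset p" using u by (rule U_cases)
  have F: "(\<lambda>x. tens U U (ue_incl (Lie X) x) \<one>\<^bsub>U\<^esub> \<oplus>\<^bsub>tensor U U\<^esub> tens U U \<one>\<^bsub>U\<^esub> (ue_incl (Lie X) x)) = generator_comult"
    by (simp add: fun_eq_iff generator_comult_def)
  have "comult (UE (Lie X)) (coset p) = linear_extension (tensor U U)
    (\<lambda>w. word_image (tensor U U) generator_comult (letters w)) p"
    unfolding UE_simps F
  proof (rule ue_lift_coset[OF p(1)])
    fix q assume q: "q \<in> free_carrier" "coset q = coset p"
    show "linear_extension (tensor U U) (\<lambda>w. word_image (tensor U U) generator_comult (letters w)) q =
      linear_extension (tensor U U) (\<lambda>w. word_image (tensor U U) generator_comult (letters w)) p"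
      using UM.dual_comult_unique dual_comult_coset[OF q(1)] dual_comult_coset[OF p(1)] unfolding q(2) by blast
  qed
  then show ?thesis using dual_comult_coset[OF p(1)] p(2) by simp
qed

lemma UE_counit:
  assumes u: "u \<in> carrier U" shows "counit (UE (Lie X)) u = canonical_morphism X u \<one>"
proof -
  obtain p where p: "p \<in> free_carrier" "u = coset p" using u by (rule U_cases)
  have w: "word_image ground (\<lambda>x. 0) w = word_product w \<one>" if "set w \<subseteq> lie_space X" for w
    using that by (cases w) (auto simp: conv_one word_product_Dual lie_space_iff)
  have E: "linear_extension ground (\<lambda>w. word_image ground (\<lambda>x. 0) (letters w)) q = eval_free q \<one>"
    if "q \<in> free_carrier" for q
    by (rule linear_extension_eval[where h = "\<lambda>c. c", OF ground_module _ _ w one_closed that]) (auto simp: functionals_iff)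
  show ?thesis unfolding UE_simps p(2) canonical_morphism_coset[OF p(1)]
  proof (rule trans[OF ue_lift_coset[OF p(1)] E[OF p(1)]])
    fix q assume q: "q \<in> free_carrier" "coset q = coset p"
    then have "eval_free q = eval_free p" using coset_eval[OF p(1) q(1)] by simp
    then show "linear_extension ground (\<lambda>w. word_image ground (\<lambda>x. 0) (letters w)) q =
        linear_extension ground (\<lambda>w. word_image ground (\<lambda>x. 0) (letters w)) p"
      by (simp only: E[OF q(1)] E[OF p(1)])
  qed
qed

lemma opposite_simps: "carrier (super_opposite U) = carrier U" "add (super_opposite U) = add U" "zero (super_opposite U) = zero U"
  "smult (super_opposite U) = smult U" "one (super_opposite U) = one U"
  by (simp_all add: super_opposite_def)

lemma module_opposite: "Module.module ground (super_opposite U)"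
  using UM.B_module
  unfolding Module.module_def module_axioms_def abelian_group_def abelian_monoid_def abelian_group_axioms_def opposite_simps .

text \<open>The super-opposite product with \<open>- x\<close> is the right-hand side of \<open>conv_antipode\<close>.\<close>

lemma antipode_word:
  assumes "set w \<subseteq> lie_space X"
  shows "word_image (super_opposite U) (\<lambda>x. \<ominus>\<^bsub>U\<^esub> ue_incl (Lie X) x) w \<in> carrier U \<and>
    (\<forall>f\<in>carrier X. canonical_morphism X (word_image (super_opposite U) (\<lambda>x. \<ominus>\<^bsub>U\<^esub> ue_incl (Lie X) x) w) f =
      word_product w (antipode X f))"
  using assms
proof (induction w)
  case Nil
  then show ?case by (simp add: opposite_simps UM.B_one UM.g_one antipode_closed counit_antipode)
next
  case (Cons x w)
  then have x: "x \<in> lie_space X" and w: "set w \<subseteq> lie_space X" by auto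
  define s where "s = word_image (super_opposite U) (\<lambda>x. \<ominus>\<^bsub>U\<^esub> ue_incl (Lie X) x) w"
  have s: "s \<in> carrier U" "\<And>f. f \<in> carrier X \<Longrightarrow> canonical_morphism X s f = word_product w (antipode X f)"
    using Cons.IH[OF w] unfolding s_def by auto
  define y where "y = (\<ominus>\<^bsub>U\<^esub> ue_incl (Lie X) x)"
  have y': "y = (- 1) \<odot>\<^bsub>U\<^esub> coset (letter x)"
    unfolding y_def ue_incl_eq by (rule module_minus[OF UM.B_module letter_in_U[OF x], symmetric])
  have y: "y \<in> carrier U" unfolding y' by (rule UM.B_smult[OF letter_in_U[OF x]])
  have gy: "canonical_morphism X y f = - x f" if "f \<in> carrier X" for f
    unfolding y' using that by (simp add: UM.g_smult letter_in_U x canonical_letter dual_smult_apply)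
  have psi: "word_product w \<in> Dual" and xD: "x \<in> Dual" using word_product_Dual[OF w] x by (auto simp: lie_space_iff)
  have ys: "y \<otimes>\<^bsub>super_opposite U\<^esub> s \<in> carrier U"
    by (rule UM.g_opposite_mult(1)[OF y s(1) homog_zero])
  have "canonical_morphism X (y \<otimes>\<^bsub>super_opposite U\<^esub> s) f = (x \<star> word_product w) (antipode X f)" if f: "f \<in> carrier X" for f
  proof (rule functionals_eqI[OF DualD[OF UM.g_Dual[OF ys]] functionals_comp[OF DualD[OF conv_Dual[OF xD psi]] antipode_linear] _ f])
    fix r f assume f: "f \<in> homog X r"
    have "canonical_morphism X (y \<otimes>\<^bsub>super_opposite U\<^esub> s) f = (\<Sum>(k, a, b)\<leftarrow>sweedler r f. - 1 * (word_product w (antipode X a) * x b))"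
      unfolding UM.g_opposite_mult(2)[OF y s(1) f]
      by (rule sweedler_sum_cong[OF f]) (simp add: s(2) gy homog_closed)
    also have "\<dots> = - (\<Sum>(k, a, b)\<leftarrow>sweedler r f. word_product w (antipode X a) * x b)"
      unfolding case_prod_unfold sum_list_const_mult by simp
    also have "\<dots> = (x \<star> word_product w) (antipode X f)"
      by (rule conv_antipode[OF psi lie_space_primitive[OF x] f, symmetric])
    finally show "canonical_morphism X (y \<otimes>\<^bsub>super_opposite U\<^esub> s) f = (x \<star> word_product w) (antipode X f)" .
  qed
  then show ?case using ys by (simp add: s_def[symmetric] y_def[symmetric])
qed

lemma UE_antipode:
  assumes u: "u \<in> carrier U"
  shows "antipode (UE (Lie X)) u \<in> carrier U"
    and "f \<in> carrier X \<Longrightarrow> canonical_morphism X (antipode (UE (Lie X)) u) f = canonical_morphism X u (antipode X f)"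
proof -
  obtain p where p: "p \<in> free_carrier" "u = coset p" using u by (rule U_cases)
  define \<gamma> where "\<gamma> w = word_image (super_opposite U) (\<lambda>x. \<ominus>\<^bsub>U\<^esub> ue_incl (Lie X) x) w" for w
  have g: "\<gamma> w \<in> carrier (super_opposite U)" "f \<in> carrier X \<Longrightarrow> canonical_morphism X (\<gamma> w) f = word_product w (antipode X f)"
    if "set w \<subseteq> lie_space X" for w f
    using antipode_word[OF that] unfolding \<gamma>_def opposite_simps by auto
  let ?E = "linear_extension (super_opposite U) (\<lambda>w. \<gamma> (letters w))"
  have cl: "?E q \<in> carrier U" if "q \<in> free_carrier" for q
    unfolding opposite_simps[symmetric]
    by (rule linear_extension_closed[OF module_opposite], rule g(1)) (use that in \<open>simp add: free_carrier_iff\<close>)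
  have ev: "canonical_morphism X (?E q) f = eval_free q (antipode X f)" if "q \<in> free_carrier" "f \<in> carrier X" for q f
    by (rule linear_extension_eval[where h = "\<lambda>u. canonical_morphism X u f",
          OF module_opposite g(1) _ g(2)[OF _ that(2)] antipode_closed[OF that(2)] that(1)])
      (use UM.g_functional[OF that(2)] in \<open>simp_all add: functionals_iff[of "\<lambda>u. canonical_morphism X u f"] opposite_simps\<close>)
  have "antipode (UE (Lie X)) (coset p) = ?E p"
    unfolding UE_simps \<gamma>_def
  proof (rule ue_lift_coset[OF p(1)], fold \<gamma>_def)
    fix q assume q: "q \<in> free_carrier" "coset q = coset p"
    then have e: "eval_free q = eval_free p" using coset_eval[OF p(1) q(1)] by simp
    show "?E q = ?E p"
    proof (rule UM.B_eqI[OF cl[OF q(1)] cl[OF p(1)]], rule Dual_eqI_carrier[OF UM.g_Dual[OF cl[OF q(1)]] UM.g_Dual[OF cl[OF p(1)]]])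
      show "f \<in> carrier X \<Longrightarrow> canonical_morphism X (?E q) f = canonical_morphism X (?E p) f" for f
        using ev q(1) p(1) e by simp
    qed
  qed
  then show "antipode (UE (Lie X)) u \<in> carrier U"
    "f \<in> carrier X \<Longrightarrow> canonical_morphism X (antipode (UE (Lie X)) u) f = canonical_morphism X u (antipode X f)"
    using cl ev p by (auto simp: canonical_morphism_coset)
qed

lemma UE_model: "functional_model X (UE (Lie X)) (canonical_morphism X)"
  by (rule functional_model_cong[OF UM.functional_model_axioms]) (simp_all add: UE_simps(1-7))

lemma UE_dual_comult: "functional_model.dual_comult X (UE (Lie X)) (canonical_morphism X) = UM.dual_comult"
  by (rule dual_comult_cong[OF UM.functional_model_axioms]) (simp_all add: UE_simps(1-7))

sublocale UH: functional_hopf_model X "UE (Lie X)" "canonical_morphism X"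
  by (rule functional_hopf_model.intro[OF UE_model], unfold_locales)
    (simp_all add: UE_simps(1) UE_dual_comult UE_comult UE_counit UE_antipode)

section \<open>The structure maps of the distribution superalgebra\<close>

abbreviation D where "D \<equiv> dist_alg X"

lemma canonical_surj: assumes "\<phi> \<in> carrier D" obtains u where "u \<in> carrier U" "canonical_morphism X u = \<phi>"
proof -
  obtain p where "p \<in> free_carrier" "eval_free p = \<phi>" using assms unfolding dist_carrier_generated by blast
  then show ?thesis using that[of "coset p"] by (simp add: coset_in_U canonical_morphism_coset)
qed

lemma canonical_in_D: "u \<in> carrier U \<Longrightarrow> canonical_morphism X u \<in> carrier D"
  unfolding dist_carrier_generated by (erule U_cases) (auto simp: canonical_morphism_coset)

lemma canonical_linear: "canonical_morphism X \<in> linear_maps U D"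
  by (auto simp: linear_maps_def canonical_in_D UM.g_add UM.g_smult dist_alg_simps(4-6))

text \<open>A distribution comes from the enveloping superalgebra, so it has a comultiplication in the tensor square of the
  distributions: the existence that \<^const>\<open>dist_comult\<close> presupposes.\<close>

lemma dual_comult_transfer:
  assumes u: "u \<in> carrier U" and t: "UM.dual_comult u t"
  shows "DM.dual_comult (canonical_morphism X u)
    (tensor_lift (tensor D D) (\<lambda>x y. tens D D (canonical_morphism X x) (canonical_morphism X y)) t)"
  unfolding DM.dual_comult_def
proof (intro conjI allI ballI)
  have b: "bilinear U U (tensor D D) (\<lambda>x y. tens D D (canonical_morphism X x) (canonical_morphism X y))"
    by (rule linear_map_bilinear[OF DM.BB.tens_bilinear canonical_linear canonical_linear])
  have tc: "t \<in> carrier (tensor U U)" using t by (simp add: UM.dual_comult_def)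
  show "tensor_lift (tensor D D) (\<lambda>x y. tens D D (canonical_morphism X x) (canonical_morphism X y)) t \<in> carrier (tensor D D)"
    by (rule linear_map_closed[OF UM.BB.tensor_lift_linear[OF DM.BB.module_T b] tc])
  fix p q f h assume f: "f \<in> homog X p" and h: "h \<in> homog X q"
  have c: "f \<in> carrier X" "h \<in> carrier X" using f h homog_closed by auto
  have "DM.pairing f h (tensor_lift (tensor D D) (\<lambda>x y. tens D D (canonical_morphism X x) (canonical_morphism X y)) t) =
      tensor_lift ground (\<lambda>x y. DM.pairing f h (tens D D (canonical_morphism X x) (canonical_morphism X y))) t"
    by (rule UM.BB.functional_lift[OF DM.BB.module_T b DM.pairing_functional[OF c] tc])
  also have "\<dots> = 1 * UM.pairing f h t"
    by (rule UM.lift_scaled_pairing[OF c tc]) (simp add: DM.pairing_tens c canonical_in_D)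
  also have "\<dots> = koszul p q * canonical_morphism X u (f \<otimes> h)" using t f h by (simp add: UM.dual_comult_def)
  finally show "DM.pairing f h (tensor_lift (tensor D D) (\<lambda>x y. tens D D (canonical_morphism X x) (canonical_morphism X y)) t) =
      koszul p q * canonical_morphism X u (f \<otimes> h)" .
qed

lemma dist_pairing_components:
  assumes t: "t \<in> carrier (tensor D D)" and f: "f \<in> carrier X" and h: "h \<in> carrier X"
  shows "dist_pairing X t f h = (\<Sum>i\<in>UNIV. \<Sum>j\<in>UNIV. koszul j i * DM.pairing (component X i f) (component X j h) t)"
proof -
  have c: "component X i f \<in> carrier X" "component X i h \<in> carrier X" for i using f h by auto
  let ?\<beta> = "\<lambda>x y. \<Sum>i\<in>UNIV. \<Sum>j\<in>UNIV. koszul j i * (x (component X i f) * y (component X j h))"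
  have b: "bilinear D D ground ?\<beta>"
    unfolding sum_bit by (intro bilinear_ground_add bilinear_ground_scale DM.pairing_bilinear c)
  have "tensor_lift ground ?\<beta> t = dist_pairing X t f h"
    unfolding dist_pairing_def
    by (rule DM.BB.lift_cong[OF ground_module b t])
      (simp add: sum_bit_pairs component_dual dist_carrier_Dual h mult.assoc)
  moreover have "tensor_lift ground ?\<beta> t = (\<Sum>i\<in>UNIV. \<Sum>j\<in>UNIV. koszul j i * DM.pairing (component X i f) (component X j h) t)"
  proof (rule DM.BB.functional_T_eqI[OF DM.BB.tensor_lift_linear[OF ground_module b] _ t])
    show "(\<lambda>t. \<Sum>i\<in>UNIV. \<Sum>j\<in>UNIV. koszul j i * DM.pairing (component X i f) (component X j h) t) \<in> functionals (tensor D D)"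
      unfolding sum_bit by (intro functionals_plus functionals_scale DM.pairing_functional c)
  qed (simp add: DM.BB.tensor_lift_tens[OF ground_module b] DM.pairing_tens c)
  ultimately show ?thesis by simp
qed

lemma dist_pairing_homog:
  assumes t: "t \<in> carrier (tensor D D)" and f: "f \<in> homog X p" and h: "h \<in> homog X q"
  shows "dist_pairing X t f h = koszul p q * DM.pairing f h t"
  unfolding dist_pairing_def
proof (rule DM.lift_scaled_pairing[OF homog_closed[OF f] homog_closed[OF h] t])
  fix x y assume "x \<in> carrier D" "y \<in> carrier D"
  note d = this[THEN dist_carrier_Dual]
  have k: "koszul j i * x (component X i f) * component dual j y h = (if i = p then if j = q then koszul p q * (x f * y h) else 0 else 0)" for i j
    using functional_zero[OF module_A DualD[OF d(1)]] functional_zero[OF module_A DualD[OF d(2)]]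
    by (simp add: component_dual[OF d(2)] homog_closed[OF h] component_homog[OF f] component_homog[OF h] koszul_sym)
  show "(\<Sum>(i, j)\<in>UNIV. koszul j i * x (component X i f) * component dual j y h) = koszul p q * (x f * y h)"
    unfolding sum_bit_pairs k by (cases p; cases q; simp add: sum_bit)
qed

text \<open>The pairing in the definition of \<^const>\<open>dist_comult\<close> is the one of the model, up to the sign that
  depends on the parities of the arguments.\<close>

lemma dual_comult_dist_pairing:
  assumes phi: "\<phi> \<in> carrier D" and t: "t \<in> carrier (tensor D D)"
  shows "(\<forall>f\<in>carrier X. \<forall>h\<in>carrier X. \<phi> (f \<otimes> h) = dist_pairing X t f h) \<longleftrightarrow> DM.dual_comult \<phi> t"
proof
  assume eq: "\<forall>f\<in>carrier X. \<forall>h\<in>carrier X. \<phi> (f \<otimes> h) = dist_pairing X t f h"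
  have "DM.pairing f h t = koszul p q * \<phi> (f \<otimes> h)" if f: "f \<in> homog X p" and h: "h \<in> homog X q" for f h p q
    using eq homog_closed[OF f] homog_closed[OF h] dist_pairing_homog[OF t f h] by simp
  then show "DM.dual_comult \<phi> t" using t unfolding DM.dual_comult_def by blast
next
  assume dc: "DM.dual_comult \<phi> t"
  show "\<forall>f\<in>carrier X. \<forall>h\<in>carrier X. \<phi> (f \<otimes> h) = dist_pairing X t f h"
  proof (intro ballI)
    fix f h assume f: "f \<in> carrier X" and h: "h \<in> carrier X"
    note F = functional_mult_bilinear[OF DualD[OF dist_carrier_Dual[OF phi]]]
    have "\<phi> (f \<otimes> h) = (\<Sum>i\<in>UNIV. \<phi> (component X i f \<otimes> h))"
      by (rule functional_components[OF bilinearD(1)[OF F h f] f])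
    also have "\<dots> = (\<Sum>i\<in>UNIV. \<Sum>j\<in>UNIV. \<phi> (component X i f \<otimes> component X j h))"
      using functional_components[OF bilinearD(2)[OF F h component_closed[OF f]] h] by (intro sum.cong refl)
    also have "\<dots> = (\<Sum>i\<in>UNIV. \<Sum>j\<in>UNIV. koszul j i * DM.pairing (component X i f) (component X j h) t)"
    proof (intro sum.cong refl)
      fix i j
      have "DM.pairing (component X i f) (component X j h) t = koszul i j * \<phi> (component X i f \<otimes> component X j h)"
        using dc component_in[OF f] component_in[OF h] unfolding DM.dual_comult_def by blast
      then show "\<phi> (component X i f \<otimes> component X j h) = koszul j i * DM.pairing (component X i f) (component X j h) t"
        by (simp add: koszul_sym[of j i])
    qed
    finally show "\<phi> (f \<otimes> h) = dist_pairing X t f h" unfolding dist_pairing_components[OF t f h] .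
  qed
qed

lemma dist_comult_eq:
  assumes phi: "\<phi> \<in> carrier D" and t: "DM.dual_comult \<phi> t" shows "dist_comult X \<phi> = t"
  unfolding dist_comult_def
proof (rule the_equality)
  have tc: "t \<in> carrier (tensor D D)" using t by (simp add: DM.dual_comult_def)
  then show "t \<in> carrier (tensor D D) \<and> (\<forall>f\<in>carrier X. \<forall>h\<in>carrier X. \<phi> (f \<otimes> h) = dist_pairing X t f h)"
    using dual_comult_dist_pairing[OF phi tc] t by blast
  show "t' = t" if "t' \<in> carrier (tensor D D) \<and> (\<forall>f\<in>carrier X. \<forall>h\<in>carrier X. \<phi> (f \<otimes> h) = dist_pairing X t' f h)" for t'
    using that dual_comult_dist_pairing[OF phi, of t'] DM.dual_comult_unique[OF _ t] by blast
qed

lemma dist_comult_canonical: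
  assumes u: "u \<in> carrier U"
  shows "dist_comult X (canonical_morphism X u) =
    tensor_lift (tensor D D) (\<lambda>x y. tens D D (canonical_morphism X x) (canonical_morphism X y)) (comult (UE (Lie X)) u)"
  by (rule dist_comult_eq[OF canonical_in_D[OF u] dual_comult_transfer[OF u UE_comult[OF u]]])

lemma dist_antipode_canonical:
  assumes u: "u \<in> carrier U"
  shows "(\<lambda>f\<in>carrier X. canonical_morphism X u (antipode X f)) = canonical_morphism X (antipode (UE (Lie X)) u)"
  by (rule Dual_eqI_carrier[OF restrict_Dual[OF functionals_comp[OF DualD[OF UM.g_Dual[OF u]] antipode_linear]]
        UM.g_Dual[OF UE_antipode(1)[OF u]]])
    (simp add: UE_antipode(2)[OF u])

lemma Dist_dual_comult: "functional_model.dual_comult X (Dist X) (\<lambda>\<phi>. \<phi>) = DM.dual_comult"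
  by (rule dual_comult_cong[OF DM.functional_model_axioms]) (simp_all add: Dist_simps(1-7))

sublocale DH: functional_hopf_model X "Dist X" "\<lambda>\<phi>. \<phi>"
proof (rule functional_hopf_model.intro[OF Dist_model], unfold_locales)
  fix \<phi> assume "\<phi> \<in> carrier (Dist X)"
  then obtain u where u: "u \<in> carrier U" "canonical_morphism X u = \<phi>" unfolding Dist_simps by (rule canonical_surj)
  show "functional_model.dual_comult X (Dist X) (\<lambda>\<phi>. \<phi>) \<phi> (comult (Dist X) \<phi>)"
    unfolding Dist_dual_comult Dist_simps u(2)[symmetric] dist_comult_canonical[OF u(1)]
    by (rule dual_comult_transfer[OF u(1) UE_comult[OF u(1)]])
  show "counit (Dist X) \<phi> = \<phi> \<one>" by (simp add: Dist_simps)
  show "antipode (Dist X) \<phi> \<in> carrier (Dist X)"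
    unfolding Dist_simps u(2)[symmetric] dist_antipode_canonical[OF u(1)] by (rule canonical_in_D[OF UE_antipode(1)[OF u(1)]])
  show "f \<in> carrier X \<Longrightarrow> antipode (Dist X) \<phi> f = \<phi> (antipode X f)" for f by (simp add: Dist_simps)
qed

theorem canonical_morphism_iso: "hopf_superalgebra_iso (UE (Lie X)) (Dist X) (canonical_morphism X)"
  unfolding hopf_superalgebra_iso_def hopf_superalgebra_hom_def
proof (intro conjI ballI)
  show "hopf_superalgebra (UE (Lie X))" by (rule UH.B_hopf_superalgebra)
  show "hopf_superalgebra (Dist X)" by (rule DH.B_hopf_superalgebra)
  show "canonical_morphism X \<in> superalgebra_hom (UE (Lie X)) (Dist X)"
    unfolding superalgebra_hom_def even_linear_maps_def ring_hom_def linear_maps_def UE_simps(1-7) Dist_simps(1-7)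
    by (auto simp: canonical_in_D UM.g_add UM.g_smult UM.g_mult UM.g_one dist_alg_simps(2-6) UM.B_homog DM.B_homog
        simp del: restrict_apply)
  fix u assume "u \<in> carrier (UE (Lie X))"
  then have u: "u \<in> carrier U" by (simp add: UE_simps)
  have T: "tensor (Dist X) (Dist X) = tensor D D" "tens (Dist X) (Dist X) = tens D D"
    by (rule tensor_cong; simp add: Dist_simps(1-7))+
  show "comult (Dist X) (canonical_morphism X u) = tensor_lift (tensor (Dist X) (Dist X))
      (\<lambda>x y. tens (Dist X) (Dist X) (canonical_morphism X x) (canonical_morphism X y)) (comult (UE (Lie X)) u)"
    unfolding T Dist_simps(8) by (rule dist_comult_canonical[OF u])
  show "counit (Dist X) (canonical_morphism X u) = counit (UE (Lie X)) u"
    by (simp add: Dist_simps(9) UE_counit[OF u])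
  show "antipode (Dist X) (canonical_morphism X u) = canonical_morphism X (antipode (UE (Lie X)) u)"
    unfolding Dist_simps(10) by (rule dist_antipode_canonical[OF u])
next
  have "canonical_morphism X ` carrier U = carrier D"
    using canonical_in_D by (auto elim: canonical_surj)
  then show "bij_betw (canonical_morphism X) (carrier (UE (Lie X))) (carrier (Dist X))"
    unfolding bij_betw_def UE_simps(1) Dist_simps(1) using UM.g_inj by blast
qed

end

theorem lemma3p1:
  fixes X :: "('k::field_char_0, 'a) hopf_superalg"
  assumes "algebraic_supergroup X"
  shows "hopf_superalgebra_iso (UE (Lie X)) (Dist X) (canonical_morphism X)"
proof -
  interpret char_zero_supergroup X
    by (intro char_zero_supergroup.intro char_zero_supergroup_axioms.intro assms) (rule of_nat_neq_0)
  show ?thesis by (rule canonical_morphism_iso)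
qed

end
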